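(* For $\mu\in\mathcal P(\mathbb R^d)$ and $\theta\in\mathbb S^{d-1}$, define $\overline l_\mu^\theta=\sup\mathrm{spt}(\mathfrak p^\theta_\sharp\mu)$ and $\underline l_\mu^\theta=\inf\mathrm{spt}(\mathfrak p^\theta_\sharp\mu)$. Let $\epsilon>0$ be arbitrary. The following hold. (i) Assume $\mu\in\mathcal P_{2+\epsilon}(\mathbb R^d)$ and $\nu\in\mathcal P_1(\mathbb R^d)$. If in addition $F_\mu(t;\theta)\ne F_\nu(t;\theta)$ for $(\lambda\otimes\sigma)$-almost all $(t,\theta)\in\{(s,\vartheta):s\in[\underline l_\mu^\vartheta,\overline l_\mu^\vartheta],\vartheta\in\mathbb S^{d-1}\}$, then $$\sqrt n\big(\underline{\mathsf W}_1(\hat\mu_n,\nu)-\underline{\mathsf W}_1(\mu,\nu)\big)\stackrel{d}{\to}N(0,v_1^2),$$ where $v_1^2$ is the variance of $\iint[\mathrm{sign}(F_\mu-F_\nu)]\mathsf G_\mu\,d\lambda\,d\sigma$. The asymptotic variance $v_1^2$ agrees with the semiparametric efficiency bound for estimating $\underline{\mathsf W}_1(\cdot,\nu)$ at $\mu$. (ii) Assume $\mu,\nu\in\mathcal P_{2+\epsilon}(\mathbb R^d)$. If in addition $F_\mu(t;\theta)\ne F_\nu(t;\theta)$ for $(\lambda\otimes\sigma)$-almost all $(t,\theta)\in\{(s,\vartheta):s\in[\underline l_\mu^\vartheta\wedge\underline l_\nu^\vartheta,\overline l_\mu^\vartheta\vee\overline l_\nu^\vartheta],\vartheta\in\mathbb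 S^{d-1}\}$, then $$\sqrt n\big(\underline{\mathsf W}_1(\hat\mu_n,\hat\nu_n)-\underline{\mathsf W}_1(\mu,\nu)\big)\stackrel{d}{\to}N(0,v_1^2+w_1^2),$$ where $v_1^2$ is the variance of $\iint[\mathrm{sign}(F_\mu-F_\nu)]\mathsf G_\mu\,d\lambda\,d\sigma$ and $w_1^2$ is the variance of $\iint[\mathrm{sign}(F_\mu-F_\nu)]\mathsf G'_\nu\,d\lambda\,d\sigma$. The asymptotic variance $v_1^2+w_1^2$ agrees with the semiparametric efficiency bound for estimating $\underline{\mathsf W}_1(\cdot,\cdot)$ at $(\mu,\nu)$. Finally, bootstrap consistency holds in both cases: in case (i), provided $v_1^2>0$, $$\sup_{t\in\mathbb R}\Big|\mathbb P^B\Big(\sqrt n\big(\underline{\mathsf W}_1(\hat\mu_n^B,\nu)-\underline{\mathsf W}_1(\hat\mu_n,\nu)\big)\le t\Big)-\mathbb P(N(0,v_1^2)\le t)\Big|\stackrel{\mathbb P}{\to}0,$$ and in case (ii), provided $v_1^2+w_1^2>0$, $$\sup_{t\in\mathbb R}\Big|\mathbb P^B\Big(\sqrt n\big(\underline{\mathsf W}_1(\hat\mu_n^B,\hat\nu_n^B)-\underline{\mathsf W}_1(\hat\mu_n,\hat\nu_n)\big)\le t\Big)-\mathbb P(N(0,v_1^2+w_1^2)\le t)\Big|\stackrel{\mathbb P}{\to}0.$$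
   Context: $\mathcal P_q(\mathbb R^d)$: Borel probability measures on $\mathbb R^d$ with finite $q$-th absolute moment; $\mathrm{spt}$ is topological support. $\mathsf W_1$ is the 1-Wasserstein distance, $\mathfrak p^\theta(x)=\theta^\intercal x$, $\sharp$ is pushforward, $\sigma$ is the uniform distribution on the unit sphere $\mathbb S^{d-1}$, $\lambda$ is Lebesgue measure on $\mathbb R$. $\underline{\mathsf W}_1(\mu,\nu)=\int_{\mathbb S^{d-1}}\mathsf W_1(\mathfrak p^\theta_\sharp\mu,\mathfrak p^\theta_\sharp\nu)\,d\sigma(\theta)$. $F_\mu(t;\theta)=\mu(\{x:\theta^\intercal x\le t\})$. $\mathrm{sign}(t)=1,0,-1$ for $t>0$, $t=0$, $t<0$. Intervals with infinite endpoints are intersected with $\mathbb R$; $a\wedge b=\min$, $a\vee b=\max$. $\mathsf G_\mu=(\mathsf G_\mu(t,\theta))_{(t,\theta)\in\mathbb R\times\mathbb S^{d-1}}$ is a jointly measurable centered Gaussian process with paths in $L^1(\lambda\otimes\sigma)$ and covariance $\mathrm{Cov}(\mathsf G_\mu(s,\theta),\mathsf G_\mu(t,\vartheta))=\mu(\{x:\theta^\intercal x\le s,\vartheta^\intercal x\le t\})-F_\mu(s;\theta)F_\mu(t;\vartheta)$ (it exists for $\mu\in\mathcal P_{2+\epsilon}(\mathbb R^d)$); $\mathsf G'_\nu$ is an analogous process with $\nu$ in place of $\mu$, independent of $\mathsf G_\mu$. $X_1,X_2,\dots\sim\mu$ and $Y_1,Y_2,\dots\sim\nu$ are independent i.i.d.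 sequences; $\hat\mu_n=n^{-1}\sum_{i=1}^n\delta_{X_i}$, $\hat\nu_n=n^{-1}\sum_{i=1}^n\delta_{Y_i}$. Given the data, $X_1^B,\dots,X_n^B$ are i.i.d. from $\hat\mu_n$, $\hat\mu_n^B=n^{-1}\sum\delta_{X_i^B}$; $\hat\nu_n^B$ is defined analogously (independently, given the data); $\mathbb P^B$ is conditional probability given the data. Semiparametric efficiency bound. Let $T_\mu$ be the set of bounded measurable $h:\mathbb R^d\to\mathbb R$ with $\mu(h)=0$. For a functional $\kappa$ of $\mu$, if there is a continuous linear functional $\dot\kappa_\mu$ on $L^2(\mu)$ with $t^{-1}\{\kappa((1+th)\mu)-\kappa(\mu)\}\to\dot\kappa_\mu h$ as $t\downarrow0$ for every $h\in T_\mu$, the bound at $\mu$ is $\sup_{h\in T_\mu,h\ne0}(\dot\kappa_\mu h)^2/\|h\|^2_{L^2(\mu)}$. In the two-sample case it is relative to the tangent space $\{h_1\oplus h_2:h_1\in T_\mu,h_2\in T_\nu\}$, $(h_1\oplus h_2)(x,y)=h_1(x)+h_2(y)$: with $\dot\kappa$ a continuous linear functional on $L^2(\mu\otimes\nu)$ such that $t^{-1}\{\kappa((1+th_1)\mu,(1+th_2)\nu)-\kappa(\mu,\nu)\}\to\dot\kappa(h_1\oplus h_2)$, the bound is $\sup(\dot\kappa(h_1\oplus h_2))^2/\|h_1\oplus h_2\|^2_{L^2(\mu\otimes\nu)}$ over nonzero $h_1\oplus h_2$. *)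

theory Defs
  imports "HOL-Probability.Probability"
begin

section \<open>Probability measures, projections, supports\<close>

definition finite_moment_measures :: "real \<Rightarrow> 'a::euclidean_space measure set" where
  "finite_moment_measures q =
     {\<mu>. sets \<mu> = sets borel \<and> prob_space \<mu> \<and> integrable \<mu> (\<lambda>x. norm x powr q)}"

definition proj_measure :: "'a::euclidean_space \<Rightarrow> 'a measure \<Rightarrow> real measure" where
  "proj_measure \<theta> \<mu> = distr \<mu> borel (\<lambda>x. \<theta> \<bullet> x)"

definition proj_cdf :: "'a::euclidean_space measure \<Rightarrow> real \<Rightarrow> 'a \<Rightarrow> real" where
  "proj_cdf \<mu> t \<theta> = measure \<mu> {x. \<theta> \<bullet> x \<le> t}"

definition spt :: "'a::topological_space measure \<Rightarrow> 'a set" where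
  "spt \<mu> = {x. \<forall>U. open U \<and> x \<in> U \<longrightarrow> emeasure \<mu> U > 0}"

definition upper_end :: "'a::euclidean_space measure \<Rightarrow> 'a \<Rightarrow> ereal" where
  "upper_end \<mu> \<theta> = (SUP x\<in>spt (proj_measure \<theta> \<mu>). ereal x)"

definition lower_end :: "'a::euclidean_space measure \<Rightarrow> 'a \<Rightarrow> ereal" where
  "lower_end \<mu> \<theta> = (INF x\<in>spt (proj_measure \<theta> \<mu>). ereal x)"

section \<open>The uniform distribution on the unit sphere\<close>

text \<open>The image of the uniform distribution on the unit ball under the radial projection
  (\<open>sgn x = x / norm x\<close>), regarded as a measure whose space is the sphere.  The origin, where
  \<open>sgn\<close> leaves the sphere, is a null set.  The lemma \<open>uniform_sphere_rotation\<close> below states the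
  rotation invariance which characterises this distribution.\<close>

definition uniform_sphere :: "'a::euclidean_space measure" where
  "uniform_sphere =
     restrict_space (distr (uniform_measure lborel (ball 0 1)) borel sgn) (sphere 0 1)"

lemma sets_uniform_sphere:
  "sets uniform_sphere = sets (restrict_space borel (sphere 0 1 :: 'a::euclidean_space set))"
  unfolding uniform_sphere_def by (rule sets_restrict_space_cong) simp

lemma space_uniform_sphere: "space (uniform_sphere :: 'a::euclidean_space measure) = sphere 0 1"
  by (simp add: uniform_sphere_def space_restrict_space)

lemma sgn_borel_measurable [measurable]: "(sgn :: 'a::euclidean_space \<Rightarrow> 'a) \<in> borel \<rightarrow>\<^sub>M borel"
  unfolding sgn_div_norm[abs_def] by measurable

lemma emeasure_unit_ball:
  "emeasure lborel (ball 0 1 :: 'a::euclidean_space set) \<noteq> 0"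
  "emeasure lborel (ball 0 1 :: 'a::euclidean_space set) \<noteq> \<infinity>"
proof -
  show "emeasure lborel (ball 0 1 :: 'a set) \<noteq> 0"
    using content_ball_pos[of 1 "0::'a"] by (auto simp: measure_def)
  show "emeasure lborel (ball 0 1 :: 'a set) \<noteq> \<infinity>"
    using emeasure_lborel_ball_finite[of "0::'a" 1] by auto
qed

lemma emeasure_uniform_sphere:
  fixes A :: "'a::euclidean_space set"
  assumes "A \<in> sets uniform_sphere"
  shows "emeasure uniform_sphere A =
    emeasure lborel (ball 0 1 \<inter> sgn -` A) / emeasure lborel (ball 0 1 :: 'a set)"
proof -
  have A: "A \<subseteq> sphere 0 1" "A \<in> sets borel"
    using assms by (auto simp: sets_uniform_sphere sets_restrict_space)
  have sA: "sgn -` A \<in> sets borel"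
    using measurable_sets[OF sgn_borel_measurable A(2)] by simp
  have "emeasure uniform_sphere A = emeasure (distr (uniform_measure lborel (ball 0 1)) borel sgn) A"
    unfolding uniform_sphere_def by (rule emeasure_restrict_space) (use A in auto)
  also have "\<dots> = emeasure (uniform_measure lborel (ball 0 1)) (sgn -` A)"
    by (subst emeasure_distr) (use A in auto)
  also have "\<dots> = emeasure lborel (ball 0 1 \<inter> sgn -` A) / emeasure lborel (ball 0 1 :: 'a set)"
    by (subst emeasure_uniform_measure) (use sA in auto)
  finally show ?thesis .
qed

lemma prob_space_uniform_sphere: "prob_space (uniform_sphere :: 'a::euclidean_space measure)"
proof
  let ?B = "ball 0 1 :: 'a set"
  have "?B \<inter> sgn -` sphere 0 1 = ?B - {0}"
    by (auto simp: norm_sgn)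
  moreover have "emeasure lborel (?B - {0}) = emeasure lborel ?B"
    by (rule emeasure_Diff_null_set) auto
  moreover have "emeasure lborel ?B / emeasure lborel ?B = 1"
    using emeasure_unit_ball by (intro ennreal_divide_self) (auto simp: less_top)
  moreover have "sphere 0 1 \<in> sets (uniform_sphere :: 'a measure)"
    using sets.top[of "uniform_sphere :: 'a measure"] by (simp add: space_uniform_sphere)
  ultimately show "emeasure uniform_sphere (space (uniform_sphere :: 'a measure)) = 1"
    by (simp add: space_uniform_sphere emeasure_uniform_sphere)
qed

lemma uniform_sphere_rotation:
  fixes f :: "real ^ 'n::{finite,wellorder} \<Rightarrow> real ^ 'n::_"
  assumes f: "orthogonal_transformation f" and A: "A \<in> sets uniform_sphere"
  shows "f ` A \<in> sets uniform_sphere" "emeasure uniform_sphere (f ` A) = emeasure uniform_sphere A"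
proof -
  have lin: "linear f" and nrm: "\<And>x. norm (f x) = norm x" and inj: "inj f"
    using f by (auto simp: orthogonal_transformation_linear orthogonal_transformation_norm
        orthogonal_transformation_inj)
  define g where "g = inv f"
  have g: "orthogonal_transformation g"
    unfolding g_def by (rule orthogonal_transformation_inv[OF f])
  have fg: "f (g x) = x" "g (f x) = x" for x
    unfolding g_def using f
    by (auto simp: inj surj_f_inv_f orthogonal_transformation_surj inv_f_f[OF inj])
  have nrmg: "norm (g x) = norm x" for x
    using g by (simp add: orthogonal_transformation_norm)
  have gm: "g \<in> borel \<rightarrow>\<^sub>M borel"
    using g by (intro borel_measurable_continuous_onI linear_continuous_on)
      (simp add: orthogonal_transformation_linear linear_linear)
  have A': "A \<subseteq> sphere 0 1" "A \<in> sets borel"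
    using A by (auto simp: sets_uniform_sphere sets_restrict_space)
  have fA: "f ` A = g -` A"
    using fg by (auto simp: image_iff) metis
  have "f ` A \<in> sets borel"
    using measurable_sets[OF gm A'(2)] by (simp add: fA)
  moreover have "f ` A \<subseteq> sphere 0 1"
    using A'(1) nrm by (auto simp: subset_iff)
  ultimately show fA_sets: "f ` A \<in> sets uniform_sphere"
    by (auto simp: sets_uniform_sphere sets_restrict_space image_iff)
  have sgn_f: "sgn (f x) = f (sgn x)" for x
    by (simp add: sgn_div_norm nrm linear_cmul[OF lin])
  let ?S = "\<lambda>A. ball 0 1 \<inter> sgn -` A :: (real, 'n) vec set"
  have eq: "?S (f ` A) = f ` ?S A"
  proof (intro equalityI subsetI)
    fix x assume x: "x \<in> ?S (f ` A)"
    then obtain a where a: "a \<in> A" "sgn x = f a" by auto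
    have "sgn (g x) = g (sgn x)"
      by (metis fg sgn_f)
    then have "g x \<in> ?S A"
      using x a nrmg[of x] by (auto simp: fg)
    then show "x \<in> f ` ?S A"
      by (metis fg(1) imageI)
  qed (auto simp: sgn_f nrm)
  have b: "?S B \<in> sets borel" if "B \<in> sets uniform_sphere" for B
    using that measurable_sets[OF sgn_borel_measurable, of B]
    by (auto simp: sets_uniform_sphere sets_restrict_space)
  have fin: "emeasure lebesgue (?S B) \<noteq> \<infinity>" if "B \<in> sets uniform_sphere" for B
    using emeasure_mono[of "?S B" "ball 0 1" lborel] emeasure_unit_ball(2)[where 'a="(real, 'n) vec"] b[OF that]
    by (auto simp: top_unique)
  have "?S A \<in> lmeasurable"
    using fin[OF A] b[OF A] by (auto simp: fmeasurable_def less_top)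
  then have "measure lebesgue (?S (f ` A)) = measure lebesgue (?S A)"
    unfolding eq by (rule measure_orthogonal_image[OF f])
  then have "emeasure lebesgue (?S (f ` A)) = emeasure lebesgue (?S A)"
    using fin[OF A] fin[OF fA_sets] by (simp add: emeasure_eq_ennreal_measure)
  then show "emeasure uniform_sphere (f ` A) = emeasure uniform_sphere A"
    using b[OF A] b[OF fA_sets]
    by (simp add: emeasure_uniform_sphere A fA_sets)
qed

section \<open>Sliced Wasserstein distance\<close>

definition couplings :: "'a::euclidean_space measure \<Rightarrow> 'a measure \<Rightarrow> ('a \<times> 'a) measure set" where
  "couplings \<mu> \<nu> =
     {\<pi>. sets \<pi> = sets (borel \<Otimes>\<^sub>M borel) \<and> distr \<pi> borel fst = \<mu> \<and> distr \<pi> borel snd = \<nu>}"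

definition wasserstein1 :: "'a::euclidean_space measure \<Rightarrow> 'a measure \<Rightarrow> ennreal" where
  "wasserstein1 \<mu> \<nu> = (INF \<pi>\<in>couplings \<mu> \<nu>. \<integral>\<^sup>+ z. ennreal (dist (fst z) (snd z)) \<partial>\<pi>)"

definition sliced_W1 :: "'a::euclidean_space measure \<Rightarrow> 'a measure \<Rightarrow> real" where
  "sliced_W1 \<mu> \<nu> =
     enn2real (\<integral>\<^sup>+ \<theta>. wasserstein1 (proj_measure \<theta> \<mu>) (proj_measure \<theta> \<nu>) \<partial>uniform_sphere)"

section \<open>Samples, empirical measures, bootstrap\<close>

text \<open>Samples are indexed from \<open>0\<close>, so the first \<open>n\<close> observations are \<open>X i\<close> with \<open>i < n\<close>.\<close>

definition iid_sample :: "'w measure \<Rightarrow> 'a::euclidean_space measure \<Rightarrow> (nat \<Rightarrow> 'w \<Rightarrow> 'a) \<Rightarrow> bool"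
  where
  "iid_sample M \<mu> X \<longleftrightarrow> prob_space M \<and> prob_space.indep_vars M (\<lambda>_. borel) X UNIV \<and>
     (\<forall>i. distr M borel (X i) = \<mu>)"

text \<open>Joint independence of all the \<open>X i\<close> and \<open>Y j\<close>, i.e. two i.i.d. sequences which are
  independent of each other.\<close>

definition two_iid_samples ::
  "'w measure \<Rightarrow> 'a::euclidean_space measure \<Rightarrow> 'a measure \<Rightarrow>
     (nat \<Rightarrow> 'w \<Rightarrow> 'a) \<Rightarrow> (nat \<Rightarrow> 'w \<Rightarrow> 'a) \<Rightarrow> bool"
  where
  "two_iid_samples M \<mu> \<nu> X Y \<longleftrightarrow>
     prob_space M \<and> prob_space.indep_vars M (\<lambda>_. borel) (case_sum X Y) UNIV \<and>
     (\<forall>i. distr M borel (X i) = \<mu>) \<and> (\<forall>i. distr M borel (Y i) = \<nu>)"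

definition empirical :: "nat \<Rightarrow> (nat \<Rightarrow> 'a::euclidean_space) \<Rightarrow> 'a measure" where
  "empirical n x = distr (uniform_count_measure {..<n}) borel x"

lemma measure_empirical:
  assumes "A \<in> sets borel"
  shows "measure (empirical n x) A = (\<Sum>i<n. indicator A (x i)) / real n"
proof -
  have "measure (empirical n x) A = measure (uniform_count_measure {..<n}) (x -` A \<inter> {..<n})"
    unfolding empirical_def
    by (subst measure_distr) (use assms in \<open>auto simp: space_uniform_count_measure\<close>)
  also have "\<dots> = real (card (x -` A \<inter> {..<n})) / real n"
    by (subst measure_uniform_count_measure) auto
  also have "real (card (x -` A \<inter> {..<n})) = (\<Sum>i<n. indicator A (x i))"
    by (simp add: sum.If_cases indicator_def Int_def vimage_def conj_commute)
  finally show ?thesis .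
qed

text \<open>The conditional law, given data \<open>x 0, \<dots>, x (n - 1)\<close>, of a bootstrap sample of size \<open>n\<close>:
  \<open>n\<close> independent draws from the empirical measure.\<close>

definition bootstrap_law :: "nat \<Rightarrow> (nat \<Rightarrow> 'a::euclidean_space) \<Rightarrow> (nat \<Rightarrow> 'a) measure" where
  "bootstrap_law n x = PiM {..<n} (\<lambda>_. empirical n x)"

text \<open>The conditional probability given the data \<open>x\<close> (and \<open>y\<close>) that the bootstrap statistic
  is at most \<open>t\<close>.\<close>

definition bootstrap_cdf1 ::
  "'a::euclidean_space measure \<Rightarrow> nat \<Rightarrow> (nat \<Rightarrow> 'a) \<Rightarrow> real \<Rightarrow> real" where
  "bootstrap_cdf1 \<nu> n x t =
     measure (bootstrap_law n x)
       {xb \<in> space (bootstrap_law n x).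
          sqrt (real n) * (sliced_W1 (empirical n xb) \<nu> - sliced_W1 (empirical n x) \<nu>) \<le> t}"

definition bootstrap_cdf2 ::
  "nat \<Rightarrow> (nat \<Rightarrow> 'a::euclidean_space) \<Rightarrow> (nat \<Rightarrow> 'a) \<Rightarrow> real \<Rightarrow> real" where
  "bootstrap_cdf2 n x y t =
     measure (bootstrap_law n x \<Otimes>\<^sub>M bootstrap_law n y)
       {(xb, yb) \<in> space (bootstrap_law n x \<Otimes>\<^sub>M bootstrap_law n y).
          sqrt (real n) * (sliced_W1 (empirical n xb) (empirical n yb)
                           - sliced_W1 (empirical n x) (empirical n y)) \<le> t}"

section \<open>Normal limits and modes of convergence\<close>

text \<open>\<open>N(0, v)\<close> parametrised by its variance \<open>v \<ge> 0\<close>; a point mass if \<open>v = 0\<close>.\<close>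

definition centered_normal :: "real \<Rightarrow> real measure" where
  "centered_normal v =
     (if v = 0 then return borel 0 else density lborel (\<lambda>x. ennreal (normal_density 0 (sqrt v) x)))"

text \<open>Measurability is part of both modes of convergence: without it the values of
  \<open>distr\<close> and \<open>measure\<close> would be meaningless.\<close>

definition conv_in_distribution :: "'w measure \<Rightarrow> (nat \<Rightarrow> 'w \<Rightarrow> real) \<Rightarrow> real measure \<Rightarrow> bool" where
  "conv_in_distribution M S N \<longleftrightarrow>
     (\<forall>n. S n \<in> borel_measurable M) \<and> weak_conv_m (\<lambda>n. distr M borel (S n)) N"

definition conv_in_probability :: "'w measure \<Rightarrow> (nat \<Rightarrow> 'w \<Rightarrow> real) \<Rightarrow> real \<Rightarrow> bool" where
  "conv_in_probability M Z c \<longleftrightarrow>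
     (\<forall>n. Z n \<in> borel_measurable M) \<and>
     (\<forall>e>0. (\<lambda>n. measure M {\<omega> \<in> space M. \<bar>Z n \<omega> - c\<bar> > e}) \<longlonglongrightarrow> 0)"

section \<open>The Gaussian processes\<close>

definition covariance :: "'g measure \<Rightarrow> ('g \<Rightarrow> real) \<Rightarrow> ('g \<Rightarrow> real) \<Rightarrow> real" where
  "covariance P U V =
     prob_space.expectation P
       (\<lambda>\<omega>. (U \<omega> - prob_space.expectation P U) * (V \<omega> - prob_space.expectation P V))"

text \<open>A process is centered Gaussian if every finite linear combination of its values has a
  centered (possibly degenerate) normal distribution.\<close>

definition projection_process ::
  "'g measure \<Rightarrow> 'a::euclidean_space measure \<Rightarrow> (real \<times> 'a \<Rightarrow> 'g \<Rightarrow> real) \<Rightarrow> bool" where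
  "projection_process P \<mu> G \<longleftrightarrow>
     prob_space P \<and>
     (\<lambda>(\<omega>, z). G z \<omega>) \<in> borel_measurable (P \<Otimes>\<^sub>M (lborel \<Otimes>\<^sub>M uniform_sphere)) \<and>
     (\<forall>\<omega>\<in>space P. integrable (lborel \<Otimes>\<^sub>M uniform_sphere) (\<lambda>z. G z \<omega>)) \<and>
     (\<forall>J c. finite J \<and> J \<subseteq> UNIV \<times> sphere 0 1 \<longrightarrow>
        (\<exists>v\<ge>0. distr P borel (\<lambda>\<omega>. \<Sum>z\<in>J. c z * G z \<omega>) = centered_normal v)) \<and>
     (\<forall>s t. \<forall>\<theta>\<in>sphere 0 1. \<forall>\<phi>\<in>sphere 0 1.
        covariance P (G (s, \<theta>)) (G (t, \<phi>)) =
          measure \<mu> {x. \<theta> \<bullet> x \<le> s \<and> \<phi> \<bullet> x \<le> t} - proj_cdf \<mu> s \<theta> * proj_cdf \<mu> t \<phi>)"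

definition independent_processes ::
  "'g measure \<Rightarrow> (real \<times> 'a::euclidean_space \<Rightarrow> 'g \<Rightarrow> real) \<Rightarrow> (real \<times> 'a \<Rightarrow> 'g \<Rightarrow> real) \<Rightarrow> bool"
  where
  "independent_processes P G G' \<longleftrightarrow>
     prob_space.indep_var P
       (PiM (UNIV \<times> sphere 0 1) (\<lambda>_. borel)) (\<lambda>\<omega>. \<lambda>z\<in>UNIV \<times> sphere 0 1. G z \<omega>)
       (PiM (UNIV \<times> sphere 0 1) (\<lambda>_. borel)) (\<lambda>\<omega>. \<lambda>z\<in>UNIV \<times> sphere 0 1. G' z \<omega>)"

text \<open>The variance of \<open>\<integral>\<integral> sign(F\<^sub>\<mu> - F\<^sub>\<nu>) G d\<lambda> d\<sigma>\<close>.\<close>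

definition sign_variance ::
  "'g measure \<Rightarrow> 'a::euclidean_space measure \<Rightarrow> 'a measure \<Rightarrow> (real \<times> 'a \<Rightarrow> 'g \<Rightarrow> real) \<Rightarrow> real"
  where
  "sign_variance P \<mu> \<nu> G =
     prob_space.variance P
       (\<lambda>\<omega>. \<integral>z. sgn (proj_cdf \<mu> (fst z) (snd z) - proj_cdf \<nu> (fst z) (snd z)) * G z \<omega>
              \<partial>(lborel \<Otimes>\<^sub>M uniform_sphere))"

section \<open>Semiparametric efficiency bounds\<close>

definition L2_fun :: "'a measure \<Rightarrow> ('a \<Rightarrow> real) set" where
  "L2_fun \<mu> = {f \<in> borel_measurable \<mu>. integrable \<mu> (\<lambda>x. (f x)\<^sup>2)}"

definition L2_nrm :: "'a measure \<Rightarrow> ('a \<Rightarrow> real) \<Rightarrow> real" where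
  "L2_nrm \<mu> f = sqrt (\<integral>x. (f x)\<^sup>2 \<partial>\<mu>)"

text \<open>Functionals on \<open>L\<^sup>2\<close> are represented on square-integrable functions; the bound makes them
  independent of the choice of a representative.\<close>

definition continuous_linear_functional_L2 :: "'a measure \<Rightarrow> (('a \<Rightarrow> real) \<Rightarrow> real) \<Rightarrow> bool" where
  "continuous_linear_functional_L2 \<mu> D \<longleftrightarrow>
     (\<forall>f\<in>L2_fun \<mu>. \<forall>g\<in>L2_fun \<mu>. D (\<lambda>x. f x + g x) = D f + D g) \<and>
     (\<forall>a. \<forall>f\<in>L2_fun \<mu>. D (\<lambda>x. a * f x) = a * D f) \<and>
     (\<exists>C. \<forall>f\<in>L2_fun \<mu>. \<bar>D f\<bar> \<le> C * L2_nrm \<mu> f)"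

definition tangent_set :: "'a::euclidean_space measure \<Rightarrow> ('a \<Rightarrow> real) set" where
  "tangent_set \<mu> = {h \<in> borel_measurable borel. bounded (range h) \<and> (\<integral>x. h x \<partial>\<mu>) = 0}"

definition perturb :: "'a measure \<Rightarrow> real \<Rightarrow> ('a \<Rightarrow> real) \<Rightarrow> 'a measure" where
  "perturb \<mu> t h = density \<mu> (\<lambda>x. ennreal (1 + t * h x))"

text \<open>Pathwise differentiability of the functional together with the value \<open>b\<close> of the bound.
  The supremum is taken in \<open>ennreal\<close>, so it is \<open>0\<close> if the tangent space is trivial; a tangent
  function counts as nonzero if it is nonzero in \<open>L\<^sup>2\<close>.\<close>

definition has_efficiency_bound ::
  "('a::euclidean_space measure \<Rightarrow> real) \<Rightarrow> 'a measure \<Rightarrow> ennreal \<Rightarrow> bool" where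
  "has_efficiency_bound \<kappa> \<mu> b \<longleftrightarrow>
     (\<exists>D. continuous_linear_functional_L2 \<mu> D \<and>
        (\<forall>h\<in>tangent_set \<mu>.
           ((\<lambda>t. (\<kappa> (perturb \<mu> t h) - \<kappa> \<mu>) / t) \<longlongrightarrow> D h) (at_right 0)) \<and>
        b = (SUP h\<in>{h \<in> tangent_set \<mu>. L2_nrm \<mu> h \<noteq> 0}.
               ennreal ((D h)\<^sup>2 / (L2_nrm \<mu> h)\<^sup>2)))"

definition osum :: "('a \<Rightarrow> real) \<Rightarrow> ('a \<Rightarrow> real) \<Rightarrow> 'a \<times> 'a \<Rightarrow> real" where
  "osum h1 h2 = (\<lambda>(x, y). h1 x + h2 y)"

definition has_efficiency_bound2 ::
  "('a::euclidean_space measure \<Rightarrow> 'a measure \<Rightarrow> real) \<Rightarrow> 'a measure \<Rightarrow> 'a measure \<Rightarrow> ennreal \<Rightarrow> bool"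
  where
  "has_efficiency_bound2 \<kappa> \<mu> \<nu> b \<longleftrightarrow>
     (\<exists>D. continuous_linear_functional_L2 (\<mu> \<Otimes>\<^sub>M \<nu>) D \<and>
        (\<forall>h1\<in>tangent_set \<mu>. \<forall>h2\<in>tangent_set \<nu>.
           ((\<lambda>t. (\<kappa> (perturb \<mu> t h1) (perturb \<nu> t h2) - \<kappa> \<mu> \<nu>) / t) \<longlongrightarrow> D (osum h1 h2))
             (at_right 0)) \<and>
        b = (SUP h\<in>{osum h1 h2 | h1 h2. h1 \<in> tangent_set \<mu> \<and> h2 \<in> tangent_set \<nu> \<and>
                                         L2_nrm (\<mu> \<Otimes>\<^sub>M \<nu>) (osum h1 h2) \<noteq> 0}.
               ennreal ((D h)\<^sup>2 / (L2_nrm (\<mu> \<Otimes>\<^sub>M \<nu>) h)\<^sup>2)))"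

end

theory Submission
  imports Defs
begin

text \<open>After an application of Fubini's theorem the sliced distance is an $L^1$ distance: on the line
\<open>W\<^sub>1\<close> is the integral of the absolute difference of the distribution functions
(\<open>wasserstein1_real_eq\<close>), so the sliced distance of \<open>\<mu>\<close> and \<open>\<nu>\<close> is the integral of \<open>\<bar>a\<bar>\<close> over
\<open>\<lambda> \<otimes> \<sigma>\<close>, where \<open>a = F\<^sub>\<mu> - F\<^sub>\<nu>\<close> (\<open>sliced_W1_eq_integral\<close>).  Replacing \<open>\<mu>\<close> by the empirical measure
adds to \<open>a\<close> the average \<open>b\<close> of the kernels \<open>k x (t, \<theta>) = 1{\<theta> \<bullet> x \<le> t} - F\<^sub>\<mu> (t; \<theta>)\<close> at the observations,
which are independent and centered.

The $L^1$ norm is not differentiable everywhere, but \<open>\<bar>a + b\<bar> - \<bar>a\<bar> - sgn a * b\<close> vanishes unless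
\<open>\<bar>a\<bar> \<le> \<bar>b\<bar>\<close> and is at most \<open>2 * \<bar>b\<bar>\<close>.  At a fixed point the average \<open>b\<close> has the second moment
\<open>\<tau>\<^sup>2 / n\<close> with \<open>\<tau>\<^sup>2 = F\<^sub>\<mu> * (1 - F\<^sub>\<mu>)\<close>; hence \<open>sqrt n\<close> times the expected remainder is at most
\<open>min (2 * \<tau>) (2 * \<tau>\<^sup>2 / (sqrt n * \<bar>a\<bar>))\<close>.  This tends to \<open>0\<close> wherever \<open>a \<noteq> 0\<close> or \<open>\<tau> = 0\<close>, and it is dominated
by \<open>2 * \<tau>\<close>, which is integrable because of the moment of order \<open>2 + \<epsilon>\<close> (\<open>integrable_slice_sd\<close>).
The hypothesis on \<open>F\<^sub>\<mu> \<noteq> F\<^sub>\<nu>\<close> makes almost every point such a point, since \<open>\<tau> = 0\<close> outside the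
interval spanned by the support.  By dominated convergence (\<open>L1_linearization_error\<close>)
the normalised statistic is, up to an error that vanishes in mean, the sum of \<open>\<Phi> (X i) / sqrt n\<close> with
the influence function \<open>\<Phi> x = \<integral> sgn a * k x\<close>.  Everything else follows from this expansion.

\<^item> The limit is normal with variance \<open>\<integral> \<Phi>\<^sup>2 d\<mu>\<close> (\<open>central_limit\<close>).  By Fubini's theorem this number and the
  variance of \<open>\<integral> sgn a * G\<close> are the same double integral of the covariance of \<open>G\<close>, which is the
  covariance of the kernel (\<open>variance_integral_projection_process\<close>).

\<^item> The distribution functions of \<open>(1 + t h) \<mu>\<close> are \<open>F\<^sub>\<mu> + t * \<integral> h * k d\<mu>\<close>, so the same expansion gives
  the pathwise derivative \<open>h \<mapsto> \<integral> \<Phi> * h d\<mu>\<close>.  Bounded centered functions approximate \<open>\<Phi>\<close>, and the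
  Cauchy--Schwarz inequality shows that the efficiency bound is \<open>\<integral> \<Phi>\<^sup>2 d\<mu>\<close>
  (\<open>efficiency_bound_eq_norm\<close>).

\<^item> The resampled and the original empirical measure are both perturbations of \<open>\<mu>\<close> of order
  \<open>1 / sqrt n\<close>, so both distances can be linearized at \<open>a\<close>; what remains is the normalised
  difference between the averages of \<open>\<Phi>\<close> over the resampled and over the original data.  Its
  conditional characteristic function converges in mean, and a smoothing inequality whose constants do not depend on the data
  (\<open>cdf_distance_le_char_distance\<close>) turns this into uniform convergence of the conditional
  distribution functions in probability (\<open>bootstrap_consistency\<close>).

For two samples the argument is the same for the measure \<open>\<mu> \<otimes> \<nu>\<close> and the kernel of a pair of
observations, which is the difference of the kernels for \<open>\<mu>\<close> and \<open>\<nu>\<close>.  The argument is therefore carried out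
for an abstract kernel and, in the case of the bootstrap, for draws from an abstract finite index
set, which consists of indices for one sample and of pairs of indices for two samples.\<close>

section \<open>The Wasserstein distance on the line\<close>

lemma nn_integral_atLeast_diff:
  fixes x y :: real
  shows "(\<integral>\<^sup>+t. ennreal \<bar>indicator {x..} t - indicator {y..} t\<bar> \<partial>lborel) = ennreal \<bar>x - y\<bar>"
proof -
  have "(\<integral>\<^sup>+t. ennreal \<bar>indicator {x..} t - indicator {y..} t\<bar> \<partial>lborel)
      = (\<integral>\<^sup>+t. indicator {min x y..<max x y} t \<partial>lborel)"
    by (intro nn_integral_cong) (auto simp: indicator_def min_def max_def)
  also have "\<dots> = ennreal \<bar>x - y\<bar>"
    by (auto simp: min_def max_def abs_if)
  finally show ?thesis .
qed

text \<open>The distance of two points of the line is the length of the set of levels that separate them.\<close>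

lemma nn_integral_dist_layer_cake:
  fixes U V :: "'w \<Rightarrow> real"
  assumes "sigma_finite_measure M" and [measurable]: "U \<in> borel_measurable M" "V \<in> borel_measurable M"
  shows "(\<integral>\<^sup>+\<omega>. ennreal (dist (U \<omega>) (V \<omega>)) \<partial>M)
       = (\<integral>\<^sup>+t. \<integral>\<^sup>+\<omega>. ennreal \<bar>indicator {U \<omega>..} t - indicator {V \<omega>..} t\<bar> \<partial>M \<partial>lborel)"
proof -
  interpret sigma_finite_measure M by fact
  interpret pair_sigma_finite lborel M ..
  have [measurable]: "(\<lambda>(t, \<omega>). ennreal \<bar>indicator {U \<omega>..} t - indicator {V \<omega>..} t\<bar>)
      \<in> borel_measurable (lborel \<Otimes>\<^sub>M M)"
    unfolding indicator_def atLeast_iff by measurable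
  show ?thesis
    by (subst Fubini'[symmetric]) (simp_all add: nn_integral_atLeast_diff dist_real_def)
qed

text \<open>In every coupling, a level \<open>t\<close> separates the two coordinates with probability at least the
difference of the distribution functions at \<open>t\<close>.  The quantile coupling attains this lower bound for all \<open>t\<close>
simultaneously: there \<open>t\<close> separates the coordinates exactly for the arguments between the
two values of the distribution functions.\<close>

theorem wasserstein1_real_eq:
  assumes "real_distribution \<mu>" "real_distribution \<nu>"
  shows "wasserstein1 \<mu> \<nu> = (\<integral>\<^sup>+t. ennreal \<bar>cdf \<mu> t - cdf \<nu> t\<bar> \<partial>lborel)"
proof -
  interpret mu: cdf_distribution \<mu> using assms(1) by (simp add: cdf_distribution_def)
  interpret nu: cdf_distribution \<nu> using assms(2) by (simp add: cdf_distribution_def)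
  show ?thesis
    unfolding wasserstein1_def
  proof (rule antisym)
    define \<Omega> where "\<Omega> = (restrict_space lborel {0<..<1::real})"
    interpret O: prob_space \<Omega>
      unfolding \<Omega>_def by (auto simp: space_restrict_space emeasure_restrict_space intro!: prob_spaceI)
    have sO: "sets \<Omega> = sets (restrict_space borel {0<..<1::real})"
      unfolding \<Omega>_def by (rule sets_restrict_space_cong) simp
    have [measurable]: "mu.I \<in> borel_measurable \<Omega>" "nu.I \<in> borel_measurable \<Omega>"
      using mu.measurable_CI nu.measurable_CI by (simp_all add: measurable_cong_sets[OF sO refl])
    \<comment> \<open>Both quantile functions are evaluated at the same uniform random number.\<close>
    define \<pi> where "\<pi> = distr \<Omega> (borel \<Otimes>\<^sub>M borel) (\<lambda>u. (mu.I u, nu.I u))"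
    have "\<pi> \<in> couplings \<mu> \<nu>"
      using mu.distr_I_eq_M nu.distr_I_eq_M
      by (simp add: couplings_def \<pi>_def distr_distr comp_def \<Omega>_def[symmetric])
    moreover have "(\<integral>\<^sup>+ z. ennreal (dist (fst z) (snd z)) \<partial>\<pi>) = (\<integral>\<^sup>+t. ennreal \<bar>cdf \<mu> t - cdf \<nu> t\<bar> \<partial>lborel)"
    proof -
      have "(\<integral>\<^sup>+ z. ennreal (dist (fst z) (snd z)) \<partial>\<pi>) = (\<integral>\<^sup>+u. ennreal (dist (mu.I u) (nu.I u)) \<partial>\<Omega>)"
        unfolding \<pi>_def by (subst nn_integral_distr) auto
      also have "\<dots> = (\<integral>\<^sup>+t. \<integral>\<^sup>+u. ennreal \<bar>indicator {mu.I u..} t - indicator {nu.I u..} t\<bar> \<partial>\<Omega> \<partial>lborel)"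
        by (intro nn_integral_dist_layer_cake O.sigma_finite_measure_axioms) auto
      also have "\<dots> = (\<integral>\<^sup>+t. ennreal \<bar>cdf \<mu> t - cdf \<nu> t\<bar> \<partial>lborel)"
      proof (intro nn_integral_cong)
        fix t
        let ?l = "min (cdf \<mu> t) (cdf \<nu> t)" and ?u = "max (cdf \<mu> t) (cdf \<nu> t)"
        have b: "0 \<le> cdf \<mu> t" "cdf \<mu> t \<le> 1" "0 \<le> cdf \<nu> t" "cdf \<nu> t \<le> 1"
          by (auto simp: mu.cdf_nonneg nu.cdf_nonneg mu.cdf_bounded_prob nu.cdf_bounded_prob)
        have "(\<integral>\<^sup>+u. ennreal \<bar>indicator {mu.I u..} t - indicator {nu.I u..} t\<bar> \<partial>\<Omega>)
            = (\<integral>\<^sup>+u. indicator {?l<..?u} u * indicator {0<..<1} u \<partial>lborel)"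
          unfolding \<Omega>_def
          by (subst nn_integral_restrict_space)
             (auto intro!: nn_integral_cong simp: indicator_def mu.pseudoinverse[symmetric] nu.pseudoinverse[symmetric])
        also have "\<dots> = (\<integral>\<^sup>+u. indicator {?l<..?u} u \<partial>lborel)"
          using AE_lborel_singleton[of "1::real"] b
          by (intro nn_integral_cong_AE) (auto simp: indicator_def split: if_splits)
        also have "\<dots> = ennreal \<bar>cdf \<mu> t - cdf \<nu> t\<bar>"
          by (auto simp: min_def max_def abs_if)
        finally show "(\<integral>\<^sup>+u. ennreal \<bar>indicator {mu.I u..} t - indicator {nu.I u..} t\<bar> \<partial>\<Omega>)
            = ennreal \<bar>cdf \<mu> t - cdf \<nu> t\<bar>" .
      qed
      finally show ?thesis .
    qed
    ultimately show "(INF \<pi>\<in>couplings \<mu> \<nu>. \<integral>\<^sup>+ z. ennreal (dist (fst z) (snd z)) \<partial>\<pi>)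
        \<le> (\<integral>\<^sup>+t. ennreal \<bar>cdf \<mu> t - cdf \<nu> t\<bar> \<partial>lborel)"
      by (intro INF_lower2[of \<pi>]) auto
  next
    show "(\<integral>\<^sup>+t. ennreal \<bar>cdf \<mu> t - cdf \<nu> t\<bar> \<partial>lborel)
      \<le> (INF \<pi>\<in>couplings \<mu> \<nu>. \<integral>\<^sup>+ z. ennreal (dist (fst z) (snd z)) \<partial>\<pi>)"
    proof (rule INF_greatest)
      fix \<pi> assume "\<pi> \<in> couplings \<mu> \<nu>"
      then have s: "sets \<pi> = sets (borel \<Otimes>\<^sub>M borel)" and d: "distr \<pi> borel fst = \<mu>" "distr \<pi> borel snd = \<nu>"
        by (auto simp: couplings_def)
      have [measurable]: "fst \<in> borel_measurable \<pi>" "snd \<in> borel_measurable \<pi>"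
        by (simp_all add: measurable_cong_sets[OF s refl])
      interpret pi: prob_space \<pi>
        using d(1) mu.prob_space_axioms by (metis prob_space_distrD \<open>fst \<in> borel_measurable \<pi>\<close>)
      have "(\<integral>\<^sup>+ z. ennreal (dist (fst z) (snd z)) \<partial>\<pi>)
        = (\<integral>\<^sup>+t. \<integral>\<^sup>+z. ennreal \<bar>indicator {fst z..} t - indicator {snd z..} t\<bar> \<partial>\<pi> \<partial>lborel)"
        by (intro nn_integral_dist_layer_cake pi.sigma_finite_measure_axioms) auto
      also have "(\<integral>\<^sup>+t. ennreal \<bar>cdf \<mu> t - cdf \<nu> t\<bar> \<partial>lborel) \<le> \<dots>"
      proof (intro nn_integral_mono)
        fix t :: real
        have [measurable]: "(\<lambda>z. indicator {fst z..} t :: real) \<in> borel_measurable \<pi>"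
          "(\<lambda>z. indicator {snd z..} t :: real) \<in> borel_measurable \<pi>"
          unfolding indicator_def atLeast_iff by measurable
        have i: "integrable \<pi> (\<lambda>z. indicator {fst z..} t :: real)" "integrable \<pi> (\<lambda>z. indicator {snd z..} t :: real)"
          by (auto intro!: pi.integrable_const_bound[where B=1])
        have "cdf \<mu> t = (\<integral>x. indicator {..t} x \<partial>\<mu>)"
          by (simp add: cdf_def)
        also have "\<dots> = (\<integral>z. indicator {..t} (fst z) \<partial>\<pi>)"
          by (subst d(1)[symmetric], subst integral_distr) auto
        also have "\<dots> = (\<integral>z. indicator {fst z..} t \<partial>\<pi>)"
          by (auto intro!: Bochner_Integration.integral_cong simp: indicator_def)
        finally have 1: "cdf \<mu> t = (\<integral>z. indicator {fst z..} t \<partial>\<pi>)" .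
        have "cdf \<nu> t = (\<integral>x. indicator {..t} x \<partial>\<nu>)"
          by (simp add: cdf_def)
        also have "\<dots> = (\<integral>z. indicator {..t} (snd z) \<partial>\<pi>)"
          by (subst d(2)[symmetric], subst integral_distr) auto
        also have "\<dots> = (\<integral>z. indicator {snd z..} t \<partial>\<pi>)"
          by (auto intro!: Bochner_Integration.integral_cong simp: indicator_def)
        finally have 2: "cdf \<nu> t = (\<integral>z. indicator {snd z..} t \<partial>\<pi>)" .
        have "\<bar>cdf \<mu> t - cdf \<nu> t\<bar> \<le> (\<integral>z. \<bar>indicator {fst z..} t - indicator {snd z..} t\<bar> \<partial>\<pi>)"
          unfolding 1 2 by (subst Bochner_Integration.integral_diff[OF i, symmetric]) (rule integral_abs_bound)
        then have "ennreal \<bar>cdf \<mu> t - cdf \<nu> t\<bar> \<le> ennreal (\<integral>z. \<bar>indicator {fst z..} t - indicator {snd z..} t\<bar> \<partial>\<pi>)"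
          by (rule ennreal_leI)
        also have "\<dots> = (\<integral>\<^sup>+z. ennreal \<bar>indicator {fst z..} t - indicator {snd z..} t\<bar> \<partial>\<pi>)"
          using i by (intro nn_integral_eq_integral[symmetric]) auto
        finally show "ennreal \<bar>cdf \<mu> t - cdf \<nu> t\<bar>
          \<le> (\<integral>\<^sup>+z. ennreal \<bar>indicator {fst z..} t - indicator {snd z..} t\<bar> \<partial>\<pi>)" .
      qed
      finally show "(\<integral>\<^sup>+t. ennreal \<bar>cdf \<mu> t - cdf \<nu> t\<bar> \<partial>lborel) \<le> (\<integral>\<^sup>+ z. ennreal (dist (fst z) (snd z)) \<partial>\<pi>)" .
    qed
  qed
qed

section \<open>Distribution functions of the slices\<close>

abbreviation (input) slices :: "(real \<times> 'a::euclidean_space) measure" where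
  "slices \<equiv> lborel \<Otimes>\<^sub>M uniform_sphere"

text \<open>As a function of \<open>z\<close>, the slice distribution functions of the point mass at \<open>x\<close>.\<close>

definition halfspace :: "'a::euclidean_space \<Rightarrow> real \<times> 'a \<Rightarrow> real" where
  "halfspace x z = (if snd z \<bullet> x \<le> fst z then 1 else 0)"

abbreviation slice_cdf :: "'a::euclidean_space measure \<Rightarrow> real \<times> 'a \<Rightarrow> real" where
  "slice_cdf \<mu> z \<equiv> proj_cdf \<mu> (fst z) (snd z)"

lemma pair_sigma_finite_slices:
  "pair_sigma_finite lborel (uniform_sphere :: 'a::euclidean_space measure)"
proof -
  interpret S: prob_space "uniform_sphere :: 'a measure" by (rule prob_space_uniform_sphere)
  show ?thesis ..
qed

lemma sigma_finite_slices: "sigma_finite_measure (slices :: (real \<times> 'a::euclidean_space) measure)"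
proof -
  interpret pair_sigma_finite lborel "uniform_sphere :: 'a measure" by (rule pair_sigma_finite_slices)
  show ?thesis ..
qed

lemma measurable_uniform_sphere_borel:
  "(\<lambda>\<theta>. \<theta>) \<in> uniform_sphere \<rightarrow>\<^sub>M (borel :: 'a::euclidean_space measure)"
proof -
  have "(\<lambda>\<theta>. \<theta>) \<in> restrict_space borel (sphere 0 1) \<rightarrow>\<^sub>M (borel :: 'a measure)"
    by (intro measurable_restrict_space1) simp
  then show ?thesis
    by (simp only: measurable_cong_sets[OF sets_uniform_sphere refl])
qed

lemma measurable_snd_slices [measurable (raw)]:
  assumes "g \<in> N \<rightarrow>\<^sub>M (slices :: (real \<times> 'a::euclidean_space) measure)"
  shows "(\<lambda>w. snd (g w)) \<in> N \<rightarrow>\<^sub>M (borel :: 'a measure)"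
  using measurable_compose[OF measurable_compose[OF assms measurable_snd] measurable_uniform_sphere_borel] .

lemma measurable_fst_slices [measurable (raw)]:
  assumes "g \<in> N \<rightarrow>\<^sub>M (slices :: (real \<times> 'a::euclidean_space) measure)"
  shows "(\<lambda>w. fst (g w)) \<in> N \<rightarrow>\<^sub>M (borel :: real measure)"
  using measurable_compose[OF assms measurable_fst] by simp

lemma measurable_halfspace [measurable (raw)]:
  assumes [measurable]: "f \<in> N \<rightarrow>\<^sub>M borel" "g \<in> N \<rightarrow>\<^sub>M slices"
  shows "(\<lambda>w. halfspace (f w) (g w)) \<in> borel_measurable N"
proof -
  have [measurable]: "(\<lambda>w. snd (g w) \<bullet> f w) \<in> borel_measurable N"
    by measurable
  show ?thesis unfolding halfspace_def by measurable
qed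

lemma halfspace_bounds: "0 \<le> halfspace x z" "halfspace x z \<le> 1" "\<bar>halfspace x z\<bar> \<le> 1"
  by (simp_all add: halfspace_def)

locale borel_prob_space = prob_space \<mu> for \<mu> :: "'a::euclidean_space measure" +
  assumes sets_eq_borel [measurable_cong, simp]: "sets \<mu> = sets borel"
begin

lemma space_eq_UNIV [simp]: "space \<mu> = UNIV"
  using sets_eq_imp_space_eq[OF sets_eq_borel] by simp

lemma measure_UNIV [simp]: "measure \<mu> UNIV = 1"
  using prob_space by simp

lemma measurable_halfspace_left [measurable]: "(\<lambda>x. halfspace x z) \<in> borel_measurable \<mu>"
proof -
  have [measurable]: "(\<lambda>x. snd z \<bullet> x) \<in> borel_measurable \<mu>"
    by measurable
  show ?thesis unfolding halfspace_def by measurable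
qed

lemma integrable_halfspace [simp]: "integrable \<mu> (\<lambda>x. halfspace x z)"
  by (rule integrable_const_bound[where B=1]) (auto simp: halfspace_bounds)

lemma slice_cdf_eq_integral: "slice_cdf \<mu> z = (\<integral>x. halfspace x z \<partial>\<mu>)"
proof -
  have [measurable]: "{x. snd z \<bullet> x \<le> fst z} \<in> sets borel"
    by measurable
  have "(\<integral>x. halfspace x z \<partial>\<mu>) = (\<integral>x. indicator {x. snd z \<bullet> x \<le> fst z} x \<partial>\<mu>)"
    by (intro Bochner_Integration.integral_cong) (auto simp: halfspace_def indicator_def)
  then show ?thesis by (simp add: proj_cdf_def)
qed

lemma slice_cdf_bounds: "0 \<le> slice_cdf \<mu> z" "slice_cdf \<mu> z \<le> 1"
  by (auto simp: proj_cdf_def)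

lemma slice_cdf_measurable [measurable]: "slice_cdf \<mu> \<in> borel_measurable slices"
proof -
  have "(\<lambda>z. \<integral>x. halfspace x z \<partial>\<mu>) \<in> borel_measurable slices"
    by measurable
  then show ?thesis by (simp add: slice_cdf_eq_integral cong: measurable_cong)
qed

lemma real_distribution_proj: "real_distribution (proj_measure \<theta> \<mu>)"
proof -
  have "(\<lambda>x. \<theta> \<bullet> x) \<in> borel_measurable \<mu>"
    by measurable
  then show ?thesis
    unfolding proj_measure_def by (rule real_distribution_distr)
qed

lemma cdf_proj: "cdf (proj_measure \<theta> \<mu>) t = proj_cdf \<mu> t \<theta>"
proof -
  have "(\<lambda>x. \<theta> \<bullet> x) \<in> borel_measurable \<mu>"
    by measurable
  then show ?thesis
    by (simp add: cdf_def proj_measure_def proj_cdf_def measure_distr vimage_def)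
qed

end

lemma sliced_W1_eq_nn_integral:
  fixes \<mu> \<nu> :: "'a::euclidean_space measure"
  assumes "borel_prob_space \<mu>" "borel_prob_space \<nu>"
  shows "sliced_W1 \<mu> \<nu> = enn2real (\<integral>\<^sup>+z. ennreal \<bar>slice_cdf \<mu> z - slice_cdf \<nu> z\<bar> \<partial>slices)"
proof -
  interpret M: borel_prob_space \<mu> by fact
  interpret N: borel_prob_space \<nu> by fact
  interpret pair_sigma_finite lborel "uniform_sphere :: 'a measure" by (rule pair_sigma_finite_slices)
  have "(\<integral>\<^sup>+ \<theta>. wasserstein1 (proj_measure \<theta> \<mu>) (proj_measure \<theta> \<nu>) \<partial>uniform_sphere)
    = (\<integral>\<^sup>+ \<theta>. \<integral>\<^sup>+t. ennreal \<bar>slice_cdf \<mu> (t, \<theta>) - slice_cdf \<nu> (t, \<theta>)\<bar> \<partial>lborel \<partial>uniform_sphere)"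
    by (simp add: wasserstein1_real_eq M.real_distribution_proj N.real_distribution_proj M.cdf_proj N.cdf_proj)
  also have "\<dots> = (\<integral>\<^sup>+z. ennreal \<bar>slice_cdf \<mu> z - slice_cdf \<nu> z\<bar> \<partial>slices)"
    by (subst nn_integral_snd[symmetric]) simp_all
  finally show ?thesis by (simp add: sliced_W1_def)
qed

text \<open>The integral is the sliced distance of two point masses, that is, the mean of the distance
of their projections.\<close>

lemma nn_integral_halfspace_diff:
  fixes x y :: "'a::euclidean_space"
  shows "(\<integral>\<^sup>+z. ennreal \<bar>halfspace x z - halfspace y z\<bar> \<partial>slices) \<le> ennreal (norm (x - y))"
proof -
  interpret S: prob_space "uniform_sphere :: 'a measure" by (rule prob_space_uniform_sphere)
  interpret pair_sigma_finite lborel "uniform_sphere :: 'a measure" by (rule pair_sigma_finite_slices)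
  have "(\<integral>\<^sup>+z. ennreal \<bar>halfspace x z - halfspace y z\<bar> \<partial>slices)
     = (\<integral>\<^sup>+\<theta>. \<integral>\<^sup>+t. ennreal \<bar>indicator {\<theta> \<bullet> x..} t - indicator {\<theta> \<bullet> y..} t\<bar> \<partial>lborel \<partial>uniform_sphere)"
    by (subst nn_integral_snd[symmetric])
       (auto intro!: nn_integral_cong simp: halfspace_def indicator_def)
  also have "\<dots> = (\<integral>\<^sup>+\<theta>. ennreal \<bar>\<theta> \<bullet> x - \<theta> \<bullet> y\<bar> \<partial>uniform_sphere)"
    by (simp add: nn_integral_atLeast_diff)
  also have "\<dots> \<le> (\<integral>\<^sup>+\<theta>. ennreal (norm (x - y)) \<partial>(uniform_sphere :: 'a measure))"
  proof (intro nn_integral_mono ennreal_leI)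
    fix \<theta> :: 'a assume "\<theta> \<in> space uniform_sphere"
    then have "norm \<theta> = 1" by (simp add: space_uniform_sphere)
    then show "\<bar>\<theta> \<bullet> x - \<theta> \<bullet> y\<bar> \<le> norm (x - y)"
      using Cauchy_Schwarz_ineq2[of \<theta> "x - y"] by (simp add: inner_diff_right)
  qed
  also have "\<dots> = ennreal (norm (x - y))"
    by (simp add: S.emeasure_space_1)
  finally show ?thesis .
qed

text \<open>The average of these kernels over a sample is the difference between the empirical and the
true distribution functions of the slices.\<close>

definition centered_halfspace :: "'a::euclidean_space measure \<Rightarrow> 'a \<Rightarrow> real \<times> 'a \<Rightarrow> real" where
  "centered_halfspace \<mu> x z = halfspace x z - slice_cdf \<mu> z"

definition slice_sd :: "'a::euclidean_space measure \<Rightarrow> real \<times> 'a \<Rightarrow> real" where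
  "slice_sd \<mu> z = sqrt (slice_cdf \<mu> z * (1 - slice_cdf \<mu> z))"

context borel_prob_space
begin

lemma measurable_centered_halfspace [measurable (raw)]:
  assumes [measurable]: "f \<in> N \<rightarrow>\<^sub>M borel" "g \<in> N \<rightarrow>\<^sub>M slices"
  shows "(\<lambda>w. centered_halfspace \<mu> (f w) (g w)) \<in> borel_measurable N"
  unfolding centered_halfspace_def by measurable

lemma measurable_slice_sd [measurable]: "slice_sd \<mu> \<in> borel_measurable slices"
  unfolding slice_sd_def[abs_def] by measurable

lemma centered_halfspace_bound: "\<bar>centered_halfspace \<mu> x z\<bar> \<le> 1"
  using slice_cdf_bounds[of z] halfspace_bounds[of x z] by (simp add: centered_halfspace_def abs_le_iff)

lemma measurable_centered_halfspace_left [measurable]: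
  "(\<lambda>x. centered_halfspace \<mu> x z) \<in> borel_measurable \<mu>"
  unfolding centered_halfspace_def by measurable

lemma integral_centered_halfspace: "(\<integral>x. centered_halfspace \<mu> x z \<partial>\<mu>) = 0"
  by (simp add: centered_halfspace_def prob_space slice_cdf_eq_integral[of z])

lemma slice_sd_nonneg: "0 \<le> slice_sd \<mu> z"
  using slice_cdf_bounds[of z] by (simp add: slice_sd_def)

lemma slice_sd_power2: "(slice_sd \<mu> z)\<^sup>2 = slice_cdf \<mu> z * (1 - slice_cdf \<mu> z)"
  using slice_cdf_bounds[of z] by (simp add: slice_sd_def)

lemma integral_centered_halfspace_power2:
  "(\<integral>x. (centered_halfspace \<mu> x z)\<^sup>2 \<partial>\<mu>) = (slice_sd \<mu> z)\<^sup>2"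
proof -
  have "(centered_halfspace \<mu> x z)\<^sup>2 = (1 - 2 * slice_cdf \<mu> z) * halfspace x z + (slice_cdf \<mu> z)\<^sup>2" for x
    by (simp add: centered_halfspace_def halfspace_def power2_eq_square algebra_simps)
  then have "(\<integral>x. (centered_halfspace \<mu> x z)\<^sup>2 \<partial>\<mu>)
     = (\<integral>x. (1 - 2 * slice_cdf \<mu> z) * halfspace x z + (slice_cdf \<mu> z)\<^sup>2 \<partial>\<mu>)"
    by simp
  also have "\<dots> = (1 - 2 * slice_cdf \<mu> z) * slice_cdf \<mu> z + (slice_cdf \<mu> z)\<^sup>2"
    by (simp add: prob_space slice_cdf_eq_integral[of z, symmetric])
  also have "\<dots> = (slice_sd \<mu> z)\<^sup>2"
    unfolding slice_sd_power2 by (simp add: power2_eq_square algebra_simps)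
  finally show ?thesis .
qed

text \<open>The kernel, regarded as a process on the probability space \<open>\<mu>\<close>, has the covariance that is
prescribed for the Gaussian process.\<close>

lemma integral_centered_halfspace_mult:
  "(\<integral>x. centered_halfspace \<mu> x (s, \<theta>) * centered_halfspace \<mu> x (t, \<phi>) \<partial>\<mu>)
     = measure \<mu> {x. \<theta> \<bullet> x \<le> s \<and> \<phi> \<bullet> x \<le> t} - proj_cdf \<mu> s \<theta> * proj_cdf \<mu> t \<phi>"
proof -
  have [measurable]: "{x. \<theta> \<bullet> x \<le> s \<and> \<phi> \<bullet> x \<le> t} \<in> sets borel"
    by measurable
  have i: "integrable \<mu> (indicator {x. \<theta> \<bullet> x \<le> s \<and> \<phi> \<bullet> x \<le> t} :: _ \<Rightarrow> real)"
    by (simp add: emeasure_eq_measure)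
  have "centered_halfspace \<mu> x (s, \<theta>) * centered_halfspace \<mu> x (t, \<phi>)
     = indicator {x. \<theta> \<bullet> x \<le> s \<and> \<phi> \<bullet> x \<le> t} x - proj_cdf \<mu> s \<theta> * halfspace x (t, \<phi>)
       - proj_cdf \<mu> t \<phi> * halfspace x (s, \<theta>) + proj_cdf \<mu> s \<theta> * proj_cdf \<mu> t \<phi>" for x
    by (simp add: centered_halfspace_def halfspace_def algebra_simps)
  then have "(\<integral>x. centered_halfspace \<mu> x (s, \<theta>) * centered_halfspace \<mu> x (t, \<phi>) \<partial>\<mu>)
    = (\<integral>x. indicator {x. \<theta> \<bullet> x \<le> s \<and> \<phi> \<bullet> x \<le> t} x - proj_cdf \<mu> s \<theta> * halfspace x (t, \<phi>)
       - proj_cdf \<mu> t \<phi> * halfspace x (s, \<theta>) + proj_cdf \<mu> s \<theta> * proj_cdf \<mu> t \<phi> \<partial>\<mu>)"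
    by simp
  also have "\<dots> = measure \<mu> {x. \<theta> \<bullet> x \<le> s \<and> \<phi> \<bullet> x \<le> t} - proj_cdf \<mu> s \<theta> * proj_cdf \<mu> t \<phi>"
    using slice_cdf_eq_integral[of "(s, \<theta>)", symmetric] slice_cdf_eq_integral[of "(t, \<phi>)", symmetric] i
    by (simp add: prob_space)
  finally show ?thesis .
qed

text \<open>The slice distribution functions of \<open>\<mu>\<close> are means of those of point masses, so the norm of the
centered kernel is at most the mean over \<open>y\<close> of the sliced distance of the point masses at \<open>x\<close> and \<open>y\<close>.\<close>

lemma centered_halfspace_L1:
  assumes "integrable \<mu> norm"
  shows "integrable slices (centered_halfspace \<mu> x)"
    and "(\<integral>z. \<bar>centered_halfspace \<mu> x z\<bar> \<partial>slices) \<le> norm x + (\<integral>y. norm y \<partial>\<mu>)"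
proof -
  interpret S: sigma_finite_measure "slices :: (real \<times> 'a) measure" by (rule sigma_finite_slices)
  interpret P: pair_sigma_finite \<mu> "slices :: (real \<times> 'a) measure" ..
  have meas: "centered_halfspace \<mu> x \<in> borel_measurable slices"
    unfolding centered_halfspace_def[abs_def] by measurable
  have "(\<integral>\<^sup>+z. ennreal \<bar>centered_halfspace \<mu> x z\<bar> \<partial>slices)
      \<le> (\<integral>\<^sup>+z. \<integral>\<^sup>+y. ennreal \<bar>halfspace x z - halfspace y z\<bar> \<partial>\<mu> \<partial>slices)"
  proof (rule nn_integral_mono)
    fix z :: "real \<times> 'a"
    have "\<bar>centered_halfspace \<mu> x z\<bar> = \<bar>\<integral>y. halfspace x z - halfspace y z \<partial>\<mu>\<bar>"
      by (simp add: prob_space centered_halfspace_def slice_cdf_eq_integral[of z])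
    also have "\<dots> \<le> (\<integral>y. \<bar>halfspace x z - halfspace y z\<bar> \<partial>\<mu>)"
      by (rule integral_abs_bound)
    finally have "ennreal \<bar>centered_halfspace \<mu> x z\<bar> \<le> ennreal (\<integral>y. \<bar>halfspace x z - halfspace y z\<bar> \<partial>\<mu>)"
      by (rule ennreal_leI)
    also have "\<dots> = (\<integral>\<^sup>+y. ennreal \<bar>halfspace x z - halfspace y z\<bar> \<partial>\<mu>)"
      by (rule nn_integral_eq_integral[symmetric]) auto
    finally show "ennreal \<bar>centered_halfspace \<mu> x z\<bar> \<le> (\<integral>\<^sup>+y. ennreal \<bar>halfspace x z - halfspace y z\<bar> \<partial>\<mu>)" .
  qed
  also have "\<dots> = (\<integral>\<^sup>+y. \<integral>\<^sup>+z. ennreal \<bar>halfspace x z - halfspace y z\<bar> \<partial>slices \<partial>\<mu>)"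
    by (rule P.Fubini') measurable
  also have "\<dots> \<le> (\<integral>\<^sup>+y. ennreal (norm x + norm y) \<partial>\<mu>)"
    by (intro nn_integral_mono order_trans[OF nn_integral_halfspace_diff] ennreal_leI norm_triangle_ineq4)
  also have "\<dots> = ennreal (\<integral>y. norm x + norm y \<partial>\<mu>)"
    using assms by (intro nn_integral_eq_integral) auto
  also have "(\<integral>y. norm x + norm y \<partial>\<mu>) = norm x + (\<integral>y. norm y \<partial>\<mu>)"
    using assms by (simp add: prob_space)
  finally have le: "(\<integral>\<^sup>+z. ennreal \<bar>centered_halfspace \<mu> x z\<bar> \<partial>slices) \<le> ennreal (norm x + (\<integral>y. norm y \<partial>\<mu>))" .
  show i: "integrable slices (centered_halfspace \<mu> x)"
    using le meas by (intro integrableI_bounded) (auto simp: top_unique less_top[symmetric])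
  have "ennreal (\<integral>z. \<bar>centered_halfspace \<mu> x z\<bar> \<partial>slices) = (\<integral>\<^sup>+z. ennreal \<bar>centered_halfspace \<mu> x z\<bar> \<partial>slices)"
    using i by (intro nn_integral_eq_integral[symmetric]) auto
  with le have "ennreal (\<integral>z. \<bar>centered_halfspace \<mu> x z\<bar> \<partial>slices) \<le> ennreal (norm x + (\<integral>y. norm y \<partial>\<mu>))"
    by (simp only:)
  then show "(\<integral>z. \<bar>centered_halfspace \<mu> x z\<bar> \<partial>slices) \<le> norm x + (\<integral>y. norm y \<partial>\<mu>)"
    by (subst (asm) ennreal_le_iff) (auto intro: add_nonneg_nonneg)
qed

end

lemma integrable_slice_cdf_diff:
  fixes \<mu> \<nu> :: "'a::euclidean_space measure"
  assumes "borel_prob_space \<mu>" "borel_prob_space \<nu>" "integrable \<mu> norm" "integrable \<nu> norm"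
  shows "integrable slices (\<lambda>z. slice_cdf \<mu> z - slice_cdf \<nu> z)"
proof -
  \<comment> \<open>Both distribution functions are compared with those of the point mass at the origin.\<close>
  have "integrable slices (\<lambda>z. centered_halfspace \<nu> 0 z - centered_halfspace \<mu> 0 z)"
    by (intro Bochner_Integration.integrable_diff borel_prob_space.centered_halfspace_L1 assms)
  then show ?thesis by (simp add: centered_halfspace_def)
qed

theorem sliced_W1_eq_integral:
  fixes \<mu> \<nu> :: "'a::euclidean_space measure"
  assumes "borel_prob_space \<mu>" "borel_prob_space \<nu>" "integrable \<mu> norm" "integrable \<nu> norm"
  shows "sliced_W1 \<mu> \<nu> = (\<integral>z. \<bar>slice_cdf \<mu> z - slice_cdf \<nu> z\<bar> \<partial>slices)"
proof -
  have "(\<integral>\<^sup>+z. ennreal \<bar>slice_cdf \<mu> z - slice_cdf \<nu> z\<bar> \<partial>slices)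
     = ennreal (\<integral>z. \<bar>slice_cdf \<mu> z - slice_cdf \<nu> z\<bar> \<partial>slices)"
    using integrable_slice_cdf_diff[OF assms] by (intro nn_integral_eq_integral) auto
  then show ?thesis
    by (simp add: sliced_W1_eq_nn_integral assms)
qed

section \<open>Moments and supports\<close>

lemma integrable_power_tail:
  fixes p :: real
  assumes "p > 1"
  shows "integrable lborel (\<lambda>t. (1 + \<bar>t\<bar>) powr (-p))"
proof -
  define f :: "real \<Rightarrow> ennreal" where "f t = ennreal ((1 + t) powr (-p)) * indicator {0..} t" for t
  have "(\<integral>\<^sup>+t. f t \<partial>lborel) = ennreal (0 - (- ((1 + 0) powr (1 - p) / (p - 1))))"
    unfolding f_def
  proof (rule nn_integral_FTC_atLeast)
    fix t :: real assume "0 \<le> t"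
    then have "((\<lambda>t. (1 + t) powr (1 - p)) has_real_derivative (1 - p) * (1 + t) powr (- p)) (at t)"
      by (auto intro!: derivative_eq_intros)
    then have "((\<lambda>t. - ((1 + t) powr (1 - p) / (p - 1))) has_real_derivative
        - ((1 - p) * (1 + t) powr (- p) / (p - 1))) (at t)"
      by (intro DERIV_minus DERIV_cdivide)
    moreover have "- ((1 - p) * y / (p - 1)) = y" for y
      using assms by (simp add: field_simps)
    ultimately show "((\<lambda>t. - ((1 + t) powr (1 - p) / (p - 1))) has_real_derivative (1 + t) powr (- p)) (at t)"
      by simp
  next
    have "((\<lambda>t::real. (1 + t) powr (1 - p)) \<longlongrightarrow> 0) at_top"
      using assms by (intro tendsto_neg_powr filterlim_tendsto_add_at_top[OF tendsto_const filterlim_ident]) simp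
    then have "((\<lambda>t. - ((1 + t) powr (1 - p) / (p - 1))) \<longlongrightarrow> - (0 / (p - 1))) at_top"
      using assms by (intro tendsto_minus tendsto_divide tendsto_const) auto
    then show "((\<lambda>t. - ((1 + t) powr (1 - p) / (p - 1))) \<longlongrightarrow> 0) at_top"
      by simp
  qed auto
  then have fin: "(\<integral>\<^sup>+t. f t \<partial>lborel) < \<infinity>" by simp
  have [measurable]: "f \<in> borel_measurable borel" unfolding f_def by measurable
  have "(\<integral>\<^sup>+t. f t \<partial>lborel) = (\<integral>\<^sup>+t. f (- t) \<partial>lborel)"
    using nn_integral_real_affine[of f "-1" 0] by simp
  with fin have fin2: "(\<integral>\<^sup>+t. f t + f (- t) \<partial>lborel) < \<infinity>"
    by (simp add: nn_integral_add)
  show ?thesis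
  proof (rule integrableI_bounded)
    have "(\<integral>\<^sup>+t. ennreal (norm ((1 + \<bar>t\<bar>) powr (-p))) \<partial>lborel) \<le> (\<integral>\<^sup>+t. f t + f (- t) \<partial>lborel)"
      by (intro nn_integral_mono) (auto simp: f_def indicator_def)
    with fin2 show "(\<integral>\<^sup>+t. ennreal (norm ((1 + \<bar>t\<bar>) powr (-p))) \<partial>lborel) < \<infinity>"
      by (rule le_less_trans[rotated])
  qed simp
qed

lemma integrable_slices_of_fst:
  fixes f :: "real \<Rightarrow> real"
  assumes "integrable lborel f"
  shows "integrable (slices :: (real \<times> 'a::euclidean_space) measure) (\<lambda>z. f (fst z))"
proof -
  interpret S: prob_space "uniform_sphere :: 'a measure" by (rule prob_space_uniform_sphere)
  interpret pair_sigma_finite lborel "uniform_sphere :: 'a measure" by (rule pair_sigma_finite_slices)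
  have [measurable]: "f \<in> borel_measurable borel" using assms by auto
  have "(\<integral>\<^sup>+z. ennreal (norm (f (fst z))) \<partial>(slices :: (real \<times> 'a) measure))
     = (\<integral>\<^sup>+t. ennreal (norm (f t)) \<partial>lborel)"
    by (subst S.nn_integral_fst[symmetric]) (simp_all add: S.emeasure_space_1)
  also have "\<dots> < \<infinity>"
    using assms by (simp add: integrable_iff_bounded)
  finally show ?thesis
    by (intro integrableI_bounded) simp_all
qed

lemma finite_moment_measuresD:
  fixes \<mu> :: "'a::euclidean_space measure"
  assumes "\<mu> \<in> finite_moment_measures q" "q \<ge> 1"
  shows "borel_prob_space \<mu>" and "integrable \<mu> norm"
    and "integrable \<mu> (\<lambda>x. (1 + norm x) powr q)"
proof -
  have P: "prob_space \<mu>" "sets \<mu> = sets borel" and i: "integrable \<mu> (\<lambda>x. norm x powr q)"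
    using assms(1) by (auto simp: finite_moment_measures_def)
  show B: "borel_prob_space \<mu>"
    using P by (simp add: borel_prob_space_def borel_prob_space_axioms_def)
  interpret borel_prob_space \<mu> by (rule B)
  have le: "(1 + r) powr q \<le> 2 powr q * (1 + r powr q)" if "r \<ge> 0" for r :: real
  proof -
    have "(1 + r) powr q \<le> (2 * max 1 r) powr q"
      using that assms by (intro powr_mono2) auto
    also have "\<dots> = 2 powr q * max 1 r powr q"
      by (simp add: powr_mult)
    also have "max 1 r powr q \<le> 1 + r powr q"
      by (simp add: max_def)
    finally show ?thesis by simp
  qed
  show i1: "integrable \<mu> (\<lambda>x. (1 + norm x) powr q)"
  proof (rule Bochner_Integration.integrable_bound)
    show "integrable \<mu> (\<lambda>x. 2 powr q * (1 + norm x powr q))"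
      using i by simp
    show "(\<lambda>x. (1 + norm x) powr q) \<in> borel_measurable \<mu>"
      by measurable
    show "AE x in \<mu>. norm ((1 + norm x) powr q) \<le> norm (2 powr q * (1 + norm x powr q))"
      using le[OF norm_ge_zero] by (intro AE_I2) (simp add: abs_mult)
  qed
  show "integrable \<mu> norm"
  proof (rule Bochner_Integration.integrable_bound[OF i1])
    have "norm x \<le> (1 + norm x) powr q" for x :: 'a
      using powr_mono[OF assms(2), of "1 + norm x"] by simp
    then show "AE x in \<mu>. norm (norm x) \<le> norm ((1 + norm x) powr q)"
      by simp
  qed simp
qed

text \<open>This is where a moment of order greater than \<open>2\<close> enters.  By Markov's inequality
the smaller of \<open>F\<close> and \<open>1 - F\<close> at level \<open>t\<close> is of order \<open>\<bar>t\<bar> powr (-q)\<close> uniformly in the direction, so the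
standard deviation is of order \<open>\<bar>t\<bar> powr (-q/2)\<close> with \<open>q/2 > 1\<close>.\<close>

lemma integrable_slice_sd:
  fixes \<mu> :: "'a::euclidean_space measure"
  assumes "\<mu> \<in> finite_moment_measures q" "q > 2"
  shows "integrable slices (slice_sd \<mu>)"
proof -
  note D = finite_moment_measuresD[OF assms(1)]
  interpret borel_prob_space \<mu> using D assms by simp
  define C where "C = (\<integral>x. (1 + norm x) powr q \<partial>\<mu>)"
  have i: "integrable \<mu> (\<lambda>x. (1 + norm x) powr q)" using D assms by simp
  have tail: "measure \<mu> {x. \<bar>t\<bar> \<le> norm x} \<le> C * (1 + \<bar>t\<bar>) powr (-q)" for t
  proof -
    have "measure \<mu> {x. \<bar>t\<bar> \<le> norm x} \<le> measure \<mu> {x \<in> space \<mu>. (1 + \<bar>t\<bar>) powr q \<le> (1 + norm x) powr q}"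
      using assms by (intro finite_measure_mono) (auto intro!: powr_mono2)
    also have "\<dots> \<le> C / (1 + \<bar>t\<bar>) powr q"
      unfolding C_def using i by (intro integral_Markov_inequality_measure[where A="{}"]) auto
    finally show ?thesis by (simp add: powr_minus divide_inverse)
  qed
  have bound: "slice_sd \<mu> z \<le> sqrt C * (1 + \<bar>fst z\<bar>) powr (-(q/2))" if z: "z \<in> space slices" for z
  proof -
    obtain t \<theta> where [simp]: "z = (t, \<theta>)" by (cases z)
    have "norm \<theta> = 1" using z by (simp add: space_pair_measure space_uniform_sphere)
    then have n: "\<bar>\<theta> \<bullet> x\<bar> \<le> norm x" for x
      using Cauchy_Schwarz_ineq2[of \<theta> x] by simp
    have "slice_cdf \<mu> z * (1 - slice_cdf \<mu> z) \<le> measure \<mu> {x. \<bar>t\<bar> \<le> norm x}"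
    proof (cases "t < 0")
      case True
      have "slice_cdf \<mu> z * (1 - slice_cdf \<mu> z) \<le> slice_cdf \<mu> z * 1"
        using slice_cdf_bounds[of z] by (intro mult_left_mono) auto
      also have "\<dots> \<le> measure \<mu> {x. \<bar>t\<bar> \<le> norm x}"
        unfolding proj_cdf_def using True n
        by (auto intro!: finite_measure_mono) (smt (verit) n)
      finally show ?thesis .
    next
      case False
      have [measurable]: "{x. \<theta> \<bullet> x \<le> t} \<in> sets borel" by measurable
      have "slice_cdf \<mu> z * (1 - slice_cdf \<mu> z) \<le> 1 * (1 - slice_cdf \<mu> z)"
        using slice_cdf_bounds[of z] by (intro mult_right_mono) auto
      also have "\<dots> = measure \<mu> (space \<mu> - {x. \<theta> \<bullet> x \<le> t})"
        by (subst prob_compl) (auto simp: proj_cdf_def)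
      also have "\<dots> \<le> measure \<mu> {x. \<bar>t\<bar> \<le> norm x}"
        using False n by (auto intro!: finite_measure_mono) (smt (verit) n)
      finally show ?thesis .
    qed
    also note tail[of t]
    finally have "slice_sd \<mu> z \<le> sqrt (C * (1 + \<bar>t\<bar>) powr (-q))"
      unfolding slice_sd_def by (rule real_sqrt_le_mono)
    also have "\<dots> = sqrt C * (1 + \<bar>t\<bar>) powr (-(q/2))"
      by (simp add: real_sqrt_mult powr_half_sqrt[symmetric] powr_powr)
    finally show ?thesis by simp
  qed
  show ?thesis
  proof (rule Bochner_Integration.integrable_bound)
    show "integrable slices (\<lambda>z :: real \<times> 'a. sqrt C * (1 + \<bar>fst z\<bar>) powr (-(q/2)))"
      using assms integrable_power_tail[of "q/2"]
      by (intro integrable_mult_right integrable_slices_of_fst) simp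
    show "AE z in slices. norm (slice_sd \<mu> z) \<le> norm (sqrt C * (1 + \<bar>fst z\<bar>) powr (-(q/2)))"
      using bound slice_sd_nonneg by (intro AE_I2) (smt (verit) real_norm_def)
  qed simp
qed

text \<open>The complement of the support is the union of all open null sets; by the Lindelof property
countably many of them suffice.\<close>

lemma emeasure_compl_spt:
  fixes \<rho> :: "'b::second_countable_topology measure"
  assumes s: "sets \<rho> = sets borel"
  shows "- spt \<rho> \<in> null_sets \<rho>"
proof -
  define \<U> where "\<U> = {U. open U \<and> emeasure \<rho> U = 0}"
  have eq: "- spt \<rho> = \<Union>\<U>"
    by (auto simp: spt_def \<U>_def zero_less_iff_neq_zero)
  obtain \<V> where V: "\<V> \<subseteq> \<U>" "countable \<V>" "\<Union>\<V> = \<Union>\<U>"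
    using Lindelof[of \<U>] by (auto simp: \<U>_def)
  have "(\<Union>U\<in>\<V>. U) \<in> null_sets \<rho>"
    using V by (intro null_sets_UN') (auto simp: \<U>_def s null_sets_def)
  with V show ?thesis by (simp add: eq)
qed

lemma (in borel_prob_space) proj_cdf_outside:
  shows "ereal t < lower_end \<mu> \<theta> \<Longrightarrow> proj_cdf \<mu> t \<theta> = 0"
    and "upper_end \<mu> \<theta> < ereal t \<Longrightarrow> proj_cdf \<mu> t \<theta> = 1"
proof -
  interpret R: real_distribution "proj_measure \<theta> \<mu>" by (rule real_distribution_proj)
  have N: "- spt (proj_measure \<theta> \<mu>) \<in> null_sets (proj_measure \<theta> \<mu>)"
    by (rule emeasure_compl_spt) (simp add: proj_measure_def)
  show "proj_cdf \<mu> t \<theta> = 0" if "ereal t < lower_end \<mu> \<theta>"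
  proof -
    have "{..t} \<subseteq> - spt (proj_measure \<theta> \<mu>)"
      using that by (auto simp: lower_end_def less_INF_D dest!: less_INF_D)
    then have "{..t} \<in> null_sets (proj_measure \<theta> \<mu>)"
      by (rule null_sets_subset[OF N, rotated]) auto
    then show ?thesis
      by (simp add: cdf_proj[symmetric] cdf_def null_sets_def measure_def)
  qed
  show "proj_cdf \<mu> t \<theta> = 1" if "upper_end \<mu> \<theta> < ereal t"
  proof -
    have "{t<..} \<subseteq> - spt (proj_measure \<theta> \<mu>)"
      using that by (auto simp: upper_end_def dest!: SUP_lessD)
    then have "{t<..} \<in> null_sets (proj_measure \<theta> \<mu>)"
      by (rule null_sets_subset[OF N, rotated]) auto
    then have "R.prob {t<..} = 0"
      by (simp add: null_sets_def measure_def)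
    moreover have "UNIV - {t<..} = {..t}" by auto
    ultimately show ?thesis
      using R.prob_compl[of "{t<..}"] by (simp add: cdf_proj[symmetric] cdf_def)
  qed
qed

section \<open>First-order expansion of the $L^1$ norm\<close>

text \<open>If \<open>\<bar>b\<bar> < \<bar>a\<bar>\<close>, then \<open>a + b\<close> has the sign of \<open>a\<close> and the expansion is exact.\<close>

lemma abs_expansion:
  fixes a b :: real
  shows "\<bar>\<bar>a + b\<bar> - \<bar>a\<bar> - sgn a * b\<bar> \<le> (if \<bar>a\<bar> \<le> \<bar>b\<bar> then 2 * \<bar>b\<bar> else 0)"
  by (cases "a = 0"; cases "a > 0") (simp_all add: sgn_if, linarith+)

lemma (in prob_space) integral_abs_le_sqrt:
  assumes "integrable M (\<lambda>x. (f x :: real)\<^sup>2)" "f \<in> borel_measurable M" "(\<integral>x. (f x)\<^sup>2 \<partial>M) \<le> c\<^sup>2" "0 \<le> c"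
  shows "integrable M f" "(\<integral>x. \<bar>f x\<bar> \<partial>M) \<le> c"
proof -
  show i: "integrable M f"
    by (rule square_integrable_imp_integrable[OF assms(2,1)])
  have "0 \<le> variance (\<lambda>x. \<bar>f x\<bar>)"
    by (rule variance_positive)
  also have "\<dots> = (\<integral>x. (f x)\<^sup>2 \<partial>M) - (\<integral>x. \<bar>f x\<bar> \<partial>M)\<^sup>2"
    using i assms by (subst variance_eq) auto
  finally have "(\<integral>x. \<bar>f x\<bar> \<partial>M)\<^sup>2 \<le> c\<^sup>2"
    using assms(3) by linarith
  then show "(\<integral>x. \<bar>f x\<bar> \<partial>M) \<le> c"
    by (rule power2_le_imp_le) (rule assms)
qed

text \<open>A bound for \<open>sqrt n\<close> times the expected remainder of \<open>abs_expansion\<close> at \<open>a = \<alpha>\<close>, for a random \<open>b\<close>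
with second moment at most \<open>t\<^sup>2 / n\<close>.  For \<open>\<alpha> = 0\<close> the quotient is \<open>0\<close> by convention, so there it
is a bound only if \<open>t = 0\<close>.\<close>

definition linearization_gap :: "real \<Rightarrow> real \<Rightarrow> nat \<Rightarrow> real" where
  "linearization_gap \<alpha> t n = min (2 * t) (2 * t\<^sup>2 / (sqrt (real n) * \<bar>\<alpha>\<bar>))"

lemma linearization_gap_bounds:
  "0 \<le> t \<Longrightarrow> 0 \<le> linearization_gap \<alpha> t n" "linearization_gap \<alpha> t n \<le> 2 * t"
  by (simp_all add: linearization_gap_def)

lemma linearization_gap_measurable:
  assumes "a \<in> borel_measurable m" "\<tau> \<in> borel_measurable m"
  shows "(\<lambda>z. linearization_gap (a z) (\<tau> z) n) \<in> borel_measurable m"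
  using assms unfolding linearization_gap_def by measurable

lemma integral_linearization_gap_tendsto_0:
  fixes a \<tau> :: "'z \<Rightarrow> real"
  assumes [measurable]: "a \<in> borel_measurable m" and \<tau>: "integrable m \<tau>" "\<And>z. z \<in> space m \<Longrightarrow> 0 \<le> \<tau> z"
  shows "(\<lambda>n. \<integral>z. linearization_gap (a z) (\<tau> z) n \<partial>m) \<longlonglongrightarrow> 0"
proof -
  have [measurable]: "\<tau> \<in> borel_measurable m" using \<tau> by auto
  have "(\<lambda>n. \<integral>z. linearization_gap (a z) (\<tau> z) n \<partial>m) \<longlonglongrightarrow> (\<integral>z. 0 \<partial>m)"
  proof (rule integral_dominated_convergence[where w="\<lambda>z. 2 * \<tau> z"])
    have lim: "(\<lambda>n. linearization_gap \<alpha> t n) \<longlonglongrightarrow> 0" if "t \<ge> 0" for \<alpha> t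
    proof (cases "\<alpha> = 0")
      case True
      then show ?thesis using that by (simp add: linearization_gap_def)
    next
      case False
      have "(\<lambda>n. 2 * t\<^sup>2 / (sqrt (real n) * \<bar>\<alpha>\<bar>)) \<longlonglongrightarrow> 0"
        using False
        by (auto intro!: tendsto_divide_0 filterlim_at_top_imp_at_infinity filterlim_at_top_mult_tendsto_pos
            sqrt_at_top[THEN filterlim_compose] filterlim_real_sequentially)
      from tendsto_min[OF tendsto_const[of "2 * t"] this] show ?thesis
        using that by (simp add: linearization_gap_def)
    qed
    show "AE z in m. (\<lambda>n. linearization_gap (a z) (\<tau> z) n) \<longlonglongrightarrow> 0"
      using lim \<tau> by (intro AE_I2) auto
    show "AE z in m. norm (linearization_gap (a z) (\<tau> z) n) \<le> 2 * \<tau> z" for n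
      using \<tau> linearization_gap_bounds by (intro AE_I2) (simp add: abs_of_nonneg)
  qed (use \<tau> in \<open>auto intro!: linearization_gap_measurable\<close>)
  then show ?thesis by simp
qed

lemma L1_norm_expansion:
  fixes a c :: "'z \<Rightarrow> real"
  assumes "integrable m a" "integrable m c"
  shows "\<bar>(\<integral>z. \<bar>a z + c z\<bar> \<partial>m) - (\<integral>z. \<bar>a z\<bar> \<partial>m) - (\<integral>z. sgn (a z) * c z \<partial>m)\<bar>
     \<le> (\<integral>z. (if \<bar>a z\<bar> \<le> \<bar>c z\<bar> then 2 * \<bar>c z\<bar> else 0) \<partial>m)"
    and "integrable m (\<lambda>z. sgn (a z) * c z)"
    and "integrable m (\<lambda>z. if \<bar>a z\<bar> \<le> \<bar>c z\<bar> then 2 * \<bar>c z\<bar> else 0)"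
proof -
  have [measurable]: "a \<in> borel_measurable m" "c \<in> borel_measurable m" using assms by auto
  show i1: "integrable m (\<lambda>z. sgn (a z) * c z)"
    by (rule Bochner_Integration.integrable_bound[OF assms(2)]) (auto simp: abs_mult sgn_if)
  have "integrable m (\<lambda>z. 2 * \<bar>c z\<bar>)"
    using assms by simp
  then show i2: "integrable m (\<lambda>z. if \<bar>a z\<bar> \<le> \<bar>c z\<bar> then 2 * \<bar>c z\<bar> else 0)"
    by (rule Bochner_Integration.integrable_bound) auto
  have "(\<integral>z. \<bar>a z + c z\<bar> \<partial>m) - (\<integral>z. \<bar>a z\<bar> \<partial>m) - (\<integral>z. sgn (a z) * c z \<partial>m)
     = (\<integral>z. \<bar>a z + c z\<bar> - \<bar>a z\<bar> - sgn (a z) * c z \<partial>m)"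
    using assms i1 by simp
  also have "\<bar>\<dots>\<bar> \<le> (\<integral>z. \<bar>\<bar>a z + c z\<bar> - \<bar>a z\<bar> - sgn (a z) * c z\<bar> \<partial>m)"
    by (rule integral_abs_bound)
  also have "\<dots> \<le> (\<integral>z. (if \<bar>a z\<bar> \<le> \<bar>c z\<bar> then 2 * \<bar>c z\<bar> else 0) \<partial>m)"
    using assms i1 i2 abs_expansion by (intro integral_mono) auto
  finally show "\<bar>(\<integral>z. \<bar>a z + c z\<bar> \<partial>m) - (\<integral>z. \<bar>a z\<bar> \<partial>m) - (\<integral>z. sgn (a z) * c z \<partial>m)\<bar>
     \<le> (\<integral>z. (if \<bar>a z\<bar> \<le> \<bar>c z\<bar> then 2 * \<bar>c z\<bar> else 0) \<partial>m)" .
qed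

text \<open>The remainder is at most \<open>2 * \<bar>c\<bar>\<close>, whose mean is controlled by the square root of the second
moment.  It is also at most \<open>2 * c\<^sup>2 / \<bar>\<alpha>\<bar>\<close>, because it vanishes unless \<open>\<bar>\<alpha>\<bar> \<le> \<bar>c\<bar>\<close>.\<close>

lemma expected_gap_pointwise:
  fixes c :: "'w \<Rightarrow> real"
  assumes "prob_space N" and [measurable]: "c \<in> borel_measurable N"
    and c2: "integrable N (\<lambda>w. (c w)\<^sup>2)" "(\<integral>w. (c w)\<^sup>2 \<partial>N) \<le> t\<^sup>2 / real n"
    and t: "0 \<le> t" "\<alpha> \<noteq> 0 \<or> t = 0" and n: "n > 0"
  shows "(\<integral>\<^sup>+w. ennreal (sqrt (real n) * (if \<bar>\<alpha>\<bar> \<le> \<bar>c w\<bar> then 2 * \<bar>c w\<bar> else 0)) \<partial>N)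
    \<le> ennreal (linearization_gap \<alpha> t n)"
proof -
  interpret prob_space N by fact
  let ?f = "\<lambda>w. sqrt (real n) * (if \<bar>\<alpha>\<bar> \<le> \<bar>c w\<bar> then 2 * \<bar>c w\<bar> else 0)"
  have c1: "integrable N c" "(\<integral>w. \<bar>c w\<bar> \<partial>N) \<le> t / sqrt (real n)"
    using integral_abs_le_sqrt[OF c2(1), of "t / sqrt (real n)"] c2 t n by (auto simp: power_divide)
  have int: "integrable N ?f"
    by (rule Bochner_Integration.integrable_bound[where f="\<lambda>w. 2 * sqrt n * c w"])
       (use c1 in \<open>auto simp: abs_mult\<close>)
  have le1: "(\<integral>w. ?f w \<partial>N) \<le> 2 * t"
  proof -
    have "(\<integral>w. ?f w \<partial>N) \<le> (\<integral>w. sqrt (real n) * (2 * \<bar>c w\<bar>) \<partial>N)"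
      using c1 int by (intro integral_mono) auto
    also have "\<dots> = 2 * (sqrt (real n) * (\<integral>w. \<bar>c w\<bar> \<partial>N))"
      by simp
    also have "\<dots> \<le> 2 * (sqrt (real n) * (t / sqrt (real n)))"
      using c1 by (intro mult_left_mono) auto
    finally show ?thesis using n by simp
  qed
  have le2: "(\<integral>w. ?f w \<partial>N) \<le> 2 * t\<^sup>2 / (sqrt (real n) * \<bar>\<alpha>\<bar>)"
  proof (cases "\<alpha> = 0")
    case False
    have "(\<integral>w. ?f w \<partial>N) \<le> (\<integral>w. sqrt (real n) * 2 / \<bar>\<alpha>\<bar> * (c w)\<^sup>2 \<partial>N)"
    proof (intro integral_mono int)
      show "?f w \<le> sqrt (real n) * 2 / \<bar>\<alpha>\<bar> * (c w)\<^sup>2" for w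
      proof (cases "\<bar>\<alpha>\<bar> \<le> \<bar>c w\<bar>")
        case True
        have "\<bar>c w\<bar> * \<bar>\<alpha>\<bar> \<le> \<bar>c w\<bar> * \<bar>c w\<bar>"
          using True by (intro mult_left_mono) auto
        then have "\<bar>c w\<bar> \<le> (c w)\<^sup>2 / \<bar>\<alpha>\<bar>"
          using False by (simp add: field_simps power2_eq_square)
        then have "sqrt (real n) * 2 * \<bar>c w\<bar> \<le> sqrt (real n) * 2 * ((c w)\<^sup>2 / \<bar>\<alpha>\<bar>)"
          by (intro mult_left_mono) auto
        then show ?thesis using True by simp
      qed simp
    qed (use c2 in simp)
    also have "\<dots> = sqrt (real n) * 2 / \<bar>\<alpha>\<bar> * (\<integral>w. (c w)\<^sup>2 \<partial>N)"
      by simp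
    also have "\<dots> \<le> sqrt (real n) * 2 / \<bar>\<alpha>\<bar> * (t\<^sup>2 / real n)"
      using c2 by (intro mult_left_mono) auto
    also have "\<dots> = 2 * t\<^sup>2 / (sqrt (real n) * \<bar>\<alpha>\<bar>)"
      using n False by (simp add: field_simps)
    finally show ?thesis .
  qed (use le1 t in simp)
  have "(\<integral>\<^sup>+w. ennreal (?f w) \<partial>N) = ennreal (\<integral>w. ?f w \<partial>N)"
    using int by (intro nn_integral_eq_integral) auto
  then show ?thesis
    using le1 le2 by (simp only:) (intro ennreal_leI, simp add: linearization_gap_def)
qed

text \<open>Integration of the pointwise bounds.  Only the second moment of \<open>c w z\<close> for each fixed \<open>z\<close> is
involved and nothing is said about the joint behaviour at different \<open>z\<close>, so that the estimate applies to
averages over a sample and to averages over resampled data alike.\<close>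

theorem L1_linearization_error:
  fixes a \<tau> :: "'z \<Rightarrow> real" and c :: "'w \<Rightarrow> 'z \<Rightarrow> real"
  assumes "prob_space N" "sigma_finite_measure m"
    and a: "integrable m a"
    and [measurable]: "case_prod c \<in> borel_measurable (N \<Otimes>\<^sub>M m)"
    and c: "\<And>w. w \<in> space N \<Longrightarrow> integrable m (c w)"
    and c2: "\<And>z. z \<in> space m \<Longrightarrow> integrable N (\<lambda>w. (c w z)\<^sup>2)"
      "\<And>z. z \<in> space m \<Longrightarrow> (\<integral>w. (c w z)\<^sup>2 \<partial>N) \<le> (\<tau> z)\<^sup>2 / real n"
    and \<tau>: "integrable m \<tau>" "\<And>z. z \<in> space m \<Longrightarrow> 0 \<le> \<tau> z" "AE z in m. a z \<noteq> 0 \<or> \<tau> z = 0"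
    and n: "n > 0"
  shows "(\<integral>\<^sup>+w. ennreal (sqrt (real n) * \<bar>(\<integral>z. \<bar>a z + c w z\<bar> \<partial>m) - (\<integral>z. \<bar>a z\<bar> \<partial>m) - (\<integral>z. sgn (a z) * c w z \<partial>m)\<bar>) \<partial>N)
     \<le> ennreal (\<integral>z. linearization_gap (a z) (\<tau> z) n \<partial>m)"
proof -
  interpret N: prob_space N by fact
  interpret m: sigma_finite_measure m by fact
  interpret P: pair_sigma_finite N m ..
  have [measurable]: "a \<in> borel_measurable m" "\<tau> \<in> borel_measurable m" using a \<tau> by auto
  let ?f = "\<lambda>w z. sqrt (real n) * (if \<bar>a z\<bar> \<le> \<bar>c w z\<bar> then 2 * \<bar>c w z\<bar> else 0)"
  have "(\<integral>\<^sup>+w. ennreal (sqrt (real n) * \<bar>(\<integral>z. \<bar>a z + c w z\<bar> \<partial>m) - (\<integral>z. \<bar>a z\<bar> \<partial>m) - (\<integral>z. sgn (a z) * c w z \<partial>m)\<bar>) \<partial>N)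
     \<le> (\<integral>\<^sup>+w. \<integral>\<^sup>+z. ennreal (?f w z) \<partial>m \<partial>N)"
  proof (rule nn_integral_mono)
    fix w assume w: "w \<in> space N"
    have "ennreal (sqrt (real n) * \<bar>(\<integral>z. \<bar>a z + c w z\<bar> \<partial>m) - (\<integral>z. \<bar>a z\<bar> \<partial>m) - (\<integral>z. sgn (a z) * c w z \<partial>m)\<bar>)
      \<le> ennreal (sqrt (real n) * (\<integral>z. (if \<bar>a z\<bar> \<le> \<bar>c w z\<bar> then 2 * \<bar>c w z\<bar> else 0) \<partial>m))"
      by (intro ennreal_leI mult_left_mono L1_norm_expansion a c w) simp
    also have "\<dots> = ennreal (\<integral>z. ?f w z \<partial>m)"
      by simp
    also have "\<dots> = (\<integral>\<^sup>+z. ennreal (?f w z) \<partial>m)"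
      using L1_norm_expansion(3)[OF a c[OF w]] by (intro nn_integral_eq_integral[symmetric]) auto
    finally show "ennreal (sqrt (real n) * \<bar>(\<integral>z. \<bar>a z + c w z\<bar> \<partial>m) - (\<integral>z. \<bar>a z\<bar> \<partial>m) - (\<integral>z. sgn (a z) * c w z \<partial>m)\<bar>)
      \<le> (\<integral>\<^sup>+z. ennreal (?f w z) \<partial>m)" .
  qed
  also have "\<dots> = (\<integral>\<^sup>+z. \<integral>\<^sup>+w. ennreal (?f w z) \<partial>N \<partial>m)"
    by (rule P.Fubini'[symmetric]) measurable
  also have "\<dots> \<le> (\<integral>\<^sup>+z. ennreal (linearization_gap (a z) (\<tau> z) n) \<partial>m)"
  proof (rule nn_integral_mono_AE)
    show "AE z in m. (\<integral>\<^sup>+w. ennreal (?f w z) \<partial>N) \<le> ennreal (linearization_gap (a z) (\<tau> z) n)"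
      using \<tau>(3) AE_space
    proof eventually_elim
      case (elim z)
      then show ?case
        by (intro expected_gap_pointwise c2 \<tau> n N.prob_space_axioms) simp_all
    qed
  qed
  also have "\<dots> = ennreal (\<integral>z. linearization_gap (a z) (\<tau> z) n \<partial>m)"
  proof (rule nn_integral_eq_integral)
    show "integrable m (\<lambda>z. linearization_gap (a z) (\<tau> z) n)"
    proof (rule Bochner_Integration.integrable_bound[where f="\<lambda>z. 2 * \<tau> z"])
      show "AE z in m. norm (linearization_gap (a z) (\<tau> z) n) \<le> norm (2 * \<tau> z)"
        using \<tau> linearization_gap_bounds by (intro AE_I2) (simp add: abs_of_nonneg)
    qed (use \<tau> in \<open>auto intro!: linearization_gap_measurable\<close>)
    show "AE z in m. 0 \<le> linearization_gap (a z) (\<tau> z) n"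
      using \<tau> linearization_gap_bounds by (intro AE_I2) simp
  qed
  finally show ?thesis .
qed

section \<open>Second moments, normal laws and characteristic functions\<close>

lemma (in prob_space) second_moment_orthogonal_sum:
  fixes f :: "'i \<Rightarrow> 'a \<Rightarrow> real"
  assumes "finite I" "\<And>i j. i \<in> I \<Longrightarrow> j \<in> I \<Longrightarrow> integrable M (\<lambda>x. f i x * f j x)"
    "\<And>i j. i \<in> I \<Longrightarrow> j \<in> I \<Longrightarrow> i \<noteq> j \<Longrightarrow> (\<integral>x. f i x * f j x \<partial>M) = 0"
  shows "integrable M (\<lambda>x. (\<Sum>i\<in>I. f i x)\<^sup>2)"
    and "(\<integral>x. (\<Sum>i\<in>I. f i x)\<^sup>2 \<partial>M) = (\<Sum>i\<in>I. \<integral>x. (f i x)\<^sup>2 \<partial>M)"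
proof -
  have eq: "(\<Sum>i\<in>I. f i x)\<^sup>2 = (\<Sum>i\<in>I. \<Sum>j\<in>I. f i x * f j x)" for x
    by (simp add: power2_eq_square sum_product)
  show "integrable M (\<lambda>x. (\<Sum>i\<in>I. f i x)\<^sup>2)"
    unfolding eq using assms by auto
  have "(\<integral>x. (\<Sum>i\<in>I. f i x)\<^sup>2 \<partial>M) = (\<Sum>i\<in>I. \<Sum>j\<in>I. \<integral>x. f i x * f j x \<partial>M)"
    unfolding eq using assms by simp
  also have "\<dots> = (\<Sum>i\<in>I. \<Sum>j\<in>I. if j = i then \<integral>x. (f i x)\<^sup>2 \<partial>M else 0)"
    using assms by (intro sum.cong refl) (auto simp: power2_eq_square)
  also have "\<dots> = (\<Sum>i\<in>I. \<integral>x. (f i x)\<^sup>2 \<partial>M)"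
    using assms by simp
  finally show "(\<integral>x. (\<Sum>i\<in>I. f i x)\<^sup>2 \<partial>M) = (\<Sum>i\<in>I. \<integral>x. (f i x)\<^sup>2 \<partial>M)" .
qed

lemma (in prob_space) second_moment_indep_sum:
  fixes f :: "'i \<Rightarrow> 'a \<Rightarrow> real"
  assumes "finite I" "indep_vars (\<lambda>_. borel) f I"
    "\<And>i. i \<in> I \<Longrightarrow> integrable M (\<lambda>x. (f i x)\<^sup>2)" "\<And>i. i \<in> I \<Longrightarrow> (\<integral>x. f i x \<partial>M) = 0"
  shows "integrable M (\<lambda>x. (\<Sum>i\<in>I. f i x)\<^sup>2)"
    and "(\<integral>x. (\<Sum>i\<in>I. f i x)\<^sup>2 \<partial>M) = (\<Sum>i\<in>I. \<integral>x. (f i x)\<^sup>2 \<partial>M)"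
proof -
  have rv: "i \<in> I \<Longrightarrow> f i \<in> borel_measurable M" for i
    using assms(2) by (auto simp: indep_vars_def)
  have i1: "i \<in> I \<Longrightarrow> integrable M (f i)" for i
    by (rule square_integrable_imp_integrable[OF rv assms(3)])
  have *: "integrable M (\<lambda>x. f i x * f j x) \<and> (\<integral>x. f i x * f j x \<partial>M) = 0" if "i \<in> I" "j \<in> I" "i \<noteq> j" for i j
  proof -
    have ij: "indep_vars (\<lambda>_. borel) f {i, j}"
      using that by (intro indep_vars_subset[OF assms(2)]) auto
    show ?thesis
      using indep_vars_lebesgue_integral[OF _ ij] indep_vars_integrable[OF _ ij] i1 that assms by auto
  qed
  have ints: "integrable M (\<lambda>x. f i x * f j x)" if "i \<in> I" "j \<in> I" for i j
    using that assms(3)[of i] * by (cases "i = j") (auto simp: power2_eq_square)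
  show "integrable M (\<lambda>x. (\<Sum>i\<in>I. f i x)\<^sup>2)"
    by (rule second_moment_orthogonal_sum) (use assms ints * in auto)
  show "(\<integral>x. (\<Sum>i\<in>I. f i x)\<^sup>2 \<partial>M) = (\<Sum>i\<in>I. \<integral>x. (f i x)\<^sup>2 \<partial>M)"
    by (rule second_moment_orthogonal_sum) (use assms ints * in auto)
qed

lemma centered_normal_eq_distr:
  assumes "v \<ge> 0"
  shows "centered_normal v = distr std_normal_distribution borel (\<lambda>x. sqrt v * x)"
proof (cases "v = 0")
  case True
  interpret real_distribution std_normal_distribution by (rule real_dist_normal_dist)
  show ?thesis using True by (simp add: centered_normal_def)
next
  case False
  interpret real_distribution std_normal_distribution by (rule real_dist_normal_dist)
  have "distributed std_normal_distribution lborel (\<lambda>x. x) (normal_density 0 1)"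
    by (auto simp: distributed_def distr_id2)
  from normal_density_affine[OF this, of "sqrt v" 0] False assms
  have "distributed std_normal_distribution lborel (\<lambda>x. sqrt v * x) (normal_density 0 (sqrt v))"
    by simp
  then have "distr std_normal_distribution lborel (\<lambda>x. sqrt v * x) = density lborel (normal_density 0 (sqrt v))"
    by (simp add: distributed_def)
  moreover have "distr std_normal_distribution borel (\<lambda>x. sqrt v * x) = distr std_normal_distribution lborel (\<lambda>x. sqrt v * x)"
    by (rule distr_cong) auto
  ultimately show ?thesis using False by (simp add: centered_normal_def)
qed

lemma real_distribution_centered_normal:
  assumes "v \<ge> 0"
  shows "real_distribution (centered_normal v)"
proof -
  interpret real_distribution std_normal_distribution by (rule real_dist_normal_dist)
  show ?thesis unfolding centered_normal_eq_distr[OF assms] by (rule real_distribution_distr) simp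
qed

lemma char_centered_normal:
  assumes "v \<ge> 0"
  shows "char (centered_normal v) u = complex_of_real (exp (- (v * u\<^sup>2 / 2)))"
proof -
  have "char (centered_normal v) u = char std_normal_distribution (u * sqrt v)"
    unfolding centered_normal_eq_distr[OF assms] char_def
    by (subst integral_distr) (auto simp: ac_simps)
  then show ?thesis
    using assms by (simp add: char_std_normal_distribution power_mult_distrib ac_simps)
qed

lemma centered_normal_moments:
  assumes "v \<ge> 0"
  shows "integrable (centered_normal v) (\<lambda>x. x)" "integral\<^sup>L (centered_normal v) (\<lambda>x. x) = 0"
    "integrable (centered_normal v) (\<lambda>x. x\<^sup>2)" "integral\<^sup>L (centered_normal v) (\<lambda>x. x\<^sup>2) = v"
proof -
  have i: "integrable std_normal_distribution (\<lambda>x. x)" "integrable std_normal_distribution (\<lambda>x. x\<^sup>2)"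
    using integrable_std_normal_distribution_moment[of 1] integrable_std_normal_distribution_moment[of 2] by auto
  have e: "integral\<^sup>L std_normal_distribution (\<lambda>x. x) = 0" "integral\<^sup>L std_normal_distribution (\<lambda>x. x\<^sup>2) = 1"
    using integral_std_normal_distribution_moment_odd[of 1] std_normal_distribution_even_moments[of 1]
    by (auto simp: fact_numeral)
  have m: "(\<lambda>x. sqrt v * x) \<in> std_normal_distribution \<rightarrow>\<^sub>M borel"
    by simp
  have m1: "(\<lambda>x::real. x) \<in> borel_measurable borel" and m2: "(\<lambda>x::real. x\<^sup>2) \<in> borel_measurable borel"
    by simp_all
  have sq: "(sqrt v * x)\<^sup>2 = v * x\<^sup>2" for x
    using assms by (simp add: power_mult_distrib)
  note eq = centered_normal_eq_distr[OF assms]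
  show "integrable (centered_normal v) (\<lambda>x. x)"
    unfolding eq integrable_distr_eq[OF m m1] by (rule integrable_mult_right) (rule i(1))
  show "integrable (centered_normal v) (\<lambda>x. x\<^sup>2)"
    unfolding eq integrable_distr_eq[OF m m2] sq by (rule integrable_mult_right) (rule i(2))
  show "integral\<^sup>L (centered_normal v) (\<lambda>x. x) = 0"
    unfolding eq integral_distr[OF m m1] integral_mult_right_zero e(1) by simp
  show "integral\<^sup>L (centered_normal v) (\<lambda>x. x\<^sup>2) = v"
    unfolding eq integral_distr[OF m m2] sq integral_mult_right_zero e(2) by simp
qed

lemma (in prob_space) char_distr_diff_le:
  fixes U V :: "'a \<Rightarrow> real"
  assumes [measurable]: "U \<in> borel_measurable M" "V \<in> borel_measurable M"
    and i: "integrable M (\<lambda>w. U w - V w)"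
  shows "cmod (char (distr M borel U) u - char (distr M borel V) u) \<le> \<bar>u\<bar> * (\<integral>w. \<bar>U w - V w\<bar> \<partial>M)"
proof -
  have ie: "cmod (iexp x - iexp y) \<le> \<bar>x - y\<bar>" for x y :: real
  proof -
    have "iexp x - iexp y = iexp y * (iexp (x - y) - 1)"
      by (simp add: algebra_simps flip: exp_add)
    then have "cmod (iexp x - iexp y) = cmod (iexp (x - y) - 1)"
      by (simp add: norm_mult)
    also have "\<dots> \<le> \<bar>x - y\<bar>"
      using iexp_approx1[of "x - y" 0] by simp
    finally show ?thesis .
  qed
  have "char (distr M borel U) u - char (distr M borel V) u = (\<integral>w. iexp (u * U w) - iexp (u * V w) \<partial>M)"
    unfolding char_def by (simp add: integral_distr integrable_iexp)
  also have "cmod \<dots> \<le> (\<integral>w. cmod (iexp (u * U w) - iexp (u * V w)) \<partial>M)"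
    by (rule integral_norm_bound)
  also have "\<dots> \<le> (\<integral>w. \<bar>u\<bar> * \<bar>U w - V w\<bar> \<partial>M)"
  proof (rule integral_mono)
    show "integrable M (\<lambda>w. cmod (iexp (u * U w) - iexp (u * V w)))"
      by (intro integrable_norm Bochner_Integration.integrable_diff integrable_iexp) auto
    show "cmod (iexp (u * U w) - iexp (u * V w)) \<le> \<bar>u\<bar> * \<bar>U w - V w\<bar>" for w
      using ie[of "u * U w" "u * V w"] by (simp add: abs_mult flip: right_diff_distrib)
  qed (use i in auto)
  finally show ?thesis by simp
qed

text \<open>The second moment \<open>s\<close> may differ from \<open>v\<close>: for resampled data \<open>s\<close> is the empirical variance and \<open>v\<close> its
limit.  Keeping the minimum of a quadratic and a cubic term inside the integral avoids a third
moment.  The condition \<open>u\<^sup>2 * v / 4 \<le> n\<close> keeps both bases in the unit disc, where the difference of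
the powers is at most \<open>n\<close> times the difference of the bases.\<close>

lemma char_power_approx:
  assumes "real_distribution \<mu>"
    and m: "integrable \<mu> (\<lambda>x. x\<^sup>2)" "integral\<^sup>L \<mu> (\<lambda>x. x) = 0" "integral\<^sup>L \<mu> (\<lambda>x. x\<^sup>2) = s"
    and v: "v \<ge> 0" and n: "n > 0" "u\<^sup>2 * v / 4 \<le> real n"
  shows "cmod ((char \<mu> (u / sqrt (real n)))^n - complex_of_real ((1 + (- (v * u\<^sup>2 / 2)) / real n)^n))
    \<le> u\<^sup>2 / 6 * (\<integral>x. min (6 * x\<^sup>2) (\<bar>u\<bar> / sqrt (real n) * \<bar>x\<bar> ^ 3) \<partial>\<mu>) + u\<^sup>2 / 2 * \<bar>s - v\<bar>"
proof -
  interpret real_distribution \<mu> by fact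
  have i1: "integrable \<mu> (\<lambda>x. x)"
    by (rule square_integrable_imp_integrable[OF _ m(1)]) simp
  define w where "w = u / sqrt (real n)"
  define I where "I = (\<integral>x. min (6 * x\<^sup>2) (\<bar>w\<bar> * \<bar>x\<bar> ^ 3) \<partial>\<mu>)"
  define r where "r = 1 + (- (v * u\<^sup>2 / 2)) / real n"
  have w2: "w\<^sup>2 = u\<^sup>2 / real n" using n by (simp add: w_def power_divide)
  have 1: "cmod (char \<mu> w - (1 - w\<^sup>2 * s / 2)) \<le> w\<^sup>2 / 6 * I"
    unfolding I_def using m i1 by (intro char_approx3) (simp_all)
  have r1: "\<bar>r\<bar> \<le> 1"
  proof -
    have "0 \<le> v * u\<^sup>2 / 2 / real n" "v * u\<^sup>2 / 2 / real n \<le> 2"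
      using n v by (simp_all add: divide_le_eq mult.commute)
    then show ?thesis by (simp add: r_def abs_le_iff)
  qed
  have "cmod ((1 - w\<^sup>2 * s / 2) - r) = w\<^sup>2 / 2 * \<bar>s - v\<bar>"
  proof -
    have "complex_of_real (1 - w\<^sup>2 * s / 2) - complex_of_real r = complex_of_real (w\<^sup>2 / 2 * (v - s))"
      unfolding of_real_diff[symmetric] of_real_eq_iff by (simp add: r_def w2 diff_divide_distrib algebra_simps)
    then have "cmod (complex_of_real (1 - w\<^sup>2 * s / 2) - complex_of_real r) = \<bar>w\<^sup>2 / 2 * (v - s)\<bar>"
      by (simp only: norm_of_real)
    then show ?thesis by (simp add: abs_mult abs_minus_commute)
  qed
  then have 2: "cmod (char \<mu> w - r) \<le> w\<^sup>2 / 6 * I + w\<^sup>2 / 2 * \<bar>s - v\<bar>"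
    by (intro norm_diff_triangle_le[OF 1]) simp
  have "cmod ((char \<mu> w)^n - (complex_of_real r)^n) \<le> n * cmod (char \<mu> w - r)"
    using r1 by (intro norm_power_diff cmod_char_le_1) simp
  also have "\<dots> \<le> n * (w\<^sup>2 / 6 * I + w\<^sup>2 / 2 * \<bar>s - v\<bar>)"
    by (intro mult_left_mono 2) simp
  also have "\<dots> = u\<^sup>2 / 6 * I + u\<^sup>2 / 2 * \<bar>s - v\<bar>"
    using n by (simp add: w2 field_simps)
  finally show ?thesis
    using n by (simp add: w_def I_def r_def)
qed

lemma power_tendsto_gaussian_char:
  "(\<lambda>n. complex_of_real ((1 + (- (v * u\<^sup>2 / 2)) / real n)^n)) \<longlonglongrightarrow> complex_of_real (exp (- (v * u\<^sup>2 / 2)))"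
  by (rule tendsto_of_real, rule tendsto_exp_limit_sequentially)

text \<open>The error term of \<open>char_power_approx\<close> for the law of \<open>\<phi>\<close>: the cubic branch makes it small at each
point, the quadratic branch is an integrable bound.\<close>

lemma lindeberg_tendsto_0:
  assumes \<phi>: "integrable Q (\<lambda>x. (\<phi> x :: real)\<^sup>2)" "\<phi> \<in> borel_measurable Q" and "0 \<le> \<alpha>" "0 \<le> \<beta>"
  shows "(\<lambda>n. \<integral>x. min (\<alpha> * (\<phi> x)\<^sup>2) (\<beta> / sqrt (real n) * \<bar>\<phi> x\<bar> ^ 3) \<partial>Q) \<longlonglongrightarrow> 0"
proof -
  have [measurable]: "\<phi> \<in> borel_measurable Q" by fact
  have "(\<lambda>n. \<integral>x. min (\<alpha> * (\<phi> x)\<^sup>2) (\<beta> / sqrt (real n) * \<bar>\<phi> x\<bar> ^ 3) \<partial>Q) \<longlonglongrightarrow> (\<integral>x. 0 \<partial>Q)"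
  proof (rule integral_dominated_convergence[where w="\<lambda>x. \<alpha> * (\<phi> x)\<^sup>2"])
    show "AE x in Q. (\<lambda>n. min (\<alpha> * (\<phi> x)\<^sup>2) (\<beta> / sqrt (real n) * \<bar>\<phi> x\<bar> ^ 3)) \<longlonglongrightarrow> 0"
    proof (rule AE_I2)
      fix x
      have "(\<lambda>n. \<beta> / sqrt (real n)) \<longlonglongrightarrow> 0"
        by (auto intro!: tendsto_divide_0 filterlim_at_top_imp_at_infinity sqrt_at_top[THEN filterlim_compose] filterlim_real_sequentially)
      from tendsto_min[OF tendsto_const[of "\<alpha> * (\<phi> x)\<^sup>2"] tendsto_mult_right[OF this, of "\<bar>\<phi> x\<bar> ^ 3"]]
      show "(\<lambda>n. min (\<alpha> * (\<phi> x)\<^sup>2) (\<beta> / sqrt (real n) * \<bar>\<phi> x\<bar> ^ 3)) \<longlonglongrightarrow> 0"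
        using assms by (simp add: min_absorb2)
    qed
    show "AE x in Q. norm (min (\<alpha> * (\<phi> x)\<^sup>2) (\<beta> / sqrt (real n) * \<bar>\<phi> x\<bar> ^ 3)) \<le> \<alpha> * (\<phi> x)\<^sup>2" for n
    proof (rule AE_I2)
      fix x
      have "0 \<le> min (\<alpha> * (\<phi> x)\<^sup>2) (\<beta> / sqrt (real n) * \<bar>\<phi> x\<bar> ^ 3)"
        using assms by simp
      then show "norm (min (\<alpha> * (\<phi> x)\<^sup>2) (\<beta> / sqrt (real n) * \<bar>\<phi> x\<bar> ^ 3)) \<le> \<alpha> * (\<phi> x)\<^sup>2"
        by simp
    qed
    show "integrable Q (\<lambda>x. \<alpha> * (\<phi> x)\<^sup>2)"
      using assms by simp
  qed measurable
  then show ?thesis by simp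
qed

section \<open>Averages of independent observations\<close>

lemma (in prob_space) second_moment_iid_average:
  fixes f :: "'s \<Rightarrow> real"
  assumes ind: "indep_vars (\<lambda>_. Q) Z {..<n}" and D: "\<And>i. i < n \<Longrightarrow> distr M Q (Z i) = Q"
    and f: "f \<in> borel_measurable Q" "integrable Q (\<lambda>x. (f x)\<^sup>2)" "(\<integral>x. f x \<partial>Q) = 0" and n: "n > 0"
  shows "integrable M (\<lambda>\<omega>. ((\<Sum>i<n. f (Z i \<omega>)) / real n)\<^sup>2)"
    and "(\<integral>\<omega>. ((\<Sum>i<n. f (Z i \<omega>)) / real n)\<^sup>2 \<partial>M) = (\<integral>x. (f x)\<^sup>2 \<partial>Q) / real n"
proof -
  have Z: "Z i \<in> M \<rightarrow>\<^sub>M Q" if "i < n" for i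
    using ind that by (auto simp: indep_vars_def)
  have indf: "indep_vars (\<lambda>_. borel) (\<lambda>i \<omega>. f (Z i \<omega>)) {..<n}"
    by (rule indep_vars_compose2[OF ind]) (use f in auto)
  have mom: "integrable M (\<lambda>\<omega>. (f (Z i \<omega>))\<^sup>2)" "(\<integral>\<omega>. (f (Z i \<omega>))\<^sup>2 \<partial>M) = (\<integral>x. (f x)\<^sup>2 \<partial>Q)"
    "(\<integral>\<omega>. f (Z i \<omega>) \<partial>M) = 0" if "i < n" for i
  proof -
    have "integrable (distr M Q (Z i)) (\<lambda>x. (f x)\<^sup>2)" using f D that by simp
    then show "integrable M (\<lambda>\<omega>. (f (Z i \<omega>))\<^sup>2)"
      using Z[OF that] f by (subst (asm) integrable_distr_eq) auto
    have "(\<integral>x. (f x)\<^sup>2 \<partial>distr M Q (Z i)) = (\<integral>\<omega>. (f (Z i \<omega>))\<^sup>2 \<partial>M)"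
      using Z[OF that] f by (subst integral_distr) auto
    then show "(\<integral>\<omega>. (f (Z i \<omega>))\<^sup>2 \<partial>M) = (\<integral>x. (f x)\<^sup>2 \<partial>Q)" using D that by simp
    have "(\<integral>x. f x \<partial>distr M Q (Z i)) = (\<integral>\<omega>. f (Z i \<omega>) \<partial>M)"
      using Z[OF that] f by (subst integral_distr) auto
    then show "(\<integral>\<omega>. f (Z i \<omega>) \<partial>M) = 0" using D that f by simp
  qed
  note S = second_moment_indep_sum[OF _ indf, simplified]
  have "integrable M (\<lambda>\<omega>. (\<Sum>i<n. f (Z i \<omega>))\<^sup>2)" "(\<integral>\<omega>. (\<Sum>i<n. f (Z i \<omega>))\<^sup>2 \<partial>M) = n * (\<integral>x. (f x)\<^sup>2 \<partial>Q)"
    using S mom by auto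
  then show "integrable M (\<lambda>\<omega>. ((\<Sum>i<n. f (Z i \<omega>)) / real n)\<^sup>2)"
    "(\<integral>\<omega>. ((\<Sum>i<n. f (Z i \<omega>)) / real n)\<^sup>2 \<partial>M) = (\<integral>x. (f x)\<^sup>2 \<partial>Q) / real n"
    using n by (auto simp: power_divide power2_eq_square)
qed

text \<open>Truncation at a level \<open>K\<close> splits \<open>f\<close> into a bounded part, whose average has a standard deviation of order
\<open>K / sqrt n\<close>, and a rest, whose average is at most \<open>\<integral> \<bar>f - g K\<bar>\<close> in mean for all \<open>n\<close>.\<close>

theorem (in prob_space) L1_law_of_large_numbers:
  fixes f :: "'s \<Rightarrow> real"
  assumes ind: "indep_vars (\<lambda>_. Q) Z UNIV" and D: "\<And>i. distr M Q (Z i) = Q"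
    and f: "integrable Q f"
  shows "(\<lambda>n. \<integral>\<omega>. \<bar>(\<Sum>i<n. f (Z i \<omega>)) / real n - (\<integral>x. f x \<partial>Q)\<bar> \<partial>M) \<longlonglongrightarrow> 0"
proof -
  have Z: "Z i \<in> M \<rightarrow>\<^sub>M Q" for i
    using ind by (auto simp: indep_vars_def)
  interpret Q: prob_space Q
    using prob_space_distr[OF Z[of 0]] by (simp add: D)
  have [measurable]: "f \<in> borel_measurable Q" using f by auto
  note [measurable] = Z
  have tr: "integrable M (\<lambda>\<omega>. g (Z i \<omega>))" "(\<integral>\<omega>. g (Z i \<omega>) \<partial>M) = (\<integral>x. g x \<partial>Q)" if "integrable Q g" for g :: "'s \<Rightarrow> real" and i
  proof -
    have [measurable]: "g \<in> borel_measurable Q" using that by auto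
    have "integrable (distr M Q (Z i)) g" using that D by simp
    then show "integrable M (\<lambda>\<omega>. g (Z i \<omega>))" by (subst (asm) integrable_distr_eq) auto
    have "(\<integral>x. g x \<partial>distr M Q (Z i)) = (\<integral>\<omega>. g (Z i \<omega>) \<partial>M)" by (subst integral_distr) auto
    then show "(\<integral>\<omega>. g (Z i \<omega>) \<partial>M) = (\<integral>x. g x \<partial>Q)" by (simp add: D)
  qed
  define g where "g K x = (if \<bar>f x\<bar> \<le> real K then f x else 0)" for K :: nat and x
  have [measurable]: "g K \<in> borel_measurable Q" for K unfolding g_def by measurable
  have gb: "\<bar>g K x\<bar> \<le> real K" for K x by (simp add: g_def)
  have ig: "integrable Q (g K)" for K
    using gb by (intro Q.integrable_const_bound[where B=K]) auto
  define r where "r K = (\<integral>x. \<bar>f x - g K x\<bar> \<partial>Q)" for K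
  have "r \<longlonglongrightarrow> (\<integral>x. 0 \<partial>Q)"
    unfolding r_def
  proof (rule integral_dominated_convergence[where w="\<lambda>x. \<bar>f x\<bar>"])
    show "AE x in Q. (\<lambda>K. \<bar>f x - g K x\<bar>) \<longlonglongrightarrow> 0"
    proof (rule AE_I2)
      fix x
      have "eventually (\<lambda>K. \<bar>f x - g K x\<bar> = 0) sequentially"
      proof (rule eventually_sequentiallyI[of "nat \<lceil>\<bar>f x\<bar>\<rceil>"])
        fix K assume "nat \<lceil>\<bar>f x\<bar>\<rceil> \<le> K"
        then have "\<bar>f x\<bar> \<le> real K"
          using real_nat_ceiling_ge[of "\<bar>f x\<bar>"] by linarith
        then show "\<bar>f x - g K x\<bar> = 0" by (simp add: g_def)
      qed
      then show "(\<lambda>K. \<bar>f x - g K x\<bar>) \<longlonglongrightarrow> 0"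
        by (simp add: tendsto_eventually)
    qed
  qed (use f in \<open>auto simp: g_def\<close>)
  then have r: "r \<longlonglongrightarrow> 0" by simp
  have main: "(\<integral>\<omega>. \<bar>(\<Sum>i<n. f (Z i \<omega>)) / real n - (\<integral>x. f x \<partial>Q)\<bar> \<partial>M) \<le> 2 * real K / sqrt (real n) + 2 * r K"
    if n: "n > 0" for n K
  proof -
    define mg where "mg = (\<integral>x. g K x \<partial>Q)"
    define A where "A \<omega> = (\<Sum>i<n. g K (Z i \<omega>) - mg) / real n" for \<omega>
    define B where "B \<omega> = (\<Sum>i<n. \<bar>f (Z i \<omega>) - g K (Z i \<omega>)\<bar>) / real n" for \<omega>
    have mgb: "\<bar>mg\<bar> \<le> K"
    proof -
      have "\<bar>mg\<bar> \<le> (\<integral>x. \<bar>g K x\<bar> \<partial>Q)" unfolding mg_def by (rule integral_abs_bound)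
      also have "\<dots> \<le> (\<integral>x. real K \<partial>Q)" using gb ig by (intro integral_mono) auto
      finally show ?thesis by (simp add: Q.prob_space)
    qed
    have g2b: "(g K x - mg)\<^sup>2 \<le> (2 * real K)\<^sup>2" for x
      using gb[of K x] mgb by (intro power2_le_iff_abs_le[THEN iffD2]) auto
    have g2: "integrable Q (\<lambda>x. (g K x - mg)\<^sup>2)"
      using g2b by (intro Q.integrable_const_bound[where B="(2 * real K)\<^sup>2"]) auto
    have "(\<integral>x. (g K x - mg)\<^sup>2 \<partial>Q) \<le> (\<integral>x. (2 * real K)\<^sup>2 \<partial>Q)"
      using g2 g2b by (intro integral_mono) auto
    then have g2le: "(\<integral>x. (g K x - mg)\<^sup>2 \<partial>Q) \<le> (2 * real K)\<^sup>2" by (simp add: Q.prob_space)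
    have ind': "indep_vars (\<lambda>_. Q) Z {..<n}" by (rule indep_vars_subset[OF ind]) simp
    have A2: "integrable M (\<lambda>\<omega>. (A \<omega>)\<^sup>2)" "(\<integral>\<omega>. (A \<omega>)\<^sup>2 \<partial>M) = (\<integral>x. (g K x - mg)\<^sup>2 \<partial>Q) / n"
      unfolding A_def
      using second_moment_iid_average[OF ind' D _ g2 _ n] ig by (auto simp: mg_def Q.prob_space)
    have [measurable]: "A \<in> borel_measurable M" unfolding A_def by measurable
    have "(\<integral>\<omega>. (A \<omega>)\<^sup>2 \<partial>M) \<le> (2 * real K / sqrt (real n))\<^sup>2"
      unfolding A2 using g2le n by (simp add: power_divide divide_right_mono)
    note A1 = integral_abs_le_sqrt[OF A2(1) _ this]
    have fg: "integrable Q (\<lambda>x. \<bar>f x - g K x\<bar>)" using f ig by auto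
    have B: "integrable M B" "(\<integral>\<omega>. B \<omega> \<partial>M) = r K"
      unfolding B_def r_def using tr[OF fg] n by auto
    have le: "\<bar>(\<Sum>i<n. f (Z i \<omega>)) / real n - (\<integral>x. f x \<partial>Q)\<bar> \<le> \<bar>A \<omega>\<bar> + B \<omega> + r K" for \<omega>
    proof -
      have "(\<Sum>i<n. f (Z i \<omega>)) / real n - (\<integral>x. f x \<partial>Q)
         = A \<omega> + (\<Sum>i<n. f (Z i \<omega>) - g K (Z i \<omega>)) / real n + (mg - (\<integral>x. f x \<partial>Q))"
        using n by (simp add: A_def sum_subtractf field_simps)
      moreover have "\<bar>(\<Sum>i<n. f (Z i \<omega>) - g K (Z i \<omega>)) / real n\<bar> \<le> B \<omega>"
        using n by (auto simp: B_def intro!: divide_right_mono sum_abs)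
      moreover have "\<bar>mg - (\<integral>x. f x \<partial>Q)\<bar> \<le> r K"
      proof -
        have "\<bar>mg - (\<integral>x. f x \<partial>Q)\<bar> = \<bar>\<integral>x. f x - g K x \<partial>Q\<bar>"
          using f ig by (simp add: mg_def)
        also have "\<dots> \<le> r K" unfolding r_def by (rule integral_abs_bound)
        finally show ?thesis .
      qed
      ultimately show ?thesis by linarith
    qed
    have "(\<integral>\<omega>. \<bar>(\<Sum>i<n. f (Z i \<omega>)) / real n - (\<integral>x. f x \<partial>Q)\<bar> \<partial>M) \<le> (\<integral>\<omega>. \<bar>A \<omega>\<bar> + B \<omega> + r K \<partial>M)"
      using le tr[OF f] A1 B by (intro integral_mono) auto
    also have "\<dots> = (\<integral>\<omega>. \<bar>A \<omega>\<bar> \<partial>M) + r K + r K"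
      using A1 B by (simp add: prob_space)
    also have "\<dots> \<le> 2 * real K / sqrt (real n) + 2 * r K"
      using A1(2) by simp
    finally show ?thesis .
  qed
  show ?thesis
  proof (rule LIMSEQ_I)
    fix e :: real assume e: "e > 0"
    have "eventually (\<lambda>K. r K < e / 4) sequentially"
      by (rule order_tendstoD(2)[OF r]) (use e in simp)
    then obtain K where K: "r K < e / 4" by (auto simp: eventually_sequentially)
    have "(\<lambda>n. 2 * real K / sqrt (real n)) \<longlonglongrightarrow> 0"
      by (auto intro!: tendsto_divide_0 filterlim_at_top_imp_at_infinity sqrt_at_top[THEN filterlim_compose] filterlim_real_sequentially)
    then have "eventually (\<lambda>n. 2 * real K / sqrt (real n) < e / 2) sequentially"
      using order_tendstoD(2) e by (metis half_gt_zero)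
    then obtain n0 where n0: "\<And>n. n \<ge> n0 \<Longrightarrow> 2 * real K / sqrt (real n) < e / 2"
      by (auto simp: eventually_sequentially)
    show "\<exists>no. \<forall>n\<ge>no. norm ((\<integral>\<omega>. \<bar>(\<Sum>i<n. f (Z i \<omega>)) / real n - (\<integral>x. f x \<partial>Q)\<bar> \<partial>M) - 0) < e"
    proof (intro exI allI impI)
      fix n assume "n \<ge> max 1 n0"
      then have "(\<integral>\<omega>. \<bar>(\<Sum>i<n. f (Z i \<omega>)) / real n - (\<integral>x. f x \<partial>Q)\<bar> \<partial>M) < e"
        using main[of n K] n0[of n] K by simp
      moreover have "0 \<le> (\<integral>\<omega>. \<bar>(\<Sum>i<n. f (Z i \<omega>)) / real n - (\<integral>x. f x \<partial>Q)\<bar> \<partial>M)"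
        by (rule Bochner_Integration.integral_nonneg) simp
      ultimately show "norm ((\<integral>\<omega>. \<bar>(\<Sum>i<n. f (Z i \<omega>)) / real n - (\<integral>x. f x \<partial>Q)\<bar> \<partial>M) - 0) < e"
        by simp
    qed
  qed
qed

section \<open>Central limit theorem for the $L^1$ norm of a perturbed function\<close>

text \<open>The common setting for one and two samples.  The function \<open>a\<close> is the difference of the distribution functions,
\<open>k x\<close> is the centered contribution of an observation \<open>x\<close> with law \<open>Q\<close>, and \<open>\<tau> z\<close> is the standard
deviation of \<open>k x z\<close>.  The bound \<open>2\<close> accommodates the kernel of a pair of observations, which is a
difference of two kernels bounded by \<open>1\<close>.  By the assumption \<open>nondegenerate\<close> the kernel
does not fluctuate where the absolute value fails to be differentiable at \<open>a z\<close>.\<close>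

locale centered_kernel = Q: prob_space Q + m: sigma_finite_measure m
  for Q :: "'s measure" and m :: "'z measure" +
  fixes a :: "'z \<Rightarrow> real" and k :: "'s \<Rightarrow> 'z \<Rightarrow> real" and \<tau> :: "'z \<Rightarrow> real"
  assumes integrable_a: "integrable m a"
    and kernel_measurable: "case_prod k \<in> borel_measurable (Q \<Otimes>\<^sub>M m)"
    and kernel_bound: "\<And>x z. \<bar>k x z\<bar> \<le> 2"
    and kernel_integrable: "\<And>x. x \<in> space Q \<Longrightarrow> integrable m (k x)"
    and kernel_mean: "\<And>z. z \<in> space m \<Longrightarrow> (\<integral>x. k x z \<partial>Q) = 0"
    and kernel_second_moment: "\<And>z. z \<in> space m \<Longrightarrow> (\<integral>x. (k x z)\<^sup>2 \<partial>Q) = (\<tau> z)\<^sup>2"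
    and \<tau>_integrable: "integrable m \<tau>" and \<tau>_nonneg: "\<And>z. 0 \<le> \<tau> z"
    and nondegenerate: "AE z in m. a z \<noteq> 0 \<or> \<tau> z = 0"
    and influence_square_integrable: "integrable Q (\<lambda>x. (\<integral>z. sgn (a z) * k x z \<partial>m)\<^sup>2)"
begin

text \<open>The derivative of the $L^1$ norm at \<open>a\<close> in the direction \<open>k x\<close>.\<close>

definition influence :: "'s \<Rightarrow> real" where
  "influence x = (\<integral>z. sgn (a z) * k x z \<partial>m)"

abbreviation asymptotic_variance :: real where
  "asymptotic_variance \<equiv> (\<integral>x. (influence x)\<^sup>2 \<partial>Q)"

sublocale P: pair_sigma_finite Q m ..

lemma measurable_kernel [measurable (raw)]:
  assumes "f \<in> N \<rightarrow>\<^sub>M Q" "g \<in> N \<rightarrow>\<^sub>M m"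
  shows "(\<lambda>w. k (f w) (g w)) \<in> borel_measurable N"
  using measurable_compose[OF measurable_Pair[OF assms] kernel_measurable] by simp

lemma measurable_a [measurable]: "a \<in> borel_measurable m" and measurable_\<tau> [measurable]: "\<tau> \<in> borel_measurable m"
  using integrable_a \<tau>_integrable by auto

lemma kernel_section_measurable: "z \<in> space m \<Longrightarrow> (\<lambda>x. k x z) \<in> borel_measurable Q"
  by measurable

lemma kernel_L2: "z \<in> space m \<Longrightarrow> integrable Q (\<lambda>x. (k x z)\<^sup>2)"
proof -
  assume z: "z \<in> space m"
  have "(k x z)\<^sup>2 \<le> 2\<^sup>2" for x
    using kernel_bound[of x z] abs_le_square_iff[of "k x z" 2] by simp
  then show "integrable Q (\<lambda>x. (k x z)\<^sup>2)"
    by (intro Q.integrable_const_bound[where B="2\<^sup>2"] AE_I2 borel_measurable_power kernel_section_measurable z) simp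
qed

lemma kernel_L1: "z \<in> space m \<Longrightarrow> integrable Q (\<lambda>x. k x z)" "z \<in> space m \<Longrightarrow> (\<integral>x. \<bar>k x z\<bar> \<partial>Q) \<le> \<tau> z"
  using Q.integral_abs_le_sqrt[OF kernel_L2 kernel_section_measurable, of z "\<tau> z"] \<tau>_nonneg kernel_second_moment by auto

lemma measurable_influence [measurable]: "influence \<in> borel_measurable Q"
  unfolding influence_def[abs_def] by measurable

lemma influence_L2: "integrable Q (\<lambda>x. (influence x)\<^sup>2)"
  using influence_square_integrable by (simp add: influence_def)

text \<open>The integrals can be exchanged because \<open>k x z\<close> has mean absolute value at most \<open>\<tau> z\<close> in \<open>x\<close>.  For a
direction of perturbation \<open>h\<close> of the law \<open>Q\<close>, the inner integral on the right is the derivative of \<open>a\<close>.\<close>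

lemma integral_influence_mult:
  assumes [measurable]: "h \<in> borel_measurable Q" and B: "\<And>x. \<bar>h x\<bar> \<le> B"
  shows "(\<integral>x. h x * influence x \<partial>Q) = (\<integral>z. sgn (a z) * (\<integral>x. h x * k x z \<partial>Q) \<partial>m)"
    and "integrable m (\<lambda>z. \<integral>x. h x * k x z \<partial>Q)"
    and "z \<in> space m \<Longrightarrow> \<bar>\<integral>x. h x * k x z \<partial>Q\<bar> \<le> B * \<tau> z"
proof -
  have B0: "B \<ge> 0" using B[of undefined] by linarith
  have i1: "integrable Q (\<lambda>x. h x * k x z)" if "z \<in> space m" for z
    by (rule Bochner_Integration.integrable_bound[where f="\<lambda>x. B * k x z"])
       (use B B0 that kernel_L1 in \<open>auto simp: abs_mult intro!: mult_right_mono borel_measurable_times kernel_section_measurable\<close>)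
  have le: "\<bar>\<integral>x. h x * k x z \<partial>Q\<bar> \<le> B * \<tau> z" "(\<integral>x. \<bar>h x * k x z\<bar> \<partial>Q) \<le> B * \<tau> z" if z: "z \<in> space m" for z
  proof -
    have "(\<integral>x. \<bar>h x * k x z\<bar> \<partial>Q) \<le> (\<integral>x. B * \<bar>k x z\<bar> \<partial>Q)"
    proof (rule integral_mono[OF integrable_abs[OF i1[OF z]]])
      show "integrable Q (\<lambda>x. B * \<bar>k x z\<bar>)"
        by (rule integrable_mult_right) (rule integrable_abs[OF kernel_L1(1)[OF z]])
    qed (use B in \<open>auto simp: abs_mult mult_right_mono\<close>)
    also have "\<dots> \<le> B * \<tau> z"
      using kernel_L1[OF z] B0 by (simp add: mult_left_mono)
    finally show 1: "(\<integral>x. \<bar>h x * k x z\<bar> \<partial>Q) \<le> B * \<tau> z" .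
    have "\<bar>\<integral>x. h x * k x z \<partial>Q\<bar> \<le> (\<integral>x. \<bar>h x * k x z\<bar> \<partial>Q)"
      by (rule integral_abs_bound)
    with 1 show "\<bar>\<integral>x. h x * k x z \<partial>Q\<bar> \<le> B * \<tau> z" by linarith
  qed
  then show "z \<in> space m \<Longrightarrow> \<bar>\<integral>x. h x * k x z \<partial>Q\<bar> \<le> B * \<tau> z" by simp
  show "integrable m (\<lambda>z. \<integral>x. h x * k x z \<partial>Q)"
  proof (rule Bochner_Integration.integrable_bound[where f="\<lambda>z. B * \<tau> z"])
    show "AE z in m. norm (\<integral>x. h x * k x z \<partial>Q) \<le> norm (B * \<tau> z)"
      using le B0 \<tau>_nonneg by (intro AE_I2) auto
  qed (use \<tau>_integrable in auto)
  have int: "integrable (Q \<Otimes>\<^sub>M m) (\<lambda>(x, z). sgn (a z) * (h x * k x z))"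
  proof (rule integrableI_bounded)
    have "(\<integral>\<^sup>+p. ennreal (norm (case p of (x, z) \<Rightarrow> sgn (a z) * (h x * k x z))) \<partial>(Q \<Otimes>\<^sub>M m))
       = (\<integral>\<^sup>+z. \<integral>\<^sup>+x. ennreal \<bar>sgn (a z) * (h x * k x z)\<bar> \<partial>Q \<partial>m)"
      by (subst P.nn_integral_snd[symmetric]) (simp_all add: split_beta')
    also have "\<dots> \<le> (\<integral>\<^sup>+z. ennreal (B * \<tau> z) \<partial>m)"
    proof (rule nn_integral_mono)
      fix z assume z: "z \<in> space m"
      have "(\<integral>\<^sup>+x. ennreal \<bar>sgn (a z) * (h x * k x z)\<bar> \<partial>Q) \<le> (\<integral>\<^sup>+x. ennreal \<bar>h x * k x z\<bar> \<partial>Q)"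
        by (intro nn_integral_mono ennreal_leI) (auto simp: sgn_if abs_mult)
      also have "\<dots> = ennreal (\<integral>x. \<bar>h x * k x z\<bar> \<partial>Q)"
        using i1[OF z] by (intro nn_integral_eq_integral) auto
      also have "\<dots> \<le> ennreal (B * \<tau> z)" using le z by (intro ennreal_leI) auto
      finally show "(\<integral>\<^sup>+x. ennreal \<bar>sgn (a z) * (h x * k x z)\<bar> \<partial>Q) \<le> ennreal (B * \<tau> z)" .
    qed
    also have "\<dots> < \<infinity>"
      using \<tau>_integrable \<tau>_nonneg B0 by (subst nn_integral_eq_integral) auto
    finally show "(\<integral>\<^sup>+p. ennreal (norm (case p of (x, z) \<Rightarrow> sgn (a z) * (h x * k x z))) \<partial>(Q \<Otimes>\<^sub>M m)) < \<infinity>" .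
  qed measurable
  have "(\<integral>x. h x * influence x \<partial>Q) = (\<integral>x. \<integral>z. sgn (a z) * (h x * k x z) \<partial>m \<partial>Q)"
    by (simp add: influence_def mult.left_commute flip: integral_mult_right_zero)
  also have "\<dots> = (\<integral>z. \<integral>x. sgn (a z) * (h x * k x z) \<partial>Q \<partial>m)"
    by (rule P.Fubini_integral[OF int, symmetric])
  finally show "(\<integral>x. h x * influence x \<partial>Q) = (\<integral>z. sgn (a z) * (\<integral>x. h x * k x z \<partial>Q) \<partial>m)"
    by simp
qed

lemma influence_mean: "(\<integral>x. influence x \<partial>Q) = 0"
proof -
  have "(\<integral>x. influence x \<partial>Q) = (\<integral>z. sgn (a z) * (\<integral>x. k x z \<partial>Q) \<partial>m)"
    using integral_influence_mult(1)[of "\<lambda>_. 1" 1] by simp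
  also have "\<dots> = (\<integral>z. 0 \<partial>m)"
    by (intro Bochner_Integration.integral_cong) (simp_all add: kernel_mean)
  finally show ?thesis by simp
qed

text \<open>The factor \<open>2\<close> leaves room for averages over resampled data, which fluctuate both with the data and
with the draws and thus have up to four times the variance bound \<open>\<tau>\<^sup>2 / n\<close>.\<close>

definition gap :: "nat \<Rightarrow> real" where
  "gap n = (\<integral>z. linearization_gap (a z) (2 * \<tau> z) n \<partial>m)"

lemma gap_tendsto_0: "gap \<longlonglongrightarrow> 0"
  unfolding gap_def using \<tau>_integrable \<tau>_nonneg
  by (intro integral_linearization_gap_tendsto_0) auto

lemma gap_nonneg: "0 \<le> gap n"
  unfolding gap_def using \<tau>_nonneg by (intro Bochner_Integration.integral_nonneg linearization_gap_bounds(1)) simp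

definition linear_error :: "('z \<Rightarrow> real) \<Rightarrow> real" where
  "linear_error c = \<bar>(\<integral>z. \<bar>a z + c z\<bar> \<partial>m) - (\<integral>z. \<bar>a z\<bar> \<partial>m) - (\<integral>z. sgn (a z) * c z \<partial>m)\<bar>"

lemma expected_linear_error:
  fixes c :: "'w \<Rightarrow> 'z \<Rightarrow> real"
  assumes "prob_space N" "case_prod c \<in> borel_measurable (N \<Otimes>\<^sub>M m)"
    and "\<And>w. w \<in> space N \<Longrightarrow> integrable m (c w)"
    and "\<And>z. z \<in> space m \<Longrightarrow> integrable N (\<lambda>w. (c w z)\<^sup>2)"
    and c2: "\<And>z. z \<in> space m \<Longrightarrow> (\<integral>w. (c w z)\<^sup>2 \<partial>N) \<le> 4 * (\<tau> z)\<^sup>2 / real n"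
    and n: "n > 0"
  shows "(\<integral>\<^sup>+w. ennreal (sqrt (real n) * linear_error (c w)) \<partial>N) \<le> ennreal (gap n)"
  unfolding linear_error_def gap_def
proof (rule L1_linearization_error[OF assms(1) m.sigma_finite_measure_axioms integrable_a assms(2-4)])
  show "(\<integral>w. (c w z)\<^sup>2 \<partial>N) \<le> (2 * \<tau> z)\<^sup>2 / real n" if "z \<in> space m" for z
    using c2[OF that] by (simp add: power_mult_distrib)
  show "integrable m (\<lambda>z. 2 * \<tau> z)"
    by (rule integrable_mult_right) (rule \<tau>_integrable)
  show "0 \<le> 2 * \<tau> z" for z
    by (simp add: \<tau>_nonneg)
  show "AE z in m. a z \<noteq> 0 \<or> 2 * \<tau> z = 0"
    using nondegenerate by simp
qed (fact n | assumption)+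

lemma integral_sgn_average:
  assumes "\<And>i. i \<in> I \<Longrightarrow> x i \<in> space Q"
  shows "(\<integral>z. sgn (a z) * ((\<Sum>i\<in>I. k (x i) z) / r) \<partial>m) = (\<Sum>i\<in>I. influence (x i)) / r"
    and "integrable m (\<lambda>z. (\<Sum>i\<in>I. k (x i) z) / r)"
proof -
  have i: "integrable m (\<lambda>z. sgn (a z) * k (x i) z)" if "i \<in> I" for i
    by (rule Bochner_Integration.integrable_bound[OF kernel_integrable[OF assms[OF that]]])
       (use assms[OF that] in \<open>auto simp: abs_mult sgn_if\<close>)
  show "(\<integral>z. sgn (a z) * ((\<Sum>i\<in>I. k (x i) z) / r) \<partial>m) = (\<Sum>i\<in>I. influence (x i)) / r"
    using i by (simp add: sum_distrib_left influence_def)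
  show "integrable m (\<lambda>z. (\<Sum>i\<in>I. k (x i) z) / r)"
    using kernel_integrable assms by auto
qed

text \<open>The statistic differs from a normalised sum of independent copies of the influence function by at most
\<open>gap n\<close> in mean, so both have the same limiting characteristic function.  Arguing with characteristic
functions includes the degenerate case of a vanishing influence function.\<close>

theorem central_limit:
  assumes "prob_space M" and ind: "prob_space.indep_vars M (\<lambda>_. Q) Z UNIV" and D: "\<And>i. distr M Q (Z i) = Q"
  shows "conv_in_distribution M
    (\<lambda>n \<omega>. sqrt (real n) * ((\<integral>z. \<bar>a z + (\<Sum>i<n. k (Z i \<omega>) z) / real n\<bar> \<partial>m) - (\<integral>z. \<bar>a z\<bar> \<partial>m)))
    (centered_normal asymptotic_variance)"
proof -
  interpret M: prob_space M by fact
  have [measurable]: "Z i \<in> M \<rightarrow>\<^sub>M Q" for i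
    using ind by (auto simp: M.indep_vars_def)
  then have Zs: "\<omega> \<in> space M \<Longrightarrow> Z i \<omega> \<in> space Q" for \<omega> i
    by (rule measurable_space)
  define v where "v = asymptotic_variance"
  have v0: "v \<ge> 0" by (simp add: v_def)
  define c where "c n \<omega> z = (\<Sum>i<n. k (Z i \<omega>) z) / real n" for n \<omega> z
  \<comment> \<open>The statistic and its linear part.\<close>
  define T where "T n \<omega> = sqrt (real n) * ((\<integral>z. \<bar>a z + c n \<omega> z\<bar> \<partial>m) - (\<integral>z. \<bar>a z\<bar> \<partial>m))" for n \<omega>
  define L where "L n \<omega> = sqrt (real n) * ((\<Sum>i<n. influence (Z i \<omega>)) / real n)" for n \<omega>
  have [measurable]: "case_prod (c n) \<in> borel_measurable (M \<Otimes>\<^sub>M m)" for n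
    unfolding c_def split_beta' by measurable
  have Tm [measurable]: "T n \<in> borel_measurable M" for n
    unfolding T_def by measurable
  have [measurable]: "L n \<in> borel_measurable M" for n
    unfolding L_def by measurable
  have TL: "\<bar>T n \<omega> - L n \<omega>\<bar> = sqrt (real n) * linear_error (c n \<omega>)" if "\<omega> \<in> space M" for n \<omega>
  proof -
    have "L n \<omega> = sqrt (real n) * (\<integral>z. sgn (a z) * c n \<omega> z \<partial>m)"
      unfolding L_def c_def using that Zs by (subst integral_sgn_average) auto
    then show ?thesis
      by (simp add: T_def linear_error_def abs_mult flip: right_diff_distrib)
  qed
  have nn: "(\<integral>\<^sup>+\<omega>. ennreal \<bar>T n \<omega> - L n \<omega>\<bar> \<partial>M) \<le> ennreal (gap n)" if n: "n > 0" for n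
  proof -
    have ind': "M.indep_vars (\<lambda>_. Q) Z {..<n}"
      by (rule M.indep_vars_subset[OF ind]) simp
    have c2: "integrable M (\<lambda>\<omega>. (c n \<omega> z)\<^sup>2)" "(\<integral>\<omega>. (c n \<omega> z)\<^sup>2 \<partial>M) = (\<tau> z)\<^sup>2 / real n" if "z \<in> space m" for z
      unfolding c_def
      using M.second_moment_iid_average[OF ind' D kernel_section_measurable kernel_L2 kernel_mean n] that kernel_second_moment
      by auto
    have "(\<integral>\<^sup>+\<omega>. ennreal \<bar>T n \<omega> - L n \<omega>\<bar> \<partial>M) = (\<integral>\<^sup>+\<omega>. ennreal (sqrt (real n) * linear_error (c n \<omega>)) \<partial>M)"
      by (intro nn_integral_cong) (simp add: TL)
    also have "\<dots> \<le> ennreal (gap n)"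
    proof (rule expected_linear_error)
      show "integrable m (c n \<omega>)" if "\<omega> \<in> space M" for \<omega>
        unfolding c_def by (rule integral_sgn_average(2)) (use Zs that in auto)
    qed (use n c2 in \<open>auto simp: divide_right_mono M.prob_space_axioms\<close>)
    finally show ?thesis .
  qed
  have E: "(\<integral>\<omega>. \<bar>T n \<omega> - L n \<omega>\<bar> \<partial>M) \<le> gap n" "integrable M (\<lambda>\<omega>. T n \<omega> - L n \<omega>)" if n: "n > 0" for n
  proof -
    show i: "integrable M (\<lambda>\<omega>. T n \<omega> - L n \<omega>)"
      using nn[OF n] by (intro integrableI_bounded) (auto simp: le_less_trans[OF _ ennreal_less_top])
    have "ennreal (\<integral>\<omega>. \<bar>T n \<omega> - L n \<omega>\<bar> \<partial>M) = (\<integral>\<^sup>+\<omega>. ennreal \<bar>T n \<omega> - L n \<omega>\<bar> \<partial>M)"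
      using i by (intro nn_integral_eq_integral[symmetric]) auto
    also note nn[OF n]
    finally show "(\<integral>\<omega>. \<bar>T n \<omega> - L n \<omega>\<bar> \<partial>M) \<le> gap n"
      by (simp add: gap_nonneg)
  qed
  interpret R: real_distribution "distr Q borel influence" by (rule Q.real_distribution_distr) simp
  have cL: "char (distr M borel (L n)) u = (char (distr Q borel influence) (u / sqrt (real n)))^n" if n: "n > 0" for n u
  proof -
    have ind': "M.indep_vars (\<lambda>_. Q) Z {..<n}"
      by (rule M.indep_vars_subset[OF ind]) simp
    have indL: "M.indep_vars (\<lambda>_. borel) (\<lambda>i \<omega>. influence (Z i \<omega>) / sqrt (real n)) {..<n}"
      by (rule M.indep_vars_compose2[OF ind']) measurable
    have "L n = (\<lambda>\<omega>. \<Sum>i<n. influence (Z i \<omega>) / sqrt (real n))"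
      using n by (simp add: L_def fun_eq_iff sum_divide_distrib[symmetric] field_simps)
    then have "char (distr M borel (L n)) u = (\<Prod>i<n. char (distr M borel (\<lambda>\<omega>. influence (Z i \<omega>) / sqrt (real n))) u)"
      using M.char_distr_sum[OF indL, of u]
      by simp
    moreover have "char (distr M borel (\<lambda>\<omega>. influence (Z i \<omega>) / sqrt (real n))) u = char (distr Q borel influence) (u / sqrt (real n))" for i
    proof -
      have "char (distr Q borel influence) (u / sqrt (real n)) = (\<integral>x. iexp (u / sqrt (real n) * influence x) \<partial>distr M Q (Z i))"
        by (simp add: char_def integral_distr D)
      also have "\<dots> = (\<integral>\<omega>. iexp (u / sqrt (real n) * influence (Z i \<omega>)) \<partial>M)"
        by (subst integral_distr) auto
      finally show ?thesis by (simp add: char_def integral_distr)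
    qed
    ultimately show ?thesis by simp
  qed
  have lim: "(\<lambda>n. char (distr M borel (T n)) u) \<longlonglongrightarrow> char (centered_normal v) u" for u
  proof -
    let ?I = "\<lambda>n. \<integral>x. min (6 * (influence x)\<^sup>2) (\<bar>u\<bar> / sqrt (real n) * \<bar>influence x\<bar> ^ 3) \<partial>Q"
    let ?p = "\<lambda>n. complex_of_real ((1 + (- (v * u\<^sup>2 / 2)) / real n)^n)"
    have "\<forall>\<^sub>F n in sequentially. cmod (char (distr M borel (T n)) u - ?p n) \<le> \<bar>u\<bar> * gap n + u\<^sup>2 / 6 * ?I n"
    proof (rule eventually_sequentiallyI)
      fix n assume "n \<ge> max 1 (nat \<lceil>u\<^sup>2 * v / 4\<rceil>)"
      then have n: "n > 0" "u\<^sup>2 * v / 4 \<le> real n" by (auto simp: nat_le_iff ceiling_le_iff)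
      have "cmod (char (distr M borel (T n)) u - char (distr M borel (L n)) u) \<le> \<bar>u\<bar> * (\<integral>\<omega>. \<bar>T n \<omega> - L n \<omega>\<bar> \<partial>M)"
        by (rule M.char_distr_diff_le) (use E n in auto)
      also have "\<dots> \<le> \<bar>u\<bar> * gap n" using E n by (intro mult_left_mono) auto
      finally have 1: "cmod (char (distr M borel (T n)) u - char (distr M borel (L n)) u) \<le> \<bar>u\<bar> * gap n" .
      have "cmod ((char (distr Q borel influence) (u / sqrt (real n)))^n - ?p n)
        \<le> u\<^sup>2 / 6 * (\<integral>x. min (6 * x\<^sup>2) (\<bar>u\<bar> / sqrt (real n) * \<bar>x\<bar> ^ 3) \<partial>distr Q borel influence) + u\<^sup>2 / 2 * \<bar>v - v\<bar>"
        using n v0 influence_L2 influence_mean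
        by (intro char_power_approx R.real_distribution_axioms) (auto simp: integrable_distr_eq integral_distr v_def)
      then have 2: "cmod (char (distr M borel (L n)) u - ?p n) \<le> u\<^sup>2 / 6 * ?I n"
        using n by (simp add: cL integral_distr)
      show "cmod (char (distr M borel (T n)) u - ?p n) \<le> \<bar>u\<bar> * gap n + u\<^sup>2 / 6 * ?I n"
        using norm_diff_triangle_le[OF 1 2] .
    qed
    moreover have "(\<lambda>n. \<bar>u\<bar> * gap n + u\<^sup>2 / 6 * ?I n) \<longlonglongrightarrow> \<bar>u\<bar> * 0 + u\<^sup>2 / 6 * 0"
      by (intro tendsto_add tendsto_mult tendsto_const gap_tendsto_0 lindeberg_tendsto_0 influence_L2 measurable_influence) auto
    then have "(\<lambda>n. \<bar>u\<bar> * gap n + u\<^sup>2 / 6 * ?I n) \<longlonglongrightarrow> 0"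
      by (simp only: mult_zero_right add_0_left)
    ultimately have "(\<lambda>n. char (distr M borel (T n)) u - ?p n) \<longlonglongrightarrow> 0"
      by (rule Lim_null_comparison)
    from Lim_transform[OF power_tendsto_gaussian_char this] show ?thesis
      unfolding char_centered_normal[OF v0] .
  qed
  have "weak_conv_m (\<lambda>n. distr M borel (T n)) (centered_normal v)"
    by (rule levy_continuity) (auto intro!: M.real_distribution_distr real_distribution_centered_normal v0 lim)
  with Tm show ?thesis
    unfolding conv_in_distribution_def T_def c_def v_def by auto
qed

end

section \<open>A smoothing inequality\<close>

lemma normal_density_le: "normal_density \<mu> \<sigma> x \<le> 1 / sqrt (2 * pi * \<sigma>\<^sup>2)"
proof -
  have "1 / sqrt (2 * pi * \<sigma>\<^sup>2) * exp (- (x - \<mu>)\<^sup>2 / (2 * \<sigma>\<^sup>2)) \<le> 1 / sqrt (2 * pi * \<sigma>\<^sup>2) * 1"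
    by (intro mult_left_mono) auto
  then show ?thesis by (simp add: normal_density_def)
qed

text \<open>The density of the normal law \<open>N(0, h\<^sup>2)\<close> is a multiple of the characteristic function of
\<open>N(0, 1 / h\<^sup>2)\<close>.  Exchanging the two integrals expresses the density of the convolution of \<open>R\<close> with
\<open>N(0, h\<^sup>2)\<close> by the characteristic function of \<open>R\<close>.\<close>

lemma char_inversion_gaussian_smoothing:
  assumes "real_distribution R" "h > 0"
  shows "complex_of_real (\<integral>x. normal_density 0 h (y - x) \<partial>R)
     = complex_of_real (1 / (sqrt (2 * pi) * h)) * (\<integral>u. iexp (- (u * y)) * char R u \<partial>centered_normal (1 / h\<^sup>2))"
proof -
  interpret R: real_distribution R by fact
  let ?\<gamma> = "centered_normal (1 / h\<^sup>2)"
  interpret G: real_distribution ?\<gamma> by (rule real_distribution_centered_normal) simp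
  interpret P: pair_prob_space R ?\<gamma> ..
  have nd: "complex_of_real (normal_density 0 h (y - x))
     = complex_of_real (1 / (sqrt (2 * pi) * h)) * (\<integral>u. iexp (u * (x - y)) \<partial>?\<gamma>)" for x
  proof -
    have "(\<integral>u. iexp (u * (x - y)) \<partial>?\<gamma>) = char ?\<gamma> (x - y)"
      by (simp add: char_def ac_simps)
    also have "\<dots> = complex_of_real (exp (- ((y - x)\<^sup>2 / (2 * h\<^sup>2))))"
      by (subst char_centered_normal) (simp_all add: power2_commute field_simps)
    finally show ?thesis
      using assms(2) by (simp add: normal_density_def real_sqrt_mult)
  qed
  have int: "integrable (R \<Otimes>\<^sub>M ?\<gamma>) (\<lambda>(x, u). iexp (u * (x - y)))"
    by (rule P.integrable_const_bound[where B=1]) (auto simp: split_beta norm_exp_i_times intro!: measurable_compose[OF _ borel_measurable_continuous_onI])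
  have "complex_of_real (\<integral>x. normal_density 0 h (y - x) \<partial>R)
     = (\<integral>x. complex_of_real (1 / (sqrt (2 * pi) * h)) * (\<integral>u. iexp (u * (x - y)) \<partial>?\<gamma>) \<partial>R)"
    unfolding nd[symmetric] by simp
  also have "\<dots> = complex_of_real (1 / (sqrt (2 * pi) * h)) * (\<integral>x. (\<integral>u. iexp (u * (x - y)) \<partial>?\<gamma>) \<partial>R)"
    by (rule integral_mult_right_zero)
  also have "(\<integral>x. (\<integral>u. iexp (u * (x - y)) \<partial>?\<gamma>) \<partial>R) = (\<integral>u. (\<integral>x. iexp (u * (x - y)) \<partial>R) \<partial>?\<gamma>)"
    by (rule P.Fubini_integral[OF int, symmetric])
  also have "\<dots> = (\<integral>u. iexp (- (u * y)) * char R u \<partial>?\<gamma>)"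
  proof (intro Bochner_Integration.integral_cong refl)
    fix u
    have "(\<integral>x. iexp (u * (x - y)) \<partial>R) = (\<integral>x. iexp (- (u * y)) * iexp (u * x) \<partial>R)"
      by (simp add: algebra_simps flip: exp_add)
    then show "(\<integral>x. iexp (u * (x - y)) \<partial>R) = iexp (- (u * y)) * char R u"
      by (simp add: char_def)
  qed
  finally show ?thesis .
qed

text \<open>The weight is dictated by \<open>char_inversion_gaussian_smoothing\<close>.\<close>

definition char_distance :: "real \<Rightarrow> real measure \<Rightarrow> real measure \<Rightarrow> real" where
  "char_distance h R N = (\<integral>u. cmod (char R u - char N u) \<partial>centered_normal (1 / h\<^sup>2))"

lemma smoothed_density_diff:
  assumes "real_distribution R" "real_distribution N" "h > 0"
  shows "(\<integral>x. normal_density 0 h (y - x) \<partial>N) \<le> (\<integral>x. normal_density 0 h (y - x) \<partial>R)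
     + 1 / (sqrt (2 * pi) * h) * char_distance h R N"
proof -
  interpret R: real_distribution R by fact
  interpret N: real_distribution N by fact
  let ?\<gamma> = "centered_normal (1 / h\<^sup>2)" and ?C = "1 / (sqrt (2 * pi) * h)"
  interpret G: real_distribution ?\<gamma> by (rule real_distribution_centered_normal) simp
  have bound: "cmod (iexp (- (u * y)) * char S u) \<le> 1" if "real_distribution S" for S u
    using real_distribution.cmod_char_le_1[OF that] by (simp add: norm_mult norm_exp_i_times)
  have [measurable]: "char R \<in> borel_measurable borel" "char N \<in> borel_measurable borel"
    by measurable
  have [measurable]: "(\<lambda>u. iexp (- (u * y))) \<in> borel_measurable borel"
    by (intro borel_measurable_continuous_onI continuous_intros)
  have i: "integrable ?\<gamma> (\<lambda>u. iexp (- (u * y)) * char R u)" "integrable ?\<gamma> (\<lambda>u. iexp (- (u * y)) * char N u)"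
    using bound assms by (auto intro!: G.integrable_const_bound[where B=1])
  have C: "?C \<ge> 0" using assms by simp
  have "complex_of_real ((\<integral>x. normal_density 0 h (y - x) \<partial>N) - (\<integral>x. normal_density 0 h (y - x) \<partial>R))
     = complex_of_real ?C * (\<integral>u. iexp (- (u * y)) * char N u - iexp (- (u * y)) * char R u \<partial>?\<gamma>)"
    unfolding of_real_diff char_inversion_gaussian_smoothing[OF assms(1,3)] char_inversion_gaussian_smoothing[OF assms(2,3)]
      Bochner_Integration.integral_diff[OF i(2) i(1)] by (simp add: algebra_simps)
  then have "cmod (complex_of_real ((\<integral>x. normal_density 0 h (y - x) \<partial>N) - (\<integral>x. normal_density 0 h (y - x) \<partial>R)))
     = ?C * cmod (\<integral>u. iexp (- (u * y)) * char N u - iexp (- (u * y)) * char R u \<partial>?\<gamma>)"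
    using C by (simp only: norm_mult norm_of_real abs_of_nonneg)
  also have "\<dots> \<le> ?C * (\<integral>u. cmod (iexp (- (u * y)) * char N u - iexp (- (u * y)) * char R u) \<partial>?\<gamma>)"
    by (intro mult_left_mono integral_norm_bound C)
  also have "(\<lambda>u. cmod (iexp (- (u * y)) * char N u - iexp (- (u * y)) * char R u)) = (\<lambda>u. cmod (char R u - char N u))"
    by (simp add: norm_mult norm_exp_i_times norm_minus_commute flip: right_diff_distrib)
  finally show ?thesis
    unfolding char_distance_def norm_of_real by linarith
qed

lemma centered_normal_tail:
  assumes "h > 0" "d > 0"
  shows "measure (centered_normal (h\<^sup>2)) {x. d \<le> \<bar>x\<bar>} \<le> h\<^sup>2 / d\<^sup>2"
proof -
  interpret real_distribution "centered_normal (h\<^sup>2)" by (rule real_distribution_centered_normal) simp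
  have "prob {x. d \<le> \<bar>x\<bar>} = prob {x \<in> space (centered_normal (h\<^sup>2)). d\<^sup>2 \<le> x\<^sup>2}"
    using assms by (intro arg_cong[where f=prob]) (auto simp: abs_le_square_iff[symmetric])
  also have "\<dots> \<le> integral\<^sup>L (centered_normal (h\<^sup>2)) (\<lambda>x. x\<^sup>2) / d\<^sup>2"
    using assms centered_normal_moments[of "h\<^sup>2"] by (intro integral_Markov_inequality_measure[where A="{}"]) auto
  also have "\<dots> = h\<^sup>2 / d\<^sup>2"
    using centered_normal_moments[of "h\<^sup>2"] by simp
  finally show ?thesis .
qed

lemma nn_integral_normal_density_interval:
  assumes "h > 0"
  shows "(\<integral>\<^sup>+y. ennreal (normal_density 0 h (y - x)) * indicator {s..t} y \<partial>lborel)
    = emeasure (centered_normal (h\<^sup>2)) {s - x..t - x}"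
proof -
  have "emeasure (centered_normal (h\<^sup>2)) {s - x..t - x}
     = (\<integral>\<^sup>+y. ennreal (normal_density 0 h y) * indicator {s - x..t - x} y \<partial>lborel)"
    using assms by (simp add: centered_normal_def emeasure_density)
  also have "\<dots> = (\<integral>\<^sup>+y. ennreal (normal_density 0 h (y - x)) * indicator {s - x..t - x} (y - x) \<partial>lborel)"
    by (subst nn_integral_real_affine[where c=1 and t="-x"]) auto
  also have "\<dots> = (\<integral>\<^sup>+y. ennreal (normal_density 0 h (y - x)) * indicator {s..t} y \<partial>lborel)"
    by (intro nn_integral_cong) (auto simp: indicator_def)
  finally show ?thesis by simp
qed

text \<open>Adding independent noise with law \<open>N(0, h\<^sup>2)\<close> moves a point by \<open>d\<close> or more with
probability at most \<open>h\<^sup>2 / d\<^sup>2\<close>.  Hence the smoothed mass of \<open>[s + d, t - d]\<close> lies between the masses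
of the interval shrunk and enlarged by \<open>d\<close>, up to this error, and the smoothed densities of \<open>N\<close> and \<open>R\<close> are
close by \<open>smoothed_density_diff\<close>.\<close>

lemma interval_mass_le_of_char:
  assumes R: "real_distribution R" and N: "real_distribution N" and h: "h > 0" and d: "d > 0" and st: "s + 2 * d \<le> t"
  shows "measure N {s + 2 * d<..t - 2 * d} \<le> measure R {s<..t} + 2 * (h\<^sup>2 / d\<^sup>2)
     + (t - s) * (1 / (sqrt (2 * pi) * h) * char_distance h R N)"
proof -
  interpret R: real_distribution R by fact
  interpret N: real_distribution N by fact
  interpret H: real_distribution "centered_normal (h\<^sup>2)" by (rule real_distribution_centered_normal) simp
  define \<eta> where "\<eta> = h\<^sup>2 / d\<^sup>2"
  define \<Delta> where "\<Delta> = 1 / (sqrt (2 * pi) * h) * char_distance h R N"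
  have \<Delta>0: "\<Delta> \<ge> 0" using h by (simp add: \<Delta>_def char_distance_def)
  have \<eta>0: "\<eta> \<ge> 0" by (simp add: \<eta>_def)
  let ?J = "{s + d..t - d}"
  \<comment> \<open>The probability that \<open>x\<close> lands in \<open>[s + d, t - d]\<close> after the noise has been added.\<close>
  define f where "f x = H.prob {s + d - x..t - d - x}" for x
  have fub: "(\<integral>\<^sup>+x. ennreal (f x) \<partial>S) = (\<integral>\<^sup>+y. ennreal (\<integral>x. normal_density 0 h (y - x) \<partial>S) * indicator ?J y \<partial>lborel)"
    if "real_distribution S" for S
  proof -
    interpret S: real_distribution S by fact
    interpret P: pair_sigma_finite S lborel ..
    have "(\<integral>\<^sup>+x. ennreal (f x) \<partial>S) = (\<integral>\<^sup>+x. \<integral>\<^sup>+y. ennreal (normal_density 0 h (y - x)) * indicator ?J y \<partial>lborel \<partial>S)"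
      unfolding f_def by (simp add: nn_integral_normal_density_interval[OF h] H.emeasure_eq_measure)
    also have "\<dots> = (\<integral>\<^sup>+y. \<integral>\<^sup>+x. ennreal (normal_density 0 h (y - x)) * indicator ?J y \<partial>S \<partial>lborel)"
      by (rule P.Fubini'[symmetric]) (unfold normal_density_def, measurable)
    also have "\<dots> = (\<integral>\<^sup>+y. ennreal (\<integral>x. normal_density 0 h (y - x) \<partial>S) * indicator ?J y \<partial>lborel)"
    proof (intro nn_integral_cong)
      fix y
      have "integrable S (\<lambda>x. normal_density 0 h (y - x))"
      proof (rule S.integrable_const_bound[where B="1 / sqrt (2 * pi * h\<^sup>2)"])
        show "AE x in S. norm (normal_density 0 h (y - x)) \<le> 1 / sqrt (2 * pi * h\<^sup>2)"
          by (intro AE_I2) (simp only: real_norm_def abs_of_nonneg[OF normal_density_nonneg] normal_density_le)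
        show "(\<lambda>x. normal_density 0 h (y - x)) \<in> borel_measurable S"
          unfolding normal_density_def by measurable
      qed
      then show "(\<integral>\<^sup>+x. ennreal (normal_density 0 h (y - x)) * indicator ?J y \<partial>S)
          = ennreal (\<integral>x. normal_density 0 h (y - x) \<partial>S) * indicator ?J y"
        by (simp add: nn_integral_multc nn_integral_eq_integral)
    qed
    finally show ?thesis .
  qed
  have Hm: "H.prob A \<le> \<eta>" if "A \<subseteq> {x. d \<le> \<bar>x\<bar>}" for A
  proof -
    have "H.prob A \<le> H.prob {x. d \<le> \<bar>x\<bar>}"
      using that by (intro H.finite_measure_mono) auto
    with centered_normal_tail[OF h d] show ?thesis by (simp add: \<eta>_def)
  qed
  have f_up: "f x \<le> indicator {s<..t} x + \<eta>" for x
  proof (cases "x \<in> {s<..t}")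
    case True
    then show ?thesis using \<eta>0 H.prob_le_1 by (simp add: f_def add_increasing2)
  next
    case False
    then have "f x \<le> \<eta>" unfolding f_def by (intro Hm) auto
    with False show ?thesis by simp
  qed
  have f_low: "indicator {s + 2 * d<..t - 2 * d} x \<le> f x + \<eta>" for x
  proof (cases "x \<in> {s + 2 * d<..t - 2 * d}")
    case True
    have "1 - f x = H.prob (space (centered_normal (h\<^sup>2)) - {s + d - x..t - d - x})"
      unfolding f_def by (rule H.prob_compl[symmetric]) simp
    also have "\<dots> \<le> \<eta>" using True by (intro Hm) auto
    finally show ?thesis using True by simp
  next
    case False
    then show ?thesis using \<eta>0 by (simp add: f_def)
  qed
  have [measurable]: "f \<in> borel_measurable borel"
  proof -
    have "(\<lambda>x. enn2real (\<integral>\<^sup>+y. ennreal (normal_density 0 h (y - x)) * indicator ?J y \<partial>lborel)) \<in> borel_measurable borel"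
      unfolding normal_density_def by measurable
    then show ?thesis
      by (simp add: f_def[abs_def] nn_integral_normal_density_interval[OF h] measure_def)
  qed
  have f0: "0 \<le> f x" "f x \<le> 1" for x by (auto simp: f_def)
  have intf: "integrable S f" if "real_distribution S" for S
  proof -
    interpret S: real_distribution S by fact
    show ?thesis using f0 by (intro S.integrable_const_bound[where B=1]) auto
  qed
  have "N.prob {s + 2 * d<..t - 2 * d} = (\<integral>x. indicator {s + 2 * d<..t - 2 * d} x \<partial>N)"
    by simp
  also have "\<dots> \<le> (\<integral>x. f x + \<eta> \<partial>N)"
    using f_low intf[OF N] by (intro integral_mono) (auto simp: N.emeasure_eq_measure)
  also have "\<dots> = (\<integral>x. f x \<partial>N) + \<eta>"
    using intf[OF N] N.prob_space by simp
  finally have 1: "N.prob {s + 2 * d<..t - 2 * d} \<le> (\<integral>x. f x \<partial>N) + \<eta>" .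
  have "(\<integral>x. f x \<partial>R) \<le> (\<integral>x. indicator {s<..t} x + \<eta> \<partial>R)"
    using f_up intf[OF R] by (intro integral_mono) (auto simp: R.emeasure_eq_measure)
  also have "\<dots> = R.prob {s<..t} + \<eta>"
    using R.prob_space by (simp add: R.emeasure_eq_measure)
  finally have 2: "(\<integral>x. f x \<partial>R) \<le> R.prob {s<..t} + \<eta>" .
  have "ennreal (\<integral>x. f x \<partial>N) = (\<integral>\<^sup>+x. ennreal (f x) \<partial>N)"
    using intf[OF N] f0 by (intro nn_integral_eq_integral[symmetric]) auto
  also have "\<dots> = (\<integral>\<^sup>+y. ennreal (\<integral>x. normal_density 0 h (y - x) \<partial>N) * indicator ?J y \<partial>lborel)"
    by (rule fub[OF N])
  also have "\<dots> \<le> (\<integral>\<^sup>+y. ennreal (\<integral>x. normal_density 0 h (y - x) \<partial>R) * indicator ?J y + ennreal \<Delta> * indicator ?J y \<partial>lborel)"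
  proof (intro nn_integral_mono)
    fix y
    have "(\<integral>x. normal_density 0 h (y - x) \<partial>N) \<le> (\<integral>x. normal_density 0 h (y - x) \<partial>R) + \<Delta>"
      using smoothed_density_diff[OF R N h] by (simp add: \<Delta>_def)
    then have "ennreal (\<integral>x. normal_density 0 h (y - x) \<partial>N) \<le> ennreal ((\<integral>x. normal_density 0 h (y - x) \<partial>R) + \<Delta>)"
      by (rule ennreal_leI)
    also have "\<dots> = ennreal (\<integral>x. normal_density 0 h (y - x) \<partial>R) + ennreal \<Delta>"
      using \<Delta>0 by (intro ennreal_plus Bochner_Integration.integral_nonneg normal_density_nonneg) auto
    finally have "ennreal (\<integral>x. normal_density 0 h (y - x) \<partial>N) \<le> ennreal (\<integral>x. normal_density 0 h (y - x) \<partial>R) + ennreal \<Delta>" .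
    then show "ennreal (\<integral>x. normal_density 0 h (y - x) \<partial>N) * indicator ?J y
      \<le> ennreal (\<integral>x. normal_density 0 h (y - x) \<partial>R) * indicator ?J y + ennreal \<Delta> * indicator ?J y"
      by (auto simp: indicator_def)
  qed
  also have "\<dots> = (\<integral>\<^sup>+x. ennreal (f x) \<partial>R) + ennreal \<Delta> * emeasure lborel ?J"
  proof (subst nn_integral_add)
    have "(\<lambda>y. \<integral>x. normal_density 0 h (y - x) \<partial>R) \<in> borel_measurable lborel"
      unfolding normal_density_def by measurable
    then show "(\<lambda>y. ennreal (\<integral>x. normal_density 0 h (y - x) \<partial>R) * indicator ?J y) \<in> borel_measurable lborel"
      by measurable
  qed (simp_all add: fub[OF R] nn_integral_cmult)
  also have "(\<integral>\<^sup>+x. ennreal (f x) \<partial>R) = ennreal (\<integral>x. f x \<partial>R)"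
    using intf[OF R] f0 by (intro nn_integral_eq_integral) auto
  also have "ennreal \<Delta> * emeasure lborel ?J \<le> ennreal ((t - s) * \<Delta>)"
  proof (cases "s + d \<le> t - d")
    case True
    then have "ennreal \<Delta> * emeasure lborel ?J = ennreal (\<Delta> * (t - d - (s + d)))"
      using \<Delta>0 by (simp add: ennreal_mult)
    also have "\<dots> \<le> ennreal (\<Delta> * (t - s))"
      using \<Delta>0 d by (intro ennreal_leI mult_left_mono) auto
    finally show ?thesis by (simp add: mult.commute)
  qed simp
  finally have "ennreal (\<integral>x. f x \<partial>N) \<le> ennreal (\<integral>x. f x \<partial>R) + ennreal ((t - s) * \<Delta>)"
    by (simp add: add_left_mono)
  then have "ennreal (\<integral>x. f x \<partial>N) \<le> ennreal ((\<integral>x. f x \<partial>R) + (t - s) * \<Delta>)"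
    using \<Delta>0 st d f0 by (subst ennreal_plus) auto
  then have 3: "(\<integral>x. f x \<partial>N) \<le> (\<integral>x. f x \<partial>R) + (t - s) * \<Delta>"
    using \<Delta>0 st d f0 by (subst (asm) ennreal_le_iff) (auto intro!: add_nonneg_nonneg)
  from 1 2 3 show ?thesis by (simp add: \<eta>_def \<Delta>_def)
qed

text \<open>The constants depend only on \<open>e\<close> and the limit law \<open>N\<close>, so that the inequality can be averaged over
a random law \<open>R\<close>.  Comparing the masses of \<open>(x, y]\<close> bounds \<open>cdf N y - cdf N x\<close> from above
by \<open>cdf R y - cdf R x\<close> and small errors, which is enough.  The left endpoint \<open>-A\<close> gives a lower bound for \<open>cdf R y\<close> and the right endpoint \<open>A\<close> an upper bound
for \<open>cdf R x\<close>, since almost all mass of \<open>N\<close> lies between \<open>-A\<close> and \<open>A\<close>.\<close>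

theorem cdf_distance_le_char_distance:
  assumes N: "real_distribution N" and L: "\<And>s t. s \<le> t \<Longrightarrow> cdf N t - cdf N s \<le> L * (t - s)" and e: "e > 0"
  obtains h C where "h > 0" "C \<ge> 0"
    "\<And>R t. real_distribution R \<Longrightarrow> \<bar>cdf R t - cdf N t\<bar> \<le> e + C * char_distance h R N"
proof -
  interpret N: real_distribution N by fact
  \<comment> \<open>The errors add up to \<open>5 * e'\<close>.\<close>
  define e' where "e' = e / 8"
  have e': "e' > 0" using e by (simp add: e'_def)
  have L0: "L \<ge> 0" using L[of 0 1] N.cdf_nondecreasing[of 0 1] by simp
  \<comment> \<open>A shift by \<open>2 * d\<close> changes the distribution function of \<open>N\<close> by at most \<open>e'\<close>.\<close>
  define d where "d = min 1 (e' / (2 * (L + 1)))"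
  have d: "d > 0" "d \<le> 1" using e' L0 by (auto simp: d_def)
  have Ld: "L * (2 * d) \<le> e'"
  proof -
    have "L * (2 * d) \<le> (L + 1) * (2 * (e' / (2 * (L + 1))))"
      using L0 d e' by (intro mult_mono) (auto simp: d_def)
    also have "\<dots> = e'" using L0 by (simp add: field_simps)
    finally show ?thesis .
  qed
  \<comment> \<open>The noise exceeds \<open>d\<close> with probability at most \<open>e'\<close>.\<close>
  define h where "h = d * sqrt e'"
  have h: "h > 0" "h\<^sup>2 / d\<^sup>2 = e'" using d e' by (auto simp: h_def power_mult_distrib)
  have "eventually (\<lambda>x. cdf N x < e') at_bot"
    using order_tendstoD(2)[OF N.cdf_lim_at_bot e'] .
  then obtain A1 where A1: "\<And>x. x \<le> A1 \<Longrightarrow> cdf N x < e'"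
    by (auto simp: eventually_at_bot_linorder)
  have "eventually (\<lambda>x. 1 - e' < cdf N x) at_top"
    using order_tendstoD(1)[OF N.cdf_lim_at_top_prob, of "1 - e'"] e' by simp
  then obtain A2 where A2: "\<And>x. x \<ge> A2 \<Longrightarrow> 1 - e' < cdf N x"
    by (auto simp: eventually_at_top_linorder)
  define A where "A = max 0 (max (- A1) A2) + 2"
  have A: "A \<ge> 2" "cdf N (- A + 2 * d) \<le> e'" "cdf N (A - 2 * d) \<ge> 1 - e'" "cdf N (- A) \<le> e'" "cdf N A \<ge> 1 - e'"
  proof -
    have "A \<ge> - A1 + 2" "A \<ge> A2 + 2" and A2': "A \<ge> 2" by (simp_all add: A_def le_max_iff_disj)
    then have "- A + 2 * d \<le> A1" "A2 \<le> A - 2 * d" "- A \<le> A1" "A2 \<le> A" using d by linarith+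
    then show "A \<ge> 2" "cdf N (- A + 2 * d) \<le> e'" "cdf N (A - 2 * d) \<ge> 1 - e'" "cdf N (- A) \<le> e'" "cdf N A \<ge> 1 - e'"
      using A1 A2 A2' by (auto intro: less_imp_le)
  qed
  define C where "C = 2 * (A + 2) * (1 / (sqrt (2 * pi) * h))"
  have C: "C \<ge> 0" using A h by (simp add: C_def)
  show thesis
  proof (rule that[OF h(1) C])
    fix R t assume R: "real_distribution R"
    interpret R: real_distribution R by fact
    define \<Delta> where "\<Delta> = char_distance h R N"
    have \<Delta>0: "\<Delta> \<ge> 0" by (simp add: \<Delta>_def char_distance_def)
    have C\<Delta>: "(t' - s') * (1 / (sqrt (2 * pi) * h) * \<Delta>) \<le> C * \<Delta>" if "t' - s' \<le> 2 * (A + 2)" for s' t'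
    proof -
      have "(t' - s') * (1 / (sqrt (2 * pi) * h) * \<Delta>) \<le> 2 * (A + 2) * (1 / (sqrt (2 * pi) * h) * \<Delta>)"
        using that h \<Delta>0 by (intro mult_right_mono) auto
      then show ?thesis by (simp add: C_def)
    qed
    have cd: "measure S {x<..y} = cdf S y - cdf S x" if "x \<le> y" "real_distribution S" for S x y
    proof -
      interpret S: real_distribution S by fact
      show ?thesis using that S.cdf_diff_eq[of x y] by (cases "x = y") auto
    qed
    have key: "cdf N (y - 2 * d) - cdf N (x + 2 * d) \<le> cdf R y - cdf R x + 2 * e' + C * \<Delta>"
      if "x \<le> y" "y - x \<le> 2 * (A + 2)" for x y
    proof (cases "x + 4 * d \<le> y")
      case True
      then have "cdf N (y - 2 * d) - cdf N (x + 2 * d) = N.prob {x + 2 * d<..y - 2 * d}"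
        by (subst cd[OF _ N]) auto
      also have "\<dots> \<le> R.prob {x<..y} + 2 * (h\<^sup>2 / d\<^sup>2) + (y - x) * (1 / (sqrt (2 * pi) * h) * \<Delta>)"
        unfolding \<Delta>_def using d True by (intro interval_mass_le_of_char R N h) auto
      also have "\<dots> \<le> R.prob {x<..y} + 2 * (h\<^sup>2 / d\<^sup>2) + C * \<Delta>"
        using that by (intro add_left_mono C\<Delta>)
      finally show ?thesis using that h by (simp add: cd[OF _ R])
    next
      case False
      then have "cdf N (y - 2 * d) \<le> cdf N (x + 2 * d)"
        by (intro N.cdf_nondecreasing) auto
      moreover have "cdf R x \<le> cdf R y" using that by (intro R.cdf_nondecreasing)
      moreover have "0 \<le> C * \<Delta>" using C \<Delta>0 by simp
      ultimately show ?thesis using e' by linarith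
    qed
    have sh: "cdf N x \<le> cdf N (x - 2 * d) + e'" "cdf N (x + 2 * d) \<le> cdf N x + e'" for x
      using L[of "x - 2 * d" x] L[of x "x + 2 * d"] Ld d by (auto simp: algebra_simps)
    have RB: "0 \<le> cdf R x" "cdf R x \<le> 1" "0 \<le> cdf N x" "cdf N x \<le> 1" for x
      by (auto simp: R.cdf_nonneg R.cdf_bounded_prob N.cdf_nonneg N.cdf_bounded_prob)
    have C0: "0 \<le> C * \<Delta>" using C \<Delta>0 by simp
    have mid: "\<bar>cdf R x - cdf N x\<bar> \<le> 4 * e' + C * \<Delta>" if "- A \<le> x" "x \<le> A" for x
      using key[of "-A" x] key[of x A] sh[of x] A RB[of x] RB[of A] RB[of "-A"] that by (auto simp: abs_le_iff)
    have "\<bar>cdf R t - cdf N t\<bar> \<le> 5 * e' + C * \<Delta>"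
    proof -
      consider "t < - A" | "- A \<le> t" "t \<le> A" | "A < t" by linarith
      then show ?thesis
      proof cases
        case 1
        then have "cdf R t \<le> cdf R (- A)" "cdf N t \<le> cdf N (- A)"
          by (auto intro!: R.cdf_nondecreasing N.cdf_nondecreasing)
        then show ?thesis using mid[of "-A"] A RB[of t] by (auto simp: abs_le_iff)
      next
        case 2
        then show ?thesis using mid[of t] e' by simp
      next
        case 3
        then have "cdf R A \<le> cdf R t" "cdf N A \<le> cdf N t"
          by (auto intro!: R.cdf_nondecreasing N.cdf_nondecreasing)
        then show ?thesis using mid[of A] A RB[of t] by (auto simp: abs_le_iff)
      qed
    qed
    also have "\<dots> \<le> e + C * \<Delta>" using e by (simp add: e'_def)
    finally show "\<bar>cdf R t - cdf N t\<bar> \<le> e + C * char_distance h R N" by (simp add: \<Delta>_def)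
  qed
qed

lemma cdf_centered_normal_lipschitz:
  assumes "v > 0" "s \<le> t"
  shows "cdf (centered_normal v) t - cdf (centered_normal v) s \<le> 1 / sqrt (2 * pi * v) * (t - s)"
proof -
  interpret N: real_distribution "centered_normal v" using assms by (intro real_distribution_centered_normal) simp
  have "cdf (centered_normal v) t - cdf (centered_normal v) s = N.prob {s<..t}"
    using N.cdf_diff_eq[of s t] assms by (cases "s = t") auto
  also have "ennreal \<dots> \<le> ennreal (1 / sqrt (2 * pi * v) * (t - s))"
  proof -
    have "ennreal (N.prob {s<..t}) = emeasure (centered_normal v) {s<..t}"
      by (simp add: N.emeasure_eq_measure)
    also have "\<dots> = (\<integral>\<^sup>+x. ennreal (normal_density 0 (sqrt v) x) * indicator {s<..t} x \<partial>lborel)"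
      using assms by (simp add: centered_normal_def emeasure_density)
    also have "\<dots> \<le> (\<integral>\<^sup>+x. ennreal (1 / sqrt (2 * pi * v)) * indicator {s<..t} x \<partial>lborel)"
      using assms normal_density_le[of 0 "sqrt v"] by (intro nn_integral_mono mult_right_mono ennreal_leI) auto
    also have "\<dots> = ennreal (1 / sqrt (2 * pi * v) * (t - s))"
      using assms by (simp add: nn_integral_cmult flip: ennreal_mult)
    finally show ?thesis .
  qed
  finally show ?thesis
    using assms by (subst (asm) ennreal_le_iff) auto
qed

section \<open>Resampling from a finite pool of observations\<close>

lemma indep_vars_PiM_coordinates:
  assumes "\<And>i. i \<in> I \<Longrightarrow> prob_space (N i)" "I \<noteq> {}"
  shows "prob_space.indep_vars (PiM I N) N (\<lambda>i x. x i) I"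
proof -
  interpret prob_space "PiM I N" by (rule prob_space_PiM) (rule assms)
  have "distr (PiM I N) (PiM I N) (\<lambda>x. \<lambda>i\<in>I. x i) = distr (PiM I N) (PiM I N) (\<lambda>x. x)"
    by (intro distr_cong) (auto simp: space_PiM PiE_def extensional_restrict)
  also have "\<dots> = (\<Pi>\<^sub>M i\<in>I. distr (PiM I N) (N i) (\<lambda>x. x i))"
    using assms by (auto simp: distr_id2 distr_PiM_component intro!: PiM_cong)
  finally show ?thesis
    using assms by (subst indep_vars_iff_distr_eq_PiM') auto
qed

text \<open>The version of \<open>char_distr_diff_le\<close> that holds for infinite right-hand sides as well, which
avoids questions of integrability for the conditional law of a bootstrap statistic.\<close>

lemma (in prob_space) nn_char_distr_diff_le:
  fixes U V :: "'a \<Rightarrow> real"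
  assumes [measurable]: "U \<in> borel_measurable M" "V \<in> borel_measurable M"
  shows "ennreal (cmod (char (distr M borel U) u - char (distr M borel V) u))
    \<le> ennreal \<bar>u\<bar> * (\<integral>\<^sup>+w. ennreal \<bar>U w - V w\<bar> \<partial>M)"
proof -
  consider "u = 0" | "u \<noteq> 0" "(\<integral>\<^sup>+w. ennreal \<bar>U w - V w\<bar> \<partial>M) = \<infinity>"
    | "(\<integral>\<^sup>+w. ennreal \<bar>U w - V w\<bar> \<partial>M) \<noteq> \<infinity>" by blast
  then show ?thesis
  proof cases
    case 1
    have "char (distr M borel W) 0 = 1" if "W \<in> borel_measurable M" for W
      using real_distribution.char_zero[OF real_distribution_distr[OF that]] .
    then show ?thesis by (simp add: 1)
  next
    case 2
    then show ?thesis unfolding 2(2) by (simp add: ennreal_mult_top)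
  next
    case 3
    then have i: "integrable M (\<lambda>w. U w - V w)"
      by (intro integrableI_bounded) (auto simp: less_top)
    have "ennreal (cmod (char (distr M borel U) u - char (distr M borel V) u)) \<le> ennreal (\<bar>u\<bar> * (\<integral>w. \<bar>U w - V w\<bar> \<partial>M))"
      by (intro ennreal_leI char_distr_diff_le i) auto
    also have "\<dots> = ennreal \<bar>u\<bar> * (\<integral>\<^sup>+w. ennreal \<bar>U w - V w\<bar> \<partial>M)"
      using i by (simp add: ennreal_mult nn_integral_eq_integral)
    finally show ?thesis .
  qed
qed

text \<open>With \<open>y\<close> the sample mean, this removes the centering from the error term of \<open>char_power_approx\<close>.  The
factors \<open>4\<close> and \<open>8\<close> stem from \<open>\<bar>x - y\<bar> \<le> 2 * \<bar>x\<bar>\<close>, valid for \<open>\<bar>y\<bar> \<le> \<bar>x\<bar>\<close>; otherwise the quadratic branch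
is at most \<open>24 * y\<^sup>2\<close>.\<close>

lemma lindeberg_min_diff_le:
  fixes x y w :: real
  assumes "w \<ge> 0"
  shows "min (6 * (x - y)\<^sup>2) (w * \<bar>x - y\<bar> ^ 3) \<le> min (24 * x\<^sup>2) (8 * w * \<bar>x\<bar> ^ 3) + 24 * y\<^sup>2"
proof (cases "\<bar>y\<bar> \<le> \<bar>x\<bar>")
  case True
  then have le: "\<bar>x - y\<bar> \<le> 2 * \<bar>x\<bar>" by linarith
  have "(x - y)\<^sup>2 \<le> (2 * \<bar>x\<bar>)\<^sup>2" using le by (metis abs_ge_zero power2_abs power_mono)
  moreover have "\<bar>x - y\<bar> ^ 3 \<le> (2 * \<bar>x\<bar>) ^ 3" using le by (intro power_mono) auto
  then have "w * \<bar>x - y\<bar> ^ 3 \<le> w * (2 * \<bar>x\<bar>) ^ 3" using assms by (rule mult_left_mono)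
  ultimately have "min (6 * (x - y)\<^sup>2) (w * \<bar>x - y\<bar> ^ 3) \<le> min (24 * x\<^sup>2) (8 * w * \<bar>x\<bar> ^ 3)"
    by (intro min.mono) (auto simp: power_mult_distrib)
  then show ?thesis using zero_le_power2[of y] by linarith
next
  case False
  then have "\<bar>x - y\<bar> \<le> 2 * \<bar>y\<bar>" by linarith
  then have "(x - y)\<^sup>2 \<le> (2 * \<bar>y\<bar>)\<^sup>2" by (metis abs_ge_zero power2_abs power_mono)
  then have "6 * (x - y)\<^sup>2 \<le> 24 * y\<^sup>2" by (simp add: power_mult_distrib)
  moreover have "0 \<le> min (24 * x\<^sup>2) (8 * w * \<bar>x\<bar> ^ 3)" using assms by simp
  ultimately show ?thesis by linarith
qed

lemma uniform_average_variance:
  fixes g :: "'b \<Rightarrow> real"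
  assumes "finite A" "A \<noteq> {}"
  defines "\<mu> \<equiv> (\<Sum>x\<in>A. g x) / real (card A)"
  shows "(\<Sum>x\<in>A. g x - \<mu>) / real (card A) = 0"
    and "(\<Sum>x\<in>A. (g x - \<mu>)\<^sup>2) / real (card A) = (\<Sum>x\<in>A. (g x)\<^sup>2) / real (card A) - \<mu>\<^sup>2"
proof -
  have c: "real (card A) > 0" using assms by (simp add: card_gt_0_iff)
  show "(\<Sum>x\<in>A. g x - \<mu>) / real (card A) = 0"
    using c by (simp add: sum_subtractf \<mu>_def)
  have S: "(\<Sum>x\<in>A. g x) = real (card A) * \<mu>" using c by (simp add: \<mu>_def)
  have "(\<Sum>x\<in>A. (g x - \<mu>)\<^sup>2) = (\<Sum>x\<in>A. (g x)\<^sup>2 - 2 * \<mu> * g x + \<mu>\<^sup>2)"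
    by (intro sum.cong refl) (simp add: power2_diff)
  also have "\<dots> = (\<Sum>x\<in>A. (g x)\<^sup>2) - real (card A) * \<mu>\<^sup>2"
    by (simp add: sum.distrib sum_subtractf sum_distrib_left[symmetric] S power2_eq_square)
  finally show "(\<Sum>x\<in>A. (g x - \<mu>)\<^sup>2) / real (card A) = (\<Sum>x\<in>A. (g x)\<^sup>2) / real (card A) - \<mu>\<^sup>2"
    using c by (simp add: diff_divide_distrib)
qed

text \<open>Resampling draws indices: \<open>J n\<close> contains the indices available for sample size \<open>n\<close>, and \<open>D \<iota>\<close> is the
observation with index \<open>\<iota>\<close>.  For one sample the indices are the numbers below \<open>n\<close>.  For two samples
they are pairs of such numbers, since independent uniform draws from both samples amount to a
uniform draw of a pair; the observations \<open>D \<iota>\<close> are then identically distributed but not independent.\<close>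

locale resampling = centered_kernel Q m a k \<tau> + M: prob_space M
  for Q :: "'s measure" and m :: "'z measure" and a k \<tau> and M :: "'w measure" +
  fixes J :: "nat \<Rightarrow> 'j set" and D :: "'j \<Rightarrow> 'w \<Rightarrow> 's"
  assumes J: "\<And>n. n > 0 \<Longrightarrow> finite (J n)" "\<And>n. n > 0 \<Longrightarrow> J n \<noteq> {}"
    and D_measurable: "\<And>n \<iota>. \<iota> \<in> J n \<Longrightarrow> D \<iota> \<in> M \<rightarrow>\<^sub>M Q"
    and D_distr: "\<And>n \<iota>. \<iota> \<in> J n \<Longrightarrow> distr M Q (D \<iota>) = Q"
begin

definition pool_average :: "nat \<Rightarrow> ('s \<Rightarrow> real) \<Rightarrow> 'w \<Rightarrow> real" where
  "pool_average n f \<omega> = (\<Sum>\<iota>\<in>J n. f (D \<iota> \<omega>)) / real (card (J n))"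

definition draw_average :: "nat \<Rightarrow> ('s \<Rightarrow> real) \<Rightarrow> 'w \<Rightarrow> (nat \<Rightarrow> 'j) \<Rightarrow> real" where
  "draw_average n f \<omega> j = (\<Sum>i<n. f (D (j i) \<omega>)) / real n"

definition resample :: "nat \<Rightarrow> (nat \<Rightarrow> 'j) measure" where
  "resample n = PiM {..<n} (\<lambda>_. uniform_count_measure (J n))"

definition boot_stat :: "nat \<Rightarrow> 'w \<Rightarrow> (nat \<Rightarrow> 'j) \<Rightarrow> real" where
  "boot_stat n \<omega> j = sqrt (real n) *
     ((\<integral>z. \<bar>a z + draw_average n (\<lambda>x. k x z) \<omega> j\<bar> \<partial>m) - (\<integral>z. \<bar>a z + pool_average n (\<lambda>x. k x z) \<omega>\<bar> \<partial>m))"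

definition boot_linear :: "nat \<Rightarrow> 'w \<Rightarrow> (nat \<Rightarrow> 'j) \<Rightarrow> real" where
  "boot_linear n \<omega> j = sqrt (real n) * (draw_average n influence \<omega> j - pool_average n influence \<omega>)"

lemma prob_space_uniform_index: "n > 0 \<Longrightarrow> prob_space (uniform_count_measure (J n))"
  using J by (intro prob_space_uniform_count_measure)

lemma prob_space_resample: "prob_space (resample n)"
  unfolding resample_def by (intro prob_space_PiM prob_space_uniform_index) auto

lemma D_space: "\<iota> \<in> J n \<Longrightarrow> \<omega> \<in> space M \<Longrightarrow> D \<iota> \<omega> \<in> space Q"
  using measurable_space[OF D_measurable] by blast

lemma resample_space: "j \<in> space (resample n) \<Longrightarrow> i < n \<Longrightarrow> j i \<in> J n"
  by (auto simp: resample_def space_PiM space_uniform_count_measure PiE_def)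

lemma measurable_draw:
  assumes f: "f \<in> N \<rightarrow>\<^sub>M M" and g: "g \<in> N \<rightarrow>\<^sub>M resample n" and i: "i < n"
  shows "(\<lambda>w. D (g w i) (f w)) \<in> N \<rightarrow>\<^sub>M Q"
proof (rule measurable_compose_countable'[where I="J n"])
  show "(\<lambda>w. D \<iota> (f w)) \<in> N \<rightarrow>\<^sub>M Q" if "\<iota> \<in> J n" for \<iota>
    using measurable_compose[OF f D_measurable[OF that]] .
  have "(\<lambda>w. g w i) \<in> N \<rightarrow>\<^sub>M uniform_count_measure (J n)"
    using measurable_compose[OF g[unfolded resample_def] measurable_component_singleton] i by auto
  then show "(\<lambda>w. g w i) \<in> N \<rightarrow>\<^sub>M count_space (J n)"
    by (simp add: measurable_cong_sets[OF refl sets_uniform_count_measure_count_space])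
  show "countable (J n)"
    using J[of n] i by (intro countable_finite) auto
qed

lemma measurable_draw_average_kernel:
  assumes [measurable]: "f \<in> N \<rightarrow>\<^sub>M M" "g \<in> N \<rightarrow>\<^sub>M resample n" "h \<in> N \<rightarrow>\<^sub>M m"
  shows "(\<lambda>w. draw_average n (\<lambda>x. k x (h w)) (f w) (g w)) \<in> borel_measurable N"
  unfolding draw_average_def
  by (intro borel_measurable_divide borel_measurable_sum measurable_kernel measurable_draw[OF assms(1,2)] assms) auto

lemma measurable_draw_average:
  assumes "f \<in> N \<rightarrow>\<^sub>M M" "g \<in> N \<rightarrow>\<^sub>M resample n" "h \<in> borel_measurable Q"
  shows "(\<lambda>w. draw_average n h (f w) (g w)) \<in> borel_measurable N"
  unfolding draw_average_def
  by (intro borel_measurable_divide borel_measurable_sum measurable_compose[OF measurable_draw[OF assms(1,2)] assms(3)]) auto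

lemma measurable_pool_average_kernel:
  assumes [measurable]: "f \<in> N \<rightarrow>\<^sub>M M" "h \<in> N \<rightarrow>\<^sub>M m"
  shows "(\<lambda>w. pool_average n (\<lambda>x. k x (h w)) (f w)) \<in> borel_measurable N"
  unfolding pool_average_def
  by (intro borel_measurable_divide borel_measurable_sum measurable_kernel measurable_compose[OF assms(1) D_measurable] assms) auto

lemma measurable_pool_average [measurable (raw)]:
  assumes "f \<in> N \<rightarrow>\<^sub>M M" "h \<in> borel_measurable Q"
  shows "(\<lambda>w. pool_average n h (f w)) \<in> borel_measurable N"
  unfolding pool_average_def
  by (intro borel_measurable_divide borel_measurable_sum measurable_compose[OF measurable_compose[OF assms(1) D_measurable] assms(2)]) auto

lemma measurable_boot_stat [measurable (raw)]:
  assumes [measurable]: "f \<in> N \<rightarrow>\<^sub>M M" "g \<in> N \<rightarrow>\<^sub>M resample n"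
  shows "(\<lambda>w. boot_stat n (f w) (g w)) \<in> borel_measurable N"
proof -
  have [measurable]: "(\<lambda>(w, z). draw_average n (\<lambda>x. k x z) (f w) (g w)) \<in> borel_measurable (N \<Otimes>\<^sub>M m)"
    "(\<lambda>(w, z). pool_average n (\<lambda>x. k x z) (f w)) \<in> borel_measurable (N \<Otimes>\<^sub>M m)"
    unfolding split_beta'
    by (rule measurable_draw_average_kernel measurable_pool_average_kernel; measurable)+
  show ?thesis unfolding boot_stat_def by measurable
qed

lemma measurable_boot_linear [measurable (raw)]:
  assumes [measurable]: "f \<in> N \<rightarrow>\<^sub>M M" "g \<in> N \<rightarrow>\<^sub>M resample n"
  shows "(\<lambda>w. boot_linear n (f w) (g w)) \<in> borel_measurable N"
proof -
  have [measurable]: "(\<lambda>w. draw_average n influence (f w) (g w)) \<in> borel_measurable N"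
    by (rule measurable_draw_average) auto
  show ?thesis unfolding boot_linear_def by measurable
qed

lemma integral_pool_average:
  assumes "n > 0" "integrable Q f"
  shows "integrable M (pool_average n f)" "(\<integral>\<omega>. pool_average n f \<omega> \<partial>M) = (\<integral>x. f x \<partial>Q)"
proof -
  have fm: "f \<in> borel_measurable Q" using assms by auto
  have 1: "integrable M (\<lambda>\<omega>. f (D \<iota> \<omega>))" "(\<integral>\<omega>. f (D \<iota> \<omega>) \<partial>M) = (\<integral>x. f x \<partial>Q)" if "\<iota> \<in> J n" for \<iota>
  proof -
    have "integrable (distr M Q (D \<iota>)) f" using assms that by (simp add: D_distr)
    then show "integrable M (\<lambda>\<omega>. f (D \<iota> \<omega>))"
      by (subst (asm) integrable_distr_eq[OF D_measurable[OF that] fm])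
    show "(\<integral>\<omega>. f (D \<iota> \<omega>) \<partial>M) = (\<integral>x. f x \<partial>Q)"
      using integral_distr[OF D_measurable[OF that] fm] D_distr[OF that] by simp
  qed
  then show "integrable M (pool_average n f)" unfolding pool_average_def by auto
  show "(\<integral>\<omega>. pool_average n f \<omega> \<partial>M) = (\<integral>x. f x \<partial>Q)"
    unfolding pool_average_def using 1 J assms by simp
qed

lemma integrable_uniform_index:
  "n > 0 \<Longrightarrow> integrable (uniform_count_measure (J n)) (f :: 'j \<Rightarrow> real)"
  using J unfolding uniform_count_measure_def by (intro integrable_point_measure_finite) auto

text \<open>Given the data, the draws are independent with the uniform law on the pool, whose variance is at most
its second moment.\<close>

lemma draw_average_second_moment:
  assumes n: "n > 0" and w: "\<omega> \<in> space M"
  shows "integrable (resample n) (\<lambda>j. (draw_average n f \<omega> j - pool_average n f \<omega>)\<^sup>2)"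
    and "(\<integral>j. (draw_average n f \<omega> j - pool_average n f \<omega>)\<^sup>2 \<partial>resample n)
      \<le> pool_average n (\<lambda>x. (f x)\<^sup>2) \<omega> / real n"
proof -
  let ?U = "uniform_count_measure (J n)"
  let ?g = "\<lambda>\<iota>. f (D \<iota> \<omega>) - pool_average n f \<omega>"
  interpret U: prob_space ?U by (rule prob_space_uniform_index) fact
  interpret K: prob_space "resample n" by (rule prob_space_resample)
  have ind: "K.indep_vars (\<lambda>_. ?U) (\<lambda>i j. j i) {..<n}"
    unfolding resample_def using n U.prob_space_axioms by (intro indep_vars_PiM_coordinates) auto
  have d: "distr (resample n) ?U (\<lambda>j. j i) = ?U" if "i < n" for i
    unfolding resample_def using that U.prob_space_axioms by (intro distr_PiM_component) auto
  note va = uniform_average_variance[OF J(1)[OF n] J(2)[OF n], of "\<lambda>\<iota>. f (D \<iota> \<omega>)", folded pool_average_def]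
  have mean: "(\<integral>\<iota>. ?g \<iota> \<partial>?U) = 0"
    using J n va(1) by (simp add: integral_uniform_count_measure)
  have var: "(\<integral>\<iota>. (?g \<iota>)\<^sup>2 \<partial>?U) = pool_average n (\<lambda>x. (f x)\<^sup>2) \<omega> - (pool_average n f \<omega>)\<^sup>2"
    using J n va(2) by (simp add: integral_uniform_count_measure pool_average_def[of n "\<lambda>x. (f x)\<^sup>2"])
  have eq: "draw_average n f \<omega> j - pool_average n f \<omega> = (\<Sum>i<n. ?g (j i)) / real n" for j
    using n by (simp add: draw_average_def sum_subtractf diff_divide_distrib)
  have gm: "?g \<in> borel_measurable ?U"
    by (simp add: measurable_cong_sets[OF sets_uniform_count_measure_count_space refl])
  note S = K.second_moment_iid_average[OF ind d gm integrable_uniform_index[OF n] mean n]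
  show "integrable (resample n) (\<lambda>j. (draw_average n f \<omega> j - pool_average n f \<omega>)\<^sup>2)"
    unfolding eq using S by simp
  have "(\<integral>j. (draw_average n f \<omega> j - pool_average n f \<omega>)\<^sup>2 \<partial>resample n) = (\<integral>\<iota>. (?g \<iota>)\<^sup>2 \<partial>?U) / real n"
    unfolding eq using S by simp
  also have "\<dots> \<le> pool_average n (\<lambda>x. (f x)\<^sup>2) \<omega> / real n"
    unfolding var by (intro divide_right_mono) auto
  finally show "(\<integral>j. (draw_average n f \<omega> j - pool_average n f \<omega>)\<^sup>2 \<partial>resample n)
      \<le> pool_average n (\<lambda>x. (f x)\<^sup>2) \<omega> / real n" .
qed

lemma char_boot_linear:
  assumes n: "n > 0" and w: "\<omega> \<in> space M"
  shows "char (distr (resample n) borel (boot_linear n \<omega>)) u =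
    (char (distr (uniform_count_measure (J n)) borel (\<lambda>\<iota>. influence (D \<iota> \<omega>) - pool_average n influence \<omega>)) (u / sqrt (real n)))^n"
proof -
  let ?U = "uniform_count_measure (J n)"
  let ?g = "\<lambda>\<iota>. influence (D \<iota> \<omega>) - pool_average n influence \<omega>"
  interpret U: prob_space ?U by (rule prob_space_uniform_index) fact
  interpret K: prob_space "resample n" by (rule prob_space_resample)
  have ind: "K.indep_vars (\<lambda>_. ?U) (\<lambda>i j. j i) {..<n}"
    unfolding resample_def using n U.prob_space_axioms by (intro indep_vars_PiM_coordinates) auto
  have d: "distr (resample n) ?U (\<lambda>j. j i) = ?U" if "i < n" for i
    unfolding resample_def using that U.prob_space_axioms by (intro distr_PiM_component) auto
  have cm: "(\<lambda>j. j i) \<in> resample n \<rightarrow>\<^sub>M ?U" if "i < n" for i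
    unfolding resample_def using that by (intro measurable_component_singleton) simp
  have gm: "h \<in> borel_measurable ?U" for h :: "'j \<Rightarrow> 'c::topological_space"
    by (simp add: measurable_cong_sets[OF sets_uniform_count_measure_count_space refl])
  have ind': "K.indep_vars (\<lambda>_. borel) (\<lambda>i j. ?g (j i) / sqrt (real n)) {..<n}"
    by (rule K.indep_vars_compose2[OF ind]) (rule gm)
  have rt: "sqrt (real n) * (x / real n) = x / sqrt (real n)" for x :: real
    using n by (simp add: field_simps)
  have "boot_linear n \<omega> = (\<lambda>j. \<Sum>i<n. ?g (j i) / sqrt (real n))"
  proof
    fix j
    have eq: "draw_average n influence \<omega> j - pool_average n influence \<omega> = (\<Sum>i<n. ?g (j i)) / real n"
      using n by (simp add: draw_average_def sum_subtractf diff_divide_distrib)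
    show "boot_linear n \<omega> j = (\<Sum>i<n. ?g (j i) / sqrt (real n))"
      unfolding boot_linear_def eq rt by (rule sum_divide_distrib)
  qed
  then have "char (distr (resample n) borel (boot_linear n \<omega>)) u
     = (\<Prod>i<n. char (distr (resample n) borel (\<lambda>j. ?g (j i) / sqrt (real n))) u)"
    using K.char_distr_sum[OF ind', of u] by simp
  also have "\<dots> = (\<Prod>i<n. char (distr ?U borel ?g) (u / sqrt (real n)))"
  proof (rule prod.cong[OF refl])
    fix i assume "i \<in> {..<n}"
    then have i: "i < n" by simp
    have "char (distr ?U borel ?g) (u / sqrt (real n)) = (\<integral>\<iota>. iexp (u / sqrt (real n) * ?g \<iota>) \<partial>?U)"
      unfolding char_def by (rule integral_distr[OF gm]) measurable
    also have "\<dots> = (\<integral>\<iota>. iexp (u / sqrt (real n) * ?g \<iota>) \<partial>distr (resample n) ?U (\<lambda>j. j i))"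
      by (simp only: d[OF i])
    also have "\<dots> = (\<integral>j. iexp (u / sqrt (real n) * ?g (j i)) \<partial>resample n)"
      by (rule integral_distr[OF cm[OF i] gm])
    also have "\<dots> = (\<integral>j. iexp (u * (?g (j i) / sqrt (real n))) \<partial>resample n)"
      by simp
    also have "\<dots> = char (distr (resample n) borel (\<lambda>j. ?g (j i) / sqrt (real n))) u"
      unfolding char_def by (rule integral_distr[symmetric]) (use measurable_compose[OF cm[OF i] gm[of "\<lambda>\<iota>. ?g \<iota> / sqrt (real n)"]] in simp_all)
    finally show "char (distr (resample n) borel (\<lambda>j. ?g (j i) / sqrt (real n))) u = char (distr ?U borel ?g) (u / sqrt (real n))"
      by simp
  qed
  finally show ?thesis by simp
qed

definition lindeberg :: "nat \<Rightarrow> real \<Rightarrow> real" where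
  "lindeberg n u = (\<integral>x. min (24 * (influence x)\<^sup>2) (8 * \<bar>u\<bar> / sqrt (real n) * \<bar>influence x\<bar> ^ 3) \<partial>Q)"

text \<open>The right-hand side of \<open>char_power_approx\<close> for the centered influences of a uniform draw from the
pool, after the centering has been removed by \<open>lindeberg_min_diff_le\<close>.\<close>

definition clt_error :: "nat \<Rightarrow> real \<Rightarrow> 'w \<Rightarrow> real" where
  "clt_error n u \<omega> =
     u\<^sup>2 / 6 * (pool_average n (\<lambda>x. min (24 * (influence x)\<^sup>2) (8 * \<bar>u\<bar> / sqrt (real n) * \<bar>influence x\<bar> ^ 3)) \<omega>
        + 24 * (pool_average n influence \<omega>)\<^sup>2)
     + u\<^sup>2 / 2 * (\<bar>pool_average n (\<lambda>x. (influence x)\<^sup>2) \<omega> - asymptotic_variance\<bar> + (pool_average n influence \<omega>)\<^sup>2)"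

lemma char_boot_linear_approx:
  assumes n: "n > 0" "u\<^sup>2 * asymptotic_variance / 4 \<le> real n" and w: "\<omega> \<in> space M"
  shows "cmod (char (distr (resample n) borel (boot_linear n \<omega>)) u
      - complex_of_real ((1 + (- (asymptotic_variance * u\<^sup>2 / 2)) / real n)^n)) \<le> clt_error n u \<omega>"
proof -
  let ?U = "uniform_count_measure (J n)"
  define \<mu> where "\<mu> = pool_average n influence \<omega>"
  let ?g = "\<lambda>\<iota>. influence (D \<iota> \<omega>) - \<mu>"
  let ?v = asymptotic_variance
  let ?w = "\<bar>u\<bar> / sqrt (real n)"
  interpret U: prob_space ?U by (rule prob_space_uniform_index) fact
  have gm: "h \<in> borel_measurable ?U" for h :: "'j \<Rightarrow> 'c::topological_space"
    by (simp add: measurable_cong_sets[OF sets_uniform_count_measure_count_space refl])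
  interpret R: real_distribution "distr ?U borel ?g" by (rule U.real_distribution_distr) (rule gm)
  note va = uniform_average_variance[OF J(1)[OF n(1)] J(2)[OF n(1)], of "\<lambda>\<iota>. influence (D \<iota> \<omega>)", folded pool_average_def \<mu>_def]
  have iU: "(\<integral>\<iota>. h \<iota> \<partial>?U) = (\<Sum>\<iota>\<in>J n. h \<iota>) / real (card (J n))" for h :: "'j \<Rightarrow> real"
    using J n by (simp add: integral_uniform_count_measure)
  let ?s = "pool_average n (\<lambda>x. (influence x)\<^sup>2) \<omega> - \<mu>\<^sup>2"
  have "cmod ((char (distr ?U borel ?g) (u / sqrt (real n)))^n - complex_of_real ((1 + (- (?v * u\<^sup>2 / 2)) / real n)^n))
    \<le> u\<^sup>2 / 6 * (\<integral>x. min (6 * x\<^sup>2) (?w * \<bar>x\<bar> ^ 3) \<partial>distr ?U borel ?g) + u\<^sup>2 / 2 * \<bar>?s - ?v\<bar>"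
  proof (rule char_power_approx[OF R.real_distribution_axioms])
    show "integrable (distr ?U borel ?g) (\<lambda>x. x\<^sup>2)"
      by (subst integrable_distr_eq[OF gm]) (auto intro: integrable_uniform_index n)
    show "integral\<^sup>L (distr ?U borel ?g) (\<lambda>x. x) = 0"
      by (subst integral_distr[OF gm]) (auto simp: iU va(1))
    show "integral\<^sup>L (distr ?U borel ?g) (\<lambda>x. x\<^sup>2) = ?s"
      by (subst integral_distr[OF gm]) (auto simp: iU va(2) pool_average_def)
  qed (use n in auto)
  also have "(\<integral>x. min (6 * x\<^sup>2) (?w * \<bar>x\<bar> ^ 3) \<partial>distr ?U borel ?g)
     = (\<Sum>\<iota>\<in>J n. min (6 * (?g \<iota>)\<^sup>2) (?w * \<bar>?g \<iota>\<bar> ^ 3)) / real (card (J n))"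
    by (subst integral_distr[OF gm]) (auto simp: iU)
  also have "\<dots> \<le> (\<Sum>\<iota>\<in>J n. min (24 * (influence (D \<iota> \<omega>))\<^sup>2) (8 * ?w * \<bar>influence (D \<iota> \<omega>)\<bar> ^ 3) + 24 * \<mu>\<^sup>2) / real (card (J n))"
    by (intro divide_right_mono sum_mono lindeberg_min_diff_le) auto
  also have "\<dots> = pool_average n (\<lambda>x. min (24 * (influence x)\<^sup>2) (8 * \<bar>u\<bar> / sqrt (real n) * \<bar>influence x\<bar> ^ 3)) \<omega> + 24 * \<mu>\<^sup>2"
    using J[OF n(1)] by (simp add: sum.distrib pool_average_def add_divide_distrib)
  also have "\<bar>?s - ?v\<bar> \<le> \<bar>pool_average n (\<lambda>x. (influence x)\<^sup>2) \<omega> - ?v\<bar> + \<mu>\<^sup>2"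
    using zero_le_power2[of \<mu>] by linarith
  finally show ?thesis
    unfolding char_boot_linear[OF n(1) w] clt_error_def \<mu>_def
    by (simp add: mult_left_mono)
qed

lemma average_kernel_bound:
  "\<bar>pool_average n (\<lambda>x. k x z) \<omega>\<bar> \<le> 2" "\<bar>draw_average n (\<lambda>x. k x z) \<omega> j\<bar> \<le> 2"
proof -
  have *: "\<bar>(\<Sum>i\<in>I. k (x i) z) / real (card I)\<bar> \<le> 2" for I :: "'i set" and x
  proof (cases "card I = 0")
    case False
    have "\<bar>\<Sum>i\<in>I. k (x i) z\<bar> \<le> (\<Sum>i\<in>I. \<bar>k (x i) z\<bar>)" by (rule sum_abs)
    also have "\<dots> \<le> real (card I) * 2" by (rule sum_bounded_above) (rule kernel_bound)
    finally show ?thesis using False by (simp add: divide_le_eq mult.commute)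
  qed simp
  show "\<bar>pool_average n (\<lambda>x. k x z) \<omega>\<bar> \<le> 2" "\<bar>draw_average n (\<lambda>x. k x z) \<omega> j\<bar> \<le> 2"
    using *[of "\<lambda>\<iota>. D \<iota> \<omega>" "J n"] *[of "\<lambda>i. D (j i) \<omega>" "{..<n}"] by (auto simp: pool_average_def draw_average_def)
qed

lemma pool_average_kernel_L2:
  assumes "z \<in> space m"
  shows "integrable M (\<lambda>\<omega>. (pool_average n (\<lambda>x. k x z) \<omega>)\<^sup>2)"
proof (rule M.integrable_const_bound[where B="2\<^sup>2"])
  show "AE \<omega> in M. norm ((pool_average n (\<lambda>x. k x z) \<omega>)\<^sup>2) \<le> 2\<^sup>2"
  proof (rule AE_I2)
    fix \<omega>
    show "norm ((pool_average n (\<lambda>x. k x z) \<omega>)\<^sup>2) \<le> 2\<^sup>2"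
      using average_kernel_bound(1)[of n z \<omega>] abs_le_square_iff[of "pool_average n (\<lambda>x. k x z) \<omega>" 2] by simp
  qed
  show "(\<lambda>\<omega>. (pool_average n (\<lambda>x. k x z) \<omega>)\<^sup>2) \<in> borel_measurable M"
    by (intro borel_measurable_power measurable_pool_average kernel_section_measurable assms) simp
qed

end

section \<open>Consistency of the bootstrap\<close>

text \<open>These properties of the pool are immediate for independent observations.  They are assumptions
because for two samples the pool consists of pairs of observations, which are dependent if they
share a component.\<close>

locale consistent_resampling = resampling Q m a k \<tau> M J D
  for Q :: "'s measure" and m :: "'z measure" and a k \<tau> and M :: "'w measure"
    and J :: "nat \<Rightarrow> 'j set" and D :: "'j \<Rightarrow> 'w \<Rightarrow> 's" +
  assumes pool_variance: "\<And>n z. n > 0 \<Longrightarrow> z \<in> space m \<Longrightarrow>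
      (\<integral>\<omega>. (pool_average n (\<lambda>x. k x z) \<omega>)\<^sup>2 \<partial>M) \<le> (\<tau> z)\<^sup>2 / real n"
    and pool_influence_L2: "\<And>n. n > 0 \<Longrightarrow> integrable M (\<lambda>\<omega>. (pool_average n influence \<omega>)\<^sup>2)"
    and pool_mean: "(\<lambda>n. \<integral>\<omega>. (pool_average n influence \<omega>)\<^sup>2 \<partial>M) \<longlonglongrightarrow> 0"
    and pool_second_moment: "(\<lambda>n. \<integral>\<omega>. \<bar>pool_average n (\<lambda>x. (influence x)\<^sup>2) \<omega> - asymptotic_variance\<bar> \<partial>M) \<longlonglongrightarrow> 0"
begin

text \<open>The average over the draws fluctuates about the average over the pool, and the latter about \<open>0\<close>, each with
second moment at most \<open>\<tau>\<^sup>2 / n\<close>; the square of the sum of both deviations is at most twice the sum of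
their squares.\<close>

lemma joint_second_moment:
  assumes n: "n > 0" and z: "z \<in> space m"
  shows "integrable (M \<Otimes>\<^sub>M resample n) (\<lambda>p. (draw_average n (\<lambda>x. k x z) (fst p) (snd p))\<^sup>2)"
    and "(\<integral>p. (draw_average n (\<lambda>x. k x z) (fst p) (snd p))\<^sup>2 \<partial>(M \<Otimes>\<^sub>M resample n)) \<le> 4 * (\<tau> z)\<^sup>2 / real n"
proof -
  interpret K: prob_space "resample n" by (rule prob_space_resample)
  interpret MK: pair_prob_space M "resample n" ..
  let ?d = "\<lambda>\<omega> j. draw_average n (\<lambda>x. k x z) \<omega> j" and ?c = "pool_average n (\<lambda>x. k x z)"
  have d2: "(?d \<omega> j)\<^sup>2 \<le> 2\<^sup>2" for \<omega> j
    using average_kernel_bound(2)[of n z \<omega> j] abs_le_square_iff[of "?d \<omega> j" 2] by simp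
  show i: "integrable (M \<Otimes>\<^sub>M resample n) (\<lambda>p. (?d (fst p) (snd p))\<^sup>2)"
  proof (rule MK.integrable_const_bound[where B="2\<^sup>2"])
    show "(\<lambda>p. (?d (fst p) (snd p))\<^sup>2) \<in> borel_measurable (M \<Otimes>\<^sub>M resample n)"
      by (intro borel_measurable_power measurable_draw_average kernel_section_measurable z measurable_fst measurable_snd)
  qed (use d2 in auto)
  have "(\<integral>p. (?d (fst p) (snd p))\<^sup>2 \<partial>(M \<Otimes>\<^sub>M resample n)) = (\<integral>\<omega>. (\<integral>j. (?d \<omega> j)\<^sup>2 \<partial>resample n) \<partial>M)"
    using MK.integral_fst'[OF i] by simp
  also have "\<dots> \<le> (\<integral>\<omega>. 2 * (?c \<omega>)\<^sup>2 + 2 * (pool_average n (\<lambda>x. (k x z)\<^sup>2) \<omega> / real n) \<partial>M)"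
  proof (rule integral_mono)
    show "integrable M (\<lambda>\<omega>. \<integral>j. (?d \<omega> j)\<^sup>2 \<partial>resample n)"
      using MK.integrable_fst'[OF i] by simp
    show "integrable M (\<lambda>\<omega>. 2 * (?c \<omega>)\<^sup>2 + 2 * (pool_average n (\<lambda>x. (k x z)\<^sup>2) \<omega> / real n))"
      by (intro Bochner_Integration.integrable_add integrable_mult_right integrable_divide_zero pool_average_kernel_L2 z
          integral_pool_average n kernel_L2)
    fix \<omega> assume w: "\<omega> \<in> space M"
    note dm = draw_average_second_moment[OF n w, of "\<lambda>x. k x z"]
    have dmeas: "(\<lambda>j. (?d \<omega> j)\<^sup>2) \<in> borel_measurable (resample n)"
      by (intro borel_measurable_power measurable_draw_average kernel_section_measurable z) (use w in auto)
    have "(\<integral>j. (?d \<omega> j)\<^sup>2 \<partial>resample n) \<le> (\<integral>j. 2 * (?c \<omega>)\<^sup>2 + 2 * (?d \<omega> j - ?c \<omega>)\<^sup>2 \<partial>resample n)"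
    proof (rule integral_mono)
      show "integrable (resample n) (\<lambda>j. (?d \<omega> j)\<^sup>2)"
        using d2 by (intro K.integrable_const_bound[where B="2\<^sup>2"] dmeas) auto
      show "(?d \<omega> j)\<^sup>2 \<le> 2 * (?c \<omega>)\<^sup>2 + 2 * (?d \<omega> j - ?c \<omega>)\<^sup>2" for j
        using zero_le_power2[of "?d \<omega> j - 2 * ?c \<omega>"] by (simp add: power2_eq_square algebra_simps)
    qed (use dm in auto)
    also have "\<dots> = 2 * (?c \<omega>)\<^sup>2 + 2 * (\<integral>j. (?d \<omega> j - ?c \<omega>)\<^sup>2 \<partial>resample n)"
      using dm(1) K.prob_space by simp
    finally show "(\<integral>j. (?d \<omega> j)\<^sup>2 \<partial>resample n) \<le> 2 * (?c \<omega>)\<^sup>2 + 2 * (pool_average n (\<lambda>x. (k x z)\<^sup>2) \<omega> / real n)"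
      using dm(2) by linarith
  qed
  also have "\<dots> = 2 * (\<integral>\<omega>. (?c \<omega>)\<^sup>2 \<partial>M) + 2 * ((\<tau> z)\<^sup>2 / real n)"
    using pool_average_kernel_L2[OF z, of n] integral_pool_average[OF n kernel_L2[OF z]] kernel_second_moment[OF z]
    by simp
  also have "\<dots> \<le> 4 * (\<tau> z)\<^sup>2 / real n"
    using pool_variance[OF n z] by simp
  finally show "(\<integral>p. (?d (fst p) (snd p))\<^sup>2 \<partial>(M \<Otimes>\<^sub>M resample n)) \<le> 4 * (\<tau> z)\<^sup>2 / real n" .
qed

text \<open>Under the joint law of data and draws both averages are small perturbations of the same function
\<open>a\<close>, so both norms are linearized there and the norm of \<open>a\<close> itself cancels.\<close>

lemma boot_linearization:
  assumes n: "n > 0"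
  shows "(\<integral>\<^sup>+\<omega>. \<integral>\<^sup>+j. ennreal \<bar>boot_stat n \<omega> j - boot_linear n \<omega> j\<bar> \<partial>resample n \<partial>M) \<le> ennreal (2 * gap n)"
proof -
  interpret K: prob_space "resample n" by (rule prob_space_resample)
  interpret MK: pair_prob_space M "resample n" ..
  let ?d = "\<lambda>p z. draw_average n (\<lambda>x. k x z) (fst p) (snd p)" and ?c = "\<lambda>\<omega> z. pool_average n (\<lambda>x. k x z) \<omega>"
  have dm [measurable]: "case_prod ?d \<in> borel_measurable ((M \<Otimes>\<^sub>M resample n) \<Otimes>\<^sub>M m)"
    unfolding split_beta' by (rule measurable_draw_average_kernel) measurable
  have cm [measurable]: "case_prod ?c \<in> borel_measurable (M \<Otimes>\<^sub>M m)"
    unfolding split_beta' by (rule measurable_pool_average_kernel) measurable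
  have lc [measurable]: "(\<lambda>\<omega>. linear_error (?c \<omega>)) \<in> borel_measurable M"
    unfolding linear_error_def by measurable
  have ld [measurable]: "(\<lambda>p. linear_error (?d p)) \<in> borel_measurable (M \<Otimes>\<^sub>M resample n)"
    unfolding linear_error_def by measurable
  have di: "integrable m (?d p)" "(\<integral>z. sgn (a z) * ?d p z \<partial>m) = draw_average n influence (fst p) (snd p)"
    if "p \<in> space (M \<Otimes>\<^sub>M resample n)" for p
  proof -
    have x: "D (snd p i) (fst p) \<in> space Q" if "i \<in> {..<n}" for i
      using that \<open>p \<in> _\<close> by (intro D_space[where n=n] resample_space) (auto simp: space_pair_measure)
    show "integrable m (?d p)" "(\<integral>z. sgn (a z) * ?d p z \<partial>m) = draw_average n influence (fst p) (snd p)"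
      unfolding draw_average_def by (intro integral_sgn_average x; assumption)+
  qed
  have ci: "integrable m (?c \<omega>)" "(\<integral>z. sgn (a z) * ?c \<omega> z \<partial>m) = pool_average n influence \<omega>"
    if "\<omega> \<in> space M" for \<omega>
    unfolding pool_average_def by (intro integral_sgn_average D_space[OF _ that]; assumption)+
  have le: "\<bar>boot_stat n \<omega> j - boot_linear n \<omega> j\<bar>
      \<le> sqrt (real n) * linear_error (?d (\<omega>, j)) + sqrt (real n) * linear_error (?c \<omega>)"
    if "\<omega> \<in> space M" "j \<in> space (resample n)" for \<omega> j
  proof -
    have p: "(\<omega>, j) \<in> space (M \<Otimes>\<^sub>M resample n)" using that by (simp add: space_pair_measure)
    define X where "X = (\<integral>z. \<bar>a z + ?d (\<omega>, j) z\<bar> \<partial>m)"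
    define Y where "Y = (\<integral>z. \<bar>a z + ?c \<omega> z\<bar> \<partial>m)"
    define A where "A = (\<integral>z. \<bar>a z\<bar> \<partial>m)"
    have "boot_stat n \<omega> j - boot_linear n \<omega> j = sqrt (real n) *
        ((X - A - draw_average n influence \<omega> j) - (Y - A - pool_average n influence \<omega>))"
      by (simp add: boot_stat_def boot_linear_def X_def Y_def algebra_simps)
    then have "\<bar>boot_stat n \<omega> j - boot_linear n \<omega> j\<bar> = sqrt (real n) *
        \<bar>(X - A - draw_average n influence \<omega> j) - (Y - A - pool_average n influence \<omega>)\<bar>"
      by (simp add: abs_mult)
    also have "\<dots> \<le> sqrt (real n) * (\<bar>X - A - draw_average n influence \<omega> j\<bar> + \<bar>Y - A - pool_average n influence \<omega>\<bar>)"
      by (intro mult_left_mono abs_triangle_ineq4) simp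
    also have "\<bar>X - A - draw_average n influence \<omega> j\<bar> = linear_error (?d (\<omega>, j))"
      using di(2)[OF p] by (simp add: linear_error_def X_def A_def)
    also have "\<bar>Y - A - pool_average n influence \<omega>\<bar> = linear_error (?c \<omega>)"
      using ci(2)[OF that(1)] by (simp add: linear_error_def Y_def A_def)
    finally show ?thesis by (simp add: distrib_left)
  qed
  have le0: "0 \<le> linear_error f" for f by (simp add: linear_error_def)
  have "(\<integral>\<^sup>+\<omega>. \<integral>\<^sup>+j. ennreal \<bar>boot_stat n \<omega> j - boot_linear n \<omega> j\<bar> \<partial>resample n \<partial>M)
     \<le> (\<integral>\<^sup>+\<omega>. \<integral>\<^sup>+j. ennreal (sqrt (real n) * linear_error (?d (\<omega>, j))) + ennreal (sqrt (real n) * linear_error (?c \<omega>)) \<partial>resample n \<partial>M)"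
    using le le0 by (intro nn_integral_mono) (simp add: ennreal_leI flip: ennreal_plus)
  also have "\<dots> = (\<integral>\<^sup>+\<omega>. (\<integral>\<^sup>+j. ennreal (sqrt (real n) * linear_error (?d (\<omega>, j))) \<partial>resample n) + ennreal (sqrt (real n) * linear_error (?c \<omega>)) \<partial>M)"
  proof (intro nn_integral_cong)
    fix \<omega> assume [measurable]: "\<omega> \<in> space M"
    have "(\<lambda>j. linear_error (?d (\<omega>, j))) \<in> borel_measurable (resample n)"
      by (rule measurable_compose[OF _ ld]) measurable
    then show "(\<integral>\<^sup>+j. ennreal (sqrt (real n) * linear_error (?d (\<omega>, j))) + ennreal (sqrt (real n) * linear_error (?c \<omega>)) \<partial>resample n)
      = (\<integral>\<^sup>+j. ennreal (sqrt (real n) * linear_error (?d (\<omega>, j))) \<partial>resample n) + ennreal (sqrt (real n) * linear_error (?c \<omega>))"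
      by (subst nn_integral_add) (auto simp: K.emeasure_space_1)
  qed
  also have "\<dots> = (\<integral>\<^sup>+p. ennreal (sqrt (real n) * linear_error (?d p)) \<partial>(M \<Otimes>\<^sub>M resample n))
      + (\<integral>\<^sup>+\<omega>. ennreal (sqrt (real n) * linear_error (?c \<omega>)) \<partial>M)"
  proof (subst nn_integral_add)
    have L: "(\<lambda>p. ennreal (sqrt (real n) * linear_error (?d p))) \<in> borel_measurable (M \<Otimes>\<^sub>M resample n)"
      by measurable
    show "(\<lambda>\<omega>. \<integral>\<^sup>+j. ennreal (sqrt (real n) * linear_error (?d (\<omega>, j))) \<partial>resample n) \<in> borel_measurable M"
      by (rule K.borel_measurable_nn_integral_fst[OF L])
    show "(\<lambda>\<omega>. ennreal (sqrt (real n) * linear_error (?c \<omega>))) \<in> borel_measurable M" by measurable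
    show "(\<integral>\<^sup>+\<omega>. \<integral>\<^sup>+j. ennreal (sqrt (real n) * linear_error (?d (\<omega>, j))) \<partial>resample n \<partial>M) + (\<integral>\<^sup>+\<omega>. ennreal (sqrt (real n) * linear_error (?c \<omega>)) \<partial>M)
      = (\<integral>\<^sup>+p. ennreal (sqrt (real n) * linear_error (?d p)) \<partial>(M \<Otimes>\<^sub>M resample n))
      + (\<integral>\<^sup>+\<omega>. ennreal (sqrt (real n) * linear_error (?c \<omega>)) \<partial>M)"
      using K.nn_integral_fst[OF L] by simp
  qed
  also have "\<dots> \<le> ennreal (gap n) + ennreal (gap n)"
  proof (rule add_mono)
    show "(\<integral>\<^sup>+p. ennreal (sqrt (real n) * linear_error (?d p)) \<partial>(M \<Otimes>\<^sub>M resample n)) \<le> ennreal (gap n)"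
      by (rule expected_linear_error[OF MK.prob_space_axioms dm di(1) joint_second_moment[OF n] n])
    show "(\<integral>\<^sup>+\<omega>. ennreal (sqrt (real n) * linear_error (?c \<omega>)) \<partial>M) \<le> ennreal (gap n)"
    proof (rule expected_linear_error[OF M.prob_space_axioms cm ci(1) pool_average_kernel_L2 _ n])
      show "(\<integral>\<omega>. (?c \<omega> z)\<^sup>2 \<partial>M) \<le> 4 * (\<tau> z)\<^sup>2 / real n" if "z \<in> space m" for z
      proof -
        have "(\<tau> z)\<^sup>2 / real n \<le> 4 * (\<tau> z)\<^sup>2 / real n"
          by (intro divide_right_mono) auto
        with pool_variance[OF n that] show ?thesis by (rule order_trans)
      qed
    qed
  qed
  also have "\<dots> = ennreal (2 * gap n)"
    using gap_nonneg[of n] by (simp flip: ennreal_plus)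
  finally show ?thesis .
qed

definition clt_bound :: "nat \<Rightarrow> real \<Rightarrow> real" where
  "clt_bound n u = u\<^sup>2 / 6 * (lindeberg n u + 24 * (\<integral>\<omega>. (pool_average n influence \<omega>)\<^sup>2 \<partial>M))
     + u\<^sup>2 / 2 * ((\<integral>\<omega>. \<bar>pool_average n (\<lambda>x. (influence x)\<^sup>2) \<omega> - asymptotic_variance\<bar> \<partial>M)
        + (\<integral>\<omega>. (pool_average n influence \<omega>)\<^sup>2 \<partial>M))"

lemma clt_bound_tendsto_0: "(\<lambda>n. clt_bound n u) \<longlonglongrightarrow> 0"
proof -
  have "(\<lambda>n. lindeberg n u) \<longlonglongrightarrow> 0"
    unfolding lindeberg_def by (rule lindeberg_tendsto_0) (auto intro: influence_L2)
  then have "(\<lambda>n. clt_bound n u) \<longlonglongrightarrow> u\<^sup>2 / 6 * (0 + 24 * 0) + u\<^sup>2 / 2 * (0 + 0)"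
    unfolding clt_bound_def by (intro tendsto_add tendsto_mult tendsto_const pool_mean pool_second_moment)
  then show ?thesis by simp
qed

lemma expected_clt_error:
  assumes n: "n > 0"
  shows "(\<integral>\<^sup>+\<omega>. ennreal (clt_error n u \<omega>) \<partial>M) = ennreal (clt_bound n u)"
proof -
  let ?l = "\<lambda>x. min (24 * (influence x)\<^sup>2) (8 * \<bar>u\<bar> / sqrt (real n) * \<bar>influence x\<bar> ^ 3)"
  have l0: "0 \<le> ?l x" for x by simp
  have "integrable Q ?l"
  proof (rule Bochner_Integration.integrable_bound)
    show "integrable Q (\<lambda>x. 24 * (influence x)\<^sup>2)" by (rule integrable_mult_right) (rule influence_L2)
    show "AE x in Q. norm (?l x) \<le> norm (24 * (influence x)\<^sup>2)"
    proof (rule AE_I2)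
      fix x
      show "norm (?l x) \<le> norm (24 * (influence x)\<^sup>2)" using l0[of x] by simp
    qed
  qed measurable
  note l = integral_pool_average[OF n this]
  note q = integral_pool_average[OF n influence_L2]
  have i2: "integrable M (\<lambda>\<omega>. \<bar>pool_average n (\<lambda>x. (influence x)\<^sup>2) \<omega> - asymptotic_variance\<bar>)"
    using q by simp
  note i3 = pool_influence_L2[OF n]
  have i: "integrable M (clt_error n u)"
    unfolding clt_error_def by (intro Bochner_Integration.integrable_add integrable_mult_right l i2 i3)
  have "(\<integral>\<omega>. clt_error n u \<omega> \<partial>M) = clt_bound n u"
    unfolding clt_error_def clt_bound_def lindeberg_def l(2)[symmetric] using l(1) i2 i3
    by (simp del: integrable_abs_cancel)
  moreover have "0 \<le> clt_error n u \<omega>" for \<omega>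
    unfolding clt_error_def pool_average_def
    by (intro add_nonneg_nonneg mult_nonneg_nonneg divide_nonneg_nonneg sum_nonneg l0) auto
  ultimately show ?thesis
    using i by (subst nn_integral_eq_integral) auto
qed

definition boot_law :: "nat \<Rightarrow> 'w \<Rightarrow> real measure" where
  "boot_law n \<omega> = distr (resample n) borel (boot_stat n \<omega>)"

lemma boot_stat_section: "\<omega> \<in> space M \<Longrightarrow> boot_stat n \<omega> \<in> borel_measurable (resample n)"
  by measurable

lemma boot_law_distribution: "\<omega> \<in> space M \<Longrightarrow> real_distribution (boot_law n \<omega>)"
  unfolding boot_law_def
  by (intro prob_space.real_distribution_distr prob_space_resample boot_stat_section)

text \<open>Joint measurability allows the mean over the data and the integral over \<open>u\<close> to be exchanged.\<close>

lemma measurable_char_boot_law: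
  "(\<lambda>(\<omega>, u). char (boot_law n \<omega>) u) \<in> borel_measurable (M \<Otimes>\<^sub>M borel)"
proof -
  interpret K: prob_space "resample n" by (rule prob_space_resample)
  have e [measurable]: "(\<lambda>x. iexp x) \<in> borel_measurable borel"
    by (intro borel_measurable_continuous_onI continuous_intros)
  have "(\<lambda>p. \<integral>j. iexp (snd p * boot_stat n (fst p) j) \<partial>resample n) \<in> borel_measurable (M \<Otimes>\<^sub>M borel)"
  proof (rule K.borel_measurable_lebesgue_integral)
    show "(\<lambda>(p, j). iexp (snd p * boot_stat n (fst p) j)) \<in> borel_measurable ((M \<Otimes>\<^sub>M borel) \<Otimes>\<^sub>M resample n)"
      unfolding split_beta' by (rule measurable_compose[OF _ e]) measurable
  qed
  moreover have "(\<lambda>(\<omega>, u). char (boot_law n \<omega>) u) p = (\<integral>j. iexp (snd p * boot_stat n (fst p) j) \<partial>resample n)"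
    if "p \<in> space (M \<Otimes>\<^sub>M borel)" for p
    using that unfolding boot_law_def char_def split_beta'
    by (subst integral_distr) (auto simp: space_pair_measure intro!: boot_stat_section measurable_compose[OF _ e])
  ultimately show ?thesis by (subst measurable_cong)
qed

definition char_error :: "nat \<Rightarrow> real \<Rightarrow> real" where
  "char_error n u = \<bar>u\<bar> * (2 * gap n) + clt_bound n u +
     cmod (complex_of_real ((1 + (- (asymptotic_variance * u\<^sup>2 / 2)) / real n)^n) - char (centered_normal asymptotic_variance) u)"

lemma char_error_tendsto_0: "(\<lambda>n. char_error n u) \<longlonglongrightarrow> 0"
proof -
  have v: "asymptotic_variance \<ge> 0" by simp
  have "(\<lambda>n. complex_of_real ((1 + (- (asymptotic_variance * u\<^sup>2 / 2)) / real n)^n) - char (centered_normal asymptotic_variance) u)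
      \<longlonglongrightarrow> 0"
    unfolding char_centered_normal[OF v] by (rule LIM_zero[OF power_tendsto_gaussian_char])
  from tendsto_norm_zero[OF this]
  have "(\<lambda>n. char_error n u) \<longlonglongrightarrow> \<bar>u\<bar> * (2 * 0) + 0 + 0"
    unfolding char_error_def by (intro tendsto_add tendsto_mult tendsto_const gap_tendsto_0 clt_bound_tendsto_0)
  then show ?thesis by simp
qed

text \<open>The statistic is replaced by its linear part, the characteristic function of the linear part by
the power \<open>(1 - v * u\<^sup>2 / (2 * n)) ^ n\<close> and this power by its limit; \<open>char_error\<close> collects
the three errors.\<close>

lemma expected_char_error:
  assumes n: "n > 0" "u\<^sup>2 * asymptotic_variance / 4 \<le> real n"
  shows "(\<integral>\<^sup>+\<omega>. ennreal (cmod (char (boot_law n \<omega>) u - char (centered_normal asymptotic_variance) u)) \<partial>M)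
    \<le> ennreal (char_error n u)"
proof -
  interpret K: prob_space "resample n" by (rule prob_space_resample)
  let ?p = "complex_of_real ((1 + (- (asymptotic_variance * u\<^sup>2 / 2)) / real n)^n)"
  let ?\<Phi> = "char (centered_normal asymptotic_variance) u"
  have tri: "ennreal (cmod (char (boot_law n \<omega>) u - ?\<Phi>))
    \<le> ennreal \<bar>u\<bar> * (\<integral>\<^sup>+j. ennreal \<bar>boot_stat n \<omega> j - boot_linear n \<omega> j\<bar> \<partial>resample n)
      + (ennreal (clt_error n u \<omega>) + ennreal (cmod (?p - ?\<Phi>)))" if w: "\<omega> \<in> space M" for \<omega>
  proof -
    let ?L = "char (distr (resample n) borel (boot_linear n \<omega>)) u"
    have lm: "boot_linear n \<omega> \<in> borel_measurable (resample n)" using w by measurable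
    have "cmod (char (boot_law n \<omega>) u - ?\<Phi>) \<le> cmod (char (boot_law n \<omega>) u - ?L) + (cmod (?L - ?p) + cmod (?p - ?\<Phi>))"
      using norm_triangle_ineq[of "char (boot_law n \<omega>) u - ?L" "?L - ?\<Phi>"] norm_triangle_ineq[of "?L - ?p" "?p - ?\<Phi>"] by simp
    also have "\<dots> \<le> cmod (char (boot_law n \<omega>) u - ?L) + (clt_error n u \<omega> + cmod (?p - ?\<Phi>))"
      using char_boot_linear_approx[OF n w] by (intro add_left_mono add_right_mono)
    finally have le: "cmod (char (boot_law n \<omega>) u - ?\<Phi>) \<le> cmod (char (boot_law n \<omega>) u - ?L) + (clt_error n u \<omega> + cmod (?p - ?\<Phi>))" .
    have ce: "0 \<le> clt_error n u \<omega>"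
      using char_boot_linear_approx[OF n w] norm_ge_zero order_trans by blast
    have "ennreal (cmod (char (boot_law n \<omega>) u - ?\<Phi>))
       \<le> ennreal (cmod (char (boot_law n \<omega>) u - ?L) + (clt_error n u \<omega> + cmod (?p - ?\<Phi>)))"
      using le by (rule ennreal_leI)
    also have "\<dots> = ennreal (cmod (char (boot_law n \<omega>) u - ?L)) + (ennreal (clt_error n u \<omega>) + ennreal (cmod (?p - ?\<Phi>)))"
      using ce by (simp add: ennreal_plus)
    also have "\<dots> \<le> ennreal \<bar>u\<bar> * (\<integral>\<^sup>+j. ennreal \<bar>boot_stat n \<omega> j - boot_linear n \<omega> j\<bar> \<partial>resample n)
      + (ennreal (clt_error n u \<omega>) + ennreal (cmod (?p - ?\<Phi>)))"
      unfolding boot_law_def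
      by (intro add_right_mono K.nn_char_distr_diff_le boot_stat_section w lm)
    finally show ?thesis .
  qed
  have m1: "(\<lambda>\<omega>. \<integral>\<^sup>+j. ennreal \<bar>boot_stat n \<omega> j - boot_linear n \<omega> j\<bar> \<partial>resample n) \<in> borel_measurable M"
    by measurable
  have m2: "(\<lambda>\<omega>. ennreal (clt_error n u \<omega>)) \<in> borel_measurable M"
    unfolding clt_error_def by measurable
  have "(\<integral>\<^sup>+\<omega>. ennreal (cmod (char (boot_law n \<omega>) u - ?\<Phi>)) \<partial>M)
    \<le> (\<integral>\<^sup>+\<omega>. ennreal \<bar>u\<bar> * (\<integral>\<^sup>+j. ennreal \<bar>boot_stat n \<omega> j - boot_linear n \<omega> j\<bar> \<partial>resample n)
      + (ennreal (clt_error n u \<omega>) + ennreal (cmod (?p - ?\<Phi>))) \<partial>M)"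
    using tri by (intro nn_integral_mono)
  also have "\<dots> = ennreal \<bar>u\<bar> * (\<integral>\<^sup>+\<omega>. \<integral>\<^sup>+j. ennreal \<bar>boot_stat n \<omega> j - boot_linear n \<omega> j\<bar> \<partial>resample n \<partial>M)
      + (ennreal (clt_bound n u) + ennreal (cmod (?p - ?\<Phi>)))"
    using m1 m2 by (simp add: nn_integral_add nn_integral_cmult expected_clt_error[OF n(1)] M.emeasure_space_1)
  also have "\<dots> \<le> ennreal \<bar>u\<bar> * ennreal (2 * gap n) + (ennreal (clt_bound n u) + ennreal (cmod (?p - ?\<Phi>)))"
    by (intro add_right_mono mult_left_mono boot_linearization n) simp
  also have "\<dots> = ennreal (char_error n u)"
  proof -
    have "0 \<le> clt_bound n u"
      unfolding clt_bound_def lindeberg_def by (intro add_nonneg_nonneg mult_nonneg_nonneg Bochner_Integration.integral_nonneg) auto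
    then show ?thesis
      using gap_nonneg[of n] by (simp add: char_error_def ennreal_plus ennreal_mult add.assoc)
  qed
  finally show ?thesis .
qed

end

text \<open>By right continuity rational arguments suffice, which makes the supremum a measurable function of
the data.\<close>

lemma sup_cdf_diff_le_iff:
  assumes "real_distribution R" "real_distribution N"
  shows "(\<Squnion>t. \<bar>cdf R t - cdf N t\<bar>) \<le> c \<longleftrightarrow> (\<forall>q\<in>\<rat>. \<bar>cdf R q - cdf N q\<bar> \<le> c)"
    and "bdd_above (range (\<lambda>t. \<bar>cdf R t - cdf N t\<bar>))"
proof -
  interpret R: real_distribution R by fact
  interpret N: real_distribution N by fact
  have "\<bar>cdf R t - cdf N t\<bar> \<le> 1" for t
    using R.cdf_nonneg[of t] R.cdf_bounded_prob[of t] N.cdf_nonneg[of t] N.cdf_bounded_prob[of t] by (simp add: abs_le_iff)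
  then show bdd: "bdd_above (range (\<lambda>t. \<bar>cdf R t - cdf N t\<bar>))"
    by (intro bdd_aboveI[where M=1]) auto
  show "(\<Squnion>t. \<bar>cdf R t - cdf N t\<bar>) \<le> c \<longleftrightarrow> (\<forall>q\<in>\<rat>. \<bar>cdf R q - cdf N q\<bar> \<le> c)"
  proof (subst cSUP_le_iff[OF _ bdd], simp, safe)
    fix t assume q: "\<forall>q\<in>\<rat>. \<bar>cdf R q - cdf N q\<bar> \<le> c"
    show "\<bar>cdf R t - cdf N t\<bar> \<le> c"
    proof (rule ccontr)
      assume "\<not> \<bar>cdf R t - cdf N t\<bar> \<le> c"
      then have gt: "c < \<bar>cdf R t - cdf N t\<bar>" by simp
      have "((\<lambda>x. \<bar>cdf R x - cdf N x\<bar>) \<longlongrightarrow> \<bar>cdf R t - cdf N t\<bar>) (at_right t)"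
        using R.cdf_is_right_cont[of t] N.cdf_is_right_cont[of t]
        unfolding continuous_within by (intro tendsto_rabs tendsto_diff)
      from order_tendstoD(1)[OF this gt] obtain b where b: "b > t" "\<And>x. t < x \<Longrightarrow> x < b \<Longrightarrow> c < \<bar>cdf R x - cdf N x\<bar>"
        by (auto simp: eventually_at_right_field)
      obtain r where "r \<in> \<rat>" "t < r" "r < b" using Rats_dense_in_real[OF b(1)] by auto
      with b(2) q show False by fastforce
    qed
  qed auto
qed

context consistent_resampling
begin

lemma cdf_boot_law:
  assumes "\<omega> \<in> space M"
  shows "cdf (boot_law n \<omega>) t = measure (resample n) {j \<in> space (resample n). boot_stat n \<omega> j \<le> t}"
proof -
  have "boot_stat n \<omega> -` {..t} \<inter> space (resample n) = {j \<in> space (resample n). boot_stat n \<omega> j \<le> t}"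
    by auto
  then show ?thesis
    unfolding cdf_def boot_law_def
    by (subst measure_distr[OF boot_stat_section[OF assms]]) simp_all
qed

lemma measurable_cdf_boot_law: "(\<lambda>\<omega>. cdf (boot_law n \<omega>) t) \<in> borel_measurable M"
proof -
  interpret K: prob_space "resample n" by (rule prob_space_resample)
  have "(\<lambda>\<omega>. \<integral>j. (indicator {..t} (boot_stat n \<omega> j) :: real) \<partial>resample n) \<in> borel_measurable M"
    by measurable
  moreover have "cdf (boot_law n \<omega>) t = (\<integral>j. indicator {..t} (boot_stat n \<omega> j) \<partial>resample n)" if "\<omega> \<in> space M" for \<omega>
  proof -
    have "cdf (boot_law n \<omega>) t = (\<integral>x. indicator {..t} x \<partial>boot_law n \<omega>)"
      by (simp add: cdf_def boot_law_def)
    also have "\<dots> = (\<integral>j. indicator {..t} (boot_stat n \<omega> j) \<partial>resample n)"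
      unfolding boot_law_def by (rule integral_distr[OF boot_stat_section[OF that]]) simp
    finally show ?thesis .
  qed
  ultimately show ?thesis by (subst measurable_cong)
qed

lemma char_distance_boot_law:
  assumes "h > 0"
  shows "(\<lambda>\<omega>. char_distance h (boot_law n \<omega>) (centered_normal asymptotic_variance)) \<in> borel_measurable M"
    and "(\<lambda>n. \<integral>\<omega>. char_distance h (boot_law n \<omega>) (centered_normal asymptotic_variance) \<partial>M) \<longlonglongrightarrow> 0"
    and "integrable M (\<lambda>\<omega>. char_distance h (boot_law n \<omega>) (centered_normal asymptotic_variance))"
proof -
  let ?N = "centered_normal asymptotic_variance" and ?\<gamma> = "centered_normal (1 / h\<^sup>2)"
  interpret N: real_distribution ?N by (rule real_distribution_centered_normal) simp
  interpret G: real_distribution ?\<gamma> by (rule real_distribution_centered_normal) simp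
  interpret MG: pair_prob_space M ?\<gamma> ..
  let ?q = "\<lambda>n \<omega> u. cmod (char (boot_law n \<omega>) u - char ?N u)"
  have qm: "(\<lambda>(\<omega>, u). ?q n \<omega> u) \<in> borel_measurable (M \<Otimes>\<^sub>M ?\<gamma>)" for n
  proof -
    have "(\<lambda>(\<omega>, u). char (boot_law n \<omega>) u) \<in> borel_measurable (M \<Otimes>\<^sub>M ?\<gamma>)"
      using measurable_char_boot_law[of n] by (simp add: measurable_cong_sets[OF sets_pair_measure_cong[OF refl G.events_eq_borel] refl])
    moreover have "(\<lambda>p. char ?N (snd p)) \<in> borel_measurable (M \<Otimes>\<^sub>M ?\<gamma>)"
      by measurable
    ultimately show ?thesis unfolding split_beta' by measurable
  qed
  have q2: "?q n \<omega> u \<le> 2" if "\<omega> \<in> space M" for n \<omega> u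
    using norm_triangle_ineq4[of "char (boot_law n \<omega>) u" "char ?N u"] N.cmod_char_le_1[of u]
      real_distribution.cmod_char_le_1[OF boot_law_distribution[OF that], of n u] by simp
  have iu: "integrable ?\<gamma> (?q n \<omega>)" if w: "\<omega> \<in> space M" for n \<omega>
  proof (rule G.integrable_const_bound[where B=2])
    show "(\<lambda>u. ?q n \<omega> u) \<in> borel_measurable ?\<gamma>"
      using measurable_compose[OF measurable_Pair1'[OF w] qm[of n]] by simp
  qed (use q2[OF w] in auto)
  have dm: "(\<lambda>\<omega>. char_distance h (boot_law n \<omega>) ?N) \<in> borel_measurable M" for n
    unfolding char_distance_def by (rule G.borel_measurable_lebesgue_integral[OF qm])
  then show "(\<lambda>\<omega>. char_distance h (boot_law n \<omega>) ?N) \<in> borel_measurable M" .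
  have di: "integrable M (\<lambda>\<omega>. char_distance h (boot_law n \<omega>) ?N)" for n
  proof (rule M.integrable_const_bound[where B=2])
    show "AE \<omega> in M. norm (char_distance h (boot_law n \<omega>) ?N) \<le> 2"
    proof (rule AE_I2)
      fix \<omega> assume w: "\<omega> \<in> space M"
      have "char_distance h (boot_law n \<omega>) ?N \<le> (\<integral>u. 2 \<partial>?\<gamma>)"
        unfolding char_distance_def using q2[OF w] by (intro integral_mono iu w) auto
      moreover have "0 \<le> char_distance h (boot_law n \<omega>) ?N" by (simp add: char_distance_def)
      ultimately show "norm (char_distance h (boot_law n \<omega>) ?N) \<le> 2" using G.prob_space by simp
    qed
  qed (rule dm)
  then show "integrable M (\<lambda>\<omega>. char_distance h (boot_law n \<omega>) ?N)" .
  have qm': "(\<lambda>(\<omega>, u). ennreal (?q n \<omega> u)) \<in> borel_measurable (M \<Otimes>\<^sub>M ?\<gamma>)" for n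
    using qm[of n] unfolding split_beta' by measurable
  have eq: "ennreal (\<integral>\<omega>. char_distance h (boot_law n \<omega>) ?N \<partial>M) = (\<integral>\<^sup>+u. \<integral>\<^sup>+\<omega>. ennreal (?q n \<omega> u) \<partial>M \<partial>?\<gamma>)" for n
  proof -
    have "ennreal (\<integral>\<omega>. char_distance h (boot_law n \<omega>) ?N \<partial>M) = (\<integral>\<^sup>+\<omega>. ennreal (char_distance h (boot_law n \<omega>) ?N) \<partial>M)"
      using di by (intro nn_integral_eq_integral[symmetric]) (auto simp: char_distance_def)
    also have "\<dots> = (\<integral>\<^sup>+\<omega>. \<integral>\<^sup>+u. ennreal (?q n \<omega> u) \<partial>?\<gamma> \<partial>M)"
      unfolding char_distance_def by (intro nn_integral_cong nn_integral_eq_integral[symmetric] iu) auto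
    also have "\<dots> = (\<integral>\<^sup>+u. \<integral>\<^sup>+\<omega>. ennreal (?q n \<omega> u) \<partial>M \<partial>?\<gamma>)"
      by (rule MG.Fubini'[OF qm', symmetric])
    finally show ?thesis .
  qed
  have "(\<lambda>n. \<integral>\<^sup>+u. \<integral>\<^sup>+\<omega>. ennreal (?q n \<omega> u) \<partial>M \<partial>?\<gamma>) \<longlonglongrightarrow> (\<integral>\<^sup>+u. 0 \<partial>?\<gamma>)"
  proof (rule nn_integral_dominated_convergence[where w="\<lambda>_. 2"])
    show "(\<lambda>u. \<integral>\<^sup>+\<omega>. ennreal (?q n \<omega> u) \<partial>M) \<in> borel_measurable ?\<gamma>" for n
      by (rule M.borel_measurable_nn_integral) (use measurable_pair_swap[OF qm'[of n]] in \<open>simp add: split_beta'\<close>)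
    show "AE u in ?\<gamma>. (\<integral>\<^sup>+\<omega>. ennreal (?q n \<omega> u) \<partial>M) \<le> 2" for n
    proof (rule AE_I2)
      fix u
      have "(\<integral>\<^sup>+\<omega>. ennreal (?q n \<omega> u) \<partial>M) \<le> (\<integral>\<^sup>+\<omega>. 2 \<partial>M)"
      proof (rule nn_integral_mono)
        fix \<omega> assume "\<omega> \<in> space M"
        from ennreal_leI[OF q2[OF this]] show "ennreal (?q n \<omega> u) \<le> 2" by simp
      qed
      then show "(\<integral>\<^sup>+\<omega>. ennreal (?q n \<omega> u) \<partial>M) \<le> 2" by (simp add: M.emeasure_space_1)
    qed
    show "AE u in ?\<gamma>. (\<lambda>n. \<integral>\<^sup>+\<omega>. ennreal (?q n \<omega> u) \<partial>M) \<longlonglongrightarrow> 0"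
    proof (rule AE_I2)
      fix u
      have L: "(\<lambda>n. ennreal (char_error n u)) \<longlonglongrightarrow> 0"
        using tendsto_ennrealI[OF char_error_tendsto_0] by (simp only: ennreal_0)
      have E: "\<forall>\<^sub>F n in sequentially. (\<integral>\<^sup>+\<omega>. ennreal (?q n \<omega> u) \<partial>M) \<le> ennreal (char_error n u)"
      proof (rule eventually_sequentiallyI)
        fix n assume "n \<ge> max 1 (nat \<lceil>u\<^sup>2 * asymptotic_variance / 4\<rceil>)"
        then have "n > 0" "u\<^sup>2 * asymptotic_variance / 4 \<le> real n" by (auto simp: nat_le_iff ceiling_le_iff)
        then show "(\<integral>\<^sup>+\<omega>. ennreal (?q n \<omega> u) \<partial>M) \<le> ennreal (char_error n u)"
          by (rule expected_char_error)
      qed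
      show "(\<lambda>n. \<integral>\<^sup>+\<omega>. ennreal (?q n \<omega> u) \<partial>M) \<longlonglongrightarrow> 0"
        by (rule tendsto_sandwich[OF always_eventually E tendsto_const L]) (rule allI, rule zero_le)
    qed
    show "(\<integral>\<^sup>+u. 2 \<partial>?\<gamma>) < \<infinity>"
      using G.emeasure_space_1 by simp
  qed simp_all
  moreover have "(\<integral>\<^sup>+u. 0 \<partial>?\<gamma>) = ennreal 0"
    by simp
  ultimately have L: "(\<lambda>n. ennreal (\<integral>\<omega>. char_distance h (boot_law n \<omega>) ?N \<partial>M)) \<longlonglongrightarrow> ennreal 0"
    unfolding eq by (simp only:)
  have "0 \<le> (\<integral>\<omega>. char_distance h (boot_law n \<omega>) ?N \<partial>M)" for n
    by (intro Bochner_Integration.integral_nonneg) (simp add: char_distance_def)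
  then show "(\<lambda>n. \<integral>\<omega>. char_distance h (boot_law n \<omega>) ?N \<partial>M) \<longlonglongrightarrow> 0"
    by (intro tendsto_ennreal_iff[THEN iffD1, OF _ _ L] always_eventually allI) simp_all
qed

text \<open>By \<open>cdf_distance_le_char_distance\<close> the supremum is at most \<open>e / 2 + C * d\<close>, where the constants do
not depend on the data and the mean of the distance \<open>d\<close> of the characteristic functions tends to \<open>0\<close>.
Markov's inequality concludes.\<close>

theorem bootstrap_consistency:
  assumes v: "asymptotic_variance > 0"
  shows "conv_in_probability M
    (\<lambda>n \<omega>. \<Squnion>t. \<bar>measure (resample n) {j \<in> space (resample n). boot_stat n \<omega> j \<le> t}
               - cdf (centered_normal asymptotic_variance) t\<bar>) 0"
proof -
  let ?N = "centered_normal asymptotic_variance"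
  interpret N: real_distribution ?N using v by (intro real_distribution_centered_normal) simp
  define Z where "Z n \<omega> = (\<Squnion>t. \<bar>cdf (boot_law n \<omega>) t - cdf ?N t\<bar>)" for n \<omega>
  have Z_eq: "(\<Squnion>t. \<bar>measure (resample n) {j \<in> space (resample n). boot_stat n \<omega> j \<le> t} - cdf ?N t\<bar>) = Z n \<omega>"
    if "\<omega> \<in> space M" for n \<omega>
    by (simp add: Z_def cdf_boot_law[OF that])
  have le_iff: "Z n \<omega> \<le> c \<longleftrightarrow> (\<forall>q\<in>\<rat>. \<bar>cdf (boot_law n \<omega>) q - cdf ?N q\<bar> \<le> c)" if "\<omega> \<in> space M" for n \<omega> c
    unfolding Z_def by (rule sup_cdf_diff_le_iff[OF boot_law_distribution[OF that] N.real_distribution_axioms])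
  have Zm: "Z n \<in> borel_measurable M" for n
  proof (subst borel_measurable_iff_le, rule allI)
    fix c
    note [measurable] = measurable_cdf_boot_law
    have "{\<omega> \<in> space M. Z n \<omega> \<le> c}
       = {\<omega> \<in> space M. \<forall>r. \<bar>cdf (boot_law n \<omega>) (of_rat r) - cdf ?N (of_rat r)\<bar> \<le> c}"
      using le_iff by (auto simp: Rats_def)
    also have "\<dots> \<in> sets M"
      by (rule sets.sets_Collect_countable_All) measurable
    finally show "{\<omega> \<in> space M. Z n \<omega> \<le> c} \<in> sets M" .
  qed
  have Z0: "0 \<le> Z n \<omega>" if "\<omega> \<in> space M" for n \<omega>
  proof -
    have "0 \<le> \<bar>cdf (boot_law n \<omega>) 0 - cdf ?N 0\<bar>" by simp
    also have "\<dots> \<le> Z n \<omega>"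
      unfolding Z_def
      by (rule cSUP_upper[OF UNIV_I sup_cdf_diff_le_iff(2)[OF boot_law_distribution[OF that] N.real_distribution_axioms]])
    finally show ?thesis .
  qed
  have lim: "(\<lambda>n. measure M {\<omega> \<in> space M. \<bar>Z n \<omega> - 0\<bar> > e}) \<longlonglongrightarrow> 0" if e: "e > 0" for e
  proof -
    obtain h C where hC: "h > 0" "C \<ge> 0"
      "\<And>R t. real_distribution R \<Longrightarrow> \<bar>cdf R t - cdf ?N t\<bar> \<le> e / 2 + C * char_distance h R ?N"
      using cdf_distance_le_char_distance[OF N.real_distribution_axioms cdf_centered_normal_lipschitz[OF v], of "e / 2"] e
      by (metis half_gt_zero)
    define d where "d n \<omega> = char_distance h (boot_law n \<omega>) ?N" for n \<omega>
    note D = char_distance_boot_law[OF hC(1), folded d_def]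
    have d0: "0 \<le> d n \<omega>" for n \<omega> by (simp add: d_def char_distance_def)
    \<comment> \<open>If the supremum exceeds \<open>e\<close>, then \<open>d\<close> is at least this number; \<open>C + 1\<close> excludes a zero denominator.\<close>
    let ?r = "e / (2 * (C + 1))"
    have r: "?r > 0" using e hC by simp
    have B: "measure M {\<omega> \<in> space M. \<bar>Z n \<omega> - 0\<bar> > e} \<le> (\<integral>\<omega>. d n \<omega> \<partial>M) / ?r" for n
    proof -
      have "measure M {\<omega> \<in> space M. \<bar>Z n \<omega> - 0\<bar> > e} \<le> measure M {\<omega> \<in> space M. ?r \<le> d n \<omega>}"
      proof (rule M.finite_measure_mono)
        show "{\<omega> \<in> space M. \<bar>Z n \<omega> - 0\<bar> > e} \<subseteq> {\<omega> \<in> space M. ?r \<le> d n \<omega>}"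
        proof safe
          fix \<omega> assume w: "\<omega> \<in> space M" and "e < \<bar>Z n \<omega> - 0\<bar>"
          then have gt: "e < Z n \<omega>" using Z0[OF w] by simp
          have "Z n \<omega> \<le> e / 2 + C * d n \<omega>"
            using hC(3)[OF boot_law_distribution[OF w]] by (simp add: le_iff[OF w] d_def)
          with gt have "e / 2 \<le> C * d n \<omega>" by simp
          also have "\<dots> \<le> (C + 1) * d n \<omega>" using d0 by (intro mult_right_mono) auto
          finally show "?r \<le> d n \<omega>" using hC(2) by (simp add: divide_le_eq algebra_simps)
        qed
        show "{\<omega> \<in> space M. ?r \<le> d n \<omega>} \<in> sets M"
          using D(1) by measurable
      qed
      also have "\<dots> \<le> (\<integral>\<omega>. d n \<omega> \<partial>M) / ?r"
        using D(3) d0 r by (intro integral_Markov_inequality_measure[where A="{}"]) auto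
      finally show ?thesis .
    qed
    have L: "(\<lambda>n. (\<integral>\<omega>. d n \<omega> \<partial>M) / ?r) \<longlonglongrightarrow> 0"
      by (rule tendsto_divide_zero) (rule D(2))
    show ?thesis
      by (rule tendsto_sandwich[OF always_eventually always_eventually tendsto_const L]) (use B in simp_all)
  qed
  have "conv_in_probability M Z 0"
    unfolding conv_in_probability_def using Zm lim by auto
  moreover have "(\<lambda>\<omega>. \<Squnion>t. \<bar>measure (resample n) {j \<in> space (resample n). boot_stat n \<omega> j \<le> t} - cdf ?N t\<bar>) \<in> borel_measurable M" for n
    by (rule measurable_cong[where g="Z n", THEN iffD2]) (use Z_eq Zm in auto)
  moreover have "{\<omega> \<in> space M. \<bar>(\<Squnion>t. \<bar>measure (resample n) {j \<in> space (resample n). boot_stat n \<omega> j \<le> t} - cdf ?N t\<bar>) - 0\<bar> > e}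
      = {\<omega> \<in> space M. \<bar>Z n \<omega> - 0\<bar> > e}" for n e
    using Z_eq by auto
  ultimately show ?thesis
    unfolding conv_in_probability_def by simp
qed

end

section \<open>Second moments of integrated processes\<close>

lemma (in prob_space) integral_abs_mult_le:
  fixes f g :: "'a \<Rightarrow> real"
  assumes [measurable]: "f \<in> borel_measurable M" "g \<in> borel_measurable M"
    and "integrable M (\<lambda>x. (f x)\<^sup>2)" "integrable M (\<lambda>x. (g x)\<^sup>2)"
    and c: "(\<integral>x. (f x)\<^sup>2 \<partial>M) \<le> c\<^sup>2" "(\<integral>x. (g x)\<^sup>2 \<partial>M) \<le> d\<^sup>2" "0 \<le> c" "0 \<le> d"
  shows "integrable M (\<lambda>x. f x * g x)" "(\<integral>x. \<bar>f x * g x\<bar> \<partial>M) \<le> c * d"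
proof -
  show i: "integrable M (\<lambda>x. f x * g x)"
  proof (rule Bochner_Integration.integrable_bound)
    show "integrable M (\<lambda>x. (f x)\<^sup>2 + (g x)\<^sup>2)" using assms by simp
    show "AE x in M. norm (f x * g x) \<le> norm ((f x)\<^sup>2 + (g x)\<^sup>2)"
    proof (rule AE_I2)
      fix x
      have "2 * (\<bar>f x\<bar> * \<bar>g x\<bar>) \<le> (f x)\<^sup>2 + (g x)\<^sup>2"
        using zero_le_power2[of "\<bar>f x\<bar> - \<bar>g x\<bar>"] by (simp add: power2_diff)
      moreover have "0 \<le> \<bar>f x\<bar> * \<bar>g x\<bar>" by simp
      ultimately have "\<bar>f x\<bar> * \<bar>g x\<bar> \<le> (f x)\<^sup>2 + (g x)\<^sup>2" by linarith
      then show "norm (f x * g x) \<le> norm ((f x)\<^sup>2 + (g x)\<^sup>2)" by (simp add: abs_mult)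
    qed
  qed measurable
  have sq: "(\<integral>\<^sup>+x. (ennreal \<bar>h x\<bar>)\<^sup>2 \<partial>M) = ennreal (\<integral>x. (h x)\<^sup>2 \<partial>M)" if "integrable M (\<lambda>x. (h x)\<^sup>2)" for h :: "'a \<Rightarrow> real"
  proof -
    have "(\<integral>\<^sup>+x. (ennreal \<bar>h x\<bar>)\<^sup>2 \<partial>M) = (\<integral>\<^sup>+x. ennreal ((h x)\<^sup>2) \<partial>M)"
      by (intro nn_integral_cong) (simp add: ennreal_power)
    then show ?thesis using that by (simp add: nn_integral_eq_integral)
  qed
  have "(ennreal (\<integral>x. \<bar>f x * g x\<bar> \<partial>M))\<^sup>2 = (\<integral>\<^sup>+x. ennreal \<bar>f x\<bar> * ennreal \<bar>g x\<bar> \<partial>M)\<^sup>2"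
  proof -
    have "ennreal (\<integral>x. \<bar>f x * g x\<bar> \<partial>M) = (\<integral>\<^sup>+x. ennreal \<bar>f x * g x\<bar> \<partial>M)"
      by (intro nn_integral_eq_integral[symmetric] integrable_abs i) auto
    also have "\<dots> = (\<integral>\<^sup>+x. ennreal \<bar>f x\<bar> * ennreal \<bar>g x\<bar> \<partial>M)"
      by (intro nn_integral_cong) (simp add: abs_mult ennreal_mult)
    finally show ?thesis by (simp only:)
  qed
  also have "\<dots> \<le> (\<integral>\<^sup>+x. (ennreal \<bar>f x\<bar>)\<^sup>2 \<partial>M) * (\<integral>\<^sup>+x. (ennreal \<bar>g x\<bar>)\<^sup>2 \<partial>M)"
    by (rule Cauchy_Schwarz_nn_integral) measurable
  also have "\<dots> = ennreal ((\<integral>x. (f x)\<^sup>2 \<partial>M) * (\<integral>x. (g x)\<^sup>2 \<partial>M))"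
    using assms by (simp add: sq ennreal_mult)
  finally have "(\<integral>x. \<bar>f x * g x\<bar> \<partial>M)\<^sup>2 \<le> (\<integral>x. (f x)\<^sup>2 \<partial>M) * (\<integral>x. (g x)\<^sup>2 \<partial>M)"
    by (simp add: ennreal_power)
  also have "\<dots> \<le> c\<^sup>2 * d\<^sup>2"
    by (intro mult_mono c) auto
  also have "\<dots> = (c * d)\<^sup>2" by (simp add: power_mult_distrib)
  finally show "(\<integral>x. \<bar>f x * g x\<bar> \<partial>M) \<le> c * d"
    by (rule power2_le_imp_le) (use c in simp)
qed

text \<open>A squared integral is a double integral.  Fubini's theorem applies because the mean of
\<open>\<bar>g w z * g w z'\<bar>\<close> is at most \<open>\<sigma> z * \<sigma> z'\<close> by the Cauchy--Schwarz inequality.  In consequence the first two moments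
of the integrated process depend only on mean and covariance of the process.\<close>

lemma second_moment_of_integral:
  fixes g :: "'w \<Rightarrow> 'z \<Rightarrow> real" and s \<sigma> :: "'z \<Rightarrow> real"
  assumes "prob_space N" "sigma_finite_measure m"
    and gm: "case_prod g \<in> borel_measurable (N \<Otimes>\<^sub>M m)"
    and gi: "\<And>w. w \<in> space N \<Longrightarrow> integrable m (g w)"
    and g2: "\<And>z. z \<in> space m \<Longrightarrow> integrable N (\<lambda>w. (g w z)\<^sup>2)"
      "\<And>z. z \<in> space m \<Longrightarrow> (\<integral>w. (g w z)\<^sup>2 \<partial>N) \<le> (\<sigma> z)\<^sup>2"
    and \<sigma>: "integrable m \<sigma>" "\<And>z. 0 \<le> \<sigma> z"
    and s: "s \<in> borel_measurable m" "\<And>z. \<bar>s z\<bar> \<le> 1"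
  shows "(\<integral>w. (\<integral>z. s z * g w z \<partial>m) \<partial>N) = (\<integral>z. s z * (\<integral>w. g w z \<partial>N) \<partial>m)"
    and "integrable N (\<lambda>w. (\<integral>z. s z * g w z \<partial>m)\<^sup>2)"
    and "(\<integral>w. (\<integral>z. s z * g w z \<partial>m)\<^sup>2 \<partial>N)
       = (\<integral>p. s (fst p) * s (snd p) * (\<integral>w. g w (fst p) * g w (snd p) \<partial>N) \<partial>(m \<Otimes>\<^sub>M m))"
proof -
  interpret N: prob_space N by fact
  interpret m: sigma_finite_measure m by fact
  interpret mm: pair_sigma_finite m m ..
  interpret Nm: pair_sigma_finite N m ..
  interpret S: sigma_finite_measure "m \<Otimes>\<^sub>M m" ..
  interpret Nmm: pair_sigma_finite N "m \<Otimes>\<^sub>M m" ..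
  have [measurable]: "\<sigma> \<in> borel_measurable m" using \<sigma> by auto
  note [measurable] = s(1)
  have gmeas [measurable (raw)]: "(\<lambda>x. g (f x) (h x)) \<in> borel_measurable L" if "f \<in> L \<rightarrow>\<^sub>M N" "h \<in> L \<rightarrow>\<^sub>M m" for L f h
    using measurable_compose[OF measurable_Pair[OF that] gm] by simp
  have gz: "(\<lambda>w. g w z) \<in> borel_measurable N" if "z \<in> space m" for z
    using that by measurable
  have sb: "\<bar>s z * x\<bar> \<le> \<bar>x\<bar>" for z x
    using mult_right_mono[OF s(2)[of z], of "\<bar>x\<bar>"] by (simp add: abs_mult)
  have si: "integrable m (\<lambda>z. s z * g w z)" if "w \<in> space N" for w
    by (rule Bochner_Integration.integrable_bound[OF gi[OF that]]) (use that sb in auto)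
  have E1: "integrable N (\<lambda>w. g w z)" "(\<integral>w. \<bar>g w z\<bar> \<partial>N) \<le> \<sigma> z" if "z \<in> space m" for z
    using N.integral_abs_le_sqrt[OF g2(1) gz g2(2) \<sigma>(2)] that by auto
  have E2: "integrable N (\<lambda>w. g w z * g w z')" "(\<integral>w. \<bar>g w z * g w z'\<bar> \<partial>N) \<le> \<sigma> z * \<sigma> z'"
    if "z \<in> space m" "z' \<in> space m" for z z'
    using N.integral_abs_mult_le[OF gz gz g2(1) g2(1) g2(2) g2(2) \<sigma>(2) \<sigma>(2)] that by auto
  have int1: "integrable (N \<Otimes>\<^sub>M m) (\<lambda>(w, z). s z * g w z)"
  proof (rule integrableI_bounded)
    have "(\<integral>\<^sup>+p. ennreal (norm (case p of (w, z) \<Rightarrow> s z * g w z)) \<partial>(N \<Otimes>\<^sub>M m))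
       = (\<integral>\<^sup>+z. \<integral>\<^sup>+w. ennreal \<bar>s z * g w z\<bar> \<partial>N \<partial>m)"
      by (subst Nm.nn_integral_snd[symmetric]) (simp_all add: split_beta')
    also have "\<dots> \<le> (\<integral>\<^sup>+z. ennreal (\<sigma> z) \<partial>m)"
    proof (rule nn_integral_mono)
      fix z assume z: "z \<in> space m"
      have "(\<integral>\<^sup>+w. ennreal \<bar>s z * g w z\<bar> \<partial>N) \<le> (\<integral>\<^sup>+w. ennreal \<bar>g w z\<bar> \<partial>N)"
        by (intro nn_integral_mono ennreal_leI sb)
      also have "\<dots> = ennreal (\<integral>w. \<bar>g w z\<bar> \<partial>N)"
        using E1[OF z] by (intro nn_integral_eq_integral) auto
      also have "\<dots> \<le> ennreal (\<sigma> z)" using E1[OF z] by (intro ennreal_leI)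
      finally show "(\<integral>\<^sup>+w. ennreal \<bar>s z * g w z\<bar> \<partial>N) \<le> ennreal (\<sigma> z)" .
    qed
    also have "\<dots> < \<infinity>"
      using \<sigma> by (subst nn_integral_eq_integral) auto
    finally show "(\<integral>\<^sup>+p. ennreal (norm (case p of (w, z) \<Rightarrow> s z * g w z)) \<partial>(N \<Otimes>\<^sub>M m)) < \<infinity>" .
  qed measurable
  have "(\<integral>w. (\<integral>z. s z * g w z \<partial>m) \<partial>N) = (\<integral>z. \<integral>w. s z * g w z \<partial>N \<partial>m)"
    by (rule Nm.Fubini_integral[OF int1, symmetric])
  then show "(\<integral>w. (\<integral>z. s z * g w z \<partial>m) \<partial>N) = (\<integral>z. s z * (\<integral>w. g w z \<partial>N) \<partial>m)"
    by simp
  let ?f = "\<lambda>w p. s (fst p) * s (snd p) * (g w (fst p) * g w (snd p))"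
  have fb: "\<bar>?f w p\<bar> \<le> \<bar>g w (fst p) * g w (snd p)\<bar>" for w p
    using sb[of "fst p" "s (snd p) * (g w (fst p) * g w (snd p))"] sb[of "snd p" "g w (fst p) * g w (snd p)"]
    by (simp add: mult.assoc)
  have \<sigma>\<sigma>: "(\<integral>\<^sup>+p. ennreal (\<sigma> (fst p) * \<sigma> (snd p)) \<partial>(m \<Otimes>\<^sub>M m)) < \<infinity>"
  proof -
    have "(\<integral>\<^sup>+p. ennreal (\<sigma> (fst p) * \<sigma> (snd p)) \<partial>(m \<Otimes>\<^sub>M m)) = (\<integral>\<^sup>+z. \<integral>\<^sup>+z'. ennreal (\<sigma> z) * ennreal (\<sigma> z') \<partial>m \<partial>m)"
      using \<sigma>(2) by (subst m.nn_integral_fst[symmetric]) (simp_all add: ennreal_mult)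
    also have "\<dots> = (\<integral>\<^sup>+z. ennreal (\<sigma> z) \<partial>m) * (\<integral>\<^sup>+z. ennreal (\<sigma> z) \<partial>m)"
      by (simp add: nn_integral_cmult nn_integral_multc)
    also have "\<dots> < \<infinity>"
      using \<sigma> by (simp add: nn_integral_eq_integral ennreal_mult_less_top)
    finally show ?thesis .
  qed
  have int2: "integrable (N \<Otimes>\<^sub>M (m \<Otimes>\<^sub>M m)) (\<lambda>(w, p). ?f w p)"
  proof (rule integrableI_bounded)
    have "(\<integral>\<^sup>+q. ennreal (norm (case q of (w, p) \<Rightarrow> ?f w p)) \<partial>(N \<Otimes>\<^sub>M (m \<Otimes>\<^sub>M m)))
       = (\<integral>\<^sup>+p. \<integral>\<^sup>+w. ennreal \<bar>?f w p\<bar> \<partial>N \<partial>(m \<Otimes>\<^sub>M m))"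
      by (subst Nmm.nn_integral_snd[symmetric]) (simp_all add: split_beta')
    also have "\<dots> \<le> (\<integral>\<^sup>+p. ennreal (\<sigma> (fst p) * \<sigma> (snd p)) \<partial>(m \<Otimes>\<^sub>M m))"
    proof (rule nn_integral_mono)
      fix p assume "p \<in> space (m \<Otimes>\<^sub>M m)"
      then have p: "fst p \<in> space m" "snd p \<in> space m" by (auto simp: space_pair_measure)
      have "(\<integral>\<^sup>+w. ennreal \<bar>?f w p\<bar> \<partial>N) \<le> (\<integral>\<^sup>+w. ennreal \<bar>g w (fst p) * g w (snd p)\<bar> \<partial>N)"
        by (intro nn_integral_mono ennreal_leI fb)
      also have "\<dots> = ennreal (\<integral>w. \<bar>g w (fst p) * g w (snd p)\<bar> \<partial>N)"
        by (intro nn_integral_eq_integral integrable_abs E2 p) auto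
      also have "\<dots> \<le> ennreal (\<sigma> (fst p) * \<sigma> (snd p))"
        by (intro ennreal_leI E2 p)
      finally show "(\<integral>\<^sup>+w. ennreal \<bar>?f w p\<bar> \<partial>N) \<le> ennreal (\<sigma> (fst p) * \<sigma> (snd p))" .
    qed
    also note \<sigma>\<sigma>
    finally show "(\<integral>\<^sup>+q. ennreal (norm (case q of (w, p) \<Rightarrow> ?f w p)) \<partial>(N \<Otimes>\<^sub>M (m \<Otimes>\<^sub>M m))) < \<infinity>" .
  qed measurable
  have sq: "(\<integral>p. ?f w p \<partial>(m \<Otimes>\<^sub>M m)) = (\<integral>z. s z * g w z \<partial>m)\<^sup>2" if w: "w \<in> space N" for w
  proof -
    define F where "F z = s z * g w z" for z
    have F: "integrable m F" using si[OF w] by (simp add: F_def[abs_def])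
    have [measurable]: "F \<in> borel_measurable m" using F by auto
    have i: "integrable (m \<Otimes>\<^sub>M m) (\<lambda>(z, z'). F z * F z')"
    proof (rule mm.Fubini_integrable)
      show "(\<lambda>(z, z'). F z * F z') \<in> borel_measurable (m \<Otimes>\<^sub>M m)"
        by measurable
      show "integrable m (\<lambda>z. \<integral>z'. norm (case (z, z') of (z, z') \<Rightarrow> F z * F z') \<partial>m)"
        using F by (simp add: abs_mult)
      show "AE z in m. integrable m (\<lambda>z'. case (z, z') of (z, z') \<Rightarrow> F z * F z')"
        using F by simp
    qed
    have "(\<integral>p. ?f w p \<partial>(m \<Otimes>\<^sub>M m)) = (\<integral>p. (case p of (z, z') \<Rightarrow> F z * F z') \<partial>(m \<Otimes>\<^sub>M m))"
      by (intro Bochner_Integration.integral_cong) (auto simp: F_def split_beta' ac_simps)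
    also have "\<dots> = (\<integral>z. \<integral>z'. F z * F z' \<partial>m \<partial>m)"
      using mm.integral_fst'[OF i] by simp
    also have "\<dots> = (\<integral>z. s z * g w z \<partial>m)\<^sup>2"
      by (simp add: power2_eq_square F_def)
    finally show ?thesis .
  qed
  have "integrable N (\<lambda>w. \<integral>p. ?f w p \<partial>(m \<Otimes>\<^sub>M m))"
    using Nmm.integrable_fst'[OF int2] by simp
  moreover have "integrable N (\<lambda>w. \<integral>p. ?f w p \<partial>(m \<Otimes>\<^sub>M m)) \<longleftrightarrow> integrable N (\<lambda>w. (\<integral>z. s z * g w z \<partial>m)\<^sup>2)"
    by (intro Bochner_Integration.integrable_cong refl sq)
  ultimately show "integrable N (\<lambda>w. (\<integral>z. s z * g w z \<partial>m)\<^sup>2)"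
    by (simp only:)
  have "(\<integral>w. (\<integral>z. s z * g w z \<partial>m)\<^sup>2 \<partial>N) = (\<integral>w. \<integral>p. ?f w p \<partial>(m \<Otimes>\<^sub>M m) \<partial>N)"
    by (intro Bochner_Integration.integral_cong) (simp_all add: sq)
  also have "\<dots> = (\<integral>p. \<integral>w. ?f w p \<partial>N \<partial>(m \<Otimes>\<^sub>M m))"
    by (rule Nmm.Fubini_integral[OF int2, symmetric])
  finally show "(\<integral>w. (\<integral>z. s z * g w z \<partial>m)\<^sup>2 \<partial>N)
       = (\<integral>p. s (fst p) * s (snd p) * (\<integral>w. g w (fst p) * g w (snd p) \<partial>N) \<partial>(m \<Otimes>\<^sub>M m))"
    by simp
qed

lemma borel_prob_influence_moments:
  fixes \<mu> :: "'a::euclidean_space measure"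
  assumes "borel_prob_space \<mu>" "integrable \<mu> norm" "integrable slices (slice_sd \<mu>)"
    and s: "s \<in> borel_measurable slices" "\<And>z. \<bar>s z\<bar> \<le> 1"
  shows "integrable \<mu> (\<lambda>x. (\<integral>z. s z * centered_halfspace \<mu> x z \<partial>slices)\<^sup>2)"
    and "(\<integral>x. (\<integral>z. s z * centered_halfspace \<mu> x z \<partial>slices) \<partial>\<mu>) = 0"
    and "(\<integral>x. (\<integral>z. s z * centered_halfspace \<mu> x z \<partial>slices)\<^sup>2 \<partial>\<mu>)
      = (\<integral>p. s (fst p) * s (snd p) *
          (\<integral>x. centered_halfspace \<mu> x (fst p) * centered_halfspace \<mu> x (snd p) \<partial>\<mu>) \<partial>(slices \<Otimes>\<^sub>M slices))"
proof -
  interpret borel_prob_space \<mu> by fact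
  have m: "case_prod (centered_halfspace \<mu>) \<in> borel_measurable (\<mu> \<Otimes>\<^sub>M slices)"
    unfolding split_beta' by measurable
  have i2: "integrable \<mu> (\<lambda>x. (centered_halfspace \<mu> x z)\<^sup>2)" for z
  proof (rule integrable_const_bound[where B=1])
    show "AE x in \<mu>. norm ((centered_halfspace \<mu> x z)\<^sup>2) \<le> 1"
      using centered_halfspace_bound[of _ z] by (intro AE_I2) (simp add: abs_square_le_1)
  qed measurable
  note F = second_moment_of_integral[OF prob_space_axioms sigma_finite_slices m centered_halfspace_L1(1)[OF assms(2)] i2
      eq_refl[OF integral_centered_halfspace_power2] assms(3) slice_sd_nonneg s]
  show "integrable \<mu> (\<lambda>x. (\<integral>z. s z * centered_halfspace \<mu> x z \<partial>slices)\<^sup>2)" by (rule F(2))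
  show "(\<integral>x. (\<integral>z. s z * centered_halfspace \<mu> x z \<partial>slices) \<partial>\<mu>) = 0"
    unfolding F(1) integral_centered_halfspace by simp
  show "(\<integral>x. (\<integral>z. s z * centered_halfspace \<mu> x z \<partial>slices)\<^sup>2 \<partial>\<mu>)
      = (\<integral>p. s (fst p) * s (snd p) *
          (\<integral>x. centered_halfspace \<mu> x (fst p) * centered_halfspace \<mu> x (snd p) \<partial>\<mu>) \<partial>(slices \<Otimes>\<^sub>M slices))"
    by (rule F(3))
qed

text \<open>The Gaussian process and the kernel have the same mean and covariance, so \<open>second_moment_of_integral\<close> yields
the same number for both.\<close>

theorem variance_integral_projection_process:
  fixes \<mu> :: "'a::euclidean_space measure"
  assumes G: "projection_process P \<mu> G"
    and \<mu>: "borel_prob_space \<mu>" "integrable \<mu> norm" "integrable slices (slice_sd \<mu>)"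
    and s: "s \<in> borel_measurable slices" "\<And>z. \<bar>s z\<bar> \<le> 1"
  shows "prob_space.variance P (\<lambda>\<omega>. \<integral>z. s z * G z \<omega> \<partial>slices)
    = (\<integral>x. (\<integral>z. s z * centered_halfspace \<mu> x z \<partial>slices)\<^sup>2 \<partial>\<mu>)"
proof -
  interpret P: prob_space P using G by (simp add: projection_process_def)
  interpret borel_prob_space \<mu> by fact
  have Gm: "case_prod (\<lambda>\<omega> z. G z \<omega>) \<in> borel_measurable (P \<Otimes>\<^sub>M slices)"
    and Gi: "\<And>\<omega>. \<omega> \<in> space P \<Longrightarrow> integrable slices (\<lambda>z. G z \<omega>)"
    and Gn: "\<And>K c. finite K \<Longrightarrow> K \<subseteq> UNIV \<times> sphere 0 1 \<Longrightarrow> \<exists>v\<ge>0. distr P borel (\<lambda>\<omega>. \<Sum>z\<in>K. c z * G z \<omega>) = centered_normal v"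
    and Gc: "\<And>t r \<theta> \<phi>. \<theta> \<in> sphere 0 1 \<Longrightarrow> \<phi> \<in> sphere 0 1 \<Longrightarrow> covariance P (G (t, \<theta>)) (G (r, \<phi>)) =
          measure \<mu> {x. \<theta> \<bullet> x \<le> t \<and> \<phi> \<bullet> x \<le> r} - proj_cdf \<mu> t \<theta> * proj_cdf \<mu> r \<phi>"
    using G unfolding projection_process_def by auto
  have sp: "z \<in> space slices \<longleftrightarrow> snd z \<in> sphere 0 1" for z :: "real \<times> 'a"
    by (cases z) (auto simp: space_pair_measure space_uniform_sphere)
  have Gz: "G z \<in> borel_measurable P" if "z \<in> space slices" for z
    using measurable_compose[OF measurable_Pair2'[OF that, of P] Gm] by simp
  have mom: "integrable P (\<lambda>\<omega>. (G z \<omega>)\<^sup>2)" "(\<integral>\<omega>. G z \<omega> \<partial>P) = 0" if z: "z \<in> space slices" for z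
  proof -
    have "snd z \<in> sphere 0 1" using z sp by blast
    then have "(fst z, snd z) \<in> UNIV \<times> sphere 0 1" by (intro SigmaI UNIV_I)
    then have "{z} \<subseteq> UNIV \<times> sphere 0 1" unfolding prod.collapse by blast
    from Gn[OF _ this, of "\<lambda>_. 1"] obtain v where v: "v \<ge> 0" and d: "distr P borel (G z) = centered_normal v"
      by auto
    have "integrable (distr P borel (G z)) (\<lambda>x. x\<^sup>2)" "integral\<^sup>L (distr P borel (G z)) (\<lambda>x. x) = 0"
      unfolding d by (rule centered_normal_moments[OF v])+
    then show "integrable P (\<lambda>\<omega>. (G z \<omega>)\<^sup>2)" "(\<integral>\<omega>. G z \<omega> \<partial>P) = 0"
      using Gz[OF z] by (auto simp: integrable_distr_eq integral_distr)
  qed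
  have cov: "(\<integral>\<omega>. G z \<omega> * G z' \<omega> \<partial>P) = (\<integral>x. centered_halfspace \<mu> x z * centered_halfspace \<mu> x z' \<partial>\<mu>)"
    if z: "z \<in> space slices" and z': "z' \<in> space slices" for z z'
  proof -
    obtain t \<theta> r \<phi> where e: "z = (t, \<theta>)" "z' = (r, \<phi>)" by (cases z, cases z')
    have "\<theta> \<in> sphere 0 1" "\<phi> \<in> sphere 0 1" using z z' by (auto simp: sp e)
    from Gc[OF this, of t r] show ?thesis
      using mom(2)[OF z] mom(2)[OF z'] by (simp add: covariance_def e integral_centered_halfspace_mult)
  qed
  have G2: "(\<integral>\<omega>. (G z \<omega>)\<^sup>2 \<partial>P) \<le> (slice_sd \<mu> z)\<^sup>2" if "z \<in> space slices" for z
    using cov[OF that that] integral_centered_halfspace_power2[of z] by (simp add: power2_eq_square)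
  note F = second_moment_of_integral[OF P.prob_space_axioms sigma_finite_slices Gm Gi mom(1) G2 \<mu>(3) slice_sd_nonneg s]
  have mean: "(\<integral>\<omega>. (\<integral>z. s z * G z \<omega> \<partial>slices) \<partial>P) = 0"
  proof -
    have "(\<integral>\<omega>. (\<integral>z. s z * G z \<omega> \<partial>slices) \<partial>P) = (\<integral>z. s z * (\<integral>\<omega>. G z \<omega> \<partial>P) \<partial>slices)"
      by (rule F(1))
    also have "\<dots> = (\<integral>z. 0 \<partial>(slices :: (real \<times> 'a) measure))"
      by (intro Bochner_Integration.integral_cong) (simp_all add: mom)
    finally show ?thesis by simp
  qed
  have "P.variance (\<lambda>\<omega>. \<integral>z. s z * G z \<omega> \<partial>slices) = (\<integral>\<omega>. (\<integral>z. s z * G z \<omega> \<partial>slices)\<^sup>2 \<partial>P)"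
    by (simp add: mean)
  also have "\<dots> = (\<integral>p. s (fst p) * s (snd p) * (\<integral>\<omega>. G (fst p) \<omega> * G (snd p) \<omega> \<partial>P) \<partial>(slices \<Otimes>\<^sub>M slices))"
    by (rule F(3))
  also have "\<dots> = (\<integral>p. s (fst p) * s (snd p) *
          (\<integral>x. centered_halfspace \<mu> x (fst p) * centered_halfspace \<mu> x (snd p) \<partial>\<mu>) \<partial>(slices \<Otimes>\<^sub>M slices))"
    by (intro Bochner_Integration.integral_cong) (auto simp: cov space_pair_measure)
  also have "\<dots> = (\<integral>x. (\<integral>z. s z * centered_halfspace \<mu> x z \<partial>slices)\<^sup>2 \<partial>\<mu>)"
    by (rule borel_prob_influence_moments(3)[OF \<mu> s, symmetric])
  finally show ?thesis .
qed

section \<open>Efficiency bounds\<close>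

lemma L2_cauchy_schwarz:
  fixes f g :: "'a \<Rightarrow> real"
  assumes "prob_space Q" "f \<in> L2_fun Q" "g \<in> L2_fun Q"
  shows "integrable Q (\<lambda>x. f x * g x)" "\<bar>\<integral>x. f x * g x \<partial>Q\<bar> \<le> L2_nrm Q f * L2_nrm Q g"
proof -
  interpret prob_space Q by fact
  have f: "f \<in> borel_measurable Q" "integrable Q (\<lambda>x. (f x)\<^sup>2)" and g: "g \<in> borel_measurable Q" "integrable Q (\<lambda>x. (g x)\<^sup>2)"
    using assms by (auto simp: L2_fun_def)
  have n: "(\<integral>x. (h x)\<^sup>2 \<partial>Q) = (L2_nrm Q h)\<^sup>2" "0 \<le> L2_nrm Q h" for h
    by (simp_all add: L2_nrm_def)
  note C = integral_abs_mult_le[OF f(1) g(1) f(2) g(2) eq_refl[OF n(1)] eq_refl[OF n(1)] n(2) n(2)]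
  show "integrable Q (\<lambda>x. f x * g x)" by (rule C(1))
  show "\<bar>\<integral>x. f x * g x \<partial>Q\<bar> \<le> L2_nrm Q f * L2_nrm Q g"
    using integral_abs_bound[of Q "\<lambda>x. f x * g x"] C(2) by linarith
qed

lemma continuous_linear_functional_L2_integral:
  assumes "prob_space Q" "\<phi> \<in> L2_fun Q"
  shows "continuous_linear_functional_L2 Q (\<lambda>f. \<integral>x. \<phi> x * f x \<partial>Q)"
  unfolding continuous_linear_functional_L2_def
proof (intro conjI ballI allI exI)
  fix f g assume "f \<in> L2_fun Q" "g \<in> L2_fun Q"
  then show "(\<integral>x. \<phi> x * (f x + g x) \<partial>Q) = (\<integral>x. \<phi> x * f x \<partial>Q) + (\<integral>x. \<phi> x * g x \<partial>Q)"
    using L2_cauchy_schwarz(1)[OF assms] by (simp add: distrib_left)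
next
  fix c f
  show "(\<integral>x. \<phi> x * (c * f x) \<partial>Q) = c * (\<integral>x. \<phi> x * f x \<partial>Q)"
    by (simp add: mult.left_commute)
next
  fix f assume "f \<in> L2_fun Q"
  then show "\<bar>\<integral>x. \<phi> x * f x \<partial>Q\<bar> \<le> L2_nrm Q \<phi> * L2_nrm Q f"
    by (rule L2_cauchy_schwarz(2)[OF assms])
qed

text \<open>By the Cauchy--Schwarz inequality the supremum is at most the squared norm of \<open>\<phi>\<close>.  The functions \<open>g j\<close>
approximate \<open>\<phi>\<close> in the sense that the quotient at \<open>g j\<close> is at least \<open>q j\<close>.\<close>

lemma efficiency_bound_eq_norm:
  fixes \<phi> :: "'a \<Rightarrow> real"
  assumes Q: "prob_space Q" and \<phi>: "\<phi> \<in> L2_fun Q" and H: "H \<subseteq> L2_fun Q"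
    and g: "\<And>j :: nat. g j \<in> H" "\<And>j. (\<integral>x. \<phi> x * g j x \<partial>Q) = q j" "\<And>j. (\<integral>x. (g j x)\<^sup>2 \<partial>Q) \<le> q j"
      "q \<longlonglongrightarrow> (\<integral>x. (\<phi> x)\<^sup>2 \<partial>Q)"
  shows "ennreal (\<integral>x. (\<phi> x)\<^sup>2 \<partial>Q)
    = (SUP h\<in>{h \<in> H. L2_nrm Q h \<noteq> 0}. ennreal ((\<integral>x. \<phi> x * h x \<partial>Q)\<^sup>2 / (L2_nrm Q h)\<^sup>2))" (is "_ = ?S")
proof (rule antisym)
  have "ennreal (q j) \<le> ?S" for j
  proof (cases "L2_nrm Q (g j) = 0")
    case True
    then have "q j = 0"
      using L2_cauchy_schwarz(2)[OF Q \<phi>, of "g j"] g(1)[of j] H g(2)[of j] by auto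
    then show ?thesis by simp
  next
    case False
    have n: "(\<integral>x. (g j x)\<^sup>2 \<partial>Q) = (L2_nrm Q (g j))\<^sup>2" by (simp add: L2_nrm_def)
    have n0: "(L2_nrm Q (g j))\<^sup>2 > 0" using False by simp
    then have q0: "q j > 0" using g(3)[of j] n by linarith
    have "q j * (L2_nrm Q (g j))\<^sup>2 \<le> q j * q j"
      using g(3)[of j] q0 n by (intro mult_left_mono) auto
    then have "q j \<le> (q j)\<^sup>2 / (L2_nrm Q (g j))\<^sup>2"
      using n0 by (simp add: le_divide_eq power2_eq_square)
    then have "ennreal (q j) \<le> ennreal ((\<integral>x. \<phi> x * g j x \<partial>Q)\<^sup>2 / (L2_nrm Q (g j))\<^sup>2)"
      unfolding g(2) by (rule ennreal_leI)
    also have "\<dots> \<le> ?S"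
      using False g(1) by (intro SUP_upper) auto
    finally show ?thesis .
  qed
  then show "ennreal (\<integral>x. (\<phi> x)\<^sup>2 \<partial>Q) \<le> ?S"
    by (intro LIMSEQ_le_const2[OF tendsto_ennrealI[OF g(4)]]) auto
  show "?S \<le> ennreal (\<integral>x. (\<phi> x)\<^sup>2 \<partial>Q)"
  proof (rule SUP_least)
    fix h assume h: "h \<in> {h \<in> H. L2_nrm Q h \<noteq> 0}"
    then have "\<bar>\<integral>x. \<phi> x * h x \<partial>Q\<bar> \<le> L2_nrm Q \<phi> * L2_nrm Q h"
      using H by (intro L2_cauchy_schwarz(2)[OF Q \<phi>]) auto
    then have "\<bar>\<integral>x. \<phi> x * h x \<partial>Q\<bar>\<^sup>2 \<le> (L2_nrm Q \<phi> * L2_nrm Q h)\<^sup>2"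
      by (intro power_mono) auto
    then have "(\<integral>x. \<phi> x * h x \<partial>Q)\<^sup>2 / (L2_nrm Q h)\<^sup>2 \<le> (L2_nrm Q \<phi>)\<^sup>2"
      using h by (simp add: divide_le_eq power_mult_distrib)
    also have "\<dots> = (\<integral>x. (\<phi> x)\<^sup>2 \<partial>Q)" by (simp add: L2_nrm_def)
    finally show "ennreal ((\<integral>x. \<phi> x * h x \<partial>Q)\<^sup>2 / (L2_nrm Q h)\<^sup>2) \<le> ennreal (\<integral>x. (\<phi> x)\<^sup>2 \<partial>Q)"
      by (rule ennreal_leI)
  qed
qed

text \<open>The function \<open>g j\<close> is \<open>\<phi>\<close>, truncated and centered again.  As \<open>\<phi>\<close> has mean \<open>0\<close>, centering does not change
the pairing with \<open>\<phi>\<close>, while it does not increase the norm.\<close>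

lemma (in borel_prob_space) truncated_tangent:
  fixes \<phi> :: "'a \<Rightarrow> real"
  assumes \<phi>: "\<phi> \<in> borel_measurable \<mu>" "integrable \<mu> (\<lambda>x. (\<phi> x)\<^sup>2)" "(\<integral>x. \<phi> x \<partial>\<mu>) = 0"
  obtains g q where "\<And>j :: nat. g j \<in> tangent_set \<mu>" "\<And>j. (\<integral>x. \<phi> x * g j x \<partial>\<mu>) = q j"
    "\<And>j. (\<integral>x. (g j x)\<^sup>2 \<partial>\<mu>) \<le> q j" "q \<longlonglongrightarrow> (\<integral>x. (\<phi> x)\<^sup>2 \<partial>\<mu>)"
proof -
  have m [measurable]: "\<phi> \<in> borel_measurable borel"
    using \<phi>(1) by (simp add: measurable_cong_sets[OF sets_eq_borel refl])
  have \<phi>1: "integrable \<mu> \<phi>" by (rule square_integrable_imp_integrable[OF \<phi>(1,2)])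
  define t where "t j x = (if \<bar>\<phi> x\<bar> \<le> real j then \<phi> x else 0)" for j x
  have tb: "\<bar>t j x\<bar> \<le> real j" for j x by (simp add: t_def)
  have [measurable]: "t j \<in> borel_measurable borel" for j unfolding t_def by measurable
  have ti: "integrable \<mu> (t j)" for j using tb by (intro integrable_const_bound[where B="real j"]) auto
  have t2b: "(t j x)\<^sup>2 \<le> (\<phi> x)\<^sup>2" for j x by (simp add: t_def)
  have t2: "integrable \<mu> (\<lambda>x. (t j x)\<^sup>2)" for j
    by (rule Bochner_Integration.integrable_bound[OF \<phi>(2)]) (use t2b in auto)
  have pt: "\<phi> x * t j x = (t j x)\<^sup>2" for j x by (simp add: t_def power2_eq_square)
  define c where "c j = (\<integral>x. t j x \<partial>\<mu>)" for j
  define g where "g j x = t j x - c j" for j x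
  define q where "q j = (\<integral>x. (t j x)\<^sup>2 \<partial>\<mu>)" for j
  show thesis
  proof (rule that[of g q])
    fix j
    have "\<bar>g j x\<bar> \<le> real j + \<bar>c j\<bar>" for x using tb[of j x] by (simp add: g_def)
    then have "bounded (range (g j))" by (intro boundedI[where B="real j + \<bar>c j\<bar>"]) auto
    moreover have "g j \<in> borel_measurable borel"
      unfolding g_def[abs_def] by measurable
    moreover have "(\<integral>x. g j x \<partial>\<mu>) = 0"
      using ti by (simp add: g_def c_def prob_space)
    ultimately show "g j \<in> tangent_set \<mu>"
      by (simp only: tangent_set_def mem_Collect_eq simp_thms)
    show "(\<integral>x. \<phi> x * g j x \<partial>\<mu>) = q j"
      using t2[of j] \<phi>1 \<phi>(3) by (simp add: g_def right_diff_distrib pt q_def)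
    have "(\<integral>x. (g j x)\<^sup>2 \<partial>\<mu>) = (\<integral>x. (t j x)\<^sup>2 \<partial>\<mu>) - (c j)\<^sup>2"
      unfolding g_def c_def by (rule variance_eq[OF ti t2])
    then show "(\<integral>x. (g j x)\<^sup>2 \<partial>\<mu>) \<le> q j" by (simp add: q_def)
  next
    show "q \<longlonglongrightarrow> (\<integral>x. (\<phi> x)\<^sup>2 \<partial>\<mu>)"
      unfolding q_def
    proof (rule integral_dominated_convergence[OF _ _ \<phi>(2)])
      show "AE x in \<mu>. (\<lambda>j. (t j x)\<^sup>2) \<longlonglongrightarrow> (\<phi> x)\<^sup>2"
      proof (rule AE_I2, rule tendsto_eventually, rule eventually_sequentiallyI)
        fix x j assume "nat \<lceil>\<bar>\<phi> x\<bar>\<rceil> \<le> j"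
        then have "\<bar>\<phi> x\<bar> \<le> real j" using real_nat_ceiling_ge[of "\<bar>\<phi> x\<bar>"] by linarith
        then show "(t j x)\<^sup>2 = (\<phi> x)\<^sup>2" by (simp add: t_def)
      qed
    qed (use t2b in auto)
  qed
qed

text \<open>The condition \<open>t * B \<le> 1\<close> makes the density nonnegative.  As \<open>h\<close> has mean \<open>0\<close>, the half-spaces may be centered
in the derivative.\<close>

lemma (in borel_prob_space) perturbation:
  fixes h :: "'a \<Rightarrow> real"
  assumes h: "h \<in> tangent_set \<mu>" and B: "\<And>x. \<bar>h x\<bar> \<le> B" and t: "0 \<le> t" "t * B \<le> 1" and n1: "integrable \<mu> norm"
  shows "borel_prob_space (perturb \<mu> t h)" and "integrable (perturb \<mu> t h) norm"
    and "slice_cdf (perturb \<mu> t h) z = slice_cdf \<mu> z + t * (\<integral>x. h x * centered_halfspace \<mu> x z \<partial>\<mu>)"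
proof -
  have [measurable]: "h \<in> borel_measurable borel" and h0: "(\<integral>x. h x \<partial>\<mu>) = 0"
    using h by (auto simp: tangent_set_def)
  have nn: "0 \<le> 1 + t * h x" for x
  proof -
    have "\<bar>t * h x\<bar> \<le> t * B" using t B[of x] by (simp add: abs_mult mult_left_mono)
    then show ?thesis using t by linarith
  qed
  have B0: "B \<ge> 0" using B[of undefined] by linarith
  have hi: "integrable \<mu> h" using B by (intro integrable_const_bound[where B=B]) auto
  have hfi: "integrable \<mu> (\<lambda>x. h x * f x)" if "integrable \<mu> f" for f
  proof (rule Bochner_Integration.integrable_bound)
    show "integrable \<mu> (\<lambda>x. B * f x)" using that by simp
    show "AE x in \<mu>. norm (h x * f x) \<le> norm (B * f x)"
      using B B0 by (intro AE_I2) (simp add: abs_mult mult_right_mono)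
  qed (use that in auto)
  have s: "sets (perturb \<mu> t h) = sets borel" by (simp add: perturb_def)
  have "emeasure (perturb \<mu> t h) (space (perturb \<mu> t h)) = (\<integral>\<^sup>+x. ennreal (1 + t * h x) \<partial>\<mu>)"
    by (simp add: perturb_def emeasure_density)
  also have "\<dots> = ennreal (\<integral>x. 1 + t * h x \<partial>\<mu>)"
    using hi nn by (intro nn_integral_eq_integral) auto
  also have "\<dots> = 1" using hi h0 by (simp add: prob_space)
  finally have "prob_space (perturb \<mu> t h)" by (rule prob_spaceI)
  with s show BP: "borel_prob_space (perturb \<mu> t h)"
    by (simp add: borel_prob_space_def borel_prob_space_axioms_def)
  show "integrable (perturb \<mu> t h) norm"
    unfolding perturb_def using nn n1 hfi[OF n1]
    by (subst integrable_density) (auto simp: distrib_right mult.assoc)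
  interpret p: borel_prob_space "perturb \<mu> t h" by (rule BP)
  have "slice_cdf (perturb \<mu> t h) z = (\<integral>x. halfspace x z \<partial>perturb \<mu> t h)"
    by (rule p.slice_cdf_eq_integral)
  also have "\<dots> = (\<integral>x. (1 + t * h x) * halfspace x z \<partial>\<mu>)"
    unfolding perturb_def using nn by (subst integral_density) auto
  also have "\<dots> = (\<integral>x. halfspace x z + t * (h x * centered_halfspace \<mu> x z) + t * slice_cdf \<mu> z * h x \<partial>\<mu>)"
    by (intro Bochner_Integration.integral_cong) (auto simp: centered_halfspace_def algebra_simps)
  also have "\<dots> = slice_cdf \<mu> z + t * (\<integral>x. h x * centered_halfspace \<mu> x z \<partial>\<mu>)"
  proof -
    have "integrable \<mu> (\<lambda>x. centered_halfspace \<mu> x z)" by (simp add: centered_halfspace_def)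
    from hfi[OF this] show ?thesis
      using hi h0 by (simp add: slice_cdf_eq_integral[of z])
  qed
  finally show "slice_cdf (perturb \<mu> t h) z = slice_cdf \<mu> z + t * (\<integral>x. h x * centered_halfspace \<mu> x z \<partial>\<mu>)" .
qed

text \<open>Where \<open>a z \<noteq> 0\<close>, the remainder vanishes for small \<open>t\<close>; elsewhere \<open>H z = 0\<close> because \<open>\<tau> z = 0\<close>.\<close>

lemma (in centered_kernel) directional_derivative:
  fixes H :: "'z \<Rightarrow> real"
  assumes H: "integrable m H" "AE z in m. \<bar>H z\<bar> \<le> B * \<tau> z"
  shows "((\<lambda>t. ((\<integral>z. \<bar>a z + t * H z\<bar> \<partial>m) - (\<integral>z. \<bar>a z\<bar> \<partial>m)) / t) \<longlongrightarrow> (\<integral>z. sgn (a z) * H z \<partial>m)) (at_right 0)"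
proof (rule tendsto_at_right_sequentially[of 0 1], simp)
  fix S :: "nat \<Rightarrow> real" assume S: "\<And>n. 0 < S n" "S \<longlonglongrightarrow> 0"
  have [measurable]: "H \<in> borel_measurable m" using H by auto
  let ?r = "\<lambda>n z. if \<bar>a z\<bar> \<le> \<bar>S n * H z\<bar> then 2 * \<bar>H z\<bar> else 0"
  have le: "\<bar>((\<integral>z. \<bar>a z + S n * H z\<bar> \<partial>m) - (\<integral>z. \<bar>a z\<bar> \<partial>m)) / S n - (\<integral>z. sgn (a z) * H z \<partial>m)\<bar> \<le> (\<integral>z. ?r n z \<partial>m)" for n
  proof -
    have i: "integrable m (\<lambda>z. S n * H z)" using H by simp
    define X where "X = (\<integral>z. \<bar>a z + S n * H z\<bar> \<partial>m) - (\<integral>z. \<bar>a z\<bar> \<partial>m)"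
    define Y where "Y = (\<integral>z. sgn (a z) * H z \<partial>m)"
    have "(\<integral>z. sgn (a z) * (S n * H z) \<partial>m) = S n * Y"
      by (simp add: Y_def mult.left_commute)
    moreover have "(\<integral>z. (if \<bar>a z\<bar> \<le> \<bar>S n * H z\<bar> then 2 * \<bar>S n * H z\<bar> else 0) \<partial>m) = S n * (\<integral>z. ?r n z \<partial>m)"
      unfolding integral_mult_right_zero[symmetric]
      using S(1)[of n] by (intro Bochner_Integration.integral_cong) (auto simp: abs_mult)
    ultimately have "\<bar>X - S n * Y\<bar> \<le> S n * (\<integral>z. ?r n z \<partial>m)"
      using L1_norm_expansion(1)[OF integrable_a i] by (simp add: X_def)
    moreover have "X / S n - Y = (X - S n * Y) / S n"
      using S(1)[of n] by (simp add: field_simps)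
    ultimately show ?thesis
      using S(1)[of n] unfolding X_def[symmetric] Y_def[symmetric] by (simp add: abs_divide divide_le_eq mult.commute)
  qed
  have "(\<lambda>n. \<integral>z. ?r n z \<partial>m) \<longlonglongrightarrow> (\<integral>z. 0 \<partial>m)"
  proof (rule integral_dominated_convergence[where w="\<lambda>z. 2 * \<bar>H z\<bar>"])
    show "AE z in m. (\<lambda>n. ?r n z) \<longlonglongrightarrow> 0"
      using nondegenerate H(2)
    proof eventually_elim
      case (elim z)
      show ?case
      proof (cases "a z = 0")
        case True
        then show ?thesis using elim by simp
      next
        case False
        have "(\<lambda>n. \<bar>S n * H z\<bar>) \<longlonglongrightarrow> 0"
          using tendsto_rabs_zero[OF tendsto_mult_left_zero[OF S(2), of "H z"]] .
        then have "eventually (\<lambda>n. \<bar>S n * H z\<bar> < \<bar>a z\<bar>) sequentially"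
          by (rule order_tendstoD(2)) (use False in simp)
        then have "eventually (\<lambda>n. ?r n z = 0) sequentially"
          by eventually_elim simp
        then show ?thesis by (rule tendsto_eventually)
      qed
    qed
  qed (use H in auto)
  then have lim: "(\<lambda>n. \<integral>z. ?r n z \<partial>m) \<longlonglongrightarrow> 0" by simp
  have "(\<lambda>n. ((\<integral>z. \<bar>a z + S n * H z\<bar> \<partial>m) - (\<integral>z. \<bar>a z\<bar> \<partial>m)) / S n - (\<integral>z. sgn (a z) * H z \<partial>m)) \<longlonglongrightarrow> 0"
    by (rule Lim_null_comparison[OF always_eventually lim]) (use le in simp)
  then show "(\<lambda>n. ((\<integral>z. \<bar>a z + S n * H z\<bar> \<partial>m) - (\<integral>z. \<bar>a z\<bar> \<partial>m)) / S n) \<longlonglongrightarrow> (\<integral>z. sgn (a z) * H z \<partial>m)"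
    by (rule LIM_zero_cancel)
qed

section \<open>Empirical measures and bootstrap laws\<close>

text \<open>This turns two independent bootstrap samples into one bootstrap sample of pairs.\<close>

lemma distr_zip_PiM:
  assumes I: "finite I" and "prob_space N1" "prob_space N2"
  shows "distr (PiM I (\<lambda>_. N1) \<Otimes>\<^sub>M PiM I (\<lambda>_. N2)) (PiM I (\<lambda>_. N1 \<Otimes>\<^sub>M N2)) (\<lambda>(f, g). \<lambda>i\<in>I. (f i, g i))
    = PiM I (\<lambda>_. N1 \<Otimes>\<^sub>M N2)"
proof -
  interpret N1: prob_space N1 by fact
  interpret N2: prob_space N2 by fact
  interpret N: pair_prob_space N1 N2 ..
  interpret P1: product_prob_space "\<lambda>_. N1" I ..
  interpret P2: product_prob_space "\<lambda>_. N2" I ..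
  interpret P: product_prob_space "\<lambda>_. N1 \<Otimes>\<^sub>M N2" I ..
  have zm: "(\<lambda>(f, g). \<lambda>i\<in>I. (f i, g i)) \<in> PiM I (\<lambda>_. N1) \<Otimes>\<^sub>M PiM I (\<lambda>_. N2) \<rightarrow>\<^sub>M PiM I (\<lambda>_. N1 \<Otimes>\<^sub>M N2)"
    unfolding split_beta' by (rule measurable_restrict) measurable
  show ?thesis
  proof (rule P.PiM_eqI[OF I])
    fix A assume A: "\<And>i. i \<in> I \<Longrightarrow> A i \<in> sets (N1 \<Otimes>\<^sub>M N2)"
    let ?z = "\<lambda>(f, g). \<lambda>i\<in>I. (f i, g i)"
    let ?P = "PiM I (\<lambda>_. N1) \<Otimes>\<^sub>M PiM I (\<lambda>_. N2)"
    have sf: "sigma_finite_measure (PiM I (\<lambda>_. N2))"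
      by (intro prob_space_imp_sigma_finite prob_space_PiM assms)
    interpret PP: pair_prob_space "PiM I (\<lambda>_. N1)" "PiM I (\<lambda>_. N2)" ..
    have AS: "PiE I A \<in> sets (PiM I (\<lambda>_. N1 \<Otimes>\<^sub>M N2))"
      using A I by (intro sets_PiM_I_finite) auto
    have im: "(\<lambda>p. \<Prod>i\<in>I. indicator (A i) (fst p i, snd p i) :: ennreal) \<in> borel_measurable ?P"
    proof (rule borel_measurable_prod_ennreal)
      fix i assume i: "i \<in> I"
      show "(\<lambda>p. indicator (A i) (fst p i, snd p i) :: ennreal) \<in> borel_measurable ?P"
        by (rule measurable_compose[where N="N1 \<Otimes>\<^sub>M N2" and g="indicator (A i)"]) (use A i in measurable)
    qed
    have prod_ind: "(\<Prod>i\<in>I. indicator (A i) (f i, g i) :: ennreal) = (if \<forall>i\<in>I. (f i, g i) \<in> A i then 1 else 0)" for f g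
      using I by (induction I rule: finite_induct) (auto simp: indicator_def)
    have "emeasure (distr ?P (PiM I (\<lambda>_. N1 \<Otimes>\<^sub>M N2)) ?z) (PiE I A) = (\<integral>\<^sup>+p. indicator (PiE I A) (?z p) \<partial>?P)"
      using AS by (subst nn_integral_distr[OF zm, symmetric]) auto
    also have "\<dots> = (\<integral>\<^sup>+p. (\<Prod>i\<in>I. indicator (A i) (fst p i, snd p i)) \<partial>?P)"
    proof (intro nn_integral_cong)
      fix p
      show "indicator (PiE I A) (?z p) = (\<Prod>i\<in>I. indicator (A i) (fst p i, snd p i) :: ennreal)"
        unfolding prod_ind by (auto simp: indicator_def PiE_def Pi_def split_beta')
    qed
    also have "\<dots> = (\<integral>\<^sup>+f. \<integral>\<^sup>+g. (\<Prod>i\<in>I. indicator (A i) (f i, g i)) \<partial>PiM I (\<lambda>_. N2) \<partial>PiM I (\<lambda>_. N1))"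
      by (subst sigma_finite_measure.nn_integral_fst[OF sf im, symmetric]) simp
    also have "\<dots> = (\<integral>\<^sup>+f. (\<Prod>i\<in>I. \<integral>\<^sup>+y. indicator (A i) (f i, y) \<partial>N2) \<partial>PiM I (\<lambda>_. N1))"
    proof (rule nn_integral_cong)
      fix f assume f: "f \<in> space (PiM I (\<lambda>_. N1))"
      show "(\<integral>\<^sup>+g. (\<Prod>i\<in>I. indicator (A i) (f i, g i)) \<partial>PiM I (\<lambda>_. N2)) = (\<Prod>i\<in>I. \<integral>\<^sup>+y. indicator (A i) (f i, y) \<partial>N2)"
      proof (rule P2.product_nn_integral_prod[OF I])
        fix i assume i: "i \<in> I"
        then have fi: "f i \<in> space N1" using f by (auto simp: space_PiM)
        show "(\<lambda>y. indicator (A i) (f i, y) :: ennreal) \<in> borel_measurable N2"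
          by (rule measurable_compose[OF measurable_Pair1'[OF fi]]) (use A[OF i] in simp)
      qed
    qed
    also have "\<dots> = (\<Prod>i\<in>I. \<integral>\<^sup>+x. \<integral>\<^sup>+y. indicator (A i) (x, y) \<partial>N2 \<partial>N1)"
    proof (rule P1.product_nn_integral_prod[OF I])
      fix i assume "i \<in> I"
      then have "indicator (A i) \<in> borel_measurable (N1 \<Otimes>\<^sub>M N2)" using A by simp
      then show "(\<lambda>x. \<integral>\<^sup>+y. indicator (A i) (x, y) \<partial>N2) \<in> borel_measurable N1"
        by (rule N2.borel_measurable_nn_integral_fst)
    qed
    also have "\<dots> = (\<Prod>i\<in>I. emeasure (N1 \<Otimes>\<^sub>M N2) (A i))"
      using A by (intro prod.cong refl) (simp add: N2.emeasure_pair_measure)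
    finally show "emeasure (distr ?P (PiM I (\<lambda>_. N1 \<Otimes>\<^sub>M N2)) ?z) (PiE I A) = (\<Prod>i\<in>I. emeasure (N1 \<Otimes>\<^sub>M N2) (A i))" .
  qed simp
qed

lemma uniform_count_measure_times:
  assumes "finite A" "finite B" "A \<noteq> {}" "B \<noteq> {}"
  shows "uniform_count_measure A \<Otimes>\<^sub>M uniform_count_measure B = uniform_count_measure (A \<times> B)"
proof (rule pair_measure_eqI)
  interpret A: prob_space "uniform_count_measure A" using assms by (intro prob_space_uniform_count_measure)
  interpret B: prob_space "uniform_count_measure B" using assms by (intro prob_space_uniform_count_measure)
  show "sigma_finite_measure (uniform_count_measure A)" ..
  show "sigma_finite_measure (uniform_count_measure B)" ..
  have "sets (uniform_count_measure A \<Otimes>\<^sub>M uniform_count_measure B) = sets (count_space A \<Otimes>\<^sub>M count_space B)"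
    by (intro sets_pair_measure_cong sets_uniform_count_measure_count_space)
  also have "\<dots> = sets (uniform_count_measure (A \<times> B))"
    using assms by (subst pair_measure_countable) (auto simp: sets_uniform_count_measure countable_finite)
  finally show "sets (uniform_count_measure A \<Otimes>\<^sub>M uniform_count_measure B) = sets (uniform_count_measure (A \<times> B))" .
  fix X Y assume "X \<in> sets (uniform_count_measure A)" "Y \<in> sets (uniform_count_measure B)"
  then have XY: "X \<subseteq> A" "Y \<subseteq> B" by (auto simp: sets_uniform_count_measure)
  then have "X \<times> Y \<subseteq> A \<times> B" by auto
  with XY assms show "emeasure (uniform_count_measure A) X * emeasure (uniform_count_measure B) Y = emeasure (uniform_count_measure (A \<times> B)) (X \<times> Y)"
    by (simp add: emeasure_uniform_count_measure card_cartesian_product ennreal_mult[symmetric])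
qed

section \<open>Slices on which the distribution functions agree\<close>

text \<open>Outside the interval spanned by the support the distribution function is \<open>0\<close> or \<open>1\<close>, and the
standard deviation vanishes.\<close>

lemma AE_distinct_or_degenerate:
  fixes \<mu> \<nu> :: "'a::euclidean_space measure"
  assumes "borel_prob_space \<mu>"
    and "AE (t, \<theta>) in slices. lower_end \<mu> \<theta> \<le> ereal t \<and> ereal t \<le> upper_end \<mu> \<theta> \<longrightarrow>
         proj_cdf \<mu> t \<theta> \<noteq> proj_cdf \<nu> t \<theta>"
  shows "AE z in slices. slice_cdf \<mu> z - slice_cdf \<nu> z \<noteq> 0 \<or> slice_sd \<mu> z = 0"
proof -
  interpret borel_prob_space \<mu> by fact
  show ?thesis
    using assms(2)
  proof eventually_elim
    case (elim z)
    obtain t \<theta> where z: "z = (t, \<theta>)" by (cases z)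
    consider "ereal t < lower_end \<mu> \<theta>" | "upper_end \<mu> \<theta> < ereal t"
      | "lower_end \<mu> \<theta> \<le> ereal t" "ereal t \<le> upper_end \<mu> \<theta>" by fastforce
    then show ?case
      using elim proj_cdf_outside(1)[of t \<theta>] proj_cdf_outside(2)[of \<theta> t] by cases (auto simp: z slice_sd_def)
  qed
qed

lemma AE_distinct_or_both_degenerate:
  fixes \<mu> \<nu> :: "'a::euclidean_space measure"
  assumes "borel_prob_space \<mu>" "borel_prob_space \<nu>"
    and "AE (t, \<theta>) in slices. min (lower_end \<mu> \<theta>) (lower_end \<nu> \<theta>) \<le> ereal t \<and>
         ereal t \<le> max (upper_end \<mu> \<theta>) (upper_end \<nu> \<theta>) \<longrightarrow> proj_cdf \<mu> t \<theta> \<noteq> proj_cdf \<nu> t \<theta>"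
  shows "AE z in slices. slice_cdf \<mu> z - slice_cdf \<nu> z \<noteq> 0 \<or> (slice_sd \<mu> z = 0 \<and> slice_sd \<nu> z = 0)"
proof -
  interpret M: borel_prob_space \<mu> by fact
  interpret N: borel_prob_space \<nu> by fact
  show ?thesis
    using assms(3)
  proof eventually_elim
    case (elim z)
    obtain t \<theta> where z: "z = (t, \<theta>)" by (cases z)
    consider "ereal t < lower_end \<mu> \<theta>" "ereal t < lower_end \<nu> \<theta>"
      | "upper_end \<mu> \<theta> < ereal t" "upper_end \<nu> \<theta> < ereal t"
      | "min (lower_end \<mu> \<theta>) (lower_end \<nu> \<theta>) \<le> ereal t \<and> ereal t \<le> max (upper_end \<mu> \<theta>) (upper_end \<nu> \<theta>)"
      unfolding min_le_iff_disj le_max_iff_disj by fastforce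
    then show ?case
      using elim M.proj_cdf_outside(1)[of t \<theta>] M.proj_cdf_outside(2)[of \<theta> t]
        N.proj_cdf_outside(1)[of t \<theta>] N.proj_cdf_outside(2)[of \<theta> t] by cases (auto simp: z slice_sd_def)
  qed
qed

lemma empirical_cong:
  assumes "\<And>i. i < n \<Longrightarrow> x i = y i"
  shows "empirical n x = empirical n y"
  unfolding empirical_def by (rule distr_cong) (auto simp: space_uniform_count_measure assms)

lemma sets_empirical [simp]: "sets (empirical n x) = sets borel"
  by (simp add: empirical_def)

lemma measurable_from_uniform_count:
  "(\<And>i. i \<in> A \<Longrightarrow> f i \<in> space N) \<Longrightarrow> f \<in> uniform_count_measure A \<rightarrow>\<^sub>M N"
  by (auto simp: measurable_def space_uniform_count_measure sets_uniform_count_measure)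

lemma empirical_facts:
  fixes x :: "nat \<Rightarrow> 'a::euclidean_space"
  assumes n: "n > 0"
  shows "borel_prob_space (empirical n x)" and "integrable (empirical n x) norm"
    and "slice_cdf (empirical n x) z = (\<Sum>i<n. halfspace (x i) z) / real n"
proof -
  interpret U: prob_space "uniform_count_measure {..<n}"
    using n by (intro prob_space_uniform_count_measure) auto
  have x: "x \<in> uniform_count_measure {..<n} \<rightarrow>\<^sub>M borel"
    by (rule measurable_from_uniform_count) simp
  show "borel_prob_space (empirical n x)"
    unfolding empirical_def borel_prob_space_def borel_prob_space_axioms_def
    using U.prob_space_distr[OF x] by simp
  show "integrable (empirical n x) norm"
    unfolding empirical_def uniform_count_measure_def
    by (subst integrable_distr_eq) (auto intro!: integrable_point_measure_finite x[unfolded uniform_count_measure_def])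
  have "{y. snd z \<bullet> y \<le> fst z} \<in> sets borel" by measurable
  then have "slice_cdf (empirical n x) z = (\<Sum>i<n. indicator {y. snd z \<bullet> y \<le> fst z} (x i)) / real n"
    unfolding proj_cdf_def by (rule measure_empirical)
  also have "(\<Sum>i<n. indicator {y. snd z \<bullet> y \<le> fst z} (x i)) = (\<Sum>i<n. halfspace (x i) z)"
    by (intro sum.cong) (auto simp: halfspace_def)
  finally show "slice_cdf (empirical n x) z = (\<Sum>i<n. halfspace (x i) z) / real n" .
qed

lemma measurable_slice_cdf_empirical:
  fixes f :: "nat \<Rightarrow> 'w \<Rightarrow> 'a::euclidean_space"
  assumes n: "n > 0" and f: "\<And>i. i < n \<Longrightarrow> f i \<in> borel_measurable N"
  shows "(\<lambda>p. slice_cdf (empirical n (\<lambda>i. f i (fst p))) (snd p)) \<in> borel_measurable (N \<Otimes>\<^sub>M slices)"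
  unfolding empirical_facts(3)[OF n]
proof (intro borel_measurable_divide borel_measurable_sum measurable_const)
  fix i assume "i \<in> {..<n}"
  then show "(\<lambda>p. halfspace (f i (fst p)) (snd p)) \<in> borel_measurable (N \<Otimes>\<^sub>M slices)"
    by (intro measurable_halfspace measurable_compose[OF measurable_fst f] measurable_snd) simp
qed simp

lemma measurable_sliced_W1_empirical:
  fixes f :: "nat \<Rightarrow> 'w \<Rightarrow> 'a::euclidean_space"
  assumes n: "n > 0" and f: "\<And>i. i < n \<Longrightarrow> f i \<in> borel_measurable N"
    and \<nu>: "borel_prob_space \<nu>" "integrable \<nu> norm"
  shows "(\<lambda>w. sliced_W1 (empirical n (\<lambda>i. f i w)) \<nu>) \<in> borel_measurable N"
proof -
  interpret S: sigma_finite_measure "slices :: (real \<times> 'a) measure" by (rule sigma_finite_slices)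
  interpret borel_prob_space \<nu> by fact
  note [measurable] = measurable_slice_cdf_empirical[OF n f]
  have "(\<lambda>(w, z). \<bar>slice_cdf (empirical n (\<lambda>i. f i w)) z - slice_cdf \<nu> z\<bar>) \<in> borel_measurable (N \<Otimes>\<^sub>M slices)"
    unfolding split_beta' using slice_cdf_measurable by measurable
  then show ?thesis
    unfolding sliced_W1_eq_integral[OF empirical_facts(1)[OF n] \<nu>(1) empirical_facts(2)[OF n] \<nu>(2)]
    by (rule S.borel_measurable_lebesgue_integral)
qed

lemma measurable_sliced_W1_empirical2:
  fixes f g :: "nat \<Rightarrow> 'w \<Rightarrow> 'a::euclidean_space"
  assumes n: "n > 0" and f: "\<And>i. i < n \<Longrightarrow> f i \<in> borel_measurable N" and g: "\<And>i. i < n \<Longrightarrow> g i \<in> borel_measurable N"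
  shows "(\<lambda>w. sliced_W1 (empirical n (\<lambda>i. f i w)) (empirical n (\<lambda>i. g i w))) \<in> borel_measurable N"
proof -
  interpret S: sigma_finite_measure "slices :: (real \<times> 'a) measure" by (rule sigma_finite_slices)
  note [measurable] = measurable_slice_cdf_empirical[OF n f] measurable_slice_cdf_empirical[OF n g]
  have "(\<lambda>(w, z). \<bar>slice_cdf (empirical n (\<lambda>i. f i w)) z - slice_cdf (empirical n (\<lambda>i. g i w)) z\<bar>) \<in> borel_measurable (N \<Otimes>\<^sub>M slices)"
    unfolding split_beta' by measurable
  then show ?thesis
    unfolding sliced_W1_eq_integral[OF empirical_facts(1)[OF n] empirical_facts(1)[OF n] empirical_facts(2)[OF n] empirical_facts(2)[OF n]]
    by (rule S.borel_measurable_lebesgue_integral)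
qed

text \<open>Drawing from the empirical measure means drawing an index uniformly.\<close>

lemma bootstrap_law_eq_distr:
  fixes x :: "nat \<Rightarrow> 'a::euclidean_space"
  assumes n: "n > 0"
  shows "compose {..<n} x \<in> PiM {..<n} (\<lambda>_. uniform_count_measure {..<n}) \<rightarrow>\<^sub>M bootstrap_law n x"
    and "bootstrap_law n x = distr (PiM {..<n} (\<lambda>_. uniform_count_measure {..<n})) (bootstrap_law n x) (compose {..<n} x)"
proof -
  let ?U = "uniform_count_measure {..<n}"
  interpret E: borel_prob_space "empirical n x" by (rule empirical_facts[OF n])
  have x: "x \<in> ?U \<rightarrow>\<^sub>M empirical n x"
    by (rule measurable_from_uniform_count) simp
  have "distr ?U (empirical n x) x = empirical n x"
    unfolding empirical_def[of n x] by (rule distr_cong) auto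
  then show "bootstrap_law n x = distr (PiM {..<n} (\<lambda>_. ?U)) (bootstrap_law n x) (compose {..<n} x)"
    unfolding bootstrap_law_def using x n
    by (subst distr_PiM_finite_prob_space') (auto intro!: prob_space_uniform_count_measure E.prob_space_axioms)
  show "compose {..<n} x \<in> PiM {..<n} (\<lambda>_. ?U) \<rightarrow>\<^sub>M bootstrap_law n x"
    unfolding bootstrap_law_def compose_def
  proof (rule measurable_restrict)
    fix i assume "i \<in> {..<n}"
    then show "(\<lambda>j. x (j i)) \<in> PiM {..<n} (\<lambda>_. ?U) \<rightarrow>\<^sub>M empirical n x"
      by (intro measurable_compose[OF _ x] measurable_component_singleton)
  qed
qed

lemma bootstrap_law_component:
  "i < n \<Longrightarrow> (\<lambda>xb. xb i) \<in> borel_measurable (bootstrap_law n x)"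
proof -
  assume "i < n"
  then have "(\<lambda>xb. xb i) \<in> bootstrap_law n x \<rightarrow>\<^sub>M empirical n x"
    unfolding bootstrap_law_def by (intro measurable_component_singleton) simp
  then show ?thesis by (simp add: measurable_cong_sets[OF refl sets_empirical])
qed

lemma prob_space_bootstrap_law: "prob_space (bootstrap_law n x)"
  unfolding bootstrap_law_def
proof (rule prob_space_PiM)
  fix i assume "i \<in> {..<n}"
  then have "n > 0" by auto
  then show "prob_space (empirical n x)"
    by (intro borel_prob_space.axioms(1) empirical_facts(1))
qed

text \<open>The bootstrap in terms of indices.  For \<open>n = 0\<close> the factor \<open>sqrt n\<close> vanishes and both sides
are the indicator of \<open>0 \<le> t\<close>, since the products over the empty index set are probability spaces.\<close>

lemma bootstrap_cdf1_eq:
  fixes x :: "nat \<Rightarrow> 'a::euclidean_space"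
  assumes \<nu>: "borel_prob_space \<nu>" "integrable \<nu> norm"
  shows "bootstrap_cdf1 \<nu> n x t = measure (PiM {..<n} (\<lambda>_. uniform_count_measure {..<n}))
    {j \<in> space (PiM {..<n} (\<lambda>_. uniform_count_measure {..<n})).
       sqrt (real n) * (sliced_W1 (empirical n (\<lambda>i. x (j i))) \<nu> - sliced_W1 (empirical n x) \<nu>) \<le> t}"
proof (cases "n = 0")
  case True
  interpret B: prob_space "bootstrap_law n x" by (rule prob_space_bootstrap_law)
  interpret K: prob_space "PiM {..<n} (\<lambda>_. uniform_count_measure {..<n})"
    using True by (intro prob_space_PiM) simp
  show ?thesis
    using B.prob_space K.prob_space by (cases "0 \<le> t") (simp_all add: bootstrap_cdf1_def True)
next
  case False
  then have n: "n > 0" by simp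
  let ?K = "PiM {..<n} (\<lambda>_. uniform_count_measure {..<n})"
  let ?E = "{xb \<in> space (bootstrap_law n x).
          sqrt (real n) * (sliced_W1 (empirical n xb) \<nu> - sliced_W1 (empirical n x) \<nu>) \<le> t}"
  have [measurable]: "(\<lambda>xb. sliced_W1 (empirical n xb) \<nu>) \<in> borel_measurable (bootstrap_law n x)"
    by (rule measurable_sliced_W1_empirical[OF n bootstrap_law_component \<nu>])
  have E: "?E \<in> sets (bootstrap_law n x)" by measurable
  have e: "empirical n (compose {..<n} x j) = empirical n (\<lambda>i. x (j i))" for j
    by (rule empirical_cong) (simp add: compose_def)
  have "bootstrap_cdf1 \<nu> n x t = measure (distr ?K (bootstrap_law n x) (compose {..<n} x)) ?E"
    unfolding bootstrap_cdf1_def by (subst bootstrap_law_eq_distr(2)[OF n, symmetric]) (rule refl)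
  also have "\<dots> = measure ?K (compose {..<n} x -` ?E \<inter> space ?K)"
    by (rule measure_distr[OF bootstrap_law_eq_distr(1)[OF n] E])
  also have "compose {..<n} x -` ?E \<inter> space ?K = {j \<in> space ?K.
       sqrt (real n) * (sliced_W1 (empirical n (\<lambda>i. x (j i))) \<nu> - sliced_W1 (empirical n x) \<nu>) \<le> t}"
    using measurable_space[OF bootstrap_law_eq_distr(1)[OF n]] by (auto simp: e)
  finally show ?thesis .
qed

lemma tangent_set_bound:
  assumes "h \<in> tangent_set \<mu>"
  obtains B where "B \<ge> 0" "\<And>x. \<bar>h x\<bar> \<le> B"
proof -
  have "bounded (range h)" using assms by (simp add: tangent_set_def)
  then obtain B where B: "\<And>x. \<bar>h x\<bar> \<le> B" by (auto simp: bounded_iff)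
  moreover have "B \<ge> 0" using B[of undefined] by linarith
  ultimately show thesis by (rule that[rotated])
qed

lemma (in borel_prob_space) tangent_set_L2: "h \<in> tangent_set \<mu> \<Longrightarrow> h \<in> L2_fun \<mu>"
proof -
  assume h: "h \<in> tangent_set \<mu>"
  obtain B where B: "B \<ge> 0" "\<And>x. \<bar>h x\<bar> \<le> B" using tangent_set_bound[OF h] by auto
  have m: "h \<in> borel_measurable \<mu>"
    using h by (simp add: tangent_set_def measurable_cong_sets[OF sets_eq_borel refl])
  have "(h x)\<^sup>2 \<le> B\<^sup>2" for x using B abs_le_square_iff[of "h x" B] by simp
  then have "integrable \<mu> (\<lambda>x. (h x)\<^sup>2)"
    by (intro integrable_const_bound[where B="B\<^sup>2"]) (use m in auto)
  with m show ?thesis by (simp add: L2_fun_def)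
qed

section \<open>One sample\<close>

locale one_sample =
  fixes \<mu> \<nu> :: "'a::euclidean_space measure"
  assumes \<mu>: "borel_prob_space \<mu>" "integrable \<mu> norm" "integrable slices (slice_sd \<mu>)"
    and \<nu>: "borel_prob_space \<nu>" "integrable \<nu> norm"
    and distinct: "AE z in slices. slice_cdf \<mu> z - slice_cdf \<nu> z \<noteq> 0 \<or> slice_sd \<mu> z = 0"
begin

sublocale \<mu>: borel_prob_space \<mu> by (rule \<mu>)
sublocale \<nu>: borel_prob_space \<nu> by (rule \<nu>)

abbreviation sign_diff :: "real \<times> 'a \<Rightarrow> real" where
  "sign_diff z \<equiv> sgn (slice_cdf \<mu> z - slice_cdf \<nu> z)"

lemma sign_diff: "sign_diff \<in> borel_measurable slices" "\<bar>sign_diff z\<bar> \<le> 1"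
proof -
  show "sign_diff \<in> borel_measurable slices"
    using \<mu>.slice_cdf_measurable \<nu>.slice_cdf_measurable by measurable
  show "\<bar>sign_diff z\<bar> \<le> 1" by (simp add: sgn_if)
qed

sublocale centered_kernel \<mu> slices "\<lambda>z. slice_cdf \<mu> z - slice_cdf \<nu> z" "centered_halfspace \<mu>" "slice_sd \<mu>"
proof (intro centered_kernel.intro centered_kernel_axioms.intro)
  show "prob_space \<mu>" by (rule \<mu>.prob_space_axioms)
  show "sigma_finite_measure (slices :: (real \<times> 'a) measure)" by (rule sigma_finite_slices)
  show "integrable slices (\<lambda>z. slice_cdf \<mu> z - slice_cdf \<nu> z)"
    by (intro integrable_slice_cdf_diff \<mu> \<nu>)
  show "case_prod (centered_halfspace \<mu>) \<in> borel_measurable (\<mu> \<Otimes>\<^sub>M slices)"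
    unfolding split_beta' by measurable
  show "\<bar>centered_halfspace \<mu> x z\<bar> \<le> 2" for x z
    using \<mu>.centered_halfspace_bound[of x z] by linarith
  show "integrable slices (centered_halfspace \<mu> x)" for x
    by (rule \<mu>.centered_halfspace_L1[OF \<mu>(2)])
  show "integrable \<mu> (\<lambda>x. (\<integral>z. sign_diff z * centered_halfspace \<mu> x z \<partial>slices)\<^sup>2)"
    by (rule borel_prob_influence_moments(1)[OF \<mu> sign_diff])
  show "(\<integral>x. centered_halfspace \<mu> x z \<partial>\<mu>) = 0" for z
    by (rule \<mu>.integral_centered_halfspace)
  show "(\<integral>x. (centered_halfspace \<mu> x z)\<^sup>2 \<partial>\<mu>) = (slice_sd \<mu> z)\<^sup>2" for z
    by (rule \<mu>.integral_centered_halfspace_power2)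
  show "integrable slices (slice_sd \<mu>)" "0 \<le> slice_sd \<mu> z" for z
    by (rule \<mu>(3), rule \<mu>.slice_sd_nonneg)
  show "AE z in slices. slice_cdf \<mu> z - slice_cdf \<nu> z \<noteq> 0 \<or> slice_sd \<mu> z = 0"
    by (rule distinct)
qed

lemma sliced_W1_eq: "sliced_W1 \<mu> \<nu> = (\<integral>z. \<bar>slice_cdf \<mu> z - slice_cdf \<nu> z\<bar> \<partial>slices)"
  by (intro sliced_W1_eq_integral \<mu> \<nu>)

lemma sliced_W1_empirical:
  assumes n: "n > 0"
  shows "sliced_W1 (empirical n x) \<nu>
    = (\<integral>z. \<bar>slice_cdf \<mu> z - slice_cdf \<nu> z + (\<Sum>i<n. centered_halfspace \<mu> (x i) z) / real n\<bar> \<partial>slices)"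
proof -
  have eq: "slice_cdf (empirical n x) z - slice_cdf \<nu> z
      = slice_cdf \<mu> z - slice_cdf \<nu> z + (\<Sum>i<n. centered_halfspace \<mu> (x i) z) / real n" for z
    using n by (simp add: empirical_facts(3) centered_halfspace_def sum_subtractf diff_divide_distrib)
  then show ?thesis
    by (subst sliced_W1_eq_integral[OF empirical_facts(1)[OF n] \<nu>(1) empirical_facts(2)[OF n] \<nu>(2)]) (simp only: eq)
qed

lemma indep_vars_law:
  assumes "iid_sample M \<mu> X"
  shows "prob_space M" "prob_space.indep_vars M (\<lambda>_. \<mu>) X UNIV" "distr M \<mu> (X i) = \<mu>" "X i \<in> M \<rightarrow>\<^sub>M \<mu>"
proof -
  show "prob_space M" using assms by (simp add: iid_sample_def)
  then interpret M: prob_space M .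
  have ind: "M.indep_vars (\<lambda>_. borel) X UNIV" and D: "distr M borel (X i) = \<mu>"
    using assms by (auto simp: iid_sample_def)
  have "M.indep_vars (\<lambda>_. \<mu>) (\<lambda>i \<omega>. X i \<omega>) UNIV"
    by (rule M.indep_vars_compose2[OF ind, where Y="\<lambda>_ x. x"]) (simp add: measurable_cong_sets[OF refl \<mu>.sets_eq_borel])
  then show "M.indep_vars (\<lambda>_. \<mu>) X UNIV" by simp
  then show "X i \<in> M \<rightarrow>\<^sub>M \<mu>" by (auto simp: M.indep_vars_def)
  show "distr M \<mu> (X i) = \<mu>"
    by (subst (2) D[symmetric]) (rule distr_cong, simp_all)
qed

theorem empirical_central_limit:
  assumes "iid_sample M \<mu> X"
  shows "conv_in_distribution M
    (\<lambda>n \<omega>. sqrt (real n) * (sliced_W1 (empirical n (\<lambda>i. X i \<omega>)) \<nu> - sliced_W1 \<mu> \<nu>))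
    (centered_normal asymptotic_variance)"
proof -
  have "(\<lambda>n \<omega>. sqrt (real n) * (sliced_W1 (empirical n (\<lambda>i. X i \<omega>)) \<nu> - sliced_W1 \<mu> \<nu>))
    = (\<lambda>n \<omega>. sqrt (real n) * ((\<integral>z. \<bar>slice_cdf \<mu> z - slice_cdf \<nu> z + (\<Sum>i<n. centered_halfspace \<mu> (X i \<omega>) z) / real n\<bar> \<partial>slices)
        - (\<integral>z. \<bar>slice_cdf \<mu> z - slice_cdf \<nu> z\<bar> \<partial>slices)))" (is "?L = ?R")
  proof (intro ext)
    fix n \<omega> show "?L n \<omega> = ?R n \<omega>"
      by (cases "n = 0") (simp_all add: sliced_W1_empirical sliced_W1_eq)
  qed
  then show ?thesis
    using central_limit[OF indep_vars_law(1,2,3)[OF assms]] by simp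
qed

lemma influence_L2_fun: "influence \<in> L2_fun \<mu>"
  using influence_L2 by (simp add: L2_fun_def)

theorem efficiency_bound: "has_efficiency_bound (\<lambda>\<rho>. sliced_W1 \<rho> \<nu>) \<mu> (ennreal asymptotic_variance)"
  unfolding has_efficiency_bound_def
proof (intro exI conjI ballI)
  let ?D = "\<lambda>f. \<integral>x. influence x * f x \<partial>\<mu>"
  show "continuous_linear_functional_L2 \<mu> ?D"
    by (rule continuous_linear_functional_L2_integral[OF \<mu>.prob_space_axioms influence_L2_fun])
  fix h assume h: "h \<in> tangent_set \<mu>"
  obtain B where B: "B \<ge> 0" "\<And>x. \<bar>h x\<bar> \<le> B" using tangent_set_bound[OF h] by auto
  have hm: "h \<in> borel_measurable \<mu>"
    using h by (simp add: tangent_set_def measurable_cong_sets[OF \<mu>.sets_eq_borel refl])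
  \<comment> \<open>The derivative of the slice distribution functions along \<open>(1 + t h) \<mu>\<close>.\<close>
  define H where "H z = (\<integral>x. h x * centered_halfspace \<mu> x z \<partial>\<mu>)" for z
  note I = integral_influence_mult[OF hm B(2), folded H_def]
  have lim: "((\<lambda>t. ((\<integral>z. \<bar>slice_cdf \<mu> z - slice_cdf \<nu> z + t * H z\<bar> \<partial>slices)
        - (\<integral>z. \<bar>slice_cdf \<mu> z - slice_cdf \<nu> z\<bar> \<partial>slices)) / t) \<longlongrightarrow> ?D h) (at_right 0)"
  proof -
    have "?D h = (\<integral>x. h x * influence x \<partial>\<mu>)"
      by (intro Bochner_Integration.integral_cong) simp_all
    then show ?thesis
      using directional_derivative[OF I(2) AE_I2[OF I(3)]] by (simp only: I(1))
  qed
  have "eventually (\<lambda>t. t \<in> {0<..<1 / (B + 1)}) (at_right 0)"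
    using B by (intro eventually_at_right_real) simp
  then have "\<forall>\<^sub>F t in at_right 0. ((\<integral>z. \<bar>slice_cdf \<mu> z - slice_cdf \<nu> z + t * H z\<bar> \<partial>slices)
        - (\<integral>z. \<bar>slice_cdf \<mu> z - slice_cdf \<nu> z\<bar> \<partial>slices)) / t = (sliced_W1 (perturb \<mu> t h) \<nu> - sliced_W1 \<mu> \<nu>) / t"
  proof eventually_elim
    case (elim t)
    then have "t * (B + 1) \<le> 1" using B by (simp add: field_simps)
    then have t: "0 \<le> t" "t * B \<le> 1" using elim by (auto simp: distrib_left)
    note p = \<mu>.perturbation[OF h B(2) t \<mu>(2)]
    have "sliced_W1 (perturb \<mu> t h) \<nu> = (\<integral>z. \<bar>slice_cdf \<mu> z - slice_cdf \<nu> z + t * H z\<bar> \<partial>slices)"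
      unfolding sliced_W1_eq_integral[OF p(1) \<nu>(1) p(2) \<nu>(2)] p(3) H_def
      by (intro Bochner_Integration.integral_cong) (auto simp: algebra_simps)
    then show ?case by (simp add: sliced_W1_eq)
  qed
  from Lim_transform_eventually[OF lim this]
  show "((\<lambda>t. (sliced_W1 (perturb \<mu> t h) \<nu> - sliced_W1 \<mu> \<nu>) / t) \<longlongrightarrow> ?D h) (at_right 0)" .
next
  obtain g q where g: "\<And>j :: nat. g j \<in> tangent_set \<mu>" "\<And>j. (\<integral>x. influence x * g j x \<partial>\<mu>) = q j"
    "\<And>j. (\<integral>x. (g j x)\<^sup>2 \<partial>\<mu>) \<le> q j" "q \<longlonglongrightarrow> asymptotic_variance"
    by (rule \<mu>.truncated_tangent[OF measurable_influence influence_L2 influence_mean]) (rule that)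
  show "ennreal asymptotic_variance =
     (SUP h\<in>{h \<in> tangent_set \<mu>. L2_nrm \<mu> h \<noteq> 0}. ennreal ((\<integral>x. influence x * h x \<partial>\<mu>)\<^sup>2 / (L2_nrm \<mu> h)\<^sup>2))"
  proof -
    have sub: "tangent_set \<mu> \<subseteq> L2_fun \<mu>" by (rule subsetI) (rule \<mu>.tangent_set_L2)
    show ?thesis
      by (rule efficiency_bound_eq_norm[where Q=\<mu> and \<phi>=influence and H="tangent_set \<mu>" and g=g and q=q,
            OF \<mu>.prob_space_axioms influence_L2_fun sub g])
  qed
qed

theorem bootstrap:
  assumes iid: "iid_sample M \<mu> X" and v: "asymptotic_variance > 0"
  shows "conv_in_probability M
    (\<lambda>n \<omega>. \<Squnion>t. \<bar>bootstrap_cdf1 \<nu> n (\<lambda>i. X i \<omega>) t - cdf (centered_normal asymptotic_variance) t\<bar>) 0"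
proof -
  note I = indep_vars_law[OF iid]
  interpret M: prob_space M by (rule I)
  have In: "M.indep_vars (\<lambda>_. \<mu>) X {..<n}" for n by (rule M.indep_vars_subset[OF I(2)]) simp
  interpret R: resampling \<mu> slices "\<lambda>z. slice_cdf \<mu> z - slice_cdf \<nu> z" "centered_halfspace \<mu>" "slice_sd \<mu>" M "\<lambda>n. {..<n}" X
  proof unfold_locales
    show "X i \<in> M \<rightarrow>\<^sub>M \<mu>" "distr M \<mu> (X i) = \<mu>" for i
      by (rule I(4), rule I(3))
  qed auto
  have pa: "R.pool_average n f \<omega> = (\<Sum>i<n. f (X i \<omega>)) / real n" for n f \<omega>
    by (simp add: R.pool_average_def)
  note S = M.second_moment_iid_average[OF In I(3)]
  interpret R: consistent_resampling \<mu> slices "\<lambda>z. slice_cdf \<mu> z - slice_cdf \<nu> z" "centered_halfspace \<mu>" "slice_sd \<mu>" M "\<lambda>n. {..<n}" X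
  proof
    show "(\<integral>\<omega>. (R.pool_average n (\<lambda>x. centered_halfspace \<mu> x z) \<omega>)\<^sup>2 \<partial>M) \<le> (slice_sd \<mu> z)\<^sup>2 / real n"
      if "n > 0" "z \<in> space slices" for n z
      unfolding pa using S(2)[OF kernel_section_measurable kernel_L2 kernel_mean] kernel_second_moment that by simp
    show "integrable M (\<lambda>\<omega>. (R.pool_average n influence \<omega>)\<^sup>2)" if "n > 0" for n
      unfolding pa by (rule S(1)[OF measurable_influence influence_L2 influence_mean that])
    have "(\<integral>\<omega>. (R.pool_average n influence \<omega>)\<^sup>2 \<partial>M) = asymptotic_variance / real n" for n
      unfolding pa using S(2)[OF measurable_influence influence_L2 influence_mean] by (cases "n = 0") simp_all
    then show "(\<lambda>n. \<integral>\<omega>. (R.pool_average n influence \<omega>)\<^sup>2 \<partial>M) \<longlonglongrightarrow> 0"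
      by (simp add: lim_const_over_n)
    show "(\<lambda>n. \<integral>\<omega>. \<bar>R.pool_average n (\<lambda>x. (influence x)\<^sup>2) \<omega> - asymptotic_variance\<bar> \<partial>M) \<longlonglongrightarrow> 0"
      unfolding pa by (rule M.L1_law_of_large_numbers[OF I(2,3) influence_L2])
  qed
  have stat: "R.boot_stat n \<omega> j = sqrt (real n) *
      (sliced_W1 (empirical n (\<lambda>i. X (j i) \<omega>)) \<nu> - sliced_W1 (empirical n (\<lambda>i. X i \<omega>)) \<nu>)" for n \<omega> j
    by (cases "n = 0") (simp_all add: R.boot_stat_def R.draw_average_def pa sliced_W1_empirical)
  show ?thesis
    using R.bootstrap_consistency[OF v]
    unfolding stat R.resample_def bootstrap_cdf1_eq[OF \<nu>] .
qed

end

section \<open>Two samples\<close>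

lemma pair_product_integral:
  fixes f :: "'a \<Rightarrow> real" and g :: "'b \<Rightarrow> real"
  assumes "prob_space M1" "prob_space M2" and f: "integrable M1 f" and g: "integrable M2 g"
  shows "integrable (M1 \<Otimes>\<^sub>M M2) (\<lambda>p. f (fst p) * g (snd p))"
    and "(\<integral>p. f (fst p) * g (snd p) \<partial>(M1 \<Otimes>\<^sub>M M2)) = (\<integral>x. f x \<partial>M1) * (\<integral>y. g y \<partial>M2)"
proof -
  interpret M1: prob_space M1 by fact
  interpret M2: prob_space M2 by fact
  interpret P: pair_prob_space M1 M2 ..
  have [measurable]: "f \<in> borel_measurable M1" "g \<in> borel_measurable M2" using f g by auto
  show i: "integrable (M1 \<Otimes>\<^sub>M M2) (\<lambda>p. f (fst p) * g (snd p))"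
  proof (rule P.Fubini_integrable)
    show "integrable M1 (\<lambda>x. \<integral>y. norm (f (fst (x, y)) * g (snd (x, y))) \<partial>M2)"
      using f by (simp add: abs_mult)
    show "AE x in M1. integrable M2 (\<lambda>y. f (fst (x, y)) * g (snd (x, y)))"
      using g by simp
  qed measurable
  have "(\<integral>p. f (fst p) * g (snd p) \<partial>(M1 \<Otimes>\<^sub>M M2)) = (\<integral>x. \<integral>y. f x * g y \<partial>M2 \<partial>M1)"
    using P.integral_fst'[OF i] by simp
  then show "(\<integral>p. f (fst p) * g (snd p) \<partial>(M1 \<Otimes>\<^sub>M M2)) = (\<integral>x. f x \<partial>M1) * (\<integral>y. g y \<partial>M2)"
    by simp
qed

text \<open>The mixed terms factor, and each contains the mean of \<open>f1\<close> or of \<open>f2\<close>.\<close>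

lemma pair_additive_integral:
  fixes f1 h1 :: "'a \<Rightarrow> real" and f2 h2 :: "'b \<Rightarrow> real"
  assumes P: "prob_space M1" "prob_space M2"
    and i: "integrable M1 f1" "integrable M1 h1" "integrable M1 (\<lambda>x. f1 x * h1 x)"
      "integrable M2 f2" "integrable M2 h2" "integrable M2 (\<lambda>y. f2 y * h2 y)"
    and m: "(\<integral>x. f1 x \<partial>M1) = 0" "(\<integral>y. f2 y \<partial>M2) = 0"
  shows "integrable (M1 \<Otimes>\<^sub>M M2) (\<lambda>p. (f1 (fst p) - f2 (snd p)) * (h1 (fst p) + h2 (snd p)))"
    and "(\<integral>p. (f1 (fst p) - f2 (snd p)) * (h1 (fst p) + h2 (snd p)) \<partial>(M1 \<Otimes>\<^sub>M M2))
      = (\<integral>x. f1 x * h1 x \<partial>M1) - (\<integral>y. f2 y * h2 y \<partial>M2)"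
proof -
  interpret M1: prob_space M1 by (rule P)
  interpret M2: prob_space M2 by (rule P)
  note I = pair_product_integral[OF P]
  have one: "integrable M1 (\<lambda>_. 1 :: real)" "integrable M2 (\<lambda>_. 1 :: real)" by simp_all
  have eq: "(f1 (fst p) - f2 (snd p)) * (h1 (fst p) + h2 (snd p))
    = (f1 (fst p) * h1 (fst p)) * 1 + f1 (fst p) * h2 (snd p) - h1 (fst p) * f2 (snd p) - 1 * (f2 (snd p) * h2 (snd p))" for p
    by (simp add: algebra_simps)
  note A = I[OF i(3) one(2)] and B = I[OF i(1) i(5)] and C = I[OF i(2) i(4)] and D = I[OF one(1) i(6)]
  show "integrable (M1 \<Otimes>\<^sub>M M2) (\<lambda>p. (f1 (fst p) - f2 (snd p)) * (h1 (fst p) + h2 (snd p)))"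
    unfolding eq by (intro Bochner_Integration.integrable_diff Bochner_Integration.integrable_add A B C D)
  have "(\<integral>p. (f1 (fst p) - f2 (snd p)) * (h1 (fst p) + h2 (snd p)) \<partial>(M1 \<Otimes>\<^sub>M M2))
    = (\<integral>p. (f1 (fst p) * h1 (fst p)) * 1 \<partial>(M1 \<Otimes>\<^sub>M M2)) + (\<integral>p. f1 (fst p) * h2 (snd p) \<partial>(M1 \<Otimes>\<^sub>M M2))
      - (\<integral>p. h1 (fst p) * f2 (snd p) \<partial>(M1 \<Otimes>\<^sub>M M2)) - (\<integral>p. 1 * (f2 (snd p) * h2 (snd p)) \<partial>(M1 \<Otimes>\<^sub>M M2))"
    unfolding eq
    by (subst Bochner_Integration.integral_diff Bochner_Integration.integral_add;
        (intro Bochner_Integration.integrable_diff Bochner_Integration.integrable_add A B C D)?)+ (rule refl)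
  also have "\<dots> = (\<integral>x. f1 x * h1 x \<partial>M1) - (\<integral>y. f2 y * h2 y \<partial>M2)"
    unfolding A(2) B(2) C(2) D(2) m by (simp add: M1.prob_space M2.prob_space)
  finally show "(\<integral>p. (f1 (fst p) - f2 (snd p)) * (h1 (fst p) + h2 (snd p)) \<partial>(M1 \<Otimes>\<^sub>M M2))
      = (\<integral>x. f1 x * h1 x \<partial>M1) - (\<integral>y. f2 y * h2 y \<partial>M2)" .
qed

lemma (in prob_space) indep_vars_blocks:
  assumes ind: "indep_vars (\<lambda>_. B) X UNIV" and "disjoint_family K"
    and g: "\<And>i. g i \<in> PiM (K i) (\<lambda>_. B) \<rightarrow>\<^sub>M N"
  shows "indep_vars (\<lambda>_. N) (\<lambda>i \<omega>. g i (restrict (\<lambda>c. X c \<omega>) (K i))) UNIV"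
  using indep_vars_restrict[OF ind subset_UNIV assms(2)]
  by (rule indep_vars_compose2) (rule g)

locale two_sample =
  fixes \<mu> \<nu> :: "'a::euclidean_space measure"
  assumes \<mu>: "borel_prob_space \<mu>" "integrable \<mu> norm" "integrable slices (slice_sd \<mu>)"
    and \<nu>: "borel_prob_space \<nu>" "integrable \<nu> norm" "integrable slices (slice_sd \<nu>)"
    and distinct: "AE z in slices. slice_cdf \<mu> z - slice_cdf \<nu> z \<noteq> 0 \<or> (slice_sd \<mu> z = 0 \<and> slice_sd \<nu> z = 0)"
begin

sublocale \<mu>: borel_prob_space \<mu> by (rule \<mu>)
sublocale \<nu>: borel_prob_space \<nu> by (rule \<nu>)
sublocale \<mu>\<nu>: pair_prob_space \<mu> \<nu> ..

abbreviation sign_diff :: "real \<times> 'a \<Rightarrow> real" where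
  "sign_diff z \<equiv> sgn (slice_cdf \<mu> z - slice_cdf \<nu> z)"

lemma sign_diff: "sign_diff \<in> borel_measurable slices" "\<bar>sign_diff z\<bar> \<le> 1"
proof -
  show "sign_diff \<in> borel_measurable slices"
    using \<mu>.slice_cdf_measurable \<nu>.slice_cdf_measurable by measurable
  show "\<bar>sign_diff z\<bar> \<le> 1" by (simp add: sgn_if)
qed

definition influence1 :: "'a \<Rightarrow> real" where
  "influence1 x = (\<integral>z. sign_diff z * centered_halfspace \<mu> x z \<partial>slices)"

definition influence2 :: "'a \<Rightarrow> real" where
  "influence2 y = (\<integral>z. sign_diff z * centered_halfspace \<nu> y z \<partial>slices)"

definition diff_kernel :: "'a \<times> 'a \<Rightarrow> real \<times> 'a \<Rightarrow> real" where
  "diff_kernel p z = centered_halfspace \<mu> (fst p) z - centered_halfspace \<nu> (snd p) z"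

text \<open>The variances add up because the components of a pair are independent under \<open>\<mu> \<otimes> \<nu>\<close>.\<close>

definition joint_sd :: "real \<times> 'a \<Rightarrow> real" where
  "joint_sd z = sqrt ((slice_sd \<mu> z)\<^sup>2 + (slice_sd \<nu> z)\<^sup>2)"

lemma influence1_moments:
  "integrable \<mu> (\<lambda>x. (influence1 x)\<^sup>2)" "(\<integral>x. influence1 x \<partial>\<mu>) = 0"
  "influence1 \<in> borel_measurable \<mu>" "integrable \<mu> influence1"
proof -
  note B = borel_prob_influence_moments[OF \<mu> sign_diff, folded influence1_def]
  show "integrable \<mu> (\<lambda>x. (influence1 x)\<^sup>2)" "(\<integral>x. influence1 x \<partial>\<mu>) = 0" by (rule B(1), rule B(2))
  interpret S: sigma_finite_measure "slices :: (real \<times> 'a) measure" by (rule sigma_finite_slices)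
  note [measurable] = sign_diff(1)
  show "influence1 \<in> borel_measurable \<mu>"
    unfolding influence1_def[abs_def] by measurable
  from \<mu>.square_integrable_imp_integrable[OF this B(1)] show "integrable \<mu> influence1" .
qed

lemma influence2_moments:
  "integrable \<nu> (\<lambda>x. (influence2 x)\<^sup>2)" "(\<integral>x. influence2 x \<partial>\<nu>) = 0"
  "influence2 \<in> borel_measurable \<nu>" "integrable \<nu> influence2"
proof -
  note B = borel_prob_influence_moments[OF \<nu> sign_diff, folded influence2_def]
  show "integrable \<nu> (\<lambda>x. (influence2 x)\<^sup>2)" "(\<integral>x. influence2 x \<partial>\<nu>) = 0" by (rule B(1), rule B(2))
  interpret S: sigma_finite_measure "slices :: (real \<times> 'a) measure" by (rule sigma_finite_slices)
  note [measurable] = sign_diff(1)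
  show "influence2 \<in> borel_measurable \<nu>"
    unfolding influence2_def[abs_def] by measurable
  from \<nu>.square_integrable_imp_integrable[OF this B(1)] show "integrable \<nu> influence2" .
qed

lemma integral_sign_diff_kernel:
  "(\<integral>z. sign_diff z * diff_kernel p z \<partial>slices) = influence1 (fst p) - influence2 (snd p)"
proof -
  have i: "integrable slices (\<lambda>z. sign_diff z * f z)" if "integrable slices f" for f :: "real \<times> 'a \<Rightarrow> real"
  proof (rule Bochner_Integration.integrable_bound[OF that])
    have [measurable]: "f \<in> borel_measurable slices" using that by auto
    note [measurable] = sign_diff(1)
    show "(\<lambda>z. sign_diff z * f z) \<in> borel_measurable slices" by measurable
    show "AE z in slices. norm (sign_diff z * f z) \<le> norm (f z)"
      by (intro AE_I2) (simp add: abs_mult mult_left_le_one_le sign_diff(2))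
  qed
  show ?thesis
    using i[OF \<mu>.centered_halfspace_L1(1)[OF \<mu>(2), of "fst p"]] i[OF \<nu>.centered_halfspace_L1(1)[OF \<nu>(2), of "snd p"]]
    by (simp add: diff_kernel_def influence1_def influence2_def right_diff_distrib)
qed

lemma integral_influence_diff_power2:
  "integrable (\<mu> \<Otimes>\<^sub>M \<nu>) (\<lambda>p. (influence1 (fst p) - influence2 (snd p))\<^sup>2)"
  "(\<integral>p. (influence1 (fst p) - influence2 (snd p))\<^sup>2 \<partial>(\<mu> \<Otimes>\<^sub>M \<nu>))
    = (\<integral>x. (influence1 x)\<^sup>2 \<partial>\<mu>) + (\<integral>y. (influence2 y)\<^sup>2 \<partial>\<nu>)"
proof -
  note A = pair_additive_integral[OF \<mu>.prob_space_axioms \<nu>.prob_space_axioms, of influence1 influence1 influence2 "\<lambda>y. - influence2 y"]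
  have eq: "(influence1 (fst p) - influence2 (snd p))\<^sup>2
      = (influence1 (fst p) - influence2 (snd p)) * (influence1 (fst p) + - influence2 (snd p))" for p
    by (simp add: power2_eq_square)
  show "integrable (\<mu> \<Otimes>\<^sub>M \<nu>) (\<lambda>p. (influence1 (fst p) - influence2 (snd p))\<^sup>2)"
    unfolding eq by (rule A(1)) (use influence1_moments influence2_moments in \<open>simp_all add: power2_eq_square\<close>)
  have "(\<integral>p. (influence1 (fst p) - influence2 (snd p))\<^sup>2 \<partial>(\<mu> \<Otimes>\<^sub>M \<nu>))
    = (\<integral>x. influence1 x * influence1 x \<partial>\<mu>) - (\<integral>y. influence2 y * - influence2 y \<partial>\<nu>)"
    unfolding eq by (rule A(2)) (use influence1_moments influence2_moments in \<open>simp_all add: power2_eq_square\<close>)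
  then show "(\<integral>p. (influence1 (fst p) - influence2 (snd p))\<^sup>2 \<partial>(\<mu> \<Otimes>\<^sub>M \<nu>))
    = (\<integral>x. (influence1 x)\<^sup>2 \<partial>\<mu>) + (\<integral>y. (influence2 y)\<^sup>2 \<partial>\<nu>)"
    by (simp add: power2_eq_square)
qed

lemma centered_halfspace_integrable:
  "integrable \<mu> (\<lambda>x. centered_halfspace \<mu> x z)" "integrable \<mu> (\<lambda>x. (centered_halfspace \<mu> x z)\<^sup>2)"
  "integrable \<nu> (\<lambda>x. centered_halfspace \<nu> x z)" "integrable \<nu> (\<lambda>x. (centered_halfspace \<nu> x z)\<^sup>2)"
proof -
  show "integrable \<mu> (\<lambda>x. centered_halfspace \<mu> x z)" "integrable \<nu> (\<lambda>x. centered_halfspace \<nu> x z)"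
    by (simp_all add: centered_halfspace_def)
  have "(centered_halfspace \<mu> x z)\<^sup>2 \<le> 1" "(centered_halfspace \<nu> x z)\<^sup>2 \<le> 1" for x
    using \<mu>.centered_halfspace_bound[of x z] \<nu>.centered_halfspace_bound[of x z] by (simp_all add: abs_square_le_1)
  then show "integrable \<mu> (\<lambda>x. (centered_halfspace \<mu> x z)\<^sup>2)" "integrable \<nu> (\<lambda>x. (centered_halfspace \<nu> x z)\<^sup>2)"
    by (auto intro!: \<mu>.integrable_const_bound[where B=1] \<nu>.integrable_const_bound[where B=1] borel_measurable_power
        \<mu>.measurable_centered_halfspace_left \<nu>.measurable_centered_halfspace_left)
qed

sublocale centered_kernel "\<mu> \<Otimes>\<^sub>M \<nu>" slices "\<lambda>z. slice_cdf \<mu> z - slice_cdf \<nu> z" diff_kernel joint_sd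
proof (intro centered_kernel.intro centered_kernel_axioms.intro)
  show "prob_space (\<mu> \<Otimes>\<^sub>M \<nu>)" by (rule \<mu>\<nu>.prob_space_axioms)
  show "sigma_finite_measure (slices :: (real \<times> 'a) measure)" by (rule sigma_finite_slices)
  show "integrable slices (\<lambda>z. slice_cdf \<mu> z - slice_cdf \<nu> z)"
    by (intro integrable_slice_cdf_diff \<mu> \<nu>)
  have "(\<lambda>q. fst (fst q)) \<in> (\<mu> \<Otimes>\<^sub>M \<nu>) \<Otimes>\<^sub>M slices \<rightarrow>\<^sub>M borel" "(\<lambda>q. snd (fst q)) \<in> (\<mu> \<Otimes>\<^sub>M \<nu>) \<Otimes>\<^sub>M slices \<rightarrow>\<^sub>M borel"
    by (simp_all add: measurable_cong_sets[OF refl \<mu>.sets_eq_borel[symmetric]] measurable_cong_sets[OF refl \<nu>.sets_eq_borel[symmetric]])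
  then show "case_prod diff_kernel \<in> borel_measurable ((\<mu> \<Otimes>\<^sub>M \<nu>) \<Otimes>\<^sub>M slices)"
    unfolding split_beta' diff_kernel_def
    by (intro borel_measurable_diff \<mu>.measurable_centered_halfspace \<nu>.measurable_centered_halfspace measurable_snd)
  show "\<bar>diff_kernel p z\<bar> \<le> 2" for p z
    using \<mu>.centered_halfspace_bound[of "fst p" z] \<nu>.centered_halfspace_bound[of "snd p" z] by (simp add: diff_kernel_def)
  show "integrable slices (diff_kernel p)" for p
    unfolding diff_kernel_def[abs_def]
    by (intro Bochner_Integration.integrable_diff \<mu>.centered_halfspace_L1 \<nu>.centered_halfspace_L1 \<mu> \<nu>)
  show "(\<integral>p. diff_kernel p z \<partial>(\<mu> \<Otimes>\<^sub>M \<nu>)) = 0" for z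
  proof -
    have one: "integrable \<mu> (\<lambda>_. 1 :: real)" "integrable \<nu> (\<lambda>_. 1 :: real)" by simp_all
    note A = pair_product_integral[OF \<mu>.prob_space_axioms \<nu>.prob_space_axioms centered_halfspace_integrable(1)[of z] one(2)]
      and B = pair_product_integral[OF \<mu>.prob_space_axioms \<nu>.prob_space_axioms one(1) centered_halfspace_integrable(3)[of z]]
    have "(\<integral>p. diff_kernel p z \<partial>(\<mu> \<Otimes>\<^sub>M \<nu>)) = (\<integral>p. centered_halfspace \<mu> (fst p) z * 1 - 1 * centered_halfspace \<nu> (snd p) z \<partial>(\<mu> \<Otimes>\<^sub>M \<nu>))"
      by (simp add: diff_kernel_def)
    also have "\<dots> = 0"
      unfolding Bochner_Integration.integral_diff[OF A(1) B(1)] A(2) B(2)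
      by (simp add: \<mu>.integral_centered_halfspace \<nu>.integral_centered_halfspace)
    finally show ?thesis .
  qed
  show "(\<integral>p. (diff_kernel p z)\<^sup>2 \<partial>(\<mu> \<Otimes>\<^sub>M \<nu>)) = (joint_sd z)\<^sup>2" for z
  proof -
    have eq: "(diff_kernel p z)\<^sup>2 = (centered_halfspace \<mu> (fst p) z - centered_halfspace \<nu> (snd p) z)
       * (centered_halfspace \<mu> (fst p) z + - centered_halfspace \<nu> (snd p) z)" for p
      by (simp add: diff_kernel_def power2_eq_square)
    have "(\<integral>p. (diff_kernel p z)\<^sup>2 \<partial>(\<mu> \<Otimes>\<^sub>M \<nu>))
      = (\<integral>x. centered_halfspace \<mu> x z * centered_halfspace \<mu> x z \<partial>\<mu>) - (\<integral>y. centered_halfspace \<nu> y z * - centered_halfspace \<nu> y z \<partial>\<nu>)"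
      unfolding eq
      by (rule pair_additive_integral(2)[OF \<mu>.prob_space_axioms \<nu>.prob_space_axioms])
         (use centered_halfspace_integrable[of z] in \<open>simp_all add: power2_eq_square \<mu>.integral_centered_halfspace \<nu>.integral_centered_halfspace\<close>)
    also have "\<dots> = (slice_sd \<mu> z)\<^sup>2 + (slice_sd \<nu> z)\<^sup>2"
      using \<mu>.integral_centered_halfspace_power2[of z] \<nu>.integral_centered_halfspace_power2[of z]
      by (simp add: power2_eq_square)
    finally show ?thesis by (simp add: joint_sd_def)
  qed
  show "integrable slices joint_sd"
  proof (rule Bochner_Integration.integrable_bound)
    show "integrable slices (\<lambda>z. slice_sd \<mu> z + slice_sd \<nu> z)" using \<mu> \<nu> by simp
    show "joint_sd \<in> borel_measurable slices"
      unfolding joint_sd_def[abs_def] using \<mu>.measurable_slice_sd \<nu>.measurable_slice_sd by measurable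
    show "AE z in slices. norm (joint_sd z) \<le> norm (slice_sd \<mu> z + slice_sd \<nu> z)"
    proof (rule AE_I2)
      fix z :: "real \<times> 'a"
      have "joint_sd z \<le> slice_sd \<mu> z + slice_sd \<nu> z"
        unfolding joint_sd_def by (rule sqrt_sum_squares_le_sum) (rule \<mu>.slice_sd_nonneg, rule \<nu>.slice_sd_nonneg)
      then show "norm (joint_sd z) \<le> norm (slice_sd \<mu> z + slice_sd \<nu> z)"
        using \<mu>.slice_sd_nonneg[of z] \<nu>.slice_sd_nonneg[of z] by (simp add: joint_sd_def)
    qed
  qed
  show "0 \<le> joint_sd z" for z by (simp add: joint_sd_def)
  show "AE z in slices. slice_cdf \<mu> z - slice_cdf \<nu> z \<noteq> 0 \<or> joint_sd z = 0"
    using distinct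
  proof eventually_elim
    case (elim z)
    then show ?case unfolding joint_sd_def by (elim disjE conjE) simp_all
  qed
  show "integrable (\<mu> \<Otimes>\<^sub>M \<nu>) (\<lambda>p. (\<integral>z. sign_diff z * diff_kernel p z \<partial>slices)\<^sup>2)"
    unfolding integral_sign_diff_kernel by (rule integral_influence_diff_power2)
qed

lemma influence_eq: "influence p = influence1 (fst p) - influence2 (snd p)"
  unfolding influence_def by (rule integral_sign_diff_kernel)

lemma asymptotic_variance_eq: "asymptotic_variance = (\<integral>x. (influence1 x)\<^sup>2 \<partial>\<mu>) + (\<integral>y. (influence2 y)\<^sup>2 \<partial>\<nu>)"
  unfolding influence_eq by (rule integral_influence_diff_power2)

lemma sliced_W1_eq: "sliced_W1 \<mu> \<nu> = (\<integral>z. \<bar>slice_cdf \<mu> z - slice_cdf \<nu> z\<bar> \<partial>slices)"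
  by (intro sliced_W1_eq_integral \<mu> \<nu>)

lemma sliced_W1_empirical:
  assumes n: "n > 0"
  shows "sliced_W1 (empirical n x) (empirical n y)
    = (\<integral>z. \<bar>slice_cdf \<mu> z - slice_cdf \<nu> z + ((\<Sum>i<n. centered_halfspace \<mu> (x i) z) / real n - (\<Sum>i<n. centered_halfspace \<nu> (y i) z) / real n)\<bar> \<partial>slices)"
proof -
  have eq: "slice_cdf (empirical n x) z - slice_cdf (empirical n y) z
      = slice_cdf \<mu> z - slice_cdf \<nu> z + ((\<Sum>i<n. centered_halfspace \<mu> (x i) z) / real n - (\<Sum>i<n. centered_halfspace \<nu> (y i) z) / real n)" for z
    using n by (simp add: empirical_facts(3) centered_halfspace_def sum_subtractf diff_divide_distrib)
  then show ?thesis
    by (subst sliced_W1_eq_integral[OF empirical_facts(1)[OF n] empirical_facts(1)[OF n] empirical_facts(2)[OF n] empirical_facts(2)[OF n]])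
       (simp only: eq)
qed

lemma influence_L2_fun: "influence \<in> L2_fun (\<mu> \<Otimes>\<^sub>M \<nu>)"
  using influence_L2 measurable_influence unfolding L2_fun_def by blast

lemma osum_integral:
  assumes h: "h1 \<in> L2_fun \<mu>" "h2 \<in> L2_fun \<nu>"
  shows "(\<integral>p. influence p * osum h1 h2 p \<partial>(\<mu> \<Otimes>\<^sub>M \<nu>)) = (\<integral>x. influence1 x * h1 x \<partial>\<mu>) - (\<integral>y. influence2 y * h2 y \<partial>\<nu>)"
proof -
  have L: "influence1 \<in> L2_fun \<mu>" "influence2 \<in> L2_fun \<nu>"
    using influence1_moments influence2_moments by (auto simp: L2_fun_def)
  have "integrable \<mu> h1" "integrable \<nu> h2"
    using h by (auto simp: L2_fun_def intro: \<mu>.square_integrable_imp_integrable \<nu>.square_integrable_imp_integrable)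
  moreover have "integrable \<mu> (\<lambda>x. influence1 x * h1 x)" "integrable \<nu> (\<lambda>y. influence2 y * h2 y)"
    by (rule L2_cauchy_schwarz(1)[OF \<mu>.prob_space_axioms L(1) h(1)], rule L2_cauchy_schwarz(1)[OF \<nu>.prob_space_axioms L(2) h(2)])
  ultimately show ?thesis
    unfolding influence_eq osum_def split_beta'
    by (intro pair_additive_integral(2) \<mu>.prob_space_axioms \<nu>.prob_space_axioms influence1_moments influence2_moments)
qed

lemma osum_L2:
  assumes h: "h1 \<in> tangent_set \<mu>" "h2 \<in> tangent_set \<nu>"
  shows "osum h1 h2 \<in> L2_fun (\<mu> \<Otimes>\<^sub>M \<nu>)"
    and "(\<integral>p. (osum h1 h2 p)\<^sup>2 \<partial>(\<mu> \<Otimes>\<^sub>M \<nu>)) = (\<integral>x. (h1 x)\<^sup>2 \<partial>\<mu>) + (\<integral>y. (h2 y)\<^sup>2 \<partial>\<nu>)"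
proof -
  have L: "h1 \<in> L2_fun \<mu>" "h2 \<in> L2_fun \<nu>"
    using h \<mu>.tangent_set_L2 \<nu>.tangent_set_L2 by auto
  have m: "h1 \<in> borel_measurable \<mu>" "h2 \<in> borel_measurable \<nu>" and i2: "integrable \<mu> (\<lambda>x. (h1 x)\<^sup>2)" "integrable \<nu> (\<lambda>x. (h2 x)\<^sup>2)"
    using L by (auto simp: L2_fun_def)
  have i1: "integrable \<mu> h1" "integrable \<nu> h2"
    using \<mu>.square_integrable_imp_integrable[OF m(1) i2(1)] \<nu>.square_integrable_imp_integrable[OF m(2) i2(2)] by auto
  have e: "(\<integral>x. h1 x \<partial>\<mu>) = 0" "(\<integral>x. h2 x \<partial>\<nu>) = 0" using h by (auto simp: tangent_set_def)
  note A = pair_additive_integral[OF \<mu>.prob_space_axioms \<nu>.prob_space_axioms, of h1 h1 "\<lambda>y. - h2 y" h2]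
  have eq: "(osum h1 h2 p)\<^sup>2 = (h1 (fst p) - - h2 (snd p)) * (h1 (fst p) + h2 (snd p))" for p
    by (simp add: osum_def split_beta' power2_eq_square)
  have "integrable (\<mu> \<Otimes>\<^sub>M \<nu>) (\<lambda>p. (osum h1 h2 p)\<^sup>2)"
    unfolding eq by (rule A(1)) (use i1 i2 e in \<open>simp_all add: power2_eq_square\<close>)
  moreover have "osum h1 h2 \<in> borel_measurable (\<mu> \<Otimes>\<^sub>M \<nu>)"
    unfolding osum_def split_beta'
    by (intro borel_measurable_add measurable_compose[OF measurable_fst m(1)] measurable_compose[OF measurable_snd m(2)])
  ultimately show "osum h1 h2 \<in> L2_fun (\<mu> \<Otimes>\<^sub>M \<nu>)" by (simp add: L2_fun_def)
  have "(\<integral>p. (osum h1 h2 p)\<^sup>2 \<partial>(\<mu> \<Otimes>\<^sub>M \<nu>)) = (\<integral>x. h1 x * h1 x \<partial>\<mu>) - (\<integral>y. - h2 y * h2 y \<partial>\<nu>)"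
    unfolding eq by (rule A(2)) (use i1 i2 e in \<open>simp_all add: power2_eq_square\<close>)
  then show "(\<integral>p. (osum h1 h2 p)\<^sup>2 \<partial>(\<mu> \<Otimes>\<^sub>M \<nu>)) = (\<integral>x. (h1 x)\<^sup>2 \<partial>\<mu>) + (\<integral>y. (h2 y)\<^sup>2 \<partial>\<nu>)"
    by (simp add: power2_eq_square)
qed

theorem efficiency_bound: "has_efficiency_bound2 sliced_W1 \<mu> \<nu> (ennreal asymptotic_variance)"
  unfolding has_efficiency_bound2_def
proof (intro exI conjI ballI)
  let ?D = "\<lambda>f. \<integral>p. influence p * f p \<partial>(\<mu> \<Otimes>\<^sub>M \<nu>)"
  show "continuous_linear_functional_L2 (\<mu> \<Otimes>\<^sub>M \<nu>) ?D"
    by (rule continuous_linear_functional_L2_integral[OF \<mu>\<nu>.prob_space_axioms influence_L2_fun])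
  fix h1 h2 assume h1: "h1 \<in> tangent_set \<mu>" and h2: "h2 \<in> tangent_set \<nu>"
  obtain B1 where B1: "B1 \<ge> 0" "\<And>x. \<bar>h1 x\<bar> \<le> B1" using tangent_set_bound[OF h1] by auto
  obtain B2 where B2: "B2 \<ge> 0" "\<And>x. \<bar>h2 x\<bar> \<le> B2" using tangent_set_bound[OF h2] by auto
  have L: "h1 \<in> L2_fun \<mu>" "h2 \<in> L2_fun \<nu>"
    using h1 h2 \<mu>.tangent_set_L2 \<nu>.tangent_set_L2 by auto
  have hm: "osum h1 h2 \<in> borel_measurable (\<mu> \<Otimes>\<^sub>M \<nu>)"
    using osum_L2(1)[OF h1 h2] by (simp add: L2_fun_def)
  have hb: "\<bar>osum h1 h2 p\<bar> \<le> B1 + B2" for p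
    using abs_triangle_ineq[of "h1 (fst p)" "h2 (snd p)"] B1(2)[of "fst p"] B2(2)[of "snd p"] by (simp add: osum_def split_beta')
  define H where "H z = (\<integral>p. osum h1 h2 p * diff_kernel p z \<partial>(\<mu> \<Otimes>\<^sub>M \<nu>))" for z
  have H_eq: "H z = (\<integral>x. h1 x * centered_halfspace \<mu> x z \<partial>\<mu>) - (\<integral>y. h2 y * centered_halfspace \<nu> y z \<partial>\<nu>)" for z
  proof -
    have K: "(\<lambda>x. centered_halfspace \<mu> x z) \<in> L2_fun \<mu>" "(\<lambda>x. centered_halfspace \<nu> x z) \<in> L2_fun \<nu>"
      using centered_halfspace_integrable[of z] by (auto simp: L2_fun_def)
    have i1: "integrable \<mu> h1" "integrable \<nu> h2"
      using L by (auto simp: L2_fun_def intro: \<mu>.square_integrable_imp_integrable \<nu>.square_integrable_imp_integrable)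
    have "H z = (\<integral>p. (centered_halfspace \<mu> (fst p) z - centered_halfspace \<nu> (snd p) z) * (h1 (fst p) + h2 (snd p)) \<partial>(\<mu> \<Otimes>\<^sub>M \<nu>))"
      unfolding H_def by (intro Bochner_Integration.integral_cong) (simp_all add: osum_def split_beta' diff_kernel_def mult.commute)
    also have "\<dots> = (\<integral>x. centered_halfspace \<mu> x z * h1 x \<partial>\<mu>) - (\<integral>y. centered_halfspace \<nu> y z * h2 y \<partial>\<nu>)"
      by (intro pair_additive_integral(2) \<mu>.prob_space_axioms \<nu>.prob_space_axioms centered_halfspace_integrable i1
          L2_cauchy_schwarz(1)[OF \<mu>.prob_space_axioms K(1) L(1)] L2_cauchy_schwarz(1)[OF \<nu>.prob_space_axioms K(2) L(2)]
          \<mu>.integral_centered_halfspace \<nu>.integral_centered_halfspace)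
    finally show ?thesis by (simp add: mult.commute)
  qed
  note I = integral_influence_mult[OF hm hb, folded H_def]
  have lim: "((\<lambda>t. ((\<integral>z. \<bar>slice_cdf \<mu> z - slice_cdf \<nu> z + t * H z\<bar> \<partial>slices)
        - (\<integral>z. \<bar>slice_cdf \<mu> z - slice_cdf \<nu> z\<bar> \<partial>slices)) / t) \<longlongrightarrow> ?D (osum h1 h2)) (at_right 0)"
  proof -
    have "?D (osum h1 h2) = (\<integral>p. osum h1 h2 p * influence p \<partial>(\<mu> \<Otimes>\<^sub>M \<nu>))"
      by (intro Bochner_Integration.integral_cong) simp_all
    then show ?thesis
      using directional_derivative[OF I(2) AE_I2[OF I(3)]] by (simp only: I(1))
  qed
  have "eventually (\<lambda>t. t \<in> {0<..<1 / (B1 + B2 + 1)}) (at_right 0)"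
    using B1 B2 by (intro eventually_at_right_real) simp
  then have "\<forall>\<^sub>F t in at_right 0. ((\<integral>z. \<bar>slice_cdf \<mu> z - slice_cdf \<nu> z + t * H z\<bar> \<partial>slices)
        - (\<integral>z. \<bar>slice_cdf \<mu> z - slice_cdf \<nu> z\<bar> \<partial>slices)) / t = (sliced_W1 (perturb \<mu> t h1) (perturb \<nu> t h2) - sliced_W1 \<mu> \<nu>) / t"
  proof eventually_elim
    case (elim t)
    then have t0: "0 < t" by simp
    have "t * (B1 + B2 + 1) \<le> 1" using B1 B2 elim by (simp add: field_simps)
    moreover have "0 \<le> t * B1" "0 \<le> t * B2" using B1 B2 t0 by auto
    ultimately have t: "0 \<le> t" "t * B1 \<le> 1" "t * B2 \<le> 1" using t0 by (auto simp: distrib_left)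
    note p = \<mu>.perturbation[OF h1 B1(2) t(1,2) \<mu>(2)] and q = \<nu>.perturbation[OF h2 B2(2) t(1,3) \<nu>(2)]
    have "sliced_W1 (perturb \<mu> t h1) (perturb \<nu> t h2) = (\<integral>z. \<bar>slice_cdf \<mu> z - slice_cdf \<nu> z + t * H z\<bar> \<partial>slices)"
      unfolding sliced_W1_eq_integral[OF p(1) q(1) p(2) q(2)] p(3) q(3) H_eq
      by (intro Bochner_Integration.integral_cong) (auto simp: algebra_simps)
    then show ?case by (simp add: sliced_W1_eq)
  qed
  from Lim_transform_eventually[OF lim this]
  show "((\<lambda>t. (sliced_W1 (perturb \<mu> t h1) (perturb \<nu> t h2) - sliced_W1 \<mu> \<nu>) / t) \<longlongrightarrow> ?D (osum h1 h2)) (at_right 0)" .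
next
  obtain g1 q1 where g1: "\<And>j :: nat. g1 j \<in> tangent_set \<mu>" "\<And>j. (\<integral>x. influence1 x * g1 j x \<partial>\<mu>) = q1 j"
    "\<And>j. (\<integral>x. (g1 j x)\<^sup>2 \<partial>\<mu>) \<le> q1 j" "q1 \<longlonglongrightarrow> (\<integral>x. (influence1 x)\<^sup>2 \<partial>\<mu>)"
    by (rule \<mu>.truncated_tangent[OF influence1_moments(3,1,2)]) (rule that)
  have mi: "(\<lambda>x. - influence2 x) \<in> borel_measurable \<nu>" "integrable \<nu> (\<lambda>x. (- influence2 x)\<^sup>2)" "(\<integral>x. - influence2 x \<partial>\<nu>) = 0"
    using influence2_moments by auto
  obtain g2 q2 where g2: "\<And>j :: nat. g2 j \<in> tangent_set \<nu>" "\<And>j. (\<integral>x. - influence2 x * g2 j x \<partial>\<nu>) = q2 j"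
    "\<And>j. (\<integral>x. (g2 j x)\<^sup>2 \<partial>\<nu>) \<le> q2 j" "q2 \<longlonglongrightarrow> (\<integral>x. (- influence2 x)\<^sup>2 \<partial>\<nu>)"
    by (rule \<nu>.truncated_tangent[OF mi]) (rule that)
  define H where "H = {osum h1 h2 | h1 h2. h1 \<in> tangent_set \<mu> \<and> h2 \<in> tangent_set \<nu>}"
  have HL: "H \<subseteq> L2_fun (\<mu> \<Otimes>\<^sub>M \<nu>)" unfolding H_def using osum_L2(1) by auto
  define g where "g j = osum (g1 j) (g2 j)" for j
  have gH: "g j \<in> H" for j unfolding g_def H_def using g1(1) g2(1) by blast
  have gq: "(\<integral>p. influence p * g j p \<partial>(\<mu> \<Otimes>\<^sub>M \<nu>)) = q1 j + q2 j" for j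
    unfolding g_def osum_integral[OF \<mu>.tangent_set_L2[OF g1(1)] \<nu>.tangent_set_L2[OF g2(1)]]
    using g1(2)[of j] g2(2)[of j] by simp
  have gn: "(\<integral>p. (g j p)\<^sup>2 \<partial>(\<mu> \<Otimes>\<^sub>M \<nu>)) \<le> q1 j + q2 j" for j
    unfolding g_def osum_L2(2)[OF g1(1) g2(1)] by (intro add_mono g1 g2)
  have lim: "(\<lambda>j. q1 j + q2 j) \<longlonglongrightarrow> asymptotic_variance"
    unfolding asymptotic_variance_eq using tendsto_add[OF g1(4) g2(4)] by simp
  have "ennreal asymptotic_variance =
     (SUP h\<in>{h \<in> H. L2_nrm (\<mu> \<Otimes>\<^sub>M \<nu>) h \<noteq> 0}. ennreal ((\<integral>p. influence p * h p \<partial>(\<mu> \<Otimes>\<^sub>M \<nu>))\<^sup>2 / (L2_nrm (\<mu> \<Otimes>\<^sub>M \<nu>) h)\<^sup>2))"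
    by (rule efficiency_bound_eq_norm[where Q="\<mu> \<Otimes>\<^sub>M \<nu>" and \<phi>=influence and H=H and g=g and q="\<lambda>j. q1 j + q2 j",
            OF \<mu>\<nu>.prob_space_axioms influence_L2_fun HL gH gq gn lim])
  moreover have "{h \<in> H. L2_nrm (\<mu> \<Otimes>\<^sub>M \<nu>) h \<noteq> 0} = {osum h1 h2 | h1 h2. h1 \<in> tangent_set \<mu> \<and> h2 \<in> tangent_set \<nu> \<and>
                                         L2_nrm (\<mu> \<Otimes>\<^sub>M \<nu>) (osum h1 h2) \<noteq> 0}"
    unfolding H_def by blast
  ultimately show "ennreal asymptotic_variance =
     (SUP h\<in>{osum h1 h2 | h1 h2. h1 \<in> tangent_set \<mu> \<and> h2 \<in> tangent_set \<nu> \<and>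
                                         L2_nrm (\<mu> \<Otimes>\<^sub>M \<nu>) (osum h1 h2) \<noteq> 0}.
        ennreal ((\<integral>p. influence p * h p \<partial>(\<mu> \<Otimes>\<^sub>M \<nu>))\<^sup>2 / (L2_nrm (\<mu> \<Otimes>\<^sub>M \<nu>) h)\<^sup>2))"
    by (simp only:)
qed

text \<open>Pairs with equal indices form an independent sequence, which suffices for the central limit
theorem; the law of a single pair is needed for all pairs of indices, because the bootstrap draws from all of them.\<close>

lemma two_sample_law:
  assumes S: "two_iid_samples M \<mu> \<nu> X Y"
  shows "prob_space M"
    and "prob_space.indep_vars M (\<lambda>_. \<mu>) X UNIV" and "prob_space.indep_vars M (\<lambda>_. \<nu>) Y UNIV"
    and "prob_space.indep_vars M (\<lambda>_. \<mu> \<Otimes>\<^sub>M \<nu>) (\<lambda>i \<omega>. (X i \<omega>, Y i \<omega>)) UNIV"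
    and "distr M \<mu> (X i) = \<mu>" and "distr M \<nu> (Y i) = \<nu>"
    and "(\<lambda>\<omega>. (X i \<omega>, Y j \<omega>)) \<in> M \<rightarrow>\<^sub>M \<mu> \<Otimes>\<^sub>M \<nu>"
    and "distr M (\<mu> \<Otimes>\<^sub>M \<nu>) (\<lambda>\<omega>. (X i \<omega>, Y j \<omega>)) = \<mu> \<Otimes>\<^sub>M \<nu>"
proof -
  show "prob_space M" using S by (simp add: two_iid_samples_def)
  then interpret M: prob_space M .
  have ind: "M.indep_vars (\<lambda>_. borel) (case_sum X Y) UNIV"
    and DX: "\<And>i. distr M borel (X i) = \<mu>" and DY: "\<And>i. distr M borel (Y i) = \<nu>"
    using S by (auto simp: two_iid_samples_def)
  have proj: "(\<lambda>f. f c) \<in> PiM K (\<lambda>_. borel :: 'a measure) \<rightarrow>\<^sub>M \<mu>" "(\<lambda>f. f c) \<in> PiM K (\<lambda>_. borel :: 'a measure) \<rightarrow>\<^sub>M \<nu>"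
    if "c \<in> K" for c :: "nat + nat" and K
    using measurable_component_singleton[OF that, of "\<lambda>_. borel :: 'a measure"]
    by (simp_all add: measurable_cong_sets[OF refl \<mu>.sets_eq_borel] measurable_cong_sets[OF refl \<nu>.sets_eq_borel])
  have bX: "M.indep_vars (\<lambda>_. \<mu>) (\<lambda>i \<omega>. (\<lambda>f. f (Inl i)) (restrict (\<lambda>c. case_sum X Y c \<omega>) {Inl i})) UNIV"
    by (rule M.indep_vars_blocks[OF ind, where K="\<lambda>i. {Inl i}" and g="\<lambda>i f. f (Inl i)"]) (auto simp: disjoint_family_on_def intro!: proj)
  then show "M.indep_vars (\<lambda>_. \<mu>) X UNIV" by simp
  have bY: "M.indep_vars (\<lambda>_. \<nu>) (\<lambda>i \<omega>. (\<lambda>f. f (Inr i)) (restrict (\<lambda>c. case_sum X Y c \<omega>) {Inr i})) UNIV"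
    by (rule M.indep_vars_blocks[OF ind, where K="\<lambda>i. {Inr i}" and g="\<lambda>i f. f (Inr i)"]) (auto simp: disjoint_family_on_def intro!: proj)
  then show "M.indep_vars (\<lambda>_. \<nu>) Y UNIV" by simp
  have bXY: "M.indep_vars (\<lambda>_. \<mu> \<Otimes>\<^sub>M \<nu>)
     (\<lambda>i \<omega>. (\<lambda>f. (f (Inl i), f (Inr i))) (restrict (\<lambda>c. case_sum X Y c \<omega>) {Inl i, Inr i})) UNIV"
    by (rule M.indep_vars_blocks[OF ind, where K="\<lambda>i. {Inl i, Inr i}" and g="\<lambda>i f. (f (Inl i), f (Inr i))"])
       (auto simp: disjoint_family_on_def intro!: measurable_Pair proj)
  then show "M.indep_vars (\<lambda>_. \<mu> \<Otimes>\<^sub>M \<nu>) (\<lambda>i \<omega>. (X i \<omega>, Y i \<omega>)) UNIV" by simp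
  show LX: "distr M \<mu> (X i) = \<mu>" for i
    by (subst (2) DX[symmetric, of i]) (rule distr_cong, simp_all)
  show LY: "distr M \<nu> (Y j) = \<nu>" for j
    by (subst (2) DY[symmetric, of j]) (rule distr_cong, simp_all)
  have "M.indep_var (PiM {Inl i} (\<lambda>_. borel)) (\<lambda>\<omega>. restrict (\<lambda>c. case_sum X Y c \<omega>) {Inl i})
     (PiM {Inr j} (\<lambda>_. borel)) (\<lambda>\<omega>. restrict (\<lambda>c. case_sum X Y c \<omega>) {Inr j})"
    by (rule M.indep_var_restrict[OF ind]) auto
  from M.indep_var_compose[OF this proj(1)[of "Inl i"] proj(2)[of "Inr j"]]
  have "M.indep_var \<mu> (X i) \<nu> (Y j)" by (simp add: comp_def)
  then have XY: "X i \<in> M \<rightarrow>\<^sub>M \<mu>" "Y j \<in> M \<rightarrow>\<^sub>M \<nu>"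
    "distr M \<mu> (X i) \<Otimes>\<^sub>M distr M \<nu> (Y j) = distr M (\<mu> \<Otimes>\<^sub>M \<nu>) (\<lambda>\<omega>. (X i \<omega>, Y j \<omega>))"
    unfolding M.indep_var_distribution_eq by auto
  then show "(\<lambda>\<omega>. (X i \<omega>, Y j \<omega>)) \<in> M \<rightarrow>\<^sub>M \<mu> \<Otimes>\<^sub>M \<nu>" by (intro measurable_Pair)
  show "distr M (\<mu> \<Otimes>\<^sub>M \<nu>) (\<lambda>\<omega>. (X i \<omega>, Y j \<omega>)) = \<mu> \<Otimes>\<^sub>M \<nu>"
    using XY(3) by (simp only: LX LY)
qed

theorem empirical_central_limit:
  assumes "two_iid_samples M \<mu> \<nu> X Y"
  shows "conv_in_distribution M
    (\<lambda>n \<omega>. sqrt (real n) * (sliced_W1 (empirical n (\<lambda>i. X i \<omega>)) (empirical n (\<lambda>i. Y i \<omega>)) - sliced_W1 \<mu> \<nu>))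
    (centered_normal asymptotic_variance)"
proof -
  have "(\<lambda>n \<omega>. sqrt (real n) * (sliced_W1 (empirical n (\<lambda>i. X i \<omega>)) (empirical n (\<lambda>i. Y i \<omega>)) - sliced_W1 \<mu> \<nu>))
    = (\<lambda>n \<omega>. sqrt (real n) * ((\<integral>z. \<bar>slice_cdf \<mu> z - slice_cdf \<nu> z + (\<Sum>i<n. diff_kernel (X i \<omega>, Y i \<omega>) z) / real n\<bar> \<partial>slices)
        - (\<integral>z. \<bar>slice_cdf \<mu> z - slice_cdf \<nu> z\<bar> \<partial>slices)))" (is "?L = ?R")
  proof (intro ext)
    fix n \<omega> show "?L n \<omega> = ?R n \<omega>"
      by (cases "n = 0") (simp_all add: sliced_W1_empirical sliced_W1_eq diff_kernel_def sum_subtractf diff_divide_distrib)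
  qed
  then show ?thesis
    using central_limit[OF two_sample_law(1,4,8)[OF assms]] by simp
qed

text \<open>Independent bootstrap samples from both samples are given by independent uniform draws of pairs of
indices.\<close>

lemma bootstrap_cdf2_eq:
  fixes x y :: "nat \<Rightarrow> 'a"
  shows "bootstrap_cdf2 n x y t = measure (PiM {..<n} (\<lambda>_. uniform_count_measure ({..<n} \<times> {..<n})))
    {j \<in> space (PiM {..<n} (\<lambda>_. uniform_count_measure ({..<n} \<times> {..<n}))).
       sqrt (real n) * (sliced_W1 (empirical n (\<lambda>i. x (fst (j i)))) (empirical n (\<lambda>i. y (snd (j i))))
          - sliced_W1 (empirical n x) (empirical n y)) \<le> t}"
proof (cases "n = 0")
  case True
  interpret Bx: prob_space "bootstrap_law n x" by (rule prob_space_bootstrap_law)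
  interpret By: prob_space "bootstrap_law n y" by (rule prob_space_bootstrap_law)
  interpret B: pair_prob_space "bootstrap_law n x" "bootstrap_law n y" ..
  interpret K: prob_space "PiM {..<n} (\<lambda>_. uniform_count_measure ({..<n} \<times> {..<n}))"
    using True by (intro prob_space_PiM) simp
  show ?thesis
    using B.prob_space K.prob_space by (cases "0 \<le> t") (simp_all add: bootstrap_cdf2_def True split_beta')
next
  case False
  then have n: "n > 0" by simp
  let ?U = "uniform_count_measure {..<n}"
  let ?K = "PiM {..<n} (\<lambda>_. ?U)"
  let ?R = "PiM {..<n} (\<lambda>_. uniform_count_measure ({..<n} \<times> {..<n}))"
  let ?B = "bootstrap_law n x \<Otimes>\<^sub>M bootstrap_law n y"
  let ?s = "\<lambda>xb yb. sqrt (real n) * (sliced_W1 (empirical n xb) (empirical n yb) - sliced_W1 (empirical n x) (empirical n y))"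
  let ?E = "{p \<in> space ?B. ?s (fst p) (snd p) \<le> t}"
  let ?F = "{j \<in> space ?R. ?s (\<lambda>i. x (fst (j i))) (\<lambda>i. y (snd (j i))) \<le> t}"
  let ?c = "\<lambda>(j1, j2). (compose {..<n} x j1, compose {..<n} y j2)"
  let ?z = "\<lambda>(j1, j2). \<lambda>i\<in>{..<n}. (j1 i, j2 i) :: nat \<times> nat"
  interpret U: prob_space ?U using n by (intro prob_space_uniform_count_measure) auto
  interpret Ky: prob_space "bootstrap_law n y" by (rule prob_space_bootstrap_law)
  note cx = bootstrap_law_eq_distr[OF n, of x] and cy = bootstrap_law_eq_distr[OF n, of y]
  have UU: "?U \<Otimes>\<^sub>M ?U = uniform_count_measure ({..<n} \<times> {..<n})"
    using n by (intro uniform_count_measure_times) auto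
  have zip: "distr (?K \<Otimes>\<^sub>M ?K) ?R ?z = ?R"
    using distr_zip_PiM[OF _ U.prob_space_axioms U.prob_space_axioms, of "{..<n}"] by (simp only: UU finite_lessThan)
  have zm: "?z \<in> ?K \<Otimes>\<^sub>M ?K \<rightarrow>\<^sub>M ?R"
    unfolding UU[symmetric] split_beta' by (rule measurable_restrict) measurable
  have cm: "?c \<in> ?K \<Otimes>\<^sub>M ?K \<rightarrow>\<^sub>M ?B"
    unfolding split_beta'
    by (intro measurable_Pair measurable_compose[OF measurable_fst cx(1)] measurable_compose[OF measurable_snd cy(1)])
  have B_eq: "?B = distr (?K \<Otimes>\<^sub>M ?K) ?B ?c"
  proof -
    have "sigma_finite_measure (distr ?K (bootstrap_law n y) (compose {..<n} y))"
      unfolding cy(2)[symmetric] ..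
    from pair_measure_distr[OF cx(1) cy(1) this] show ?thesis
      by (simp only: cx(2)[symmetric] cy(2)[symmetric])
  qed
  have sm: "(\<lambda>p. ?s (fst p) (snd p)) \<in> borel_measurable ?B"
    by (intro borel_measurable_times borel_measurable_diff borel_measurable_const
        measurable_sliced_W1_empirical2[OF n, where f="\<lambda>i p. fst p i" and g="\<lambda>i p. snd p i"]
        measurable_compose[OF measurable_fst bootstrap_law_component] measurable_compose[OF measurable_snd bootstrap_law_component])
  have E: "?E \<in> sets ?B" using sm by measurable
  have Rm: "(\<lambda>j. f (j i)) \<in> borel_measurable ?R" if "i < n" for i and f :: "nat \<times> nat \<Rightarrow> 'a"
  proof -
    have "(\<lambda>j. j i) \<in> ?R \<rightarrow>\<^sub>M uniform_count_measure ({..<n} \<times> {..<n})"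
      using that by (intro measurable_component_singleton) simp
    from measurable_compose[OF this measurable_from_uniform_count[of _ f borel]] show ?thesis by simp
  qed
  have "(\<lambda>j. ?s (\<lambda>i. x (fst (j i))) (\<lambda>i. y (snd (j i)))) \<in> borel_measurable ?R"
    by (intro borel_measurable_times borel_measurable_diff borel_measurable_const
        measurable_sliced_W1_empirical2[OF n, where f="\<lambda>i j. x (fst (j i))" and g="\<lambda>i j. y (snd (j i))"]
        Rm[of _ "\<lambda>p. x (fst p)"] Rm[of _ "\<lambda>p. y (snd p)"])
  then have F: "?F \<in> sets ?R" by measurable
  have e: "empirical n (compose {..<n} w j) = empirical n (\<lambda>i. w (j i))" for w :: "nat \<Rightarrow> 'a" and j
    by (rule empirical_cong) (simp add: compose_def)
  have ez: "empirical n (\<lambda>i. w (fst (?z p i))) = empirical n (\<lambda>i. w (fst p i))"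
    "empirical n (\<lambda>i. w (snd (?z p i))) = empirical n (\<lambda>i. w (snd p i))" for w :: "nat \<Rightarrow> 'a" and p
    by (auto intro!: empirical_cong simp: split_beta')
  have "bootstrap_cdf2 n x y t = measure ?B ?E"
    unfolding bootstrap_cdf2_def by (intro arg_cong[where f="measure ?B"]) (simp add: split_beta')
  also have "\<dots> = measure (distr (?K \<Otimes>\<^sub>M ?K) ?B ?c) ?E"
    by (subst B_eq[symmetric]) (rule refl)
  also have "\<dots> = measure (?K \<Otimes>\<^sub>M ?K) (?c -` ?E \<inter> space (?K \<Otimes>\<^sub>M ?K))"
    by (rule measure_distr[OF cm E])
  also have "?c -` ?E \<inter> space (?K \<Otimes>\<^sub>M ?K) = ?z -` ?F \<inter> space (?K \<Otimes>\<^sub>M ?K)"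
  proof (intro set_eqI)
    fix p
    have "?c p \<in> ?E \<longleftrightarrow> ?z p \<in> ?F" if p: "p \<in> space (?K \<Otimes>\<^sub>M ?K)"
    proof -
      have "?c p \<in> space ?B" "?z p \<in> space ?R"
        using measurable_space[OF cm p] measurable_space[OF zm p] by auto
      moreover have "fst (?c p) = compose {..<n} x (fst p)" "snd (?c p) = compose {..<n} y (snd p)"
        by (simp_all add: split_beta')
      ultimately show ?thesis by (simp only: mem_Collect_eq simp_thms e ez)
    qed
    then show "p \<in> ?c -` ?E \<inter> space (?K \<Otimes>\<^sub>M ?K) \<longleftrightarrow> p \<in> ?z -` ?F \<inter> space (?K \<Otimes>\<^sub>M ?K)"
      unfolding vimage_def by blast
  qed
  also have "measure (?K \<Otimes>\<^sub>M ?K) \<dots> = measure (distr (?K \<Otimes>\<^sub>M ?K) ?R ?z) ?F"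
    by (rule measure_distr[OF zm F, symmetric])
  also have "\<dots> = measure ?R ?F" by (simp only: zip)
  finally show ?thesis .
qed

text \<open>The average of a product \<open>f x * g y\<close> over all pairs of observations is the product of the averages of \<open>f\<close> and \<open>g\<close>.
Hence averages of the kernel and of the influence function over all pairs agree with those over the
independent pairs \<open>(X i, Y i)\<close>.  The average of the squared influence function contains the mixed
term \<open>-2 * (AX n influence1 \<omega> * AY n influence2 \<omega>)\<close>, a product of two factors of order \<open>1 / sqrt n\<close> in mean
square.\<close>

theorem bootstrap:
  assumes iid: "two_iid_samples M \<mu> \<nu> X Y" and v: "asymptotic_variance > 0"
  shows "conv_in_probability M
    (\<lambda>n \<omega>. \<Squnion>t. \<bar>bootstrap_cdf2 n (\<lambda>i. X i \<omega>) (\<lambda>i. Y i \<omega>) t - cdf (centered_normal asymptotic_variance) t\<bar>) 0"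
proof -
  note I = two_sample_law[OF iid]
  interpret M: prob_space M by (rule I)
  have IX: "M.indep_vars (\<lambda>_. \<mu>) X {..<n}" and IY: "M.indep_vars (\<lambda>_. \<nu>) Y {..<n}"
    and IXY: "M.indep_vars (\<lambda>_. \<mu> \<Otimes>\<^sub>M \<nu>) (\<lambda>i \<omega>. (X i \<omega>, Y i \<omega>)) {..<n}" for n
    by (rule M.indep_vars_subset[OF I(2)], simp, rule M.indep_vars_subset[OF I(3)], simp, rule M.indep_vars_subset[OF I(4)], simp)
  let ?J = "\<lambda>n::nat. {..<n} \<times> {..<n}"
  let ?D = "\<lambda>\<iota> \<omega>. (X (fst \<iota>) \<omega>, Y (snd \<iota>) \<omega>)"
  interpret R: resampling "\<mu> \<Otimes>\<^sub>M \<nu>" slices "\<lambda>z. slice_cdf \<mu> z - slice_cdf \<nu> z" diff_kernel joint_sd M ?J ?D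
  proof unfold_locales
    show "(\<lambda>\<omega>. (X (fst \<iota>) \<omega>, Y (snd \<iota>) \<omega>)) \<in> M \<rightarrow>\<^sub>M \<mu> \<Otimes>\<^sub>M \<nu>"
      "distr M (\<mu> \<Otimes>\<^sub>M \<nu>) (\<lambda>\<omega>. (X (fst \<iota>) \<omega>, Y (snd \<iota>) \<omega>)) = \<mu> \<Otimes>\<^sub>M \<nu>" for \<iota>
      by (rule I(7), rule I(8))
  qed auto
  define AX where "AX n f \<omega> = (\<Sum>i<n. f (X i \<omega>)) / real n" for n and f :: "'a \<Rightarrow> real" and \<omega>
  define AY where "AY n f \<omega> = (\<Sum>i<n. f (Y i \<omega>)) / real n" for n and f :: "'a \<Rightarrow> real" and \<omega>
  have pool: "R.pool_average n (\<lambda>p. f (fst p) * g (snd p)) \<omega> = AX n f \<omega> * AY n g \<omega>" for n f g \<omega>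
    by (simp add: R.pool_average_def AX_def AY_def sum_product sum.cartesian_product split_beta' card_cartesian_product)
  have pool_diff: "R.pool_average n (\<lambda>p. f (fst p) - g (snd p)) \<omega> = AX n f \<omega> - AY n g \<omega>" if n: "n > 0" for n f g \<omega>
  proof -
    have "R.pool_average n (\<lambda>p. f (fst p)) \<omega> = AX n f \<omega>"
      using pool[of n f "\<lambda>_. 1" \<omega>] n by (simp add: AY_def)
    moreover have "R.pool_average n (\<lambda>p. g (snd p)) \<omega> = AY n g \<omega>"
      using pool[of n "\<lambda>_. 1" g \<omega>] n by (simp add: AX_def)
    ultimately show ?thesis
      by (simp add: R.pool_average_def sum_subtractf diff_divide_distrib)
  qed
  have pk: "R.pool_average n (\<lambda>p. diff_kernel p z) \<omega> = (\<Sum>i<n. diff_kernel (X i \<omega>, Y i \<omega>) z) / real n" if "n > 0" for n z \<omega>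
    using pool_diff[OF that, of "\<lambda>x. centered_halfspace \<mu> x z" "\<lambda>y. centered_halfspace \<nu> y z" \<omega>]
    by (simp add: AX_def AY_def diff_kernel_def sum_subtractf diff_divide_distrib)
  have pi: "R.pool_average n influence \<omega> = (\<Sum>i<n. influence (X i \<omega>, Y i \<omega>)) / real n" if "n > 0" for n \<omega>
    unfolding ext[of influence, OF influence_eq]
    using pool_diff[OF that, of influence1 influence2 \<omega>]
    by (simp add: AX_def AY_def sum_subtractf diff_divide_distrib)
  have p2: "R.pool_average n (\<lambda>p. (influence p)\<^sup>2) \<omega> =
      AX n (\<lambda>x. (influence1 x)\<^sup>2) \<omega> + AY n (\<lambda>y. (influence2 y)\<^sup>2) \<omega> - 2 * (AX n influence1 \<omega> * AY n influence2 \<omega>)"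
    if n: "n > 0" for n \<omega>
  proof -
    have "R.pool_average n (\<lambda>p. (influence p)\<^sup>2) \<omega>
      = R.pool_average n (\<lambda>p. (influence1 (fst p))\<^sup>2 - - (influence2 (snd p))\<^sup>2) \<omega>
        - 2 * R.pool_average n (\<lambda>p. influence1 (fst p) * influence2 (snd p)) \<omega>"
      by (simp add: R.pool_average_def influence_eq power2_diff sum_subtractf sum.distrib diff_divide_distrib
          add_divide_distrib sum_distrib_left mult.assoc)
    also have "R.pool_average n (\<lambda>p. (influence1 (fst p))\<^sup>2 - - (influence2 (snd p))\<^sup>2) \<omega>
       = AX n (\<lambda>x. (influence1 x)\<^sup>2) \<omega> + AY n (\<lambda>y. (influence2 y)\<^sup>2) \<omega>"
      using pool_diff[OF n, of "\<lambda>x. (influence1 x)\<^sup>2" "\<lambda>y. - (influence2 y)\<^sup>2" \<omega>]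
      by (simp add: AY_def sum_negf)
    finally show ?thesis by (simp add: pool)
  qed
  note S = M.second_moment_iid_average[OF IXY I(8)]
  note SX = M.second_moment_iid_average[OF IX I(5) influence1_moments(3,1,2), folded AX_def]
    and SY = M.second_moment_iid_average[OF IY I(6) influence2_moments(3,1,2), folded AY_def]
  have Ximeas: "X i \<in> M \<rightarrow>\<^sub>M \<mu>" and Yimeas: "Y i \<in> M \<rightarrow>\<^sub>M \<nu>" for i
    using I(2,3) by (auto simp: M.indep_vars_def)
  have tX: "integrable M (AX n f)" if f: "integrable \<mu> f" for n f
  proof -
    have fm: "f \<in> borel_measurable \<mu>" using f by auto
    have "integrable M (\<lambda>\<omega>. f (X i \<omega>))" for i
      using f I(5)[of i] integrable_distr_eq[OF Ximeas[of i] fm] by simp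
    then show ?thesis unfolding AX_def[abs_def] by simp
  qed
  have tY: "integrable M (AY n f)" if f: "integrable \<nu> f" for n f
  proof -
    have fm: "f \<in> borel_measurable \<nu>" using f by auto
    have "integrable M (\<lambda>\<omega>. f (Y i \<omega>))" for i
      using f I(6)[of i] integrable_distr_eq[OF Yimeas[of i] fm] by simp
    then show ?thesis unfolding AY_def[abs_def] by simp
  qed
  define v1 where "v1 = (\<integral>x. (influence1 x)\<^sup>2 \<partial>\<mu>)"
  define v2 where "v2 = (\<integral>x. (influence2 x)\<^sup>2 \<partial>\<nu>)"
  have LX: "(\<lambda>n. \<integral>\<omega>. \<bar>AX n (\<lambda>x. (influence1 x)\<^sup>2) \<omega> - v1\<bar> \<partial>M) \<longlonglongrightarrow> 0"
    unfolding AX_def v1_def by (rule M.L1_law_of_large_numbers[OF I(2,5) influence1_moments(1)])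
  have LY: "(\<lambda>n. \<integral>\<omega>. \<bar>AY n (\<lambda>x. (influence2 x)\<^sup>2) \<omega> - v2\<bar> \<partial>M) \<longlonglongrightarrow> 0"
    unfolding AY_def v2_def by (rule M.L1_law_of_large_numbers[OF I(3,6) influence2_moments(1)])
  interpret R: consistent_resampling "\<mu> \<Otimes>\<^sub>M \<nu>" slices "\<lambda>z. slice_cdf \<mu> z - slice_cdf \<nu> z" diff_kernel joint_sd M ?J ?D
  proof
    show "(\<integral>\<omega>. (R.pool_average n (\<lambda>p. diff_kernel p z) \<omega>)\<^sup>2 \<partial>M) \<le> (joint_sd z)\<^sup>2 / real n"
      if "n > 0" "z \<in> space slices" for n z
      unfolding pk[OF that(1)]
      using S(2)[OF kernel_section_measurable kernel_L2 kernel_mean, of z n] kernel_second_moment[of z] that by simp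
    show "integrable M (\<lambda>\<omega>. (R.pool_average n influence \<omega>)\<^sup>2)" if "n > 0" for n
      unfolding pi[OF that] by (rule S(1)[OF measurable_influence influence_L2 influence_mean that])
    have "(\<integral>\<omega>. (R.pool_average n influence \<omega>)\<^sup>2 \<partial>M) = asymptotic_variance / real n" for n
    proof (cases "n = 0")
      case True then show ?thesis by (simp add: R.pool_average_def)
    next
      case False
      then show ?thesis using S(2)[OF measurable_influence influence_L2 influence_mean, of n] by (simp add: pi)
    qed
    then show "(\<lambda>n. \<integral>\<omega>. (R.pool_average n influence \<omega>)\<^sup>2 \<partial>M) \<longlonglongrightarrow> 0"
      by (simp add: lim_const_over_n)
    have bound: "(\<integral>\<omega>. \<bar>R.pool_average n (\<lambda>p. (influence p)\<^sup>2) \<omega> - asymptotic_variance\<bar> \<partial>M)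
      \<le> (\<integral>\<omega>. \<bar>AX n (\<lambda>x. (influence1 x)\<^sup>2) \<omega> - v1\<bar> \<partial>M) + (\<integral>\<omega>. \<bar>AY n (\<lambda>x. (influence2 x)\<^sup>2) \<omega> - v2\<bar> \<partial>M)
        + (v1 / real n + v2 / real n)" if n: "n > 0" for n
    proof -
      have iX: "integrable M (\<lambda>\<omega>. \<bar>AX n (\<lambda>x. (influence1 x)\<^sup>2) \<omega> - v1\<bar>)"
        and iY: "integrable M (\<lambda>\<omega>. \<bar>AY n (\<lambda>x. (influence2 x)\<^sup>2) \<omega> - v2\<bar>)"
        using tX[OF influence1_moments(1), of n] tY[OF influence2_moments(1), of n] by simp_all
      have "(\<integral>\<omega>. \<bar>R.pool_average n (\<lambda>p. (influence p)\<^sup>2) \<omega> - asymptotic_variance\<bar> \<partial>M)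
        \<le> (\<integral>\<omega>. \<bar>AX n (\<lambda>x. (influence1 x)\<^sup>2) \<omega> - v1\<bar> + \<bar>AY n (\<lambda>x. (influence2 x)\<^sup>2) \<omega> - v2\<bar>
            + ((AX n influence1 \<omega>)\<^sup>2 + (AY n influence2 \<omega>)\<^sup>2) \<partial>M)"
      proof (rule integral_mono)
        show "integrable M (\<lambda>\<omega>. \<bar>R.pool_average n (\<lambda>p. (influence p)\<^sup>2) \<omega> - asymptotic_variance\<bar>)"
          using R.integral_pool_average(1)[OF n influence_L2] by simp
        show "integrable M (\<lambda>\<omega>. \<bar>AX n (\<lambda>x. (influence1 x)\<^sup>2) \<omega> - v1\<bar> + \<bar>AY n (\<lambda>x. (influence2 x)\<^sup>2) \<omega> - v2\<bar>
            + ((AX n influence1 \<omega>)\<^sup>2 + (AY n influence2 \<omega>)\<^sup>2))"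
          by (intro Bochner_Integration.integrable_add iX iY SX(1)[OF n] SY(1)[OF n])
        fix \<omega>
        have "2 * \<bar>AX n influence1 \<omega> * AY n influence2 \<omega>\<bar> \<le> (AX n influence1 \<omega>)\<^sup>2 + (AY n influence2 \<omega>)\<^sup>2"
          using zero_le_power2[of "\<bar>AX n influence1 \<omega>\<bar> - \<bar>AY n influence2 \<omega>\<bar>"] by (simp add: power2_diff abs_mult)
        then show "\<bar>R.pool_average n (\<lambda>p. (influence p)\<^sup>2) \<omega> - asymptotic_variance\<bar>
          \<le> \<bar>AX n (\<lambda>x. (influence1 x)\<^sup>2) \<omega> - v1\<bar> + \<bar>AY n (\<lambda>x. (influence2 x)\<^sup>2) \<omega> - v2\<bar>
            + ((AX n influence1 \<omega>)\<^sup>2 + (AY n influence2 \<omega>)\<^sup>2)"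
          unfolding p2[OF n] asymptotic_variance_eq v1_def[symmetric] v2_def[symmetric] by linarith
      qed
      also have "\<dots> = (\<integral>\<omega>. \<bar>AX n (\<lambda>x. (influence1 x)\<^sup>2) \<omega> - v1\<bar> \<partial>M) + (\<integral>\<omega>. \<bar>AY n (\<lambda>x. (influence2 x)\<^sup>2) \<omega> - v2\<bar> \<partial>M)
        + (v1 / real n + v2 / real n)"
        using iX iY SX[OF n] SY[OF n]
        by (simp add: v1_def v2_def)
      finally show ?thesis .
    qed
    have "(\<lambda>n. (\<integral>\<omega>. \<bar>AX n (\<lambda>x. (influence1 x)\<^sup>2) \<omega> - v1\<bar> \<partial>M) + (\<integral>\<omega>. \<bar>AY n (\<lambda>x. (influence2 x)\<^sup>2) \<omega> - v2\<bar> \<partial>M)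
        + (v1 / real n + v2 / real n)) \<longlonglongrightarrow> 0 + 0 + (0 + 0)"
      by (intro tendsto_add LX LY lim_const_over_n)
    then have lim: "(\<lambda>n. (\<integral>\<omega>. \<bar>AX n (\<lambda>x. (influence1 x)\<^sup>2) \<omega> - v1\<bar> \<partial>M) + (\<integral>\<omega>. \<bar>AY n (\<lambda>x. (influence2 x)\<^sup>2) \<omega> - v2\<bar> \<partial>M)
        + (v1 / real n + v2 / real n)) \<longlonglongrightarrow> 0" by simp
    show "(\<lambda>n. \<integral>\<omega>. \<bar>R.pool_average n (\<lambda>p. (influence p)\<^sup>2) \<omega> - asymptotic_variance\<bar> \<partial>M) \<longlonglongrightarrow> 0"
    proof (rule Lim_null_comparison[OF _ lim], rule eventually_sequentiallyI)
      fix n :: nat assume "1 \<le> n"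
      then show "norm (\<integral>\<omega>. \<bar>R.pool_average n (\<lambda>p. (influence p)\<^sup>2) \<omega> - asymptotic_variance\<bar> \<partial>M)
        \<le> (\<integral>\<omega>. \<bar>AX n (\<lambda>x. (influence1 x)\<^sup>2) \<omega> - v1\<bar> \<partial>M) + (\<integral>\<omega>. \<bar>AY n (\<lambda>x. (influence2 x)\<^sup>2) \<omega> - v2\<bar> \<partial>M)
        + (v1 / real n + v2 / real n)"
        using bound[of n] by simp
    qed
  qed
  have stat: "R.boot_stat n \<omega> j = sqrt (real n) *
      (sliced_W1 (empirical n (\<lambda>i. X (fst (j i)) \<omega>)) (empirical n (\<lambda>i. Y (snd (j i)) \<omega>))
        - sliced_W1 (empirical n (\<lambda>i. X i \<omega>)) (empirical n (\<lambda>i. Y i \<omega>)))" for n \<omega> j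
  proof (cases "n = 0")
    case False
    then have n: "n > 0" by simp
    have p: "R.pool_average n (\<lambda>p. diff_kernel p z) \<omega>
      = (\<Sum>i<n. centered_halfspace \<mu> (X i \<omega>) z) / real n - (\<Sum>i<n. centered_halfspace \<nu> (Y i \<omega>) z) / real n" for z
      unfolding pk[OF n] by (simp add: diff_kernel_def sum_subtractf diff_divide_distrib)
    have d: "R.draw_average n (\<lambda>p. diff_kernel p z) \<omega> j
      = (\<Sum>i<n. centered_halfspace \<mu> (X (fst (j i)) \<omega>) z) / real n - (\<Sum>i<n. centered_halfspace \<nu> (Y (snd (j i)) \<omega>) z) / real n" for z
      by (simp add: R.draw_average_def diff_kernel_def sum_subtractf diff_divide_distrib)
    show ?thesis
      unfolding R.boot_stat_def p d sliced_W1_empirical[OF n] ..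
  qed (simp add: R.boot_stat_def)
  show ?thesis
    using R.bootstrap_consistency[OF v]
    unfolding stat R.resample_def bootstrap_cdf2_eq .
qed

end

section \<open>Limit law, efficiency and bootstrap for the sliced Wasserstein distance\<close>

theorem corollary3:
  fixes \<mu> \<nu> :: "(real ^ 'n) measure"
    and \<epsilon> :: real
    and M :: "'w measure"
    and X Y :: "nat \<Rightarrow> 'w \<Rightarrow> real ^ 'n"
    and P :: "'g measure"
    and G G' :: "real \<times> (real ^ 'n) \<Rightarrow> 'g \<Rightarrow> real"
  assumes "\<epsilon> > 0"
  shows
    "(\<mu> \<in> finite_moment_measures (2 + \<epsilon>) \<and> \<nu> \<in> finite_moment_measures 1 \<and>
      (AE (t, \<theta>) in lborel \<Otimes>\<^sub>M uniform_sphere.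
         lower_end \<mu> \<theta> \<le> ereal t \<and> ereal t \<le> upper_end \<mu> \<theta> \<longrightarrow>
         proj_cdf \<mu> t \<theta> \<noteq> proj_cdf \<nu> t \<theta>) \<and>
      iid_sample M \<mu> X \<and> projection_process P \<mu> G
      \<longrightarrow>
      (let v = sign_variance P \<mu> \<nu> G in
         conv_in_distribution M
           (\<lambda>n \<omega>. sqrt (real n) * (sliced_W1 (empirical n (\<lambda>i. X i \<omega>)) \<nu> - sliced_W1 \<mu> \<nu>))
           (centered_normal v) \<and>
         has_efficiency_bound (\<lambda>\<rho>. sliced_W1 \<rho> \<nu>) \<mu> (ennreal v) \<and>
         (v > 0 \<longrightarrow>
           conv_in_probability M
             (\<lambda>n \<omega>. \<Squnion>t. \<bar>bootstrap_cdf1 \<nu> n (\<lambda>i. X i \<omega>) t - cdf (centered_normal v) t\<bar>) 0)))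
     \<and>
     (\<mu> \<in> finite_moment_measures (2 + \<epsilon>) \<and> \<nu> \<in> finite_moment_measures (2 + \<epsilon>) \<and>
      (AE (t, \<theta>) in lborel \<Otimes>\<^sub>M uniform_sphere.
         min (lower_end \<mu> \<theta>) (lower_end \<nu> \<theta>) \<le> ereal t \<and>
         ereal t \<le> max (upper_end \<mu> \<theta>) (upper_end \<nu> \<theta>) \<longrightarrow>
         proj_cdf \<mu> t \<theta> \<noteq> proj_cdf \<nu> t \<theta>) \<and>
      two_iid_samples M \<mu> \<nu> X Y \<and> projection_process P \<mu> G \<and> projection_process P \<nu> G' \<and>
      independent_processes P G G'
      \<longrightarrow>
      (let v = sign_variance P \<mu> \<nu> G; w = sign_variance P \<mu> \<nu> G' in
         conv_in_distribution M
           (\<lambda>n \<omega>. sqrt (real n) *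
              (sliced_W1 (empirical n (\<lambda>i. X i \<omega>)) (empirical n (\<lambda>i. Y i \<omega>)) - sliced_W1 \<mu> \<nu>))
           (centered_normal (v + w)) \<and>
         has_efficiency_bound2 sliced_W1 \<mu> \<nu> (ennreal (v + w)) \<and>
         (v + w > 0 \<longrightarrow>
           conv_in_probability M
             (\<lambda>n \<omega>. \<Squnion>t. \<bar>bootstrap_cdf2 n (\<lambda>i. X i \<omega>) (\<lambda>i. Y i \<omega>) t
                             - cdf (centered_normal (v + w)) t\<bar>) 0)))"
proof (intro conjI impI; elim conjE)
  have q: "2 + \<epsilon> \<ge> 1" "2 + \<epsilon> > 2" using \<open>\<epsilon> > 0\<close> by auto
  {
    assume \<mu>: "\<mu> \<in> finite_moment_measures (2 + \<epsilon>)" and \<nu>: "\<nu> \<in> finite_moment_measures 1"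
      and ae: "AE (t, \<theta>) in slices. lower_end \<mu> \<theta> \<le> ereal t \<and> ereal t \<le> upper_end \<mu> \<theta> \<longrightarrow>
         proj_cdf \<mu> t \<theta> \<noteq> proj_cdf \<nu> t \<theta>"
      and iid: "iid_sample M \<mu> X" and G: "projection_process P \<mu> G"
    note m = finite_moment_measuresD(1,2)[OF \<mu> q(1)] integrable_slice_sd[OF \<mu> q(2)]
      and n = finite_moment_measuresD(1,2)[OF \<nu> order_refl]
    interpret one_sample \<mu> \<nu>
      by (intro one_sample.intro m n AE_distinct_or_degenerate ae)
    have v: "sign_variance P \<mu> \<nu> G = asymptotic_variance"
      unfolding sign_variance_def influence_def
      by (rule variance_integral_projection_process[OF G m sign_diff])
    show "let v = sign_variance P \<mu> \<nu> G in
         conv_in_distribution M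
           (\<lambda>n \<omega>. sqrt (real n) * (sliced_W1 (empirical n (\<lambda>i. X i \<omega>)) \<nu> - sliced_W1 \<mu> \<nu>))
           (centered_normal v) \<and>
         has_efficiency_bound (\<lambda>\<rho>. sliced_W1 \<rho> \<nu>) \<mu> (ennreal v) \<and>
         (v > 0 \<longrightarrow>
           conv_in_probability M
             (\<lambda>n \<omega>. \<Squnion>t. \<bar>bootstrap_cdf1 \<nu> n (\<lambda>i. X i \<omega>) t - cdf (centered_normal v) t\<bar>) 0)"
      unfolding Let_def v
      by (intro conjI impI empirical_central_limit efficiency_bound bootstrap iid)
  next
    assume \<mu>: "\<mu> \<in> finite_moment_measures (2 + \<epsilon>)" and \<nu>: "\<nu> \<in> finite_moment_measures (2 + \<epsilon>)"
      and ae: "AE (t, \<theta>) in slices. min (lower_end \<mu> \<theta>) (lower_end \<nu> \<theta>) \<le> ereal t \<and>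
         ereal t \<le> max (upper_end \<mu> \<theta>) (upper_end \<nu> \<theta>) \<longrightarrow> proj_cdf \<mu> t \<theta> \<noteq> proj_cdf \<nu> t \<theta>"
      and iid: "two_iid_samples M \<mu> \<nu> X Y"
      and G: "projection_process P \<mu> G" "projection_process P \<nu> G'"
    note m = finite_moment_measuresD(1,2)[OF \<mu> q(1)] integrable_slice_sd[OF \<mu> q(2)]
      and n = finite_moment_measuresD(1,2)[OF \<nu> q(1)] integrable_slice_sd[OF \<nu> q(2)]
    interpret two_sample \<mu> \<nu>
      by (intro two_sample.intro m n AE_distinct_or_both_degenerate ae)
    have vw: "sign_variance P \<mu> \<nu> G + sign_variance P \<mu> \<nu> G' = asymptotic_variance"
      unfolding sign_variance_def asymptotic_variance_eq influence1_def influence2_def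
      by (intro arg_cong2[where f="(+)"] variance_integral_projection_process[OF G(1) m sign_diff]
          variance_integral_projection_process[OF G(2) n sign_diff])
    show "let v = sign_variance P \<mu> \<nu> G; w = sign_variance P \<mu> \<nu> G' in
         conv_in_distribution M
           (\<lambda>n \<omega>. sqrt (real n) *
              (sliced_W1 (empirical n (\<lambda>i. X i \<omega>)) (empirical n (\<lambda>i. Y i \<omega>)) - sliced_W1 \<mu> \<nu>))
           (centered_normal (v + w)) \<and>
         has_efficiency_bound2 sliced_W1 \<mu> \<nu> (ennreal (v + w)) \<and>
         (v + w > 0 \<longrightarrow>
           conv_in_probability M
             (\<lambda>n \<omega>. \<Squnion>t. \<bar>bootstrap_cdf2 n (\<lambda>i. X i \<omega>) (\<lambda>i. Y i \<omega>) t
                             - cdf (centered_normal (v + w)) t\<bar>) 0)"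
      unfolding Let_def vw
      by (intro conjI impI empirical_central_limit efficiency_bound bootstrap iid)
  }
qed

end
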